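(* Let $\{X_{t,T_1}\}_{t=1}^{T_1}$ and $\{Y_{t,T_2}\}_{t=1}^{T_2}$ be independent $H$-valued functional time series with $$X_{t,T_1}(s)=m_1\Big(\frac t{T_1},s\Big)+v_{t,T_1}(s),\qquad Y_{t,T_2}(s)=m_2\Big(\frac t{T_2},s\Big)+w_{t,T_2}(s),$$ where $m_j(u,\cdot)\in H$ and $\|m_j(v,\cdot)-m_j(u,\cdot)\|\le C_m|u-v|$ for all $u,v\in[0,1]$, $j=1,2$, for some constant $C_m>0$. Assume each of the error processes $\{v_{t,T_1}\}$, $\{w_{t,T_2}\}$ is a zero-mean locally stationary process in $L^4_H$ (definition with $p=4$, $\rho=4$) whose associated stationary processes $\{v_t^{(u)}\}$, $\{w_t^{(u)}\}$ are $L^4$-$m$-approximable with mean zero in $L^2$ and satisfy $\lim_{m\to\infty}m\,v_2(v_0^{(u)}-v_{m,0}^{(u)})=0$ and $\lim_{m\to\infty}m\,v_2(w_0^{(u)}-w_{m,0}^{(u)})=0$. Let $K_1:\mathbb R\to\mathbb R$ be symmetric around zero, bounded, Lipschitz continuous, with compact support and $\int K_1(z)\,dz=1$, and let $K_2:\mathbb R\to\mathbb R$ be bounded, with compact support, and $K_2(0)=1$. Suppose that, as $\min\{T_1,T_2\}\to\infty$, $h\to0$, $\min\{T_ih,\frac1{T_ih^3},b,\frac{T_ih}b\}\to\infty$ for $i=1,2$, and $\frac{T_1}{T_1+T_2}\to\theta\in(0,1)$. Fix $u\in(0,1)$, let $\phi^{(u)},\hat\phi^{(u)}$ be the kernels defined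 in the context, let $\eta_{u,1}\ge\eta_{u,2}\ge\cdots\ge0$ be the eigenvalues of the integral operator with kernel $\phi^{(u)}$ and $\hat\eta_{u,j}$ the $j$-th largest eigenvalue of the integral operator with kernel $\hat\phi^{(u)}$. Suppose $\eta_{u,q_0}>\eta_{u,q_0+1}=0$ for some positive integer $q_0$. Let $\varepsilon_0$ be a prespecified small positive number, let $\bar q\ge q_0$ be a prespecified positive integer, and let $$\hat q_0=\operatorname*{arg\,min}_{1\le j\le\bar q}\frac{\hat\eta_{u,j+1}}{\hat\eta_{u,j}},$$ where $|\hat\eta_{u,j}/\hat\eta_{u,1}|$ is set to $0$ (that is, $\hat\eta_{u,j}$ is treated as $0$ in these ratios) whenever it is smaller than $\varepsilon_0$, and $0/0:=1$. Then $\hat q_0\stackrel p\to q_0$ as $\min\{T_1,T_2\}\to\infty$.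
   Context: $H=L^2=L^2([0,1]^d)$ is the real Hilbert space with $\langle x,y\rangle=\int_{[0,1]^d}x(t)y(t)\,dt$ and norm $\|\cdot\|$. $L^p_H$ is the space of $H$-valued random functions $X$ on a probability space with $v_p(X)=(E\|X\|^p)^{1/p}<\infty$. $K_{1,h}(x)=K_1(x/h)$. $\stackrel p\to$ denotes convergence in probability. Sample means: $\bar X_{T_1}^{(u)}=\frac1{T_1h}\sum_{t=1}^{T_1}K_{1,h}(u-\frac t{T_1})X_{t,T_1}$, and $\bar Y_{T_2}^{(u)}=\frac1{T_2h}\sum_{t=1}^{T_2}K_{1,h}(u-\frac t{T_2})Y_{t,T_2}$. Long-run covariance kernel of a stationary zero-mean process $\{Z_t\}$ in $H$: $c(s_1,s_2)=E[Z_0(s_1)Z_0(s_2)]+\sum_{t\ge1}E[Z_0(s_1)Z_t(s_2)]+\sum_{t\ge1}E[Z_0(s_2)Z_t(s_1)]$ (sums in $L^2([0,1]^d\times[0,1]^d)$). Let $c_{1,u}$, $c_{2,u}$ be those of $\{v_t^{(u)}\}$, $\{w_t^{(u)}\}$, and $\phi^{(u)}=(1-\theta)c_{1,u}+\theta c_{2,u}$. Estimators: $\hat c_{1,u}(s_1,s_2)=\hat\gamma_0(s_1,s_2)+\sum_{t=1}^{T_1-1}K_2(t/b)\{\hat\gamma_t(s_1,s_2)+\hat\gamma_t(s_2,s_1)\}$ with $\hat\gamma_t(s_1,s_2)=\frac1{T_1h}\sum_{j=t+1}^{T_1}K_{1,h}(u-\frac j{T_1})(X_{j,T_1}(s_1)-\bar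 X_{T_1}^{(u)}(s_1))(X_{j-t,T_1}(s_2)-\bar X_{T_1}^{(u)}(s_2))$; $\hat c_{2,u}$ is defined in the same way from $\{Y_{t,T_2}\}$, $T_2$, $\bar Y_{T_2}^{(u)}$. Put $\hat\phi^{(u)}=(1-\hat\theta)\hat c_{1,u}+\hat\theta\hat c_{2,u}$, $\hat\theta=\frac{T_1}{T_1+T_2}$. Local stationarity. $\{X_{t,T}\}_{t=1}^T$ in $L^p_H$ is locally stationary if for each $u\in[0,1]$ there is an $H$-valued process $\{X_t^{(u)}\}_{t\in\mathbb Z}$ in $L^p_H$ such that (i) $\{X_t^{(u)}\}_t$ is strictly stationary; (ii) for all $1\le t\le T$, almost surely $$\|X_{t,T}-X_t^{(u)}\|\le\Big(\Big|\frac tT-u\Big|+\frac1T\Big)U_{t,T}^{(u)},$$ where $U_{t,T}^{(u)}$ are positive random variables with $E[(U_{t,T}^{(u)})^\rho]<C$ for some $\rho>0$ and $C<\infty$ independent of $u,t,T$. $L^p$-$m$-approximability. $\{X_t^{(u)}\}$ is $L^p$-$m$-approximable if $X_t^{(u)}\in L^p_H$ has the form $X_t^{(u)}=f_u(\varepsilon_t,\varepsilon_{t-1},\dots)$ with $\varepsilon_j$ i.i.d. elements of a measurable space $S$ and $f_u:S^\infty\to H$ measurable, and, with $\{\varepsilon_{t,k}^{(m)}\}_k$ (for each $t$ and $m$) independent copies of $\{\varepsilon_k\}_k$ defined on the same probability space and $$X_{m,t}^{(u)}=f_u(\varepsilon_t,\dots,\varepsilon_{t-m+1},\varepsilon_{t,t-m}^{(m)},\varepsilon_{t,t-m-1}^{(m)},\dots),$$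 one has $\sum_{m\ge1}v_p(X_t^{(u)}-X_{m,t}^{(u)})<\infty$. The variables $v_{m,0}^{(u)}$, $w_{m,0}^{(u)}$ denote these approximations for $\{v_t^{(u)}\}$, $\{w_t^{(u)}\}$.
   Formalization: K_2 is additionally assumed right-continuous at 0 (without this the claim fails, e.g. K_2 equal to the indicator of {0}), and "small" ε_0 is made precise as 0 < ε_0 < η_{u,q_0}/η_{u,1}. *)

theory Defs
  imports "HOL-Probability.Probability"
begin

section \<open>The Hilbert space of square-integrable functions on the unit cube\<close>

text \<open>
  \<open>'a L2\<close> is the space of a.e.-classes of square-integrable functions on the unit cube
  of \<open>'a\<close>; thus \<open>(real ^ 'd) L2\<close> is \<open>L\<^sup>2([0,1]\<^sup>d)\<close> with \<open>d = CARD('d)\<close>. It is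
  a separable Hilbert space (instances \<open>real_inner\<close>, \<open>banach\<close> and \<open>second_countable_topology\<close>), so
  Borel measurability and Bochner integrals of random elements are those of the library.
\<close>

definition cube :: "'a::euclidean_space measure" where
  "cube = restrict_space lborel (cbox 0 One)"

definition square_integrable :: "('a::euclidean_space \<Rightarrow> real) \<Rightarrow> bool" where
  "square_integrable f \<longleftrightarrow> f \<in> borel_measurable cube \<and> integrable cube (\<lambda>x. (f x)\<^sup>2)"

lemma emeasure_cube_space: "emeasure (cube :: 'a::euclidean_space measure) (space cube) = 1"
  by (simp add: cube_def emeasure_restrict_space space_restrict_space emeasure_lborel_cbox)

lemma prob_space_cube: "prob_space (cube :: 'a::euclidean_space measure)"
  by (rule prob_spaceI) (rule emeasure_cube_space)

lemma sets_cube_borel: "A \<in> sets borel \<Longrightarrow> A \<inter> cbox 0 One \<in> sets (cube :: 'a::euclidean_space measure)"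
  by (auto simp: cube_def sets_restrict_space)

lemma square_integrable_mult:
  assumes "square_integrable f" "square_integrable g"
  shows "integrable cube (\<lambda>x. f x * g x)"
proof (rule Bochner_Integration.integrable_bound)
  show "integrable cube (\<lambda>x. (f x)\<^sup>2 + (g x)\<^sup>2)"
    using assms by (auto simp: square_integrable_def)
  show "(\<lambda>x. f x * g x) \<in> borel_measurable cube"
    using assms by (auto simp: square_integrable_def)
  have "\<bar>a * b\<bar> \<le> a\<^sup>2 + b\<^sup>2" for a b :: real
  proof -
    have "2 * (\<bar>a\<bar> * \<bar>b\<bar>) \<le> \<bar>a\<bar>\<^sup>2 + \<bar>b\<bar>\<^sup>2"
      using sum_squares_bound[of "\<bar>a\<bar>" "\<bar>b\<bar>"] by (simp add: mult.assoc)
    moreover have "0 \<le> \<bar>a\<bar> * \<bar>b\<bar>" by simp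
    ultimately show ?thesis unfolding abs_mult power2_abs by linarith
  qed
  then show "AE x in cube. norm (f x * g x) \<le> norm ((f x)\<^sup>2 + (g x)\<^sup>2)"
    by simp
qed

lemma square_integrable_zero: "square_integrable (\<lambda>_. 0)"
  by (simp add: square_integrable_def)

lemma square_integrable_add:
  assumes "square_integrable f" "square_integrable g"
  shows "square_integrable (\<lambda>x. f x + g x)"
proof -
  have "integrable cube (\<lambda>x. (f x)\<^sup>2 + (g x)\<^sup>2 + 2 * (f x * g x))"
    using assms square_integrable_mult[OF assms] by (auto simp: square_integrable_def)
  then show ?thesis
    using assms by (auto simp: square_integrable_def power2_sum algebra_simps)
qed

lemma square_integrable_scale:
  "square_integrable f \<Longrightarrow> square_integrable (\<lambda>x. c * f x)"
  by (auto simp: square_integrable_def power_mult_distrib)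

lemma square_integrable_uminus:
  "square_integrable f \<Longrightarrow> square_integrable (\<lambda>x. - f x)"
  by (auto simp: square_integrable_def)

lemma square_integrable_diff:
  assumes "square_integrable f" "square_integrable g"
  shows "square_integrable (\<lambda>x. f x - g x)"
  using square_integrable_add[OF assms(1) square_integrable_uminus[OF assms(2)]] by simp

definition L2rel :: "('a::euclidean_space \<Rightarrow> real) \<Rightarrow> ('a \<Rightarrow> real) \<Rightarrow> bool" where
  "L2rel f g \<longleftrightarrow> square_integrable f \<and> square_integrable g \<and> (AE x in cube. f x = g x)"

quotient_type (overloaded) 'a L2 = "'a::euclidean_space \<Rightarrow> real" / partial: L2rel
proof (rule part_equivpI)
  show "\<exists>f::'a \<Rightarrow> real. L2rel f f"
    by (rule exI[of _ "\<lambda>_. 0"]) (simp add: L2rel_def square_integrable_zero)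
  show "symp (L2rel :: ('a \<Rightarrow> real) \<Rightarrow> _)"
    by (rule sympI) (auto simp: L2rel_def elim: eventually_mono)
  show "transp (L2rel :: ('a \<Rightarrow> real) \<Rightarrow> _)"
  proof (rule transpI)
    fix f g h :: "'a \<Rightarrow> real"
    assume *: "L2rel f g" "L2rel g h"
    then have "AE x in cube. f x = g x" "AE x in cube. g x = h x" by (auto simp: L2rel_def)
    then have "AE x in cube. f x = h x" by eventually_elim simp
    with * show "L2rel f h" by (simp add: L2rel_def)
  qed
qed

instantiation L2 :: (euclidean_space) real_inner
begin

lift_definition zero_L2 :: "'a L2" is "\<lambda>_. 0"
  by (simp add: L2rel_def square_integrable_zero)

lift_definition plus_L2 :: "'a L2 \<Rightarrow> 'a L2 \<Rightarrow> 'a L2" is "\<lambda>f g x. f x + g x"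
proof -
  fix f f' g g' :: "'a \<Rightarrow> real"
  assume *: "L2rel f f'" "L2rel g g'"
  then have "AE x in cube. f x = f' x" "AE x in cube. g x = g' x" by (auto simp: L2rel_def)
  then have "AE x in cube. f x + g x = f' x + g' x" by eventually_elim simp
  with * show "L2rel (\<lambda>x. f x + g x) (\<lambda>x. f' x + g' x)"
    by (auto simp: L2rel_def intro: square_integrable_add)
qed

lift_definition minus_L2 :: "'a L2 \<Rightarrow> 'a L2 \<Rightarrow> 'a L2" is "\<lambda>f g x. f x - g x"
proof -
  fix f f' g g' :: "'a \<Rightarrow> real"
  assume *: "L2rel f f'" "L2rel g g'"
  then have "AE x in cube. f x = f' x" "AE x in cube. g x = g' x" by (auto simp: L2rel_def)
  then have "AE x in cube. f x - g x = f' x - g' x" by eventually_elim simp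
  with * show "L2rel (\<lambda>x. f x - g x) (\<lambda>x. f' x - g' x)"
    by (auto simp: L2rel_def intro: square_integrable_diff)
qed

lift_definition uminus_L2 :: "'a L2 \<Rightarrow> 'a L2" is "\<lambda>f x. - f x"
  by (auto simp: L2rel_def intro: square_integrable_uminus)

lift_definition scaleR_L2 :: "real \<Rightarrow> 'a L2 \<Rightarrow> 'a L2" is "\<lambda>c f x. c * f x"
  by (auto simp: L2rel_def intro: square_integrable_scale elim: eventually_mono)

lift_definition inner_L2 :: "'a L2 \<Rightarrow> 'a L2 \<Rightarrow> real" is "\<lambda>f g. \<integral>x. f x * g x \<partial>cube"
proof -
  fix f f' g g' :: "'a \<Rightarrow> real"
  assume *: "L2rel f f'" "L2rel g g'"
  then have "AE x in cube. f x = f' x" "AE x in cube. g x = g' x" by (auto simp: L2rel_def)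
  then have "AE x in cube. f x * g x = f' x * g' x" by eventually_elim simp
  with * show "(\<integral>x. f x * g x \<partial>cube) = (\<integral>x. f' x * g' x \<partial>cube)"
    by (intro integral_cong_AE) (auto simp: L2rel_def square_integrable_def)
qed

definition norm_L2 :: "'a L2 \<Rightarrow> real" where "norm_L2 x = sqrt (inner x x)"
definition sgn_L2 :: "'a L2 \<Rightarrow> 'a L2" where "sgn_L2 x = inverse (norm x) *\<^sub>R x"
definition dist_L2 :: "'a L2 \<Rightarrow> 'a L2 \<Rightarrow> real" where "dist_L2 x y = norm (x - y)"
definition uniformity_L2 :: "('a L2 \<times> 'a L2) filter" where
  "uniformity_L2 = (INF e\<in>{0<..}. principal {(x, y). dist x y < e})"
definition open_L2 :: "'a L2 set \<Rightarrow> bool" where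
  "open_L2 U \<longleftrightarrow> (\<forall>x\<in>U. \<forall>\<^sub>F (x', y) in uniformity. x' = x \<longrightarrow> y \<in> U)"

instance
proof
  fix x y z :: "'a L2" and a b c :: real
  show "x + y + z = x + (y + z)"
    by transfer (auto simp: L2rel_def algebra_simps intro!: square_integrable_add)
  show "x + y = y + x"
    by transfer (auto simp: L2rel_def algebra_simps intro!: square_integrable_add)
  show "0 + x = x" by transfer (auto simp: L2rel_def)
  show "- x + x = 0" by transfer (auto simp: L2rel_def intro: square_integrable_zero)
  show "x - y = x + - y"
    by transfer (auto simp: L2rel_def intro: square_integrable_diff)
  show "a *\<^sub>R (x + y) = a *\<^sub>R x + a *\<^sub>R y"
    by transfer (auto simp: L2rel_def algebra_simps
        intro!: square_integrable_add square_integrable_scale)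
  show "(a + b) *\<^sub>R x = a *\<^sub>R x + b *\<^sub>R x"
    by transfer (auto simp: L2rel_def algebra_simps
        intro!: square_integrable_add square_integrable_scale)
  show "a *\<^sub>R b *\<^sub>R x = (a * b) *\<^sub>R x"
    by transfer (auto simp: L2rel_def algebra_simps
        intro!: square_integrable_add square_integrable_scale)
  show "1 *\<^sub>R x = x" by transfer (auto simp: L2rel_def)
  show "inner x y = inner y x" by transfer (simp add: mult.commute)
  show "inner (x + y) z = inner x z + inner y z"
    by transfer (auto simp: L2rel_def distrib_right square_integrable_mult)
  show "inner (c *\<^sub>R x) y = c * inner x y"
    by transfer (auto simp: L2rel_def mult.assoc)
  show "0 \<le> inner x x" by transfer simp
  show "inner x x = 0 \<longleftrightarrow> x = 0"
    by transfer (auto simp: L2rel_def square_integrable_zero square_integrable_mult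
        integral_nonneg_eq_0_iff_AE)
qed (rule norm_L2_def sgn_L2_def dist_L2_def uniformity_L2_def open_L2_def)+

end

text \<open>
  \<open>L2_of f\<close> is the class of \<open>f\<close>, and \<open>L2_fun x\<close> is some representative of the class \<open>x\<close>. The
  definitions below that use \<open>L2_fun\<close> do not depend on the choice of the representative.
\<close>

definition L2_of :: "('a::euclidean_space \<Rightarrow> real) \<Rightarrow> 'a L2" where
  "L2_of f = (if square_integrable f then abs_L2 f else 0)"

definition L2_fun :: "'a::euclidean_space L2 \<Rightarrow> 'a \<Rightarrow> real" where
  "L2_fun x = rep_L2 x"

lemma square_integrable_L2_fun [simp, intro]: "square_integrable (L2_fun x)"
  using Quotient3_rep_reflp[OF Quotient3_L2, of x] by (simp add: L2_fun_def L2rel_def)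

lemma L2_of_L2_fun [simp]: "L2_of (L2_fun x) = x"
  by (metis L2_of_def L2_fun_def square_integrable_L2_fun Quotient3_abs_rep[OF Quotient3_L2])

lemma L2_of_eq_iff:
  "square_integrable f \<Longrightarrow> square_integrable g \<Longrightarrow> L2_of f = L2_of g \<longleftrightarrow> (AE x in cube. f x = g x)"
  using Quotient3_rel[OF Quotient3_L2, of f g] by (auto simp: L2_of_def L2rel_def)

lemma L2_fun_L2_of: "square_integrable f \<Longrightarrow> AE x in cube. L2_fun (L2_of f) x = f x"
  using L2_of_eq_iff[of "L2_fun (L2_of f)" f] by simp

lemma L2_of_add: "square_integrable f \<Longrightarrow> square_integrable g \<Longrightarrow> L2_of f + L2_of g = L2_of (\<lambda>x. f x + g x)"
  by (simp add: L2_of_def plus_L2.abs_eq L2rel_def square_integrable_add)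

lemma L2_of_diff: "square_integrable f \<Longrightarrow> square_integrable g \<Longrightarrow> L2_of f - L2_of g = L2_of (\<lambda>x. f x - g x)"
  by (simp add: L2_of_def minus_L2.abs_eq L2rel_def square_integrable_diff)

lemma L2_of_scaleR: "square_integrable f \<Longrightarrow> c *\<^sub>R L2_of f = L2_of (\<lambda>x. c * f x)"
  by (simp add: L2_of_def scaleR_L2.abs_eq L2rel_def square_integrable_scale)

lemma L2_of_zero: "L2_of (\<lambda>_. 0) = 0"
  by (simp add: L2_of_def zero_L2_def)

lemma inner_L2_of:
  "square_integrable f \<Longrightarrow> square_integrable g \<Longrightarrow> inner (L2_of f) (L2_of g) = (\<integral>x. f x * g x \<partial>cube)"
  by (simp add: L2_of_def inner_L2.abs_eq L2rel_def)

lemma inner_L2_fun: "inner x y = (\<integral>s. L2_fun x s * L2_fun y s \<partial>cube)"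
  using inner_L2_of[of "L2_fun x" "L2_fun y"] by simp

lemma norm_L2_of: "square_integrable f \<Longrightarrow> (norm (L2_of f))\<^sup>2 = (\<integral>x. (f x)\<^sup>2 \<partial>cube)"
  by (simp only: power2_norm_eq_inner inner_L2_of) (simp add: power2_eq_square)

lemma dist_L2_of:
  "square_integrable f \<Longrightarrow> square_integrable g \<Longrightarrow>
    (dist (L2_of f) (L2_of g))\<^sup>2 = (\<integral>x. (f x - g x)\<^sup>2 \<partial>cube)"
  by (simp add: dist_norm L2_of_diff norm_L2_of square_integrable_diff)


subsection \<open>Completeness\<close>

lemma L1_le_L2:
  assumes "square_integrable f"
  shows "(\<integral>\<^sup>+x. ennreal \<bar>f x\<bar> \<partial>cube) \<le> ennreal (norm (L2_of f))"
proof -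
  interpret prob_space "cube :: 'a measure" by (rule prob_space_cube)
  have sq1: "square_integrable (\<lambda>x. \<bar>f x\<bar>)"
    using assms by (auto simp: square_integrable_def)
  have one: "square_integrable (\<lambda>x::'a. 1)"
    by (auto simp: square_integrable_def)
  have int: "integrable cube (\<lambda>x. \<bar>f x\<bar>)"
    using square_integrable_mult[OF sq1 one] by simp
  have "(\<integral>x. \<bar>f x\<bar> \<partial>cube) = inner (L2_of (\<lambda>x. \<bar>f x\<bar>)) (L2_of (\<lambda>x. 1))"
    by (simp add: inner_L2_of[OF sq1 one])
  also have "\<dots> \<le> norm (L2_of (\<lambda>x. \<bar>f x\<bar>)) * norm (L2_of (\<lambda>x::'a. 1))"
    by (rule norm_cauchy_schwarz)
  also have "norm (L2_of (\<lambda>x::'a. 1)) = 1"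
    using norm_L2_of[OF one] emeasure_cube_space
    by (simp add: prob_space power2_eq_1_iff) (smt (verit) norm_ge_zero)
  also have "norm (L2_of (\<lambda>x. \<bar>f x\<bar>)) = norm (L2_of f)"
    by (rule power2_eq_imp_eq) (simp_all add: norm_L2_of[OF sq1] norm_L2_of[OF assms])
  finally have "(\<integral>x. \<bar>f x\<bar> \<partial>cube) \<le> norm (L2_of f)" by simp
  then show ?thesis
    using int by (simp add: nn_integral_eq_integral)
qed

lemma L2_fast_Cauchy_convergent:
  fixes X :: "nat \<Rightarrow> 'a::euclidean_space L2"
  assumes C: "Cauchy X" and fast: "\<And>n. norm (X (Suc n) - X n) \<le> (1/2)^n"
  shows "convergent X"
proof -
  define f where "f n = L2_fun (X n)" for n
  have sq: "square_integrable (f n)" for n by (simp add: f_def)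
  have Xf: "X n = L2_of (f n)" for n by (simp add: f_def)
  have [measurable]: "f n \<in> borel_measurable cube" for n
    using sq by (simp add: square_integrable_def)
  have "(\<integral>\<^sup>+x. (\<Sum>n. ennreal \<bar>f (Suc n) x - f n x\<bar>) \<partial>cube)
      = (\<Sum>n. \<integral>\<^sup>+x. ennreal \<bar>f (Suc n) x - f n x\<bar> \<partial>cube)"
    by (rule nn_integral_suminf) measurable
  also have "\<dots> \<le> (\<Sum>n. ennreal ((1/2)^n))"
  proof (rule suminf_le)
    fix n
    have "(\<integral>\<^sup>+x. ennreal \<bar>f (Suc n) x - f n x\<bar> \<partial>cube)
        \<le> ennreal (norm (L2_of (\<lambda>x. f (Suc n) x - f n x)))"
      by (rule L1_le_L2) (intro square_integrable_diff sq)
    also have "\<dots> \<le> ennreal ((1/2)^n)"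
      using fast[of n] by (simp add: Xf L2_of_diff sq)
    finally show "(\<integral>\<^sup>+x. ennreal \<bar>f (Suc n) x - f n x\<bar> \<partial>cube) \<le> ennreal ((1/2)^n)" .
  qed auto
  also have "\<dots> = ennreal (\<Sum>n. (1/2)^n)"
    by (rule suminf_ennreal2) (auto intro: summable_geometric)
  finally have "(\<integral>\<^sup>+x. (\<Sum>n. ennreal \<bar>f (Suc n) x - f n x\<bar>) \<partial>cube) \<noteq> \<infinity>"
    by (auto simp: top_unique)
  then have "AE x in cube. (\<Sum>n. ennreal \<bar>f (Suc n) x - f n x\<bar>) \<noteq> \<infinity>"
    by (intro nn_integral_PInf_AE) auto
  then have conv: "AE x in cube. convergent (\<lambda>n. f n x)"
  proof eventually_elim
    fix x assume "(\<Sum>n. ennreal \<bar>f (Suc n) x - f n x\<bar>) \<noteq> \<infinity>"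
    then have "summable (\<lambda>n. \<bar>f (Suc n) x - f n x\<bar>)"
      by (intro summable_suminf_not_top) auto
    then have "summable (\<lambda>n. f (Suc n) x - f n x)"
      by (rule summable_rabs_cancel)
    then have "convergent (\<lambda>n. \<Sum>i<n. f (Suc i) x - f i x)"
      by (simp add: summable_iff_convergent)
    then have "convergent (\<lambda>n. f n x - f 0 x)"
      by (subst (asm) sum_lessThan_telescope)
    then have "convergent (\<lambda>n. (f n x - f 0 x) + f 0 x)"
      by (intro convergent_add convergent_const)
    then show "convergent (\<lambda>n. f n x)" by simp
  qed
  define g where "g x = lim (\<lambda>n. f n x)" for x
  have [measurable]: "g \<in> borel_measurable cube"
    unfolding g_def by measurable
  have lim: "AE x in cube. (\<lambda>n. f n x) \<longlonglongrightarrow> g x"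
    using conv by eventually_elim (simp add: g_def convergent_LIMSEQ_iff)
  have key: "square_integrable (\<lambda>x. g x - f n x) \<and> norm (L2_of (\<lambda>x. g x - f n x)) \<le> e"
    if e: "e > 0" and N: "\<And>m. m \<ge> n \<Longrightarrow> dist (X m) (X n) \<le> e" for n e
  proof -
    have "(\<integral>\<^sup>+x. ennreal ((g x - f n x)\<^sup>2) \<partial>cube)
        = (\<integral>\<^sup>+x. liminf (\<lambda>m. ennreal ((f m x - f n x)\<^sup>2)) \<partial>cube)"
    proof (rule nn_integral_cong_AE)
      show "AE x in cube. ennreal ((g x - f n x)\<^sup>2) = liminf (\<lambda>m. ennreal ((f m x - f n x)\<^sup>2))"
        using lim
      proof eventually_elim
        fix x assume "(\<lambda>n. f n x) \<longlonglongrightarrow> g x"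
        then have "(\<lambda>m. ennreal ((f m x - f n x)\<^sup>2)) \<longlonglongrightarrow> ennreal ((g x - f n x)\<^sup>2)"
          by (intro tendsto_intros) auto
        then show "ennreal ((g x - f n x)\<^sup>2) = liminf (\<lambda>m. ennreal ((f m x - f n x)\<^sup>2))"
          by (metis lim_imp_Liminf trivial_limit_sequentially)
      qed
    qed
    also have "\<dots> \<le> liminf (\<lambda>m. \<integral>\<^sup>+x. ennreal ((f m x - f n x)\<^sup>2) \<partial>cube)"
      by (rule nn_integral_liminf) measurable
    also have "\<dots> \<le> ennreal (e\<^sup>2)"
    proof -
      have "\<forall>\<^sub>F m in sequentially. (\<integral>\<^sup>+x. ennreal ((f m x - f n x)\<^sup>2) \<partial>cube) \<le> ennreal (e\<^sup>2)"
        unfolding eventually_sequentially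
      proof (intro exI allI impI)
        fix m assume "n \<le> m"
        have s: "square_integrable (\<lambda>x. f m x - f n x)" by (intro square_integrable_diff sq)
        have "(\<integral>\<^sup>+x. ennreal ((f m x - f n x)\<^sup>2) \<partial>cube) = ennreal (\<integral>x. (f m x - f n x)\<^sup>2 \<partial>cube)"
          using s by (intro nn_integral_eq_integral) (auto simp: square_integrable_def)
        also have "\<dots> = ennreal ((dist (X m) (X n))\<^sup>2)"
          by (simp add: Xf dist_L2_of sq)
        also have "\<dots> \<le> ennreal (e\<^sup>2)"
          using N[OF \<open>n \<le> m\<close>] by (intro ennreal_leI power_mono) auto
        finally show "(\<integral>\<^sup>+x. ennreal ((f m x - f n x)\<^sup>2) \<partial>cube) \<le> ennreal (e\<^sup>2)" .
      qed
      then have "liminf (\<lambda>m. \<integral>\<^sup>+x. ennreal ((f m x - f n x)\<^sup>2) \<partial>cube) \<le> liminf (\<lambda>m::nat. ennreal (e\<^sup>2))"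
        by (rule Liminf_mono)
      then show ?thesis by (simp add: Liminf_const)
    qed
    finally have le: "(\<integral>\<^sup>+x. ennreal ((g x - f n x)\<^sup>2) \<partial>cube) \<le> ennreal (e\<^sup>2)" .
    have int: "integrable cube (\<lambda>x. (g x - f n x)\<^sup>2)"
      using le by (intro integrableI_nonneg) (auto intro: le_less_trans)
    then have s: "square_integrable (\<lambda>x. g x - f n x)"
      by (auto simp: square_integrable_def)
    have "(norm (L2_of (\<lambda>x. g x - f n x)))\<^sup>2 \<le> e\<^sup>2"
      using le int by (simp add: norm_L2_of[OF s] nn_integral_eq_integral)
    then have "norm (L2_of (\<lambda>x. g x - f n x)) \<le> e"
      by (rule power2_le_imp_le) (use e in simp)
    with s show ?thesis by blast
  qed
  have ex: "\<exists>N. \<forall>n\<ge>N. \<forall>m\<ge>n. dist (X m) (X n) \<le> e" if e: "e > 0" for e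
  proof -
    obtain N where N: "\<forall>m\<ge>N. \<forall>n\<ge>N. dist (X m) (X n) < e"
      using C e unfolding Cauchy_def by blast
    show ?thesis by (rule exI[of _ N]) (use N in \<open>auto intro!: less_imp_le\<close>)
  qed
  obtain N1 where N1: "\<And>m. m \<ge> N1 \<Longrightarrow> dist (X m) (X N1) \<le> 1"
    using ex[of 1] by auto
  have sg: "square_integrable g"
    using square_integrable_add[OF conjunct1[OF key[OF zero_less_one N1]] sq[of N1]] by simp
  have "X \<longlonglongrightarrow> L2_of g"
  proof (rule metric_LIMSEQ_I)
    fix r :: real assume "0 < r"
    then obtain N where N: "\<And>n m. n \<ge> N \<Longrightarrow> m \<ge> n \<Longrightarrow> dist (X m) (X n) \<le> r/2"
      using ex[of "r/2"] by auto
    have "dist (X n) (L2_of g) < r" if "n \<ge> N" for n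
    proof -
      have "dist (X n) (L2_of g) = norm (L2_of (\<lambda>x. g x - f n x))"
        by (subst dist_commute) (simp add: dist_norm Xf L2_of_diff sg sq)
      also have "\<dots> \<le> r/2"
        using key[of "r/2" n] N[OF that] \<open>0 < r\<close> by simp
      finally show ?thesis using \<open>0 < r\<close> by simp
    qed
    then show "\<exists>no. \<forall>n\<ge>no. dist (X n) (L2_of g) < r" by blast
  qed
  then show ?thesis by (auto simp: convergent_def)
qed

instance L2 :: (euclidean_space) banach
proof
  fix X :: "nat \<Rightarrow> 'a L2"
  assume C: "Cauchy X"
  have ex: "\<exists>N. \<forall>n\<ge>N. \<forall>m\<ge>N. dist (X m) (X n) \<le> (1/2)^k" for k :: nat
  proof -
    have "(0::real) < (1/2)^k" by simp
    then obtain N where N: "\<forall>m\<ge>N. \<forall>n\<ge>N. dist (X m) (X n) < (1/2)^k"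
      using C unfolding Cauchy_def by blast
    show ?thesis by (rule exI[of _ N]) (use N in \<open>auto intro!: less_imp_le\<close>)
  qed
  then obtain N where N: "\<And>k n m. n \<ge> N k \<Longrightarrow> m \<ge> N k \<Longrightarrow> dist (X m) (X n) \<le> (1/2)^k"
    by metis
  define r where "r k = (\<Sum>i\<le>k. N i) + k" for k
  have r: "strict_mono r" by (rule strict_monoI_Suc) (simp add: r_def)
  have rN: "r k \<ge> N k" for k
    unfolding r_def by (rule trans_le_add1) (rule member_le_sum, auto)
  have "convergent (X \<circ> r)"
  proof (rule L2_fast_Cauchy_convergent)
    show "Cauchy (X \<circ> r)" using C r by (rule Cauchy_subseq_Cauchy)
    fix n
    have "r (Suc n) \<ge> N n"
      by (rule order_trans[OF rN]) (use r in \<open>simp add: strict_mono_less_eq\<close>)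
    then show "norm ((X \<circ> r) (Suc n) - (X \<circ> r) n) \<le> (1/2)^n"
      using N[of n "r n" "r (Suc n)"] rN[of n] by (simp add: dist_norm)
  qed
  then obtain l where "(X \<circ> r) \<longlonglongrightarrow> l" by (auto simp: convergent_def)
  then show "convergent X"
    using Cauchy_converges_subseq[OF C r] by (auto simp: convergent_def)
qed



subsection \<open>Separability\<close>

definition L2_ind :: "'a::euclidean_space set \<Rightarrow> 'a L2" where
  "L2_ind A = L2_of (indicator A)"

lemma square_integrable_indicator: "A \<in> sets borel \<Longrightarrow> square_integrable (indicator A :: 'a::euclidean_space \<Rightarrow> real)"
proof -
  interpret prob_space "cube :: 'a measure" by (rule prob_space_cube)
  assume A: "A \<in> sets borel"
  then have [measurable]: "(indicator A :: 'a \<Rightarrow> real) \<in> borel_measurable cube"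
    unfolding cube_def by (intro measurable_restrict_space1) simp
  have "(\<lambda>x. (indicator A x :: real)\<^sup>2) = indicator A" by (simp add: indicator_def fun_eq_iff)
  then show ?thesis
    unfolding square_integrable_def by (auto intro!: integrable_const_bound[where B=1])
qed

lemma L2_dominated_convergence:
  fixes s :: "nat \<Rightarrow> 'a::euclidean_space \<Rightarrow> real"
  assumes s: "\<And>n. square_integrable (s n)" and f: "square_integrable f" and w: "square_integrable w"
    and lim: "\<And>x. x \<in> space cube \<Longrightarrow> (\<lambda>n. s n x) \<longlonglongrightarrow> f x"
    and bd: "\<And>n x. x \<in> space cube \<Longrightarrow> \<bar>s n x - f x\<bar> \<le> \<bar>w x\<bar>"
  shows "(\<lambda>n. L2_of (s n)) \<longlonglongrightarrow> L2_of f"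
proof -
  have "(\<lambda>n. \<integral>x. (s n x - f x)\<^sup>2 \<partial>cube) \<longlonglongrightarrow> (\<integral>x. 0 \<partial>(cube :: 'a measure))"
  proof (rule integral_dominated_convergence)
    show "integrable cube (\<lambda>x. (w x)\<^sup>2)" using w by (simp add: square_integrable_def)
    show "(\<lambda>x. (s n x - f x)\<^sup>2) \<in> borel_measurable cube" for n
      using square_integrable_diff[OF s f, of n] by (auto simp: square_integrable_def intro: borel_measurable_power)
    show "AE x in cube. (\<lambda>n. (s n x - f x)\<^sup>2) \<longlonglongrightarrow> 0"
    proof (rule AE_I2)
      fix x :: 'a assume "x \<in> space cube"
      then have "(\<lambda>n. (s n x - f x)\<^sup>2) \<longlonglongrightarrow> (f x - f x)\<^sup>2"
        by (intro tendsto_intros lim)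
      then show "(\<lambda>n. (s n x - f x)\<^sup>2) \<longlonglongrightarrow> 0" by simp
    qed
    show "AE x in cube. norm ((s n x - f x)\<^sup>2) \<le> (w x)\<^sup>2" for n
      using bd by (auto intro!: AE_I2 simp: abs_le_square_iff)
  qed simp
  then have "(\<lambda>n. (dist (L2_of (s n)) (L2_of f))\<^sup>2) \<longlonglongrightarrow> 0"
    by (simp add: dist_L2_of s f)
  then have "(\<lambda>n. sqrt ((dist (L2_of (s n)) (L2_of f))\<^sup>2)) \<longlonglongrightarrow> sqrt 0"
    by (rule tendsto_real_sqrt)
  then show ?thesis by (subst tendsto_dist_iff) simp
qed

lemma L2_of_sum:
  assumes "finite I" "\<And>i. i \<in> I \<Longrightarrow> square_integrable (f i)"
  shows "square_integrable (\<lambda>x. \<Sum>i\<in>I. f i x) \<and> L2_of (\<lambda>x. \<Sum>i\<in>I. f i x) = (\<Sum>i\<in>I. L2_of (f i))"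
  using assms
  by (induction I rule: finite_induct)
     (auto simp: square_integrable_zero L2_of_zero L2_of_add[symmetric] square_integrable_add)

lemma L2_ind_in_closed_subspace:
  fixes V :: "'a::euclidean_space L2 set"
  assumes V: "closed V" "subspace V" and P: "Int_stable P" "sigma_sets UNIV P = sets borel"
    and PV: "\<And>A. A \<in> P \<Longrightarrow> L2_ind A \<in> V" and U: "L2_ind UNIV \<in> V" and A: "A \<in> sets borel"
  shows "L2_ind A \<in> V"
proof -
  have "P \<subseteq> Pow UNIV" by simp
  have "A \<in> sigma_sets UNIV P" using A P by simp
  with P(1) \<open>P \<subseteq> Pow UNIV\<close> show ?thesis
  proof (induction rule: sigma_sets_induct_disjoint)
    case (basic A) then show ?case by (rule PV)
  next
    case empty
    have "(indicator {} :: 'a \<Rightarrow> real) = (\<lambda>_. 0)" by (simp add: fun_eq_iff)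
    then have "L2_ind {} = (0 :: 'a L2)" by (simp only: L2_ind_def L2_of_zero)
    then show ?case using V(2) by (simp add: subspace_0)
  next
    case (compl A)
    then have "A \<in> sets borel" using P by simp
    have "(indicator (UNIV - A) :: 'a \<Rightarrow> real) = (\<lambda>x. indicator UNIV x - indicator A x)"
      by (simp add: indicator_def fun_eq_iff)
    with \<open>A \<in> sets borel\<close> have "L2_ind (UNIV - A) = L2_ind UNIV - L2_ind A"
      unfolding L2_ind_def by (simp only: L2_of_diff square_integrable_indicator sets.top space_borel[symmetric])
    then show ?case using compl U V(2) by (simp add: subspace_diff)
  next
    case (union B)
    have B: "B i \<in> sets borel" for i using union(2) P by auto
    have ind: "indicator (\<Union>i<n. B i) x = (\<Sum>i<n. indicator (B i) x :: real)" for n x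
      by (rule indicator_UN_disjoint) (use union(1) in \<open>auto intro: disjoint_family_on_mono\<close>)
    have eq: "L2_of (indicator (\<Union>i<n. B i)) = (\<Sum>i<n. L2_ind (B i))" for n
      using L2_of_sum[of "{..<n}" "\<lambda>i. indicator (B i)"] B
      by (simp add: L2_ind_def square_integrable_indicator ind[abs_def])
    have "(\<lambda>n. L2_of (indicator (\<Union>i<n. B i) :: 'a \<Rightarrow> real)) \<longlonglongrightarrow> L2_of (indicator (\<Union>i. B i))"
    proof (rule L2_dominated_convergence)
      show "square_integrable (indicator (UNIV :: 'a set) :: 'a \<Rightarrow> real)"
        by (rule square_integrable_indicator) simp
      show "(\<lambda>n. indicator (\<Union>i<n. B i) x :: real) \<longlonglongrightarrow> indicator (\<Union>i. B i) x" for x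
        by (rule LIMSEQ_indicator_UN)
    qed (use B in \<open>auto intro!: square_integrable_indicator simp: indicator_def\<close>)
    moreover have "L2_of (indicator (\<Union>i<n. B i)) \<in> V" for n
      unfolding eq using union V(2) by (auto intro: subspace_sum)
    ultimately show ?case
      unfolding L2_ind_def by (rule closed_sequentially[OF V(1), rotated])
  qed
qed

lemma L2_closed_subspace_UNIV:
  fixes V :: "'a::euclidean_space L2 set"
  assumes V: "closed V" "subspace V" and A: "\<And>A. A \<in> sets borel \<Longrightarrow> L2_ind A \<in> V"
  shows "x \<in> V"
proof -
  let ?f = "L2_fun x"
  have f: "?f \<in> borel_measurable cube"
    using square_integrable_L2_fun[of x] by (simp add: square_integrable_def)
  obtain s where s: "\<And>i. simple_function cube (s i)"
      "\<And>x. x \<in> space cube \<Longrightarrow> (\<lambda>i. s i x) \<longlonglongrightarrow> ?f x"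
      "\<And>i x. x \<in> space cube \<Longrightarrow> norm (s i x) \<le> 2 * norm (?f x)"
    using borel_measurable_implies_sequence_metric[OF f, of 0] unfolding norm_conv_dist by metis
  have step: "square_integrable (s i) \<and> L2_of (s i) \<in> V" for i
  proof -
    let ?S = "s i ` space (cube :: 'a measure)"
    have fin: "finite ?S" using s(1) by (simp add: simple_function_def)
    define C where "C y = s i -` {y} \<inter> space (cube :: 'a measure)" for y
    have C: "C y \<in> sets borel" if "y \<in> ?S" for y
    proof -
      have "C y \<in> sets cube" using s(1)[of i] that by (auto simp: C_def simple_function_def)
      then show ?thesis by (auto simp: cube_def sets_restrict_space)
    qed
    let ?t = "\<lambda>x. \<Sum>y\<in>?S. y * indicator (C y) x"
    have st: "s i x = ?t x" if "x \<in> space cube" for x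
    proof -
      have "?t x = (\<Sum>y\<in>?S. if y = s i x then y else 0)"
        using that by (intro sum.cong) (auto simp: C_def indicator_def)
      also have "\<dots> = s i x" using fin that by simp
      finally show ?thesis by simp
    qed
    have "square_integrable ?t \<and> L2_of ?t = (\<Sum>y\<in>?S. L2_of (\<lambda>x. y * indicator (C y) x))"
      by (rule L2_of_sum[OF fin]) (intro square_integrable_scale square_integrable_indicator C)
    moreover have "(\<Sum>y\<in>?S. L2_of (\<lambda>x. y * indicator (C y) x)) = (\<Sum>y\<in>?S. y *\<^sub>R L2_ind (C y))"
      by (intro sum.cong refl) (simp add: L2_ind_def L2_of_scaleR square_integrable_indicator C)
    moreover have "(\<Sum>y\<in>?S. y *\<^sub>R L2_ind (C y)) \<in> V"
      using V(2) A C by (intro subspace_sum subspace_scale) auto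
    ultimately have t: "square_integrable ?t" "L2_of ?t \<in> V" by auto
    have sq: "square_integrable (s i)"
      using t(1) st unfolding square_integrable_def
      by (metis (mono_tags, lifting) measurable_cong Bochner_Integration.integrable_cong)
    have "L2_of (s i) = L2_of ?t"
      by (subst L2_of_eq_iff[OF sq t(1)]) (rule AE_I2, rule st)
    with t sq show ?thesis by simp
  qed
  have "(\<lambda>i. L2_of (s i)) \<longlonglongrightarrow> L2_of ?f"
  proof (rule L2_dominated_convergence)
    show "square_integrable (\<lambda>y. 3 * ?f y)" by (intro square_integrable_scale) simp
    show "\<bar>s n y - ?f y\<bar> \<le> \<bar>3 * ?f y\<bar>" if "y \<in> space cube" for n y
      using s(3)[OF that, of n] by simp
  qed (use s step in auto)
  then have "L2_of ?f \<in> V"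
    by (rule closed_sequentially[OF V(1), rotated]) (use step in blast)
  then show ?thesis by simp
qed

lemma subspace_closure_L2:
  fixes S :: "'a::euclidean_space L2 set"
  assumes "subspace S" shows "subspace (closure S)"
proof (rule subspaceI)
  show "0 \<in> closure S" using assms closure_subset subspace_0 by blast
next
  fix x y assume "x \<in> closure S" "y \<in> closure S"
  then obtain a b where "\<And>n. a n \<in> S" "a \<longlonglongrightarrow> x" "\<And>n. b n \<in> S" "b \<longlonglongrightarrow> y"
    by (auto simp: closure_sequential)
  then have "(\<forall>n. a n + b n \<in> S) \<and> (\<lambda>n. a n + b n) \<longlonglongrightarrow> x + y"
    using assms by (auto intro: tendsto_add subspace_add)
  then show "x + y \<in> closure S" unfolding closure_sequential by (intro exI[of _ "\<lambda>n. a n + b n"])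
next
  fix c x assume "x \<in> closure S"
  then obtain a where "\<And>n. a n \<in> S" "a \<longlonglongrightarrow> x" by (auto simp: closure_sequential)
  then have "(\<forall>n. c *\<^sub>R a n \<in> S) \<and> (\<lambda>n. c *\<^sub>R a n) \<longlonglongrightarrow> c *\<^sub>R x"
    using assms by (auto intro: tendsto_scaleR tendsto_const subspace_scale)
  then show "c *\<^sub>R x \<in> closure S" unfolding closure_sequential by (intro exI[of _ "\<lambda>n. c *\<^sub>R a n"])
qed

lemma L2_separable: "\<exists>D :: 'a::euclidean_space L2 set. countable D \<and> closure D = UNIV"
proof -
  obtain B :: "'a set set" where B: "countable B" "topological_basis B"
    using ex_countable_basis by blast
  define P where "P = Inter ` {F. finite F \<and> F \<subseteq> B}"
  have cP: "countable P"
    unfolding P_def using countable_Collect_finite_subset[OF B(1)]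
    by (auto intro: countable_image simp: conj_commute)
  have BP: "B \<subseteq> P"
  proof
    fix b assume "b \<in> B"
    then have "\<Inter>{b} \<in> P" unfolding P_def by (intro imageI) auto
    then show "b \<in> P" by simp
  qed
  have Pborel: "P \<subseteq> sets borel"
  proof
    fix p assume "p \<in> P"
    then obtain F where "finite F" "F \<subseteq> B" "p = \<Inter>F" by (auto simp: P_def)
    then have "open p" using B(2) by (auto intro!: open_Inter simp: topological_basis_open)
    then show "p \<in> sets borel" by simp
  qed
  have UP: "UNIV \<in> P" unfolding P_def by (rule image_eqI[of _ _ "{}"]) auto
  have Pst: "Int_stable P"
  proof (rule Int_stableI)
    fix a b assume "a \<in> P" "b \<in> P"
    then obtain F G where "finite F" "F \<subseteq> B" "a = \<Inter>F" "finite G" "G \<subseteq> B" "b = \<Inter>G"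
      by (auto simp: P_def)
    then have "finite (F \<union> G) \<and> F \<union> G \<subseteq> B \<and> a \<inter> b = \<Inter>(F \<union> G)" by auto
    then show "a \<inter> b \<in> P" by (auto simp: P_def)
  qed
  have Psig: "sigma_sets UNIV P = sets borel"
  proof
    show "sigma_sets UNIV P \<subseteq> sets borel"
      using Pborel sets.sigma_sets_subset[of P borel] by simp
    have "sets borel = sigma_sets UNIV B"
      by (subst borel_eq_countable_basis[OF B]) simp
    also have "\<dots> \<subseteq> sigma_sets UNIV P" by (rule sigma_sets_subseteq[OF BP])
    finally show "sets borel \<subseteq> sigma_sets UNIV P" .
  qed
  define S where "S = L2_ind ` P"
  have cS: "countable S" using cP by (simp add: S_def)
  define D where "D = (\<lambda>(xs :: (rat \<times> 'a L2) list). \<Sum>(q, y)\<leftarrow>xs. of_rat q *\<^sub>R y) ` lists (UNIV \<times> S)"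
  have cD: "countable D" unfolding D_def using cS by auto
  have D0: "0 \<in> D" unfolding D_def by (rule image_eqI[of _ _ "[]"]) auto
  have Dadd: "x + y \<in> D" if "x \<in> D" "y \<in> D" for x y
  proof -
    from that obtain xs ys where "x = (\<Sum>(q, y)\<leftarrow>xs. of_rat q *\<^sub>R y)" "y = (\<Sum>(q, y)\<leftarrow>ys. of_rat q *\<^sub>R y)"
      "xs \<in> lists (UNIV \<times> S)" "ys \<in> lists (UNIV \<times> S)" by (auto simp: D_def)
    then show ?thesis unfolding D_def by (intro image_eqI[of _ _ "xs @ ys"]) auto
  qed
  have Dq: "of_rat q *\<^sub>R x \<in> D" if "x \<in> S" for q x
    unfolding D_def using that by (intro image_eqI[of _ _ "[(q, x)]"]) auto
  have cl_add: "x + y \<in> closure D" if "x \<in> closure D" "y \<in> closure D" for x y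
  proof -
    from that obtain a b where "\<And>n. a n \<in> D" "a \<longlonglongrightarrow> x" "\<And>n. b n \<in> D" "b \<longlonglongrightarrow> y"
      by (auto simp: closure_sequential)
    then have "(\<forall>n. a n + b n \<in> D) \<and> (\<lambda>n. a n + b n) \<longlonglongrightarrow> x + y"
      using Dadd by (auto intro: tendsto_add)
    then show ?thesis unfolding closure_sequential by (intro exI[of _ "\<lambda>n. a n + b n"])
  qed
  have cl_scale: "c *\<^sub>R x \<in> closure D" if "x \<in> S" for c :: real and x
  proof -
    have "\<exists>q::rat. \<bar>of_rat q - c\<bar> < 1 / Suc n" for n
    proof -
      obtain q :: rat where "c < of_rat q" "of_rat q < c + 1 / Suc n"
        using of_rat_dense[of c "c + 1 / Suc n"] by auto
      then show ?thesis by (intro exI[of _ q]) (simp add: abs_if)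
    qed
    then obtain q where q: "\<And>n. \<bar>of_rat (q n) - c\<bar> < 1 / Suc n" by metis
    have "(\<lambda>n. of_rat (q n) - c :: real) \<longlonglongrightarrow> 0"
      by (rule Lim_null_comparison[OF _ LIMSEQ_inverse_real_of_nat])
         (use q in \<open>auto intro!: always_eventually less_imp_le simp: inverse_eq_divide\<close>)
    then have "(\<lambda>n. of_rat (q n) :: real) \<longlonglongrightarrow> c" by (rule LIM_zero_cancel)
    then have "(\<lambda>n. of_rat (q n) *\<^sub>R x) \<longlonglongrightarrow> c *\<^sub>R x" by (intro tendsto_intros)
    then show ?thesis
      unfolding closure_sequential using Dq[OF that] by (intro exI[of _ "\<lambda>n. of_rat (q n) *\<^sub>R x"]) auto
  qed
  have "span S \<subseteq> closure D"
  proof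
    fix x assume "x \<in> span S"
    then show "x \<in> closure D"
    proof (induction rule: span_induct_alt)
      case base show ?case using D0 closure_subset by blast
    next
      case (step c x y) then show ?case using cl_add cl_scale by blast
    qed
  qed
  then have sub: "closure (span S) \<subseteq> closure D" by (simp add: closure_minimal)
  have "x \<in> closure (span S)" for x :: "'a L2"
  proof (rule L2_closed_subspace_UNIV)
    show "closed (closure (span S))" by simp
    show "subspace (closure (span S))" by (rule subspace_closure_L2) simp
    fix A :: "'a set" assume A: "A \<in> sets borel"
    show "L2_ind A \<in> closure (span S)"
    proof (rule L2_ind_in_closed_subspace[OF _ _ Pst Psig _ _ A])
      show "closed (closure (span S))" by simp
      show "subspace (closure (span S))" by (rule subspace_closure_L2) simp
      have *: "L2_ind A \<in> closure (span S)" if "A \<in> P" for A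
        by (rule subsetD[OF closure_subset], rule span_base) (simp add: S_def that)
      show "L2_ind A \<in> closure (span S)" if "A \<in> P" for A
        using that by (rule *)
      show "L2_ind UNIV \<in> closure (span S)" by (rule *[OF UP])
    qed
  qed
  with sub have "closure D = UNIV" by blast
  with cD show ?thesis by blast
qed

instance L2 :: (euclidean_space) second_countable_topology
proof
  obtain D :: "'a L2 set" where D: "countable D" "closure D = UNIV"
    using L2_separable by blast
  define B where "B = (\<lambda>(d, n). ball d (1 / real (Suc n))) ` (D \<times> UNIV)"
  have "countable B" unfolding B_def using D(1) by auto
  moreover have "topological_basis B"
  proof (rule topological_basisI)
    show "open b" if "b \<in> B" for b using that by (auto simp: B_def)
    fix U :: "'a L2 set" and x assume "open U" "x \<in> U"
    then obtain e where e: "e > 0" "ball x e \<subseteq> U" by (auto simp: open_contains_ball)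
    obtain n where n: "1 / real (Suc n) < e / 2"
      using e by (metis nat_approx_posE half_gt_zero)
    have "x \<in> closure D" using D by simp
    then obtain d where d: "d \<in> D" "dist d x < 1 / real (Suc n)"
      unfolding closure_approachable by (metis zero_less_divide_1_iff of_nat_0_less_iff zero_less_Suc)
    show "\<exists>b\<in>B. x \<in> b \<and> b \<subseteq> U"
    proof (intro bexI conjI)
      show "ball d (1 / real (Suc n)) \<in> B" using d by (auto simp: B_def)
      show "x \<in> ball d (1 / real (Suc n))" using d by simp
      show "ball d (1 / real (Suc n)) \<subseteq> U"
      proof
        fix y assume "y \<in> ball d (1 / real (Suc n))"
        then have "dist x y < e"
          using d n dist_triangle[of x y d] by (simp add: dist_commute)
        then show "y \<in> U" using e by auto
      qed
    qed
  qed
  ultimately show "\<exists>B :: 'a L2 set set. countable B \<and> open = generate_topology B"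
    using topological_basis_imp_subbasis by blast
qed



section \<open>Kernels and integral operators\<close>

text \<open>
  A square-integrable kernel on the cube is an element of \<open>('a \<times> 'a) L2\<close>, since the cube of
  \<open>'a \<times> 'a\<close> is the product of the cubes (lemma \<open>cube_prod\<close>).
\<close>

lemma cube_prod: "(cube :: ('a::euclidean_space \<times> 'b::euclidean_space) measure) = cube \<Otimes>\<^sub>M cube"
proof -
  interpret A: prob_space "cube :: 'a measure" by (rule prob_space_cube)
  interpret B: prob_space "cube :: 'b measure" by (rule prob_space_cube)
  have box: "cbox 0 One = cbox (0::'a) One \<times> cbox (0::'b) One"
  proof -
    have "(One :: 'a \<times> 'b) = (One, One)"
            unfolding sum_Basis_prod_eq by (simp add: prod_eq_iff fst_sum snd_sum)
    then show ?thesis by (simp add: zero_prod_def cbox_Pair_eq)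
  qed
  have "cube \<Otimes>\<^sub>M cube = (cube :: ('a \<times> 'b) measure)"
  proof (rule pair_measure_eqI)
    show "sigma_finite_measure (cube :: 'a measure)" "sigma_finite_measure (cube :: 'b measure)" by unfold_locales
    have "sets (cube \<Otimes>\<^sub>M cube :: ('a \<times> 'b) measure) \<subseteq> sets cube"
    proof (rule sets_pair_in_sets)
      fix a :: "'a set" and b :: "'b set"
      assume "a \<in> sets cube" "b \<in> sets cube"
      then obtain a' b' where ab: "a' \<in> sets borel" "a = a' \<inter> cbox 0 One" "b' \<in> sets borel" "b = b' \<inter> cbox 0 One"
        by (auto simp: cube_def sets_restrict_space)
      then have "a' \<times> b' \<in> sets borel" by (metis borel_prod pair_measureI)
      moreover have "a \<times> b = (a' \<times> b') \<inter> cbox 0 One" unfolding box using ab by auto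
      ultimately show "a \<times> b \<in> sets cube" using sets_cube_borel by metis
    qed
    moreover have "sets cube \<subseteq> sets (cube \<Otimes>\<^sub>M cube :: ('a \<times> 'b) measure)"
    proof
      fix A :: "('a \<times> 'b) set" assume "A \<in> sets cube"
      then obtain A' where A': "A' \<in> sets borel" "A = A' \<inter> cbox 0 One"
        by (auto simp: cube_def sets_restrict_space)
      have id: "(\<lambda>x. x) \<in> measurable (cube :: 'c::euclidean_space measure) borel"
        unfolding cube_def by (rule measurable_restrict_space1) simp
      have "(\<lambda>x. (fst x, snd x)) \<in> measurable (cube \<Otimes>\<^sub>M cube :: ('a \<times> 'b) measure) (borel \<Otimes>\<^sub>M borel)"
        by (intro measurable_Pair measurable_compose[OF measurable_fst id] measurable_compose[OF measurable_snd id])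
      then have "(\<lambda>x. x) \<in> measurable (cube \<Otimes>\<^sub>M cube :: ('a \<times> 'b) measure) borel"
        by (simp add: borel_prod)
      from measurable_sets[OF this A'(1)]
      have "A' \<inter> space (cube \<Otimes>\<^sub>M cube :: ('a \<times> 'b) measure) \<in> sets (cube \<Otimes>\<^sub>M cube)" by simp
      moreover have "space (cube \<Otimes>\<^sub>M cube :: ('a \<times> 'b) measure) = cbox 0 One"
        unfolding box by (simp add: space_pair_measure cube_def space_restrict_space)
      ultimately show "A \<in> sets (cube \<Otimes>\<^sub>M cube)" using A' by simp
    qed
    ultimately show "sets (cube \<Otimes>\<^sub>M cube :: ('a \<times> 'b) measure) = sets cube" by (rule antisym)
    fix A :: "'a set" and B :: "'b set"
    assume "A \<in> sets cube" "B \<in> sets cube"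
    then have AB: "A \<in> sets borel" "B \<in> sets borel" "A \<subseteq> cbox 0 One" "B \<subseteq> cbox 0 One"
      by (auto simp: cube_def sets_restrict_space)
    then have "emeasure cube (A \<times> B) = emeasure (lborel \<Otimes>\<^sub>M lborel) (A \<times> B)"
      unfolding cube_def lborel_prod box
      using borel_closed[OF closed_cbox, of "0 :: 'a \<times> 'b" One, unfolded box]
      by (subst emeasure_restrict_space) auto
    also have "\<dots> = emeasure lborel A * emeasure lborel B"
      using AB by (intro lborel.emeasure_pair_measure_Times) auto
    finally show "emeasure cube A * emeasure cube B = emeasure cube (A \<times> B)"
      using AB by (simp add: cube_def emeasure_restrict_space)
  qed
  then show ?thesis by simp
qed

definition kernel_tensor :: "'a::euclidean_space L2 \<Rightarrow> 'a L2 \<Rightarrow> ('a \<times> 'a) L2" where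
  "kernel_tensor x y = L2_of (\<lambda>(s1, s2). L2_fun x s1 * L2_fun y s2)"

definition kernel_swap :: "('a::euclidean_space \<times> 'a) L2 \<Rightarrow> ('a \<times> 'a) L2" where
  "kernel_swap k = L2_of (\<lambda>(s1, s2). L2_fun k (s2, s1))"

definition integral_operator :: "('a::euclidean_space \<times> 'a) L2 \<Rightarrow> 'a L2 \<Rightarrow> 'a L2" where
  "integral_operator k x = L2_of (\<lambda>s1. \<integral>s2. L2_fun k (s1, s2) * L2_fun x s2 \<partial>cube)"

context
begin

private lemma cube_pair: "pair_sigma_finite (cube :: 'a::euclidean_space measure) (cube :: 'b::euclidean_space measure)"
  by (intro pair_sigma_finite.intro prob_space_imp_sigma_finite prob_space_cube)

lemma integrable_cube_tensor:
  fixes f g :: "'a::euclidean_space \<Rightarrow> real"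
  assumes "integrable cube f" "integrable cube g"
  shows "integrable (cube \<Otimes>\<^sub>M cube) (\<lambda>s. f (fst s) * g (snd s))"
proof -
  interpret pair_sigma_finite "cube :: 'a measure" "cube :: 'a measure" by (rule cube_pair)
  have "integrable (cube \<Otimes>\<^sub>M cube) (\<lambda>(s, t). f s * g t)"
    unfolding case_prod_beta
    by (rule Fubini_integrable) (use assms in \<open>auto simp: abs_mult\<close>)
  then show ?thesis unfolding case_prod_beta by simp
qed

lemma square_integrable_kernel_tensor:
  fixes x y :: "'a::euclidean_space L2"
  shows "square_integrable (\<lambda>(s1, s2). L2_fun x s1 * L2_fun y s2)"
proof -
  have m: "L2_fun x \<in> borel_measurable cube" "L2_fun y \<in> borel_measurable cube"
    and i: "integrable cube (\<lambda>s. (L2_fun x s)\<^sup>2)" "integrable cube (\<lambda>s. (L2_fun y s)\<^sup>2)"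
    using square_integrable_L2_fun[of x] square_integrable_L2_fun[of y] by (auto simp: square_integrable_def)
  from integrable_cube_tensor[OF i] m show ?thesis
    unfolding square_integrable_def cube_prod case_prod_beta power_mult_distrib by simp
qed

lemma square_integrable_kernel_swap:
  fixes k :: "('a::euclidean_space \<times> 'a) L2"
  shows "square_integrable (\<lambda>(s1, s2). L2_fun k (s2, s1))"
proof -
  interpret pair_sigma_finite "cube :: 'a measure" "cube :: 'a measure" by (rule cube_pair)
  have k: "L2_fun k \<in> borel_measurable (cube \<Otimes>\<^sub>M cube)" "integrable (cube \<Otimes>\<^sub>M cube) (\<lambda>s. (L2_fun k s)\<^sup>2)"
    using square_integrable_L2_fun[of k] by (auto simp: square_integrable_def cube_prod)
  show ?thesis
    using measurable_pair_swap[OF k(1)] integrable_product_swap[OF k(2)]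
    unfolding square_integrable_def cube_prod case_prod_beta by simp
qed

lemma square_integrable_kernel_section:
  fixes k :: "('a::euclidean_space \<times> 'a) L2"
  shows "AE s1 in cube. square_integrable (\<lambda>s2. L2_fun k (s1, s2))"
proof -
  interpret pair_sigma_finite "cube :: 'a measure" "cube :: 'a measure" by (rule cube_pair)
  have k: "L2_fun k \<in> borel_measurable (cube \<Otimes>\<^sub>M cube)" "integrable (cube \<Otimes>\<^sub>M cube) (\<lambda>s. (L2_fun k s)\<^sup>2)"
    using square_integrable_L2_fun[of k] by (auto simp: square_integrable_def cube_prod)
  have "AE s1 in cube. integrable cube (\<lambda>s2. (L2_fun k (s1, s2))\<^sup>2)"
    using AE_integrable_fst'[OF k(2)] by simp
  moreover have "AE s1 in cube. (\<lambda>s2. L2_fun k (s1, s2)) \<in> borel_measurable cube"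
    by (rule AE_I2) (use k(1) in measurable)
  ultimately show ?thesis by eventually_elim (simp add: square_integrable_def)
qed

lemma square_integrable_integral_operator:
  fixes k :: "('a::euclidean_space \<times> 'a) L2"
  shows "square_integrable (\<lambda>s1. \<integral>s2. L2_fun k (s1, s2) * L2_fun x s2 \<partial>cube)"
proof -
  interpret pair_sigma_finite "cube :: 'a measure" "cube :: 'a measure" by (rule cube_pair)
  have k: "L2_fun k \<in> borel_measurable (cube \<Otimes>\<^sub>M cube)" "integrable (cube \<Otimes>\<^sub>M cube) (\<lambda>s. (L2_fun k s)\<^sup>2)"
    using square_integrable_L2_fun[of k] by (auto simp: square_integrable_def cube_prod)
  have [measurable]: "L2_fun x \<in> borel_measurable cube" "L2_fun k \<in> borel_measurable (cube \<Otimes>\<^sub>M cube)"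
    using square_integrable_L2_fun[of x] k by (auto simp: square_integrable_def)
  have m [measurable]: "(\<lambda>s1. \<integral>s2. L2_fun k (s1, s2) * L2_fun x s2 \<partial>cube) \<in> borel_measurable cube"
    by measurable
  have "integrable cube (\<lambda>s1. (\<integral>s2. L2_fun k (s1, s2) * L2_fun x s2 \<partial>cube)\<^sup>2)"
  proof (rule Bochner_Integration.integrable_bound)
    show "integrable cube (\<lambda>s1. (\<integral>s2. (L2_fun k (s1, s2))\<^sup>2 \<partial>cube) * (norm x)\<^sup>2)"
      using integrable_fst'[OF k(2)] by simp
    show "AE s1 in cube. norm ((\<integral>s2. L2_fun k (s1, s2) * L2_fun x s2 \<partial>cube)\<^sup>2)
        \<le> norm ((\<integral>s2. (L2_fun k (s1, s2))\<^sup>2 \<partial>cube) * (norm x)\<^sup>2)"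
      using square_integrable_kernel_section[of k]
    proof eventually_elim
      fix s1 assume s: "square_integrable (\<lambda>s2. L2_fun k (s1, s2))"
      have "\<bar>\<integral>s2. L2_fun k (s1, s2) * L2_fun x s2 \<partial>cube\<bar> = \<bar>inner (L2_of (\<lambda>s2. L2_fun k (s1, s2))) x\<bar>"
        using inner_L2_of[OF s square_integrable_L2_fun, of x] by simp
      also have "\<dots> \<le> norm (L2_of (\<lambda>s2. L2_fun k (s1, s2))) * norm x"
        by (rule Cauchy_Schwarz_ineq2)
      finally have "\<bar>\<integral>s2. L2_fun k (s1, s2) * L2_fun x s2 \<partial>cube\<bar>\<^sup>2
          \<le> (norm (L2_of (\<lambda>s2. L2_fun k (s1, s2))) * norm x)\<^sup>2"
        by (rule power_mono) simp
      then show "norm ((\<integral>s2. L2_fun k (s1, s2) * L2_fun x s2 \<partial>cube)\<^sup>2)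
        \<le> norm ((\<integral>s2. (L2_fun k (s1, s2))\<^sup>2 \<partial>cube) * (norm x)\<^sup>2)"
        by (simp add: power_mult_distrib norm_L2_of[OF s] abs_mult)
    qed
  qed measurable
  with m show ?thesis by (simp add: square_integrable_def)
qed

lemma inner_integral_operator:
  fixes k :: "('a::euclidean_space \<times> 'a) L2"
  shows "inner (integral_operator k x) z = inner k (kernel_tensor z x)"
proof -
  interpret pair_sigma_finite "cube :: 'a measure" "cube :: 'a measure" by (rule cube_pair)
  have int: "integrable (cube \<Otimes>\<^sub>M cube) (\<lambda>(s1, s2). L2_fun k (s1, s2) * (L2_fun z s1 * L2_fun x s2))"
    using square_integrable_mult[OF square_integrable_L2_fun[of k] square_integrable_kernel_tensor[of z x]]
    unfolding cube_prod case_prod_beta by simp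
  have "inner k (kernel_tensor z x)
      = (\<integral>s. L2_fun k s * (case s of (s1, s2) \<Rightarrow> L2_fun z s1 * L2_fun x s2) \<partial>cube)"
    unfolding kernel_tensor_def
    using inner_L2_of[OF square_integrable_L2_fun[of k] square_integrable_kernel_tensor[of z x]] by simp
  also have "\<dots> = (\<integral>(s1, s2). L2_fun k (s1, s2) * (L2_fun z s1 * L2_fun x s2) \<partial>(cube \<Otimes>\<^sub>M cube))"
    unfolding cube_prod case_prod_beta by simp
  also have "\<dots> = (\<integral>s1. (\<integral>s2. L2_fun k (s1, s2) * (L2_fun z s1 * L2_fun x s2) \<partial>cube) \<partial>cube)"
    using integral_fst[OF int] by simp
  also have "\<dots> = (\<integral>s1. (\<integral>s2. L2_fun k (s1, s2) * L2_fun x s2 \<partial>cube) * L2_fun z s1 \<partial>cube)"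
    by (simp add: mult_ac flip: integral_mult_left_zero integral_mult_right_zero)
  also have "\<dots> = inner (integral_operator k x) z"
    unfolding integral_operator_def
    using inner_L2_of[OF square_integrable_integral_operator[of k x] square_integrable_L2_fun[of z]] by simp
  finally show ?thesis by simp
qed

end

text \<open>Eigenvalues are counted with (geometric) multiplicity: the \<open>j\<close>-th largest one is the largest
  eigenvalue \<open>l\<close> such that there are \<open>j\<close> linearly independent eigenvectors to eigenvalues \<open>\<ge> l\<close>.
  Since the space is infinite-dimensional, a self-adjoint operator of finite rank has \<open>0\<close> as
  an eigenvalue of infinite multiplicity, so that its negative eigenvalues are never reached.\<close>

definition nth_largest_eigenvalue :: "('v::real_vector \<Rightarrow> 'v) \<Rightarrow> nat \<Rightarrow> real" where
  "nth_largest_eigenvalue A j = (GREATEST l.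
     (\<exists>x. x \<noteq> 0 \<and> A x = l *\<^sub>R x) \<and>
     (\<exists>B. finite B \<and> card B = j \<and> independent B \<and> (\<forall>x\<in>B. \<exists>\<mu>\<ge>l. A x = \<mu> *\<^sub>R x)))"


section \<open>Random elements and functional time series\<close>

definition Lp_space :: "'w measure \<Rightarrow> real \<Rightarrow> ('w \<Rightarrow> 'h::{banach, second_countable_topology}) set" where
  "Lp_space M p = {X. X \<in> borel_measurable M \<and> integrable M (\<lambda>\<omega>. norm (X \<omega>) powr p)}"

definition Lp_norm :: "'w measure \<Rightarrow> real \<Rightarrow> ('w \<Rightarrow> 'h::{banach, second_countable_topology}) \<Rightarrow> real" where
  "Lp_norm M p X = (\<integral>\<omega>. norm (X \<omega>) powr p \<partial>M) powr (1 / p)"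

definition strictly_stationary :: "'w measure \<Rightarrow> (int \<Rightarrow> 'w \<Rightarrow> 'h::topological_space) \<Rightarrow> bool" where
  "strictly_stationary M Z \<longleftrightarrow>
     (\<forall>I k. finite I \<longrightarrow>
        distr M (Pi\<^sub>M I (\<lambda>_. borel)) (\<lambda>\<omega>. \<lambda>t\<in>I. Z (t + k) \<omega>) =
        distr M (Pi\<^sub>M I (\<lambda>_. borel)) (\<lambda>\<omega>. \<lambda>t\<in>I. Z t \<omega>))"

text \<open>
  \<open>X T t\<close> is the \<open>t\<close>-th observation (\<open>1 \<le> t \<le> T\<close>) in the \<open>T\<close>-th row of a triangular array;
  \<open>Xs u\<close> is the stationary process associated with the rescaled time \<open>u\<close>.
\<close>

definition locally_stationary ::
  "'w measure \<Rightarrow> real \<Rightarrow> real \<Rightarrow> (nat \<Rightarrow> nat \<Rightarrow> 'w \<Rightarrow> 'h::{banach, second_countable_topology}) \<Rightarrow>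
   (real \<Rightarrow> int \<Rightarrow> 'w \<Rightarrow> 'h) \<Rightarrow> bool" where
  "locally_stationary M p \<rho> X Xs \<longleftrightarrow>
     \<rho> > 0 \<and>
     (\<forall>T t. 1 \<le> t \<and> t \<le> T \<longrightarrow> X T t \<in> Lp_space M p) \<and>
     (\<forall>u\<in>{0..1}. (\<forall>t. Xs u t \<in> Lp_space M p) \<and> strictly_stationary M (Xs u)) \<and>
     (\<exists>C. \<forall>u\<in>{0..1}. \<exists>U. \<forall>T t. 1 \<le> t \<and> t \<le> T \<longrightarrow>
        U T t \<in> borel_measurable M \<and> (\<forall>\<omega>\<in>space M. U T t \<omega> > 0) \<and>
        integrable M (\<lambda>\<omega>. U T t \<omega> powr \<rho>) \<and> (\<integral>\<omega>. U T t \<omega> powr \<rho> \<partial>M) < C \<and>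
        (AE \<omega> in M. norm (X T t \<omega> - Xs u (int t) \<omega>) \<le>
           (\<bar>real t / real T - u\<bar> + 1 / real T) * U T t \<omega>))"

text \<open>
  The coupling \<open>f(\<epsilon>\<^sub>t, \<dots>, \<epsilon>\<^bsub>t-m+1\<^esub>, \<epsilon>'\<^bsub>t,t-m\<^esub>, \<epsilon>'\<^bsub>t,t-m-1\<^esub>, \<dots>)\<close>, where the array
  \<open>epsc t m\<close> is the independent copy of the innovations used for the pair \<open>(t, m)\<close>.
\<close>

definition m_coupling ::
  "((nat \<Rightarrow> 's) \<Rightarrow> 'h) \<Rightarrow> (int \<Rightarrow> 'w \<Rightarrow> 's) \<Rightarrow> (int \<Rightarrow> nat \<Rightarrow> int \<Rightarrow> 'w \<Rightarrow> 's) \<Rightarrow>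
   nat \<Rightarrow> int \<Rightarrow> 'w \<Rightarrow> 'h" where
  "m_coupling f eps epsc m t \<omega> =
     f (\<lambda>k. if k < m then eps (t - int k) \<omega> else epsc t m (t - int k) \<omega>)"

definition Lp_m_approximable ::
  "'w measure \<Rightarrow> real \<Rightarrow> 's measure \<Rightarrow> ((nat \<Rightarrow> 's) \<Rightarrow> 'h::{banach, second_countable_topology}) \<Rightarrow>
   (int \<Rightarrow> 'w \<Rightarrow> 's) \<Rightarrow> (int \<Rightarrow> nat \<Rightarrow> int \<Rightarrow> 'w \<Rightarrow> 's) \<Rightarrow> (int \<Rightarrow> 'w \<Rightarrow> 'h) \<Rightarrow> bool" where
  "Lp_m_approximable M p S f eps epsc Z \<longleftrightarrow>
     (\<forall>t. Z t \<in> Lp_space M p) \<and>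
     prob_space.indep_vars M (\<lambda>_. S) eps UNIV \<and>
     (\<forall>t. distr M S (eps t) = distr M S (eps 0)) \<and>
     f \<in> borel_measurable (Pi\<^sub>M UNIV (\<lambda>_. S)) \<and>
     (\<forall>t. AE \<omega> in M. Z t \<omega> = f (\<lambda>k. eps (t - int k) \<omega>)) \<and>
     (\<forall>t m. m \<ge> 1 \<longrightarrow>
        prob_space.indep_var M
          (Pi\<^sub>M UNIV (\<lambda>_. S)) (\<lambda>\<omega> k. eps k \<omega>) (Pi\<^sub>M UNIV (\<lambda>_. S)) (\<lambda>\<omega> k. epsc t m k \<omega>) \<and>
        distr M (Pi\<^sub>M UNIV (\<lambda>_. S)) (\<lambda>\<omega> k. epsc t m k \<omega>) =
        distr M (Pi\<^sub>M UNIV (\<lambda>_. S)) (\<lambda>\<omega> k. eps k \<omega>)) \<and>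
     (\<forall>t. summable (\<lambda>m. Lp_norm M p (\<lambda>\<omega>. Z t \<omega> - m_coupling f eps epsc (Suc m) t \<omega>)))"

text \<open>
  For square-integrable random elements the expectations below exist as Bochner integrals in the
  space of kernels; \<open>E[Z\<^sub>0(s2) Z\<^sub>t(s1)]\<close>, as a function of \<open>(s1, s2)\<close>, is \<open>E[Z\<^sub>t \<otimes> Z\<^sub>0]\<close>.
\<close>

definition long_run_covariance ::
  "'w measure \<Rightarrow> (int \<Rightarrow> 'w \<Rightarrow> 'a::euclidean_space L2) \<Rightarrow> ('a \<times> 'a) L2" where
  "long_run_covariance M Z =
     (\<integral>\<omega>. kernel_tensor (Z 0 \<omega>) (Z 0 \<omega>) \<partial>M) +
     (\<Sum>t. \<integral>\<omega>. kernel_tensor (Z 0 \<omega>) (Z (int (Suc t)) \<omega>) \<partial>M) +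
     (\<Sum>t. \<integral>\<omega>. kernel_tensor (Z (int (Suc t)) \<omega>) (Z 0 \<omega>) \<partial>M)"


section \<open>Estimators\<close>

text \<open>In this section \<open>x t\<close>, \<open>1 \<le> t \<le> T\<close>, is one realization of the observed series.\<close>

definition local_mean ::
  "(real \<Rightarrow> real) \<Rightarrow> real \<Rightarrow> real \<Rightarrow> nat \<Rightarrow> (nat \<Rightarrow> 'a::euclidean_space L2) \<Rightarrow> 'a L2" where
  "local_mean K1 h u T x =
     (1 / (real T * h)) *\<^sub>R (\<Sum>t=1..T. K1 ((u - real t / real T) / h) *\<^sub>R x t)"

definition local_autocovariance ::
  "(real \<Rightarrow> real) \<Rightarrow> real \<Rightarrow> real \<Rightarrow> nat \<Rightarrow> (nat \<Rightarrow> 'a::euclidean_space L2) \<Rightarrow> nat \<Rightarrow> ('a \<times> 'a) L2" where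
  "local_autocovariance K1 h u T x t =
     (1 / (real T * h)) *\<^sub>R (\<Sum>j=t+1..T. K1 ((u - real j / real T) / h) *\<^sub>R
        kernel_tensor (x j - local_mean K1 h u T x) (x (j - t) - local_mean K1 h u T x))"

definition local_long_run_covariance ::
  "(real \<Rightarrow> real) \<Rightarrow> (real \<Rightarrow> real) \<Rightarrow> real \<Rightarrow> real \<Rightarrow> real \<Rightarrow> nat \<Rightarrow>
   (nat \<Rightarrow> 'a::euclidean_space L2) \<Rightarrow> ('a \<times> 'a) L2" where
  "local_long_run_covariance K1 K2 h b u T x =
     local_autocovariance K1 h u T x 0 +
     (\<Sum>t=1..T-1. K2 (real t / b) *\<^sub>R
        (local_autocovariance K1 h u T x t + kernel_swap (local_autocovariance K1 h u T x t)))"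

definition pooled_estimator ::
  "(real \<Rightarrow> real) \<Rightarrow> (real \<Rightarrow> real) \<Rightarrow> real \<Rightarrow> real \<Rightarrow> real \<Rightarrow> nat \<Rightarrow> nat \<Rightarrow>
   (nat \<Rightarrow> 'a::euclidean_space L2) \<Rightarrow> (nat \<Rightarrow> 'a L2) \<Rightarrow> ('a \<times> 'a) L2" where
  "pooled_estimator K1 K2 h b u T1 T2 x y =
     (let \<theta> = real T1 / (real T1 + real T2) in
        (1 - \<theta>) *\<^sub>R local_long_run_covariance K1 K2 h b u T1 x +
        \<theta> *\<^sub>R local_long_run_covariance K1 K2 h b u T2 y)"

text \<open>
  \<open>\<eta> j\<close> is the \<open>j\<close>-th largest eigenvalue, with \<open>j\<close> starting from 1. For decreasing nonnegative
  \<open>\<eta>\<close> a truncated eigenvalue \<open>0\<close> is followed by truncated eigenvalues \<open>0\<close> only, so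
  \<open>0/0 := 1\<close> is the only division by zero that occurs in \<open>eigenvalue_ratio\<close>.
\<close>

definition truncated_eigenvalue :: "real \<Rightarrow> (nat \<Rightarrow> real) \<Rightarrow> nat \<Rightarrow> real" where
  "truncated_eigenvalue \<epsilon>0 \<eta> j = (if \<bar>\<eta> j / \<eta> 1\<bar> < \<epsilon>0 then 0 else \<eta> j)"

definition eigenvalue_ratio :: "real \<Rightarrow> (nat \<Rightarrow> real) \<Rightarrow> nat \<Rightarrow> real" where
  "eigenvalue_ratio \<epsilon>0 \<eta> j =
     (if truncated_eigenvalue \<epsilon>0 \<eta> (j + 1) = 0 \<and> truncated_eigenvalue \<epsilon>0 \<eta> j = 0 then 1
      else truncated_eigenvalue \<epsilon>0 \<eta> (j + 1) / truncated_eigenvalue \<epsilon>0 \<eta> j)"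

text \<open>Should there be several minimizers, \<open>arg_min_on\<close> selects one of them.\<close>

definition rank_estimator :: "real \<Rightarrow> nat \<Rightarrow> ('a::euclidean_space \<times> 'a) L2 \<Rightarrow> nat" where
  "rank_estimator \<epsilon>0 qbar k =
     arg_min_on (eigenvalue_ratio \<epsilon>0 (nth_largest_eigenvalue (integral_operator k))) {1..qbar}"

text \<open>
  Measurability is part of the notion: otherwise the probabilities could be \<open>0\<close> merely because
  \<open>measure\<close> vanishes outside the sigma-algebra.
\<close>

definition converges_in_probability ::
  "'w measure \<Rightarrow> (nat \<Rightarrow> 'w \<Rightarrow> 'b::{metric_space, second_countable_topology}) \<Rightarrow> ('w \<Rightarrow> 'b) \<Rightarrow> bool" where
  "converges_in_probability M X Y \<longleftrightarrow>
     (\<forall>n. X n \<in> borel_measurable M) \<and> Y \<in> borel_measurable M \<and>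
     (\<forall>e>0. (\<lambda>n. measure M {\<omega>\<in>space M. dist (X n \<omega>) (Y \<omega>) > e}) \<longlonglongrightarrow> 0)"

end

theory Submission
  imports Defs
begin

text \<open>
  Up to a swap of its arguments, the estimated kernel is a weighted quadratic form in the
  observations near \<open>u\<close>, each observation being coupled to about \<open>b\<close> others. Weighted sums of
  \<open>b\<close> terms of the stationary process have \<open>L\<^sup>2\<close> norm \<open>O(sqrt b)\<close>, so replacing the centred
  observations by the stationary process costs \<open>O(b\<^sup>1\<^sup>/\<^sup>2 d + b d\<^sup>2)\<close> in \<open>L\<^sup>1\<close>, where
  \<open>d = O(h + 1 / sqrt (T h))\<close> collects trend, local stationarity and centring. The resulting
  quadratic form has variance \<open>O(b / (T h))\<close> by the Efron--Stein inequality: replacing a single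
  innovation changes it by an amount controlled by the summable coupling coefficients. (The
  fourth moments of linear sums needed there come from the same inequality applied to \<open>|S|\<^sup>2\<close>.)
  Its mean converges to the long-run covariance kernel by dominated convergence. Hence the pooled
  estimator converges in probability, and so do its eigenvalues, which are \<open>1\<close>-Lipschitz in the
  kernel by the min-max principle. Near the limit the truncated ratios are positive for \<open>j < q0\<close>,
  zero at \<open>q0\<close>, and \<open>0/0 = 1\<close> afterwards, so the minimiser is \<open>q0\<close>.
\<close>

section \<open>Moment bounds\<close>

text \<open>The observations carry no dependence structure of their own: local stationarity only
  says that each is close in norm to the stationary process at \<open>u\<close>. Deviations must
  therefore be summed by absolute value, and only the product of one deviation with a linear sum of
  the stationary process gains from cancellation. This is why replacement is measured in L^1, while
  the variance of the stationary form needs both factors in L^4. Approximability provides a separate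
  independent copy for each time and each m and says nothing about their joint law. Only the law of
  one coupled pair is used; it is carried over to a product space with just two copies of the
  innovations, where all replacements can be compared. \<open>nth_largest_eigenvalue\<close> is a
  \<open>GREATEST\<close>, which may fail to exist for kernels of infinite rank. The analysis is
  done for \<open>positive_eigenvalue\<close>; the estimates have finite rank, where both agree, and
  for the limit kernel the two are compared only at the orders 1, \<open>q0\<close> and
  \<open>q0 + 1\<close>. \<open>Lp_le\<close> bundles measurability with an explicit bound, so that
  the inequalities of Minkowski and Cauchy-Schwarz compose as rules.\<close>

definition Lp_le :: "'w measure \<Rightarrow> nat \<Rightarrow> ('w \<Rightarrow> 'h::{banach, second_countable_topology}) \<Rightarrow> real \<Rightarrow> bool" where
  "Lp_le M p X c \<longleftrightarrow> X \<in> borel_measurable M \<and> 0 \<le> c \<and>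
     (\<integral>\<^sup>+\<omega>. ennreal (norm (X \<omega>) ^ p) \<partial>M) \<le> ennreal (c ^ p)"

lemma Lp_leD: "Lp_le M p X c \<Longrightarrow> X \<in> borel_measurable M" "Lp_le M p X c \<Longrightarrow> 0 \<le> c"
  by (auto simp: Lp_le_def)

lemma Lp_le_mono: "Lp_le M p X c \<Longrightarrow> c \<le> d \<Longrightarrow> Lp_le M p X d"
  unfolding Lp_le_def
  by (meson ennreal_leI order_trans power_mono)

lemma Lp_le_AE_mono:
  assumes "Lp_le M p X c" "Y \<in> borel_measurable M" "AE \<omega> in M. norm (Y \<omega>) \<le> norm (X \<omega>)"
  shows "Lp_le M p Y c"
proof -
  have "(\<integral>\<^sup>+\<omega>. ennreal (norm (Y \<omega>) ^ p) \<partial>M) \<le> (\<integral>\<^sup>+\<omega>. ennreal (norm (X \<omega>) ^ p) \<partial>M)"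
    by (rule nn_integral_mono_AE, use assms(3) in eventually_elim) (auto intro: ennreal_leI power_mono)
  then show ?thesis using assms by (auto simp: Lp_le_def)
qed

lemma Lp_le_uminus: "Lp_le M p X c \<Longrightarrow> Lp_le M p (\<lambda>\<omega>. - X \<omega>) c"
  by (auto simp: Lp_le_def)

lemma Lp_le_minus_commute:
  "Lp_le M p (\<lambda>\<omega>. X \<omega> - Y \<omega>) c \<Longrightarrow> Lp_le M p (\<lambda>\<omega>. Y \<omega> - X \<omega>) c"
  by (drule Lp_le_uminus) simp

lemma Lp_le_scaleR:
  assumes "Lp_le M p X c" shows "Lp_le M p (\<lambda>\<omega>. a *\<^sub>R X \<omega>) (\<bar>a\<bar> * c)"
proof -
  have [measurable]: "X \<in> borel_measurable M" using assms by (simp add: Lp_le_def)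
  have "(\<integral>\<^sup>+\<omega>. ennreal (norm (a *\<^sub>R X \<omega>) ^ p) \<partial>M) = ennreal (\<bar>a\<bar> ^ p) * (\<integral>\<^sup>+\<omega>. ennreal (norm (X \<omega>) ^ p) \<partial>M)"
    by (subst nn_integral_cmult[symmetric]) (auto simp: power_mult_distrib ennreal_mult)
  also have "\<dots> \<le> ennreal (\<bar>a\<bar> ^ p) * ennreal (c ^ p)"
    using assms by (intro mult_left_mono) (auto simp: Lp_le_def)
  also have "\<dots> = ennreal ((\<bar>a\<bar> * c) ^ p)"
    using assms by (simp add: Lp_le_def ennreal_mult power_mult_distrib)
  finally show ?thesis using assms by (auto simp: Lp_le_def)
qed

lemma Lp_le_0_AE:
  assumes "Lp_le M p X 0" "p \<ge> 1" shows "AE \<omega> in M. X \<omega> = 0"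
proof -
  have [measurable]: "X \<in> borel_measurable M" using assms by (simp add: Lp_le_def)
  have "(\<integral>\<^sup>+\<omega>. ennreal (norm (X \<omega>) ^ p) \<partial>M) = 0"
    using assms by (auto simp: Lp_le_def zero_power)
  then have "AE \<omega> in M. ennreal (norm (X \<omega>) ^ p) = 0"
    by (subst (asm) nn_integral_0_iff_AE) auto
  then show ?thesis
  proof eventually_elim
    fix \<omega> assume "ennreal (norm (X \<omega>) ^ p) = 0"
    then have "norm (X \<omega>) ^ p \<le> 0" by (simp add: ennreal_eq_0_iff)
    moreover have "0 \<le> norm (X \<omega>) ^ p" by simp
    ultimately have "norm (X \<omega>) ^ p = 0" by linarith
    then show "X \<omega> = 0" by simp
  qed
qed

text \<open>Convexity of the power, applied to x / c and y / d with weights c / (c + d) and d / (c +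
  d). With these weights, integration against the norm bounds c and d gives Minkowski's inequality
  with the exact constant c + d.\<close>

lemma power_add_le_weighted:
  fixes x y c d :: real
  assumes "0 \<le> x" "0 \<le> y" "0 < c" "0 < d"
  shows "(x + y) ^ p \<le> (c + d) ^ p * (c / (c + d) * (x ^ p / c ^ p) + d / (c + d) * (y ^ p / d ^ p))"
proof -
  have cvx: "convex_on {0::real..} (\<lambda>x. x ^ p)"
    by (cases "even p") (auto intro: convex_power_odd convex_on_subset[OF convex_power_even])
  have "1 - d / (c + d) = c / (c + d)" "0 \<le> d / (c + d)" "d / (c + d) \<le> 1"
    using assms by (simp_all add: field_simps)
  then have "(c / (c + d) * (x / c) + d / (c + d) * (y / d)) ^ p
      \<le> c / (c + d) * (x / c) ^ p + d / (c + d) * (y / d) ^ p"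
    using convex_onD[OF cvx, of "d / (c + d)" "x / c" "y / d"] assms by simp
  moreover have "c / (c + d) * (x / c) + d / (c + d) * (y / d) = (x + y) / (c + d)"
    using assms by (simp add: add_divide_distrib)
  ultimately have "((x + y) / (c + d)) ^ p \<le> c / (c + d) * (x / c) ^ p + d / (c + d) * (y / d) ^ p"
    by simp
  then have "(c + d) ^ p * ((x + y) / (c + d)) ^ p
      \<le> (c + d) ^ p * (c / (c + d) * (x / c) ^ p + d / (c + d) * (y / d) ^ p)"
    using assms by (intro mult_left_mono) auto
  then show ?thesis using assms by (simp add: power_divide)
qed

text \<open>Minkowski's inequality. The weighted convexity bound divides by c and d, so a vanishing
  bound is split off; the corresponding function is then 0 almost surely.\<close>

lemma Lp_le_add:
  assumes "Lp_le M p X c" "Lp_le M p Y d" "p \<ge> 1"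
  shows "Lp_le M p (\<lambda>\<omega>. X \<omega> + Y \<omega>) (c + d)"
proof -
  have [measurable]: "X \<in> borel_measurable M" "Y \<in> borel_measurable M" and "0 \<le> c" "0 \<le> d"
    using assms by (simp_all add: Lp_le_def)
  consider "c = 0" | "d = 0" | "0 < c" "0 < d" using \<open>0 \<le> c\<close> \<open>0 \<le> d\<close> by linarith
  then show ?thesis
  proof cases
    case 1
    then have "AE \<omega> in M. X \<omega> = 0" using assms Lp_le_0_AE by blast
    then show ?thesis using 1 assms(2)
      by (intro Lp_le_AE_mono[OF assms(2), THEN Lp_le_mono]) (auto elim!: eventually_mono)
  next
    case 2
    then have "AE \<omega> in M. Y \<omega> = 0" using assms Lp_le_0_AE by blast
    then show ?thesis using 2 assms(2)
      by (intro Lp_le_AE_mono[OF assms(1), THEN Lp_le_mono]) (auto elim!: eventually_mono)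
  next
    case 3
    let ?s = "c + d"
    have "(\<integral>\<^sup>+\<omega>. ennreal (norm (X \<omega> + Y \<omega>) ^ p) \<partial>M)
        \<le> (\<integral>\<^sup>+\<omega>. ennreal (?s ^ p * (c / ?s / c ^ p)) * ennreal (norm (X \<omega>) ^ p)
              + ennreal (?s ^ p * (d / ?s / d ^ p)) * ennreal (norm (Y \<omega>) ^ p) \<partial>M)"
    proof (rule nn_integral_mono)
      fix \<omega>
      have "norm (X \<omega> + Y \<omega>) ^ p \<le> (norm (X \<omega>) + norm (Y \<omega>)) ^ p"
        by (intro power_mono norm_triangle_ineq) auto
      also have "\<dots> \<le> ?s ^ p * (c / ?s * (norm (X \<omega>) ^ p / c ^ p) + d / ?s * (norm (Y \<omega>) ^ p / d ^ p))"
        using 3 by (intro power_add_le_weighted) auto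
      also have "\<dots> = ?s ^ p * (c / ?s / c ^ p) * norm (X \<omega>) ^ p + ?s ^ p * (d / ?s / d ^ p) * norm (Y \<omega>) ^ p"
        by (simp add: field_simps)
      finally show "ennreal (norm (X \<omega> + Y \<omega>) ^ p) \<le> ennreal (?s ^ p * (c / ?s / c ^ p)) * ennreal (norm (X \<omega>) ^ p)
              + ennreal (?s ^ p * (d / ?s / d ^ p)) * ennreal (norm (Y \<omega>) ^ p)"
        using 3 by (simp add: ennreal_mult[symmetric] ennreal_plus[symmetric] ennreal_leI del: ennreal_plus)
    qed
    also have "\<dots> = ennreal (?s ^ p * (c / ?s / c ^ p)) * (\<integral>\<^sup>+\<omega>. ennreal (norm (X \<omega>) ^ p) \<partial>M)
              + ennreal (?s ^ p * (d / ?s / d ^ p)) * (\<integral>\<^sup>+\<omega>. ennreal (norm (Y \<omega>) ^ p) \<partial>M)"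
      by (subst nn_integral_add) (auto simp: nn_integral_cmult)
    also have "\<dots> \<le> ennreal (?s ^ p * (c / ?s / c ^ p)) * ennreal (c ^ p)
              + ennreal (?s ^ p * (d / ?s / d ^ p)) * ennreal (d ^ p)"
      using assms by (intro add_mono mult_left_mono) (auto simp: Lp_le_def)
    also have "\<dots> = ennreal (?s ^ p * (c / ?s / c ^ p) * c ^ p + ?s ^ p * (d / ?s / d ^ p) * d ^ p)"
      using 3 by (simp add: ennreal_mult[symmetric] ennreal_plus[symmetric] del: ennreal_plus)
    also have "?s ^ p * (c / ?s / c ^ p) * c ^ p + ?s ^ p * (d / ?s / d ^ p) * d ^ p = ?s ^ p * (c / ?s + d / ?s)"
      using 3 by (simp add: distrib_left)
    also have "\<dots> = ?s ^ p" using 3 by (simp add: add_divide_distrib[symmetric])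
    finally show ?thesis using 3 by (auto simp: Lp_le_def)
  qed
qed

lemma Lp_le_diff:
  "Lp_le M p X c \<Longrightarrow> Lp_le M p Y d \<Longrightarrow> p \<ge> 1 \<Longrightarrow> Lp_le M p (\<lambda>\<omega>. X \<omega> - Y \<omega>) (c + d)"
  using Lp_le_add[of M p X c "\<lambda>\<omega>. - Y \<omega>" d] by (simp add: Lp_le_uminus)

lemma Lp_le_zero: "Lp_le M p (\<lambda>\<omega>. 0) 0" if "p \<ge> 1"
  using that by (auto simp: Lp_le_def zero_power)

lemma Lp_le_sum:
  assumes "finite I" "\<And>i. i \<in> I \<Longrightarrow> Lp_le M p (X i) (c i)" "p \<ge> 1"
  shows "Lp_le M p (\<lambda>\<omega>. \<Sum>i\<in>I. X i \<omega>) (\<Sum>i\<in>I. c i)"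
  using assms by (induction I rule: finite_induct) (auto intro!: Lp_le_add Lp_le_zero)

text \<open>Cauchy-Schwarz. It is enough that \<open>Z\<close> is dominated by the product of the
  norms, so that one rule covers inner products, bilinear maps and differences of squared
  norms.\<close>

lemma Lp_le_mult:
  assumes X: "Lp_le M (2 * p) X c" and Y: "Lp_le M (2 * p) Y d" and p: "p \<ge> 1"
    and Z: "Z \<in> borel_measurable M" "AE \<omega> in M. norm (Z \<omega>) \<le> norm (X \<omega>) * norm (Y \<omega>)"
  shows "Lp_le M p Z (c * d)"
proof -
  have [measurable]: "X \<in> borel_measurable M" "Y \<in> borel_measurable M" and "0 \<le> c" "0 \<le> d"
    using assms by (simp_all add: Lp_le_def)
  let ?I = "(\<integral>\<^sup>+\<omega>. ennreal (norm (Z \<omega>) ^ p) \<partial>M)"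
  have "?I \<le> (\<integral>\<^sup>+\<omega>. ennreal (norm (X \<omega>) ^ p) * ennreal (norm (Y \<omega>) ^ p) \<partial>M)"
  proof (rule nn_integral_mono_AE, use Z(2) in eventually_elim)
    fix \<omega> assume "norm (Z \<omega>) \<le> norm (X \<omega>) * norm (Y \<omega>)"
    then have "norm (Z \<omega>) ^ p \<le> norm (X \<omega>) ^ p * norm (Y \<omega>) ^ p"
      by (metis norm_ge_zero power_mono power_mult_distrib)
    then show "ennreal (norm (Z \<omega>) ^ p) \<le> ennreal (norm (X \<omega>) ^ p) * ennreal (norm (Y \<omega>) ^ p)"
      by (simp add: ennreal_mult[symmetric] ennreal_leI)
  qed
  then have "?I\<^sup>2 \<le> (\<integral>\<^sup>+\<omega>. ennreal (norm (X \<omega>) ^ p) * ennreal (norm (Y \<omega>) ^ p) \<partial>M)\<^sup>2"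
    by (rule power_mono) simp
  also have "\<dots> \<le> (\<integral>\<^sup>+\<omega>. (ennreal (norm (X \<omega>) ^ p))\<^sup>2 \<partial>M) * (\<integral>\<^sup>+\<omega>. (ennreal (norm (Y \<omega>) ^ p))\<^sup>2 \<partial>M)"
    by (rule Cauchy_Schwarz_nn_integral) auto
  also have "\<dots> = (\<integral>\<^sup>+\<omega>. ennreal (norm (X \<omega>) ^ (2*p)) \<partial>M) * (\<integral>\<^sup>+\<omega>. ennreal (norm (Y \<omega>) ^ (2*p)) \<partial>M)"
    by (simp add: ennreal_power power_mult[symmetric] mult.commute)
  also have "\<dots> \<le> ennreal (c ^ (2 * p)) * ennreal (d ^ (2 * p))"
    using X Y by (intro mult_mono) (auto simp: Lp_le_def)
  also have "\<dots> = (ennreal ((c * d) ^ p))\<^sup>2"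
    using \<open>0 \<le> c\<close> \<open>0 \<le> d\<close>
    by (simp add: ennreal_mult[symmetric] ennreal_power power_mult[symmetric] mult.commute power_mult_distrib)
  finally have le: "?I\<^sup>2 \<le> (ennreal ((c * d) ^ p))\<^sup>2" .
  have "?I \<le> ennreal ((c * d) ^ p)"
  \<comment> \<open>Taking the square root of an inequality in \<open>ennreal\<close>: that the
    integral is finite is part of what has to be shown.\<close>
  proof (cases ?I)
    case (real r)
    then have "r\<^sup>2 \<le> ((c * d) ^ p)\<^sup>2"
      using le \<open>0 \<le> c\<close> \<open>0 \<le> d\<close> by (simp add: ennreal_power)
    then have "r \<le> (c * d) ^ p"
      by (rule power2_le_imp_le) (use \<open>0 \<le> c\<close> \<open>0 \<le> d\<close> in simp)
    then show ?thesis using real by (simp add: ennreal_leI)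
  next
    case top
    then show ?thesis using le by (simp add: ennreal_power top_unique power2_eq_square ennreal_top_mult ennreal_mult_eq_top_iff)
  qed
  then show ?thesis using Z \<open>0 \<le> c\<close> \<open>0 \<le> d\<close> by (auto simp: Lp_le_def)
qed

lemma (in prob_space) Lp_le_const: "Lp_le M p (\<lambda>\<omega>. a) (norm a)"
  by (auto simp: Lp_le_def emeasure_space_1)

text \<open>Cauchy-Schwarz against the constant 1.\<close>

lemma (in prob_space) Lp_le_half:
  assumes "Lp_le M (2 * p) X c" "p \<ge> 1"
  shows "Lp_le M p X c"
  using Lp_le_mult[OF assms(1) Lp_le_const[of "2*p" "1::real"] assms(2), of X] Lp_leD(1)[OF assms(1)]
  by simp

lemma Lp_le_distr:
  assumes "g \<in> measurable M N"
  shows "X \<in> borel_measurable N \<Longrightarrow> Lp_le (distr M N g) p X c \<longleftrightarrow> Lp_le M p (\<lambda>\<omega>. X (g \<omega>)) c"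
  unfolding Lp_le_def using assms by (subst nn_integral_distr) auto

lemma Lp_le_AE_cong:
  assumes "Lp_le M p X c" "Y \<in> borel_measurable M" "AE \<omega> in M. Y \<omega> = X \<omega>"
  shows "Lp_le M p Y c"
  by (rule Lp_le_AE_mono[OF assms(1,2)]) (use assms(3) in \<open>auto elim!: eventually_mono\<close>)

lemma Lp_le_integrable_norm:
  assumes "Lp_le M p X c" shows "integrable M (\<lambda>\<omega>. norm (X \<omega>) ^ p)"
    and "(\<integral>\<omega>. norm (X \<omega>) ^ p \<partial>M) \<le> c ^ p"
proof -
  have [measurable]: "X \<in> borel_measurable M" and "0 \<le> c"
    using assms by (simp_all add: Lp_le_def)
  show *: "integrable M (\<lambda>\<omega>. norm (X \<omega>) ^ p)"
    using assms by (intro integrableI_nonneg) (auto simp: Lp_le_def intro: le_less_trans)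
  show "(\<integral>\<omega>. norm (X \<omega>) ^ p \<partial>M) \<le> c ^ p"
    using assms \<open>0 \<le> c\<close> by (subst (asm) Lp_le_def, subst (asm) nn_integral_eq_integral[OF *]) (auto)
qed

lemma Lp_leI_integrable:
  assumes "X \<in> borel_measurable M" "integrable M (\<lambda>\<omega>. norm (X \<omega>) ^ p)" "(\<integral>\<omega>. norm (X \<omega>) ^ p \<partial>M) \<le> c ^ p" "0 \<le> c"
  shows "Lp_le M p X c"
  using assms unfolding Lp_le_def by (subst nn_integral_eq_integral) (auto intro: ennreal_leI)

lemma Lp_le_1_integrable:
  assumes "Lp_le M 1 X c" shows "integrable M X" "norm (\<integral>\<omega>. X \<omega> \<partial>M) \<le> c"
proof -
  show "integrable M X"
    using Lp_le_integrable_norm(1)[OF assms] Lp_leD(1)[OF assms] by (simp add: integrable_norm_iff)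
  show "norm (\<integral>\<omega>. X \<omega> \<partial>M) \<le> c"
    using order_trans[OF integral_norm_bound Lp_le_integrable_norm(2)[OF assms, unfolded power_one_right]] by simp
qed

lemma (in prob_space) Lp_le_2_integrable:
  assumes "Lp_le M 2 X c" shows "integrable M X" "norm (\<integral>\<omega>. X \<omega> \<partial>M) \<le> c"
  using Lp_le_1_integrable[OF Lp_le_half[of 1 X c]] assms by auto

lemma (in prob_space) Lp_le_1_Markov:
  assumes "Lp_le M 1 X c" "\<delta> > 0"
  shows "prob {\<omega>\<in>space M. norm (X \<omega>) \<ge> \<delta>} \<le> c / \<delta>"
proof -
  have "prob {\<omega>\<in>space M. norm (X \<omega>) \<ge> \<delta>} \<le> (\<integral>\<omega>. norm (X \<omega>) \<partial>M) / \<delta>"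
    using Lp_le_integrable_norm(1)[OF assms(1)] assms(2)
    by (intro integral_Markov_inequality_measure[where A="{}"]) auto
  also have "\<dots> \<le> c / \<delta>"
    using Lp_le_integrable_norm(2)[OF assms(1)] assms(2) by (intro divide_right_mono) auto
  finally show ?thesis .
qed

lemma integral_inner_Lp_le:
  fixes X Y :: "'w \<Rightarrow> 'h::{real_inner, banach, second_countable_topology}"
  assumes "Lp_le M 2 X c" "Lp_le M 2 Y d"
  shows "integrable M (\<lambda>\<omega>. inner (X \<omega>) (Y \<omega>))" "\<bar>\<integral>\<omega>. inner (X \<omega>) (Y \<omega>) \<partial>M\<bar> \<le> c * d"
proof -
  have [measurable]: "X \<in> borel_measurable M" "Y \<in> borel_measurable M"
    using assms by (simp_all add: Lp_le_def)
  have "Lp_le M 1 (\<lambda>\<omega>. inner (X \<omega>) (Y \<omega>)) (c * d)"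
    using assms by (intro Lp_le_mult[of M 1 X c Y d]) (auto simp: Cauchy_Schwarz_ineq2)
  from Lp_le_1_integrable[OF this]
  show "integrable M (\<lambda>\<omega>. inner (X \<omega>) (Y \<omega>))" "\<bar>\<integral>\<omega>. inner (X \<omega>) (Y \<omega>) \<partial>M\<bar> \<le> c * d" by auto
qed

lemma borel_measurable_bounded_bilinear:
  fixes b :: "'a::{real_normed_vector, second_countable_topology} \<Rightarrow> 'b::{real_normed_vector, second_countable_topology} \<Rightarrow> 'c::real_normed_vector"
  assumes "bounded_bilinear b" "X \<in> borel_measurable M" "Y \<in> borel_measurable M"
  shows "(\<lambda>\<omega>. b (X \<omega>) (Y \<omega>)) \<in> borel_measurable M"
proof -
  have "continuous_on UNIV (\<lambda>z. b (fst z) (snd z))"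
    by (intro bounded_bilinear.continuous_on[OF assms(1)] continuous_intros)
  then show ?thesis
    using borel_measurable_continuous_on[of "\<lambda>z. b (fst z) (snd z)" "\<lambda>\<omega>. (X \<omega>, Y \<omega>)" M] assms(2,3) by simp
qed

lemma Lp_le_bilinear:
  fixes b :: "'a::{banach, second_countable_topology} \<Rightarrow> 'b::{banach, second_countable_topology} \<Rightarrow> 'c::{banach, second_countable_topology}"
  assumes "bounded_bilinear b" "\<And>x y. norm (b x y) \<le> norm x * norm y"
    and "Lp_le M (2 * p) X c" "Lp_le M (2 * p) Y d" "p \<ge> 1"
  shows "Lp_le M p (\<lambda>\<omega>. b (X \<omega>) (Y \<omega>)) (c * d)"
  by (rule Lp_le_mult[OF assms(3,4,5)], rule borel_measurable_bounded_bilinear[OF assms(1) Lp_leD(1)[OF assms(3)] Lp_leD(1)[OF assms(4)]])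
     (rule AE_I2, rule assms(2))

text \<open>Schur's test: splitting each weight as sqrt r times sqrt r in Cauchy-Schwarz, the row
  and column sums bound the operator norm on square-summable sequences by \<open>G\<close>. Below,
  \<open>r l j\<close> is the influence of innovation \<open>l\<close> on observation
  \<open>j\<close>.\<close>

lemma schur_test_sum:
  fixes r :: "'l \<Rightarrow> 'j \<Rightarrow> real"
  assumes "\<And>l j. 0 \<le> r l j" "\<And>l. (\<Sum>j\<in>I. r l j) \<le> G" "\<And>j. (\<Sum>l\<in>L. r l j) \<le> G" "0 \<le> G"
  shows "(\<Sum>l\<in>L. (\<Sum>j\<in>I. \<bar>a j\<bar> * r l j)\<^sup>2) \<le> G\<^sup>2 * (\<Sum>j\<in>I. (a j)\<^sup>2)"
proof -
  have "(\<Sum>j\<in>I. \<bar>a j\<bar> * r l j)\<^sup>2 \<le> G * (\<Sum>j\<in>I. (a j)\<^sup>2 * r l j)" for l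
  proof -
    have "(\<Sum>j\<in>I. \<bar>a j\<bar> * r l j)\<^sup>2 = (\<Sum>j\<in>I. (\<bar>a j\<bar> * sqrt (r l j)) * sqrt (r l j))\<^sup>2"
      using assms(1) by (simp add: mult.assoc)
    also have "\<dots> \<le> (\<Sum>j\<in>I. (\<bar>a j\<bar> * sqrt (r l j))\<^sup>2) * (\<Sum>j\<in>I. (sqrt (r l j))\<^sup>2)"
      by (rule Cauchy_Schwarz_ineq_sum)
    also have "\<dots> = (\<Sum>j\<in>I. (a j)\<^sup>2 * r l j) * (\<Sum>j\<in>I. r l j)"
      using assms(1) by (simp add: power_mult_distrib)
    also have "\<dots> \<le> (\<Sum>j\<in>I. (a j)\<^sup>2 * r l j) * G"
      using assms by (intro mult_left_mono sum_nonneg) auto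
    finally show ?thesis by (simp add: mult.commute)
  qed
  then have "(\<Sum>l\<in>L. (\<Sum>j\<in>I. \<bar>a j\<bar> * r l j)\<^sup>2) \<le> (\<Sum>l\<in>L. G * (\<Sum>j\<in>I. (a j)\<^sup>2 * r l j))"
    by (rule sum_mono)
  also have "\<dots> = G * (\<Sum>l\<in>L. \<Sum>j\<in>I. (a j)\<^sup>2 * r l j)"
    by (simp only: sum_distrib_left)
  also have "\<dots> = G * (\<Sum>j\<in>I. \<Sum>l\<in>L. (a j)\<^sup>2 * r l j)"
    by (subst sum.swap) (rule refl)
  also have "\<dots> = G * (\<Sum>j\<in>I. (a j)\<^sup>2 * (\<Sum>l\<in>L. r l j))"
    by (simp only: sum_distrib_left)
  also have "\<dots> \<le> G * (\<Sum>j\<in>I. (a j)\<^sup>2 * G)"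
    using assms by (intro mult_left_mono sum_mono) auto
  also have "\<dots> = G\<^sup>2 * (\<Sum>j\<in>I. (a j)\<^sup>2)"
    by (simp only: sum_distrib_right[symmetric]) (simp add: power2_eq_square)
  finally show ?thesis .
qed

text \<open>For matrices that depend only on the lag: a row or a column runs injectively through the
  lags, so its sum is at most the whole series.\<close>

lemma sum_reindex_le_suminf:
  fixes \<rho> :: "nat \<Rightarrow> real"
  assumes "summable \<rho>" "\<And>n. 0 \<le> \<rho> n" "finite A" "inj_on g {x\<in>A. P x}"
  shows "(\<Sum>x\<in>A. if P x then \<rho> (g x) else 0) \<le> suminf \<rho>"
proof -
  have "(\<Sum>x\<in>A. if P x then \<rho> (g x) else 0) = (\<Sum>x\<in>{x\<in>A. P x}. \<rho> (g x))"
    using assms(3) by (simp add: sum.inter_filter)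
  also have "\<dots> = (\<Sum>n\<in>g ` {x\<in>A. P x}. \<rho> n)"
    using assms(4) by (simp add: sum.reindex)
  also have "\<dots> \<le> suminf \<rho>"
    using assms by (intro sum_le_suminf) auto
  finally show ?thesis .
qed

section \<open>The Efron--Stein inequality\<close>

text \<open>A point of \<open>RZ\<close> below holds two independent copies of the innovations, the second one at
  the indices \<open>(True, k)\<close>. \<open>sel L\<close> uses the second copy exactly on \<open>L\<close>, and \<open>swp K\<close>, which
  preserves the measure, exchanges the copies on \<open>K\<close>.\<close>

definition sel :: "int set \<Rightarrow> (bool \<times> int \<Rightarrow> 's) \<Rightarrow> int \<Rightarrow> 's" where
  "sel L \<omega> k = \<omega> (k \<in> L, k)"

definition swp :: "int set \<Rightarrow> (bool \<times> int \<Rightarrow> 's) \<Rightarrow> bool \<times> int \<Rightarrow> 's" where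
  "swp K \<omega> i = \<omega> (fst i \<noteq> (snd i \<in> K), snd i)"

lemma sel_swp: "sel L (swp K \<omega>) = sel {k. (k \<in> L) \<noteq> (k \<in> K)} \<omega>"
  by (auto simp: sel_def swp_def fun_eq_iff)

locale iid_sequence =
  fixes N :: "'s measure"
  assumes prob_N: "prob_space N"
begin

abbreviation PZ :: "(int \<Rightarrow> 's) measure" where "PZ \<equiv> Pi\<^sub>M UNIV (\<lambda>_. N)"
abbreviation RZ :: "(bool \<times> int \<Rightarrow> 's) measure" where "RZ \<equiv> Pi\<^sub>M UNIV (\<lambda>_. N)"

sublocale PZ: prob_space PZ by (rule prob_space_PiM) (rule prob_N)
sublocale RZ: prob_space RZ by (rule prob_space_PiM) (rule prob_N)

lemma measurable_sel [measurable]: "sel L \<in> measurable RZ PZ"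
  by (rule measurable_PiM_single') (auto simp: sel_def space_PiM intro!: measurable_component_singleton)

lemma measurable_swp [measurable]: "swp K \<in> measurable RZ RZ"
  by (rule measurable_PiM_single') (auto simp: swp_def space_PiM intro!: measurable_component_singleton)

text \<open>\<open>sel L\<close> reads every time exactly once, from one copy or the other. This is
  an injective reindexing of the coordinates, so the law does not depend on
  \<open>L\<close>.\<close>

lemma distr_sel: "distr RZ PZ (sel L) = PZ"
proof -
  have "distr RZ PZ (\<lambda>\<omega>. \<lambda>n\<in>UNIV. \<omega> (n \<in> L, n)) = PZ"
    using prob_N by (intro distr_PiM_reindex[where f="\<lambda>k. (k \<in> L, k)"]) (auto intro!: inj_onI)
  then show ?thesis by (simp add: sel_def[abs_def] restrict_def)
qed

lemma distr_swp: "distr RZ RZ (swp K) = RZ"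
proof -
  have "distr RZ RZ (\<lambda>\<omega>. \<lambda>i\<in>UNIV. \<omega> (fst i \<noteq> (snd i \<in> K), snd i)) = RZ"
    using prob_N by (intro distr_PiM_reindex[where f="\<lambda>i. (fst i \<noteq> (snd i \<in> K), snd i)"]) (auto intro!: inj_onI)
  then show ?thesis by (simp add: swp_def[abs_def] restrict_def)
qed

lemma distr_shift: "distr PZ PZ (\<lambda>x k. x (k + j)) = PZ"
proof -
  have "distr PZ PZ (\<lambda>x. \<lambda>k\<in>UNIV. x (k + j)) = PZ"
    using prob_N by (intro distr_PiM_reindex[where f="\<lambda>k. k + j"]) (auto intro!: inj_onI)
  then show ?thesis by (simp add: restrict_def)
qed

lemma measurable_shift [measurable]: "(\<lambda>x k. x (k + j)) \<in> measurable PZ PZ"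
  by (rule measurable_PiM_single') (auto simp: space_PiM intro!: measurable_component_singleton)

lemma distr_shift2: "distr RZ RZ (\<lambda>\<omega> i. \<omega> (fst i, snd i + j)) = RZ"
proof -
  have "distr RZ RZ (\<lambda>\<omega>. \<lambda>i\<in>UNIV. \<omega> (fst i, snd i + j)) = RZ"
    using prob_N by (intro distr_PiM_reindex[where f="\<lambda>i. (fst i, snd i + j)"]) (auto intro!: inj_onI)
  then show ?thesis by (simp add: restrict_def)
qed

lemma measurable_shift2 [measurable]: "(\<lambda>\<omega> i. \<omega> (fst i, snd i + j)) \<in> measurable RZ RZ"
  by (rule measurable_PiM_single') (auto simp: space_PiM intro!: measurable_component_singleton)

lemma integral_swp:
  fixes \<Phi> :: "_ \<Rightarrow> 'b::{banach, second_countable_topology}"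
  shows "\<Phi> \<in> borel_measurable RZ \<Longrightarrow> (\<integral>\<omega>. \<Phi> (swp K \<omega>) \<partial>RZ) = (\<integral>\<omega>. \<Phi> \<omega> \<partial>RZ)"
  using integral_distr[of "swp K" RZ RZ \<Phi>] by (simp add: distr_swp)

lemma integral_sel:
  fixes \<Phi> :: "_ \<Rightarrow> 'b::{banach, second_countable_topology}"
  shows "\<Phi> \<in> borel_measurable PZ \<Longrightarrow> (\<integral>\<omega>. \<Phi> (sel L \<omega>) \<partial>RZ) = (\<integral>\<omega>. \<Phi> \<omega> \<partial>PZ)"
  using integral_distr[of "sel L" RZ PZ \<Phi>] by (simp add: distr_sel)

lemma Lp_le_swp: "Lp_le RZ p X c \<Longrightarrow> Lp_le RZ p (\<lambda>\<omega>. X (swp K \<omega>)) c"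
  using Lp_le_distr[of "swp K" RZ RZ X p c] by (auto simp: distr_swp dest: Lp_leD(1))

lemma Lp_le_sel: "Lp_le PZ p X c \<Longrightarrow> Lp_le RZ p (\<lambda>\<omega>. X (sel L \<omega>)) c"
  using Lp_le_distr[of "sel L" RZ PZ X p c] by (auto simp: distr_sel dest: Lp_leD(1))

section \<open>The two copies of the innovations are independent\<close>

lemma measurable_pair_merge: "(\<lambda>(x, y) (b, k). if b then y k else x k) \<in> measurable (PZ \<Otimes>\<^sub>M PZ) RZ"
proof (rule measurable_PiM_single')
  fix i :: "bool \<times> int"
  show "(\<lambda>\<omega>. (case \<omega> of (x, y) \<Rightarrow> \<lambda>(b, k). if b then y k else x k) i) \<in> PZ \<Otimes>\<^sub>M PZ \<rightarrow>\<^sub>M N"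
    by (cases i; cases "fst i") (auto simp: case_prod_beta intro!: measurable_compose[OF measurable_fst] measurable_compose[OF measurable_snd] measurable_component_singleton)
qed (auto simp: space_PiM space_pair_measure PiE_iff)

text \<open>A product measure is determined by its cylinders. A finite index set splits into the
  parts lying in the two copies, and the measure of the cylinder factors accordingly.\<close>

lemma distr_pair_merge:
  "distr (PZ \<Otimes>\<^sub>M PZ) RZ (\<lambda>(x, y) (b, k). if b then y k else x k) = RZ" (is "distr _ _ ?m = _")
proof -
  interpret R: product_prob_space "\<lambda>_. N" "UNIV :: (bool \<times> int) set"
    by (intro product_prob_spaceI prob_N)
  interpret P: product_prob_space "\<lambda>_. N" "UNIV :: int set"
    by (intro product_prob_spaceI prob_N)
  note m [measurable] = measurable_pair_merge
  show ?thesis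
  proof (rule R.PiM_eq)
    show "sets (distr (PZ \<Otimes>\<^sub>M PZ) RZ ?m) = sets RZ" by simp
    fix J :: "(bool \<times> int) set" and F
    assume J: "finite J" "J \<subseteq> UNIV" and F: "\<And>j. j \<in> J \<Longrightarrow> F j \<in> sets N"
    define J0 J1 where "J0 = Pair False -` J" and "J1 = Pair True -` J"
    have "i \<in> J \<longleftrightarrow> i \<in> Pair False ` J0 \<union> Pair True ` J1" for i
      by (cases i; cases "fst i") (auto simp: J0_def J1_def)
    then have J01: "J = Pair False ` J0 \<union> Pair True ` J1" by blast
    have fin: "finite J0" "finite J1"
      unfolding J0_def J1_def using J(1) by (auto intro!: finite_vimageI inj_onI)
    have emb: "x \<in> prod_emb UNIV (\<lambda>_. N) K (Pi\<^sub>E K H) \<longleftrightarrow> (\<forall>i. x i \<in> space N) \<and> (\<forall>i\<in>K. x i \<in> H i)"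
      for x :: "'i \<Rightarrow> 's" and K H
      by (auto simp: prod_emb_def PiE_iff)
    have S: "prod_emb UNIV (\<lambda>_. N) J (Pi\<^sub>E J F) \<in> sets RZ"
      by (rule sets_PiM_I) (use J F in auto)
    have pre: "?m -` prod_emb UNIV (\<lambda>_. N) J (Pi\<^sub>E J F) \<inter> space (PZ \<Otimes>\<^sub>M PZ)
       = prod_emb UNIV (\<lambda>_. N) J0 (\<Pi>\<^sub>E k\<in>J0. F (False, k)) \<times> prod_emb UNIV (\<lambda>_. N) J1 (\<Pi>\<^sub>E k\<in>J1. F (True, k))"
    proof (intro set_eqI)
      fix z :: "(int \<Rightarrow> 's) \<times> (int \<Rightarrow> 's)"
      obtain x y where z: "z = (x, y)" by (cases z)
      have h1: "(\<forall>j\<in>J. ?m (x, y) j \<in> F j) \<longleftrightarrow> (\<forall>k\<in>J0. x k \<in> F (False, k)) \<and> (\<forall>k\<in>J1. y k \<in> F (True, k))"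
        by (subst J01) (simp add: ball_Un)
      have h2: "(\<forall>i. ?m (x, y) i \<in> space N) \<longleftrightarrow> (\<forall>k. x k \<in> space N) \<and> (\<forall>k. y k \<in> space N)"
        by (simp add: split_paired_All all_bool_eq conj_commute)
      have h3: "(x, y) \<in> space (PZ \<Otimes>\<^sub>M PZ) \<longleftrightarrow> (\<forall>k. x k \<in> space N) \<and> (\<forall>k. y k \<in> space N)"
        by (simp add: space_pair_measure space_PiM PiE_iff)
      show "z \<in> ?m -` prod_emb UNIV (\<lambda>_. N) J (Pi\<^sub>E J F) \<inter> space (PZ \<Otimes>\<^sub>M PZ) \<longleftrightarrow>
         z \<in> prod_emb UNIV (\<lambda>_. N) J0 (\<Pi>\<^sub>E k\<in>J0. F (False, k)) \<times> prod_emb UNIV (\<lambda>_. N) J1 (\<Pi>\<^sub>E k\<in>J1. F (True, k))"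
        by (simp only: z vimage_eq Int_iff mem_Times_iff fst_conv snd_conv emb h1 h2 h3) argo
    qed
    have "emeasure (distr (PZ \<Otimes>\<^sub>M PZ) RZ ?m) (prod_emb UNIV (\<lambda>_. N) J (Pi\<^sub>E J F))
        = emeasure (PZ \<Otimes>\<^sub>M PZ) (prod_emb UNIV (\<lambda>_. N) J0 (\<Pi>\<^sub>E k\<in>J0. F (False, k)) \<times> prod_emb UNIV (\<lambda>_. N) J1 (\<Pi>\<^sub>E k\<in>J1. F (True, k)))"
      by (subst emeasure_distr[OF m S]) (simp only: pre)
    also have "\<dots> = emeasure PZ (prod_emb UNIV (\<lambda>_. N) J0 (\<Pi>\<^sub>E k\<in>J0. F (False, k))) * emeasure PZ (prod_emb UNIV (\<lambda>_. N) J1 (\<Pi>\<^sub>E k\<in>J1. F (True, k)))"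
      using fin F by (intro PZ.emeasure_pair_measure_Times sets_PiM_I) (auto simp: J01)
    also have "\<dots> = (\<Prod>k\<in>J0. emeasure N (F (False, k))) * (\<Prod>k\<in>J1. emeasure N (F (True, k)))"
      using fin F by (subst (1 2) P.emeasure_PiM_emb) (auto simp: J01)
    also have "\<dots> = (\<Prod>j\<in>J. emeasure N (F j))"
      unfolding J01 using fin
      by (subst prod.union_disjoint) (auto simp: prod.reindex inj_on_def)
    finally show "emeasure (distr (PZ \<Otimes>\<^sub>M PZ) RZ ?m) (prod_emb UNIV (\<lambda>_. N) J (Pi\<^sub>E J F)) = (\<Prod>j\<in>J. emeasure N (F j))" .
  qed
qed

text \<open>Reading off the two copies inverts the merging map, so their joint law is the product of
  the marginals.\<close>

lemma distr_sel_pair: "distr RZ (PZ \<Otimes>\<^sub>M PZ) (\<lambda>\<omega>. (sel {} \<omega>, sel UNIV \<omega>)) = PZ \<Otimes>\<^sub>M PZ"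
proof -
  let ?m = "\<lambda>(x, y) (b, k). if b then y k else x k"
  note m [measurable] = measurable_pair_merge
  have "distr RZ (PZ \<Otimes>\<^sub>M PZ) (\<lambda>\<omega>. (sel {} \<omega>, sel UNIV \<omega>))
      = distr (distr (PZ \<Otimes>\<^sub>M PZ) RZ ?m) (PZ \<Otimes>\<^sub>M PZ) (\<lambda>\<omega>. (sel {} \<omega>, sel UNIV \<omega>))"
    by (simp only: distr_pair_merge)
  also have "\<dots> = distr (PZ \<Otimes>\<^sub>M PZ) (PZ \<Otimes>\<^sub>M PZ) ((\<lambda>\<omega>. (sel {} \<omega>, sel UNIV \<omega>)) \<circ> ?m)"
    by (rule distr_distr) measurable
  also have "(\<lambda>\<omega>. (sel {} \<omega>, sel UNIV \<omega>)) \<circ> ?m = (\<lambda>x. x)"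
    by (auto simp: fun_eq_iff sel_def)
  finally show ?thesis by simp
qed

text \<open>Independence lets the expectation pass into both arguments. First moments suffice for
  Fubini, because the bilinear map is bounded by a multiple of the product of the norms.\<close>

lemma integral_bilinear_sel:
  fixes b :: "'a::{banach, second_countable_topology} \<Rightarrow> 'b::{banach, second_countable_topology} \<Rightarrow> 'c::{banach, second_countable_topology}"
  assumes b: "bounded_bilinear b" and F: "integrable PZ F" and G: "integrable PZ G"
  shows "(\<integral>\<omega>. b (F (sel {} \<omega>)) (G (sel UNIV \<omega>)) \<partial>RZ) = b (\<integral>x. F x \<partial>PZ) (\<integral>y. G y \<partial>PZ)"
proof -
  interpret b: bounded_bilinear b by (rule b)
  interpret PP: pair_prob_space PZ PZ ..
  have [measurable]: "F \<in> borel_measurable PZ" "G \<in> borel_measurable PZ" using F G by auto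
  have bm: "(\<lambda>(x, y). b x y) \<in> borel_measurable (borel \<Otimes>\<^sub>M borel)"
  proof -
    have "continuous_on UNIV (\<lambda>z. b (fst z) (snd z))"
      by (intro b.continuous_on continuous_intros)
    then show ?thesis unfolding case_prod_beta borel_prod by (rule borel_measurable_continuous_onI)
  qed
  have mz [measurable]: "(\<lambda>z. b (F (fst z)) (G (snd z))) \<in> borel_measurable (PZ \<Otimes>\<^sub>M PZ)"
    using measurable_compose[OF _ bm, of "\<lambda>z. (F (fst z), G (snd z))" "PZ \<Otimes>\<^sub>M PZ"] by simp
  obtain K where K: "K > 0" "\<And>x y. norm (b x y) \<le> norm x * norm y * K" using b.pos_bounded by blast
  have ir: "integrable PZ (\<lambda>y. b (F x) (G y))" for x
    by (rule integrable_bounded_linear[OF b.bounded_linear_right G])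
  have bound: "(\<integral>y. norm (b (F x) (G y)) \<partial>PZ) \<le> norm (F x) * (\<integral>y. norm (G y) * K \<partial>PZ)" for x
  proof -
    have "(\<integral>y. norm (b (F x) (G y)) \<partial>PZ) \<le> (\<integral>y. norm (F x) * (norm (G y) * K) \<partial>PZ)"
    proof (rule integral_mono)
      show "integrable PZ (\<lambda>y. norm (b (F x) (G y)))" by (rule integrable_norm[OF ir])
      show "integrable PZ (\<lambda>y. norm (F x) * (norm (G y) * K))"
        by (intro integrable_mult_right integrable_mult_left integrable_norm G)
    qed (use K(2) in \<open>simp add: mult.assoc\<close>)
    then show ?thesis by simp
  qed
  have int: "integrable (PZ \<Otimes>\<^sub>M PZ) (\<lambda>z. b (F (fst z)) (G (snd z)))"
  proof (rule PP.Fubini_integrable)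
    show "integrable PZ (\<lambda>x. \<integral>y. norm (b (F (fst (x, y))) (G (snd (x, y)))) \<partial>PZ)"
    proof (rule Bochner_Integration.integrable_bound)
      show "integrable PZ (\<lambda>x. norm (F x) * (\<integral>y. norm (G y) * K \<partial>PZ))"
        by (intro integrable_mult_left integrable_norm F)
      show "(\<lambda>x. \<integral>y. norm (b (F (fst (x, y))) (G (snd (x, y)))) \<partial>PZ) \<in> borel_measurable PZ"
        by (rule PZ.borel_measurable_lebesgue_integral) (simp add: split_beta')
      show "AE x in PZ. norm (\<integral>y. norm (b (F (fst (x, y))) (G (snd (x, y)))) \<partial>PZ) \<le> norm (norm (F x) * (\<integral>y. norm (G y) * K \<partial>PZ))"
      proof (rule AE_I2)
        fix x
        have "0 \<le> (\<integral>y. norm (b (F x) (G y)) \<partial>PZ)" by simp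
        then show "norm (\<integral>y. norm (b (F (fst (x, y))) (G (snd (x, y)))) \<partial>PZ) \<le> norm (norm (F x) * (\<integral>y. norm (G y) * K \<partial>PZ))"
          using bound[of x] unfolding fst_conv snd_conv real_norm_def by linarith
      qed
    qed
    show "AE x in PZ. integrable PZ (\<lambda>y. b (F (fst (x, y))) (G (snd (x, y))))"
      using ir by simp
  qed (rule mz)
  have sm: "(\<lambda>\<omega>. (sel {} \<omega>, sel UNIV \<omega>)) \<in> measurable RZ (PZ \<Otimes>\<^sub>M PZ)"
    by (intro measurable_Pair measurable_sel)
  have "(\<integral>\<omega>. b (F (sel {} \<omega>)) (G (sel UNIV \<omega>)) \<partial>RZ) = (\<integral>z. b (F (fst z)) (G (snd z)) \<partial>distr RZ (PZ \<Otimes>\<^sub>M PZ) (\<lambda>\<omega>. (sel {} \<omega>, sel UNIV \<omega>)))"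
    using integral_distr[OF sm, of "\<lambda>z. b (F (fst z)) (G (snd z))"] by simp
  also have "\<dots> = (\<integral>x. (\<integral>y. b (F x) (G y) \<partial>PZ) \<partial>PZ)"
    unfolding distr_sel_pair using PP.integral_fst'[OF int] by simp
  also have "\<dots> = (\<integral>x. b (F x) (\<integral>y. G y \<partial>PZ) \<partial>PZ)"
    by (intro Bochner_Integration.integral_cong refl integral_bounded_linear b.bounded_linear_right G)
  also have "\<dots> = b (\<integral>x. F x \<partial>PZ) (\<integral>y. G y \<partial>PZ)"
    by (rule integral_bounded_linear[OF b.bounded_linear_left F])
  finally show ?thesis .
qed

text \<open>Innovations are replaced one at a time, from \<open>J\<close> downwards. The factor \<open>1/2\<close> comes from
  symmetrising each increment with the swap of the coordinate \<open>J - i\<close>.\<close>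

lemma efron_stein:
  fixes F :: "(int \<Rightarrow> 's) \<Rightarrow> 'h::{real_inner, banach, second_countable_topology}"
  assumes F: "Lp_le PZ 2 F c"
    and dep: "\<And>x y. (\<forall>k\<le>J. x k = y k) \<Longrightarrow> F x = F y"
    and tail: "\<forall>\<^sub>F n in sequentially. Lp_le RZ 2 (\<lambda>\<omega>. F (sel {} \<omega>) - F (sel {..J - int n} \<omega>)) (t n)" "t \<longlonglongrightarrow> 0"
    and single: "\<And>l. l \<le> J \<Longrightarrow> Lp_le RZ 2 (\<lambda>\<omega>. F (sel {} \<omega>) - F (sel {l} \<omega>)) (d l)"
    and D: "\<And>n. (\<Sum>i<n. (d (J - int i))\<^sup>2) \<le> D"
  shows "(\<integral>x. (norm (F x))\<^sup>2 \<partial>PZ) - (norm (\<integral>x. F x \<partial>PZ))\<^sup>2 \<le> D / 2"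
proof -
  have [measurable]: "F \<in> borel_measurable PZ" using F by (rule Lp_leD)
  \<comment> \<open>Hybrids that start at \<open>F\<close> on the first copy for
    \<open>i = 0\<close> and tend to \<open>F\<close> on the second copy.\<close>
  define G where "G i \<omega> = F (sel {k. k > J - int i} \<omega>)" for i :: nat and \<omega>
  define F0 where "F0 \<omega> = F (sel {} \<omega>)" for \<omega>
  have F0: "Lp_le RZ 2 F0 c" unfolding F0_def using F by (rule Lp_le_sel)
  have G: "Lp_le RZ 2 (G i) c" for i unfolding G_def using F by (rule Lp_le_sel)
  have Fm: "(\<lambda>\<omega>. F (sel L \<omega>)) \<in> borel_measurable RZ" for L by measurable
  have G0: "G 0 = F0" unfolding G_def F0_def by (intro ext dep) (auto simp: sel_def)
  have term_le: "(\<integral>\<omega>. inner (F0 \<omega>) (G i \<omega> - G (Suc i) \<omega>) \<partial>RZ) \<le> (d (J - int i))\<^sup>2 / 2" for i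
  proof -
    define l where "l = J - int i"
    have l: "l \<le> J" by (simp add: l_def)
    have s1: "sel {} (swp {l} \<omega>) = sel {l} \<omega>" for \<omega> :: "bool \<times> int \<Rightarrow> 's"
      by (subst sel_swp) (rule arg_cong[where f="\<lambda>L. sel L \<omega>"], auto)
    have s2: "sel {k. k > l} (swp {l} \<omega>) = sel {k. k > J - int (Suc i)} \<omega>" for \<omega> :: "bool \<times> int \<Rightarrow> 's"
      by (subst sel_swp) (rule arg_cong[where f="\<lambda>L. sel L \<omega>"], auto simp: l_def)
    have s3: "sel {k. k > J - int (Suc i)} (swp {l} \<omega>) = sel {k. k > l} \<omega>" for \<omega> :: "bool \<times> int \<Rightarrow> 's"
      by (subst sel_swp) (rule arg_cong[where f="\<lambda>L. sel L \<omega>"], auto simp: l_def)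
    have s4: "sel {} (swp {k. k > l} \<omega>) = sel {k. k > l} \<omega>" for \<omega> :: "bool \<times> int \<Rightarrow> 's"
      by (subst sel_swp) (rule arg_cong[where f="\<lambda>L. sel L \<omega>"], auto)
    have s5: "sel {l} (swp {k. k > l} \<omega>) = sel {k. k > J - int (Suc i)} \<omega>" for \<omega> :: "bool \<times> int \<Rightarrow> 's"
      by (subst sel_swp) (rule arg_cong[where f="\<lambda>L. sel L \<omega>"], auto simp: l_def)
    have Fl: "Lp_le RZ 2 (\<lambda>\<omega>. F (sel {l} \<omega>)) c" using F by (rule Lp_le_sel)
    \<comment> \<open>Exchanging the copies at all times above \<open>l\<close> turns the
      replacement of \<open>l\<close> alone into the increment between consecutive hybrids, which
      therefore obeys the same bound.\<close>
    have Gd: "Lp_le RZ 2 (\<lambda>\<omega>. G i \<omega> - G (Suc i) \<omega>) (d l)"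
      using Lp_le_swp[OF single[OF l], of "{k. k > l}"] by (simp only: s4 s5 G_def l_def[symmetric])
    have Fd: "Lp_le RZ 2 (\<lambda>\<omega>. F0 \<omega> - F (sel {l} \<omega>)) (d l)"
      using single[OF l] by (simp add: F0_def)
    \<comment> \<open>The swap at \<open>l\<close> preserves the integral, exchanges the two hybrids
      and renews innovation \<open>l\<close> in \<open>F0\<close>. Averaging the two expressions
      puts a difference into each factor, so the term is quadratic in \<open>d l\<close>.\<close>
    have "(\<integral>\<omega>. inner (F0 \<omega>) (G i \<omega> - G (Suc i) \<omega>) \<partial>RZ)
        = (\<integral>\<omega>. inner (F0 (swp {l} \<omega>)) (G i (swp {l} \<omega>) - G (Suc i) (swp {l} \<omega>)) \<partial>RZ)"
      unfolding G_def F0_def by (rule integral_swp[symmetric]) measurable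
    also have "\<dots> = (\<integral>\<omega>. inner (F (sel {l} \<omega>)) (G (Suc i) \<omega> - G i \<omega>) \<partial>RZ)"
      by (simp only: F0_def G_def s1 s2 s3 l_def[symmetric])
    also have "\<dots> = - (\<integral>\<omega>. inner (F (sel {l} \<omega>)) (G i \<omega> - G (Suc i) \<omega>) \<partial>RZ)"
      by (subst integral_minus[symmetric]) (simp add: inner_diff_right)
    finally have "2 * (\<integral>\<omega>. inner (F0 \<omega>) (G i \<omega> - G (Suc i) \<omega>) \<partial>RZ)
        = (\<integral>\<omega>. inner (F0 \<omega>) (G i \<omega> - G (Suc i) \<omega>) \<partial>RZ) - (\<integral>\<omega>. inner (F (sel {l} \<omega>)) (G i \<omega> - G (Suc i) \<omega>) \<partial>RZ)"
      by simp
    also have "\<dots> = (\<integral>\<omega>. inner (F0 \<omega> - F (sel {l} \<omega>)) (G i \<omega> - G (Suc i) \<omega>) \<partial>RZ)"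
      by (subst Bochner_Integration.integral_diff[symmetric])
         (auto intro!: integral_inner_Lp_le(1)[OF F0 Gd] integral_inner_Lp_le(1)[OF Fl Gd] simp: inner_diff_left)
    also have "\<dots> \<le> (d l)\<^sup>2"
      using integral_inner_Lp_le(2)[OF Fd Gd] by (simp add: power2_eq_square)
    finally show ?thesis by (simp add: l_def)
  qed
  have Fs: "(\<integral>x. (norm (F x))\<^sup>2 \<partial>PZ) = (\<integral>\<omega>. inner (F0 \<omega>) (F0 \<omega>) \<partial>RZ)"
    unfolding F0_def by (subst integral_sel[of "\<lambda>x. inner (F x) (F x)"]) (auto simp: power2_norm_eq_inner)
  have part: "(\<integral>x. (norm (F x))\<^sup>2 \<partial>PZ) - (\<integral>\<omega>. inner (F0 \<omega>) (G n \<omega>) \<partial>RZ) \<le> D / 2" for n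
  proof -
    have "(\<integral>x. (norm (F x))\<^sup>2 \<partial>PZ) - (\<integral>\<omega>. inner (F0 \<omega>) (G n \<omega>) \<partial>RZ) = (\<Sum>i<n. \<integral>\<omega>. inner (F0 \<omega>) (G i \<omega> - G (Suc i) \<omega>) \<partial>RZ)"
    proof (induction n)
      case 0 then show ?case by (simp add: Fs G0)
    next
      case (Suc n)
      have "(\<integral>\<omega>. inner (F0 \<omega>) (G n \<omega> - G (Suc n) \<omega>) \<partial>RZ) = (\<integral>\<omega>. inner (F0 \<omega>) (G n \<omega>) \<partial>RZ) - (\<integral>\<omega>. inner (F0 \<omega>) (G (Suc n) \<omega>) \<partial>RZ)"
        unfolding inner_diff_right
        by (intro Bochner_Integration.integral_diff integral_inner_Lp_le(1)[OF F0 G])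
      with Suc show ?case by simp
    qed
    also have "\<dots> \<le> (\<Sum>i<n. (d (J - int i))\<^sup>2 / 2)" by (intro sum_mono term_le)
    also have "\<dots> \<le> D / 2" using D[of n] by (simp add: sum_divide_distrib[symmetric])
    finally show ?thesis .
  qed
  have FU: "Lp_le RZ 2 (\<lambda>\<omega>. F (sel UNIV \<omega>)) c" using F by (rule Lp_le_sel)
  \<comment> \<open>After all copies are exchanged, the tail hypothesis compares the hybrid with
    \<open>F\<close> on the second copy alone. That copy is independent of \<open>F0\<close>, so the
    limit of the cross term is the squared norm of the mean.\<close>
  have lim: "(\<lambda>n. \<integral>\<omega>. inner (F0 \<omega>) (G n \<omega>) \<partial>RZ) \<longlonglongrightarrow> (\<integral>\<omega>. inner (F0 \<omega>) (F (sel UNIV \<omega>)) \<partial>RZ)"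
  proof (rule LIM_zero_cancel, rule Lim_null_comparison)
    show "(\<lambda>n. c * t n) \<longlonglongrightarrow> 0" using tendsto_mult_right_zero[OF tail(2)] by simp
    show "\<forall>\<^sub>F n in sequentially. norm ((\<integral>\<omega>. inner (F0 \<omega>) (G n \<omega>) \<partial>RZ) - (\<integral>\<omega>. inner (F0 \<omega>) (F (sel UNIV \<omega>)) \<partial>RZ)) \<le> c * t n"
      using tail(1)
    proof eventually_elim
      fix n assume *: "Lp_le RZ 2 (\<lambda>\<omega>. F (sel {} \<omega>) - F (sel {..J - int n} \<omega>)) (t n)"
      have s6: "sel {} (swp UNIV \<omega>) = sel UNIV \<omega>" for \<omega> :: "bool \<times> int \<Rightarrow> 's"
        by (subst sel_swp) (rule arg_cong[where f="\<lambda>L. sel L \<omega>"], auto)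
      have s7: "sel {..J - int n} (swp UNIV \<omega>) = sel {k. k > J - int n} \<omega>" for \<omega> :: "bool \<times> int \<Rightarrow> 's"
        by (subst sel_swp) (rule arg_cong[where f="\<lambda>L. sel L \<omega>"], auto)
      have d: "Lp_le RZ 2 (\<lambda>\<omega>. G n \<omega> - F (sel UNIV \<omega>)) (t n)"
        using Lp_le_swp[OF *, of UNIV] unfolding s6 s7 G_def by (rule Lp_le_minus_commute)
      have "(\<integral>\<omega>. inner (F0 \<omega>) (G n \<omega>) \<partial>RZ) - (\<integral>\<omega>. inner (F0 \<omega>) (F (sel UNIV \<omega>)) \<partial>RZ)
        = (\<integral>\<omega>. inner (F0 \<omega>) (G n \<omega> - F (sel UNIV \<omega>)) \<partial>RZ)"
        unfolding inner_diff_right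
        by (intro Bochner_Integration.integral_diff[symmetric] integral_inner_Lp_le(1)[OF F0 G] integral_inner_Lp_le(1)[OF F0 FU])
      then show "norm ((\<integral>\<omega>. inner (F0 \<omega>) (G n \<omega>) \<partial>RZ) - (\<integral>\<omega>. inner (F0 \<omega>) (F (sel UNIV \<omega>)) \<partial>RZ)) \<le> c * t n"
        using integral_inner_Lp_le(2)[OF F0 d] by simp
    qed
  qed
  have "(\<lambda>n. (\<integral>x. (norm (F x))\<^sup>2 \<partial>PZ) - (\<integral>\<omega>. inner (F0 \<omega>) (G n \<omega>) \<partial>RZ))
      \<longlonglongrightarrow> (\<integral>x. (norm (F x))\<^sup>2 \<partial>PZ) - (\<integral>\<omega>. inner (F0 \<omega>) (F (sel UNIV \<omega>)) \<partial>RZ)"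
    by (intro tendsto_intros lim)
  then have "(\<integral>x. (norm (F x))\<^sup>2 \<partial>PZ) - (\<integral>\<omega>. inner (F0 \<omega>) (F (sel UNIV \<omega>)) \<partial>RZ) \<le> D / 2"
    by (rule LIMSEQ_le_const2) (use part in blast)
  moreover have "(\<integral>\<omega>. inner (F0 \<omega>) (F (sel UNIV \<omega>)) \<partial>RZ) = (norm (\<integral>x. F x \<partial>PZ))\<^sup>2"
    unfolding F0_def power2_norm_eq_inner
    by (rule integral_bilinear_sel[OF bounded_bilinear_inner]) (rule PZ.Lp_le_2_integrable[OF F])+
  ultimately show ?thesis by simp
qed

lemma efron_stein_centered:
  fixes F :: "(int \<Rightarrow> 's) \<Rightarrow> 'h::{real_inner, banach, second_countable_topology}"
  assumes F: "Lp_le PZ 2 F c"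
    and var: "(\<integral>x. (norm (F x))\<^sup>2 \<partial>PZ) - (norm (\<integral>x. F x \<partial>PZ))\<^sup>2 \<le> V"
  shows "Lp_le PZ 2 (\<lambda>x. F x - (\<integral>x. F x \<partial>PZ)) (sqrt V)"
proof -
  define m where "m = (\<integral>x. F x \<partial>PZ)"
  have [measurable]: "F \<in> borel_measurable PZ" using F by (rule Lp_leD)
  have int: "integrable PZ F" "integrable PZ (\<lambda>x. (norm (F x))\<^sup>2)"
    using PZ.Lp_le_2_integrable(1)[OF F] Lp_le_integrable_norm(1)[OF F] by auto
  have eq: "(norm (F x - m))\<^sup>2 = (norm (F x))\<^sup>2 - 2 * inner (F x) m + (norm m)\<^sup>2" for x
    by (simp add: power2_norm_eq_inner inner_diff_left inner_diff_right inner_commute)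
  have "(\<integral>x. (norm (F x - m))\<^sup>2 \<partial>PZ) = (\<integral>x. (norm (F x))\<^sup>2 \<partial>PZ) - 2 * inner m m + (norm m)\<^sup>2"
    unfolding eq using int by (simp add: PZ.prob_space m_def integral_inner_left)
  also have "\<dots> \<le> V" using var by (simp add: m_def power2_norm_eq_inner)
  finally have V: "(\<integral>x. (norm (F x - m))\<^sup>2 \<partial>PZ) \<le> V" .
  have "0 \<le> (\<integral>x. (norm (F x - m))\<^sup>2 \<partial>PZ)" by simp
  with V have "0 \<le> V" by linarith
  show ?thesis unfolding m_def[symmetric]
  proof (rule Lp_leI_integrable)
    show "integrable PZ (\<lambda>x. (norm (F x - m))\<^sup>2)" unfolding eq using int by simp
  qed (use V \<open>0 \<le> V\<close> in auto)
qed

end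

section \<open>Causal functions of independent innovations\<close>

definition causal :: "((nat \<Rightarrow> 's) \<Rightarrow> 'h) \<Rightarrow> int \<Rightarrow> (int \<Rightarrow> 's) \<Rightarrow> 'h" where
  "causal f j x = f (\<lambda>k. x (j - int k))"

lemma causal_cong: "(\<And>k. k \<le> j \<Longrightarrow> x k = y k) \<Longrightarrow> causal f j x = causal f j y"
  unfolding causal_def by (rule arg_cong[where f=f]) auto

lemma causal_shift: "causal f (j + i) x = causal f j (\<lambda>k. x (k + i))"
  unfolding causal_def by (simp add: algebra_simps)

lemma causal_eq_shift: "causal f j = (\<lambda>x. causal f 0 (\<lambda>k. x (k + j)))"
  using causal_shift[of f 0 j] by auto

lemma sum_mult_power2: "(\<Sum>i\<in>A. (x i * y)\<^sup>2) = y\<^sup>2 * (\<Sum>i\<in>A. (x i)\<^sup>2)" for y :: real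
  by (simp add: sum_distrib_left power_mult_distrib mult.commute)

lemma tendsto_shifted_coupling:
  fixes \<delta> :: "nat \<Rightarrow> real"
  assumes "\<delta> \<longlonglongrightarrow> 0" shows "(\<lambda>n. \<delta> (nat (j + int n))) \<longlonglongrightarrow> 0"
proof -
  have "filterlim (\<lambda>n. nat (j + int n)) sequentially sequentially"
    unfolding filterlim_at_top
  proof
    fix Z
    show "\<forall>\<^sub>F n in sequentially. Z \<le> nat (j + int n)"
      unfolding eventually_sequentially by (rule exI[of _ "Z + nat \<bar>j\<bar>"]) auto
  qed
  from filterlim_compose[OF assms this] show ?thesis .
qed

lemma (in iid_sequence) measurable_causal_comp:
  assumes "f \<in> borel_measurable (Pi\<^sub>M UNIV (\<lambda>_. N))"
  shows "causal f j \<in> borel_measurable PZ"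
proof -
  have "(\<lambda>x k. x (j - int k)) \<in> measurable PZ (Pi\<^sub>M UNIV (\<lambda>_. N))"
    by (rule measurable_PiM_single') (auto simp: space_PiM intro!: measurable_component_singleton)
  from measurable_compose[OF this assms] show ?thesis
    unfolding causal_def[abs_def] .
qed

text \<open>The stationary process on the canonical space, reduced to what its law determines. The
  set \<open>{..- int m}\<close> occurs because the coupling of order \<open>m\<close> keeps the
  \<open>m\<close> innovations at the times 0, -1, ..., -(m - 1).\<close>

locale causal_process = iid_sequence N for N :: "'s measure" +
  fixes f :: "(nat \<Rightarrow> 's) \<Rightarrow> 'h::{real_inner, banach, second_countable_topology}"
    and \<delta> :: "nat \<Rightarrow> real" and c4 :: real
  assumes f_measurable: "f \<in> borel_measurable (Pi\<^sub>M UNIV (\<lambda>_. N))"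
    and moment: "Lp_le PZ 4 (causal f 0) c4"
    and mean_zero: "(\<integral>x. causal f 0 x \<partial>PZ) = 0"
    and coupling0: "\<And>m. Lp_le RZ 4 (\<lambda>\<omega>. causal f 0 (sel {} \<omega>) - causal f 0 (sel {..- int m} \<omega>)) (\<delta> m)"
    and summable_\<delta>: "summable \<delta>"
begin

lemmas measurable_causal [measurable] = measurable_causal_comp[OF f_measurable]

lemma causal_moment: "Lp_le PZ 4 (causal f j) c4"
proof -
  have "Lp_le (distr PZ PZ (\<lambda>x k. x (k + j))) 4 (causal f 0) c4" using moment by (simp add: distr_shift)
  then show ?thesis
    by (subst (asm) Lp_le_distr) (auto simp: causal_eq_shift[of f j])
qed

lemma causal_mean: "(\<integral>x. causal f j x \<partial>PZ) = 0"
proof -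
  have "(\<integral>x. causal f 0 x \<partial>distr PZ PZ (\<lambda>x k. x (k + j))) = (\<integral>x. causal f j x \<partial>PZ)"
    by (subst integral_distr) (auto simp: causal_eq_shift[of f j])
  then show ?thesis by (simp add: distr_shift mean_zero)
qed

lemma \<delta>_nonneg: "0 \<le> \<delta> m" using coupling0 by (rule Lp_leD)

lemma coupling: "Lp_le RZ 4 (\<lambda>\<omega>. causal f j (sel {} \<omega>) - causal f j (sel {..j - int m} \<omega>)) (\<delta> m)"
proof -
  have eq: "causal f j (sel L \<omega>) = causal f 0 (sel {k. k + j \<in> L} (\<lambda>i. \<omega> (fst i, snd i + j)))" for L \<omega>
    using causal_shift[of f 0 j "sel L \<omega>"] by (simp add: sel_def[abs_def])
  have "{k. k + j \<in> {..j - int m}} = {..- int m}" by auto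
  moreover have "Lp_le (distr RZ RZ (\<lambda>\<omega> i. \<omega> (fst i, snd i + j))) 4 (\<lambda>\<omega>. causal f 0 (sel {} \<omega>) - causal f 0 (sel {..- int m} \<omega>)) (\<delta> m)"
    using coupling0 by (simp add: distr_shift2)
  then have "Lp_le RZ 4 (\<lambda>\<omega>. causal f 0 (sel {} (\<lambda>i. \<omega> (fst i, snd i + j))) - causal f 0 (sel {..- int m} (\<lambda>i. \<omega> (fst i, snd i + j)))) (\<delta> m)"
    by (subst (asm) Lp_le_distr) auto
  ultimately show ?thesis by (simp only: eq) simp
qed

text \<open>Replacing the innovation \<open>l\<close> alone amounts to replacing all innovations up to \<open>l\<close>
  and restoring those below \<open>l\<close>; hence two coupling coefficients per lag.\<close>

definition \<rho> :: "nat \<Rightarrow> real" where "\<rho> n = \<delta> n + \<delta> (Suc n)"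
definition influence :: "int \<Rightarrow> nat \<Rightarrow> real" where "influence l j = (if l \<le> int j then \<rho> (nat (int j - l)) else 0)"
definition G :: real where "G = suminf \<rho>"

lemma \<rho>_nonneg: "0 \<le> \<rho> n" by (simp add: \<rho>_def \<delta>_nonneg)
lemma summable_\<rho>: "summable \<rho>"
  unfolding \<rho>_def[abs_def] using summable_\<delta> by (intro summable_add) (auto simp: summable_Suc_iff)
lemma influence_nonneg: "0 \<le> influence l j" by (simp add: influence_def \<rho>_nonneg)
lemma G_nonneg: "0 \<le> G" unfolding G_def by (rule suminf_nonneg[OF summable_\<rho>]) (rule \<rho>_nonneg)

lemma influence_row: "finite I \<Longrightarrow> (\<Sum>j\<in>I. influence l j) \<le> G"
  unfolding influence_def G_def by (rule sum_reindex_le_suminf[OF summable_\<rho> \<rho>_nonneg]) (auto simp: inj_on_def)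

lemma influence_col: "(\<Sum>i<n. influence (J - int i) j) \<le> G"
  unfolding influence_def G_def by (rule sum_reindex_le_suminf[OF summable_\<rho> \<rho>_nonneg]) (auto simp: inj_on_def)

lemma single_coupling: "Lp_le RZ 4 (\<lambda>\<omega>. causal f (int j) (sel {} \<omega>) - causal f (int j) (sel {l} \<omega>)) (influence l j)"
proof (cases "l \<le> int j")
  case True
  define n where "n = nat (int j - l)"
  have e: "{..int j - int n} = {..l}" "{..int j - int (Suc n)} = {..l - 1}" using True by (auto simp: n_def)
  have s1: "sel {} (swp {l} \<omega>) = sel {l} \<omega>" for \<omega> :: "bool \<times> int \<Rightarrow> 's"
    by (subst sel_swp) (rule arg_cong[where f="\<lambda>L. sel L \<omega>"], auto)
  have s2: "sel {..l - 1} (swp {l} \<omega>) = sel {..l} \<omega>" for \<omega> :: "bool \<times> int \<Rightarrow> 's"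
    by (subst sel_swp) (rule arg_cong[where f="\<lambda>L. sel L \<omega>"], auto)
  have 1: "Lp_le RZ 4 (\<lambda>\<omega>. causal f (int j) (sel {} \<omega>) - causal f (int j) (sel {..l} \<omega>)) (\<delta> n)"
    using coupling[of "int j" n] unfolding e .
  \<comment> \<open>Exchanging the copies at \<open>l\<close> makes the comparison that replaces
    everything below \<open>l\<close> start from the sequence with \<open>l\<close> already
    replaced. Both comparisons now end at the same sequence, and subtracting them leaves the single
    replacement.\<close>
  have 2: "Lp_le RZ 4 (\<lambda>\<omega>. causal f (int j) (sel {l} \<omega>) - causal f (int j) (sel {..l} \<omega>)) (\<delta> (Suc n))"
    using Lp_le_swp[OF coupling[of "int j" "Suc n"], of "{l}"] unfolding e s1 s2 .
  from Lp_le_diff[OF 1 2] True show ?thesis by (simp add: influence_def \<rho>_def n_def)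
next
  case False
  then have "causal f (int j) (sel {} \<omega>) = causal f (int j) (sel {l} \<omega>)" for \<omega>
    by (intro causal_cong) (auto simp: sel_def)
  then show ?thesis using False by (simp add: influence_def Lp_le_zero)
qed

section \<open>Linear sums of the process\<close>

definition linsum :: "nat set \<Rightarrow> (nat \<Rightarrow> real) \<Rightarrow> (int \<Rightarrow> 's) \<Rightarrow> 'h" where
  "linsum I a x = (\<Sum>j\<in>I. a j *\<^sub>R causal f (int j) x)"

lemma measurable_linsum [measurable]: "linsum I a \<in> borel_measurable PZ"
  unfolding linsum_def[abs_def] by measurable

lemma linsum_cong: "(\<And>j. j \<in> I \<Longrightarrow> int j \<le> J) \<Longrightarrow> \<forall>k\<le>J. x k = y k \<Longrightarrow> linsum I a x = linsum I a y"
  unfolding linsum_def by (intro sum.cong refl arg_cong2[where f=scaleR] causal_cong) force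

lemma linsum_moment: "finite I \<Longrightarrow> Lp_le PZ 4 (linsum I a) (\<Sum>j\<in>I. \<bar>a j\<bar> * c4)"
  unfolding linsum_def[abs_def] by (intro Lp_le_sum Lp_le_scaleR causal_moment) auto

lemma linsum_mean: "finite I \<Longrightarrow> (\<integral>x. linsum I a x \<partial>PZ) = 0"
  unfolding linsum_def
  using PZ.Lp_le_2_integrable(1)[OF PZ.Lp_le_half[of 2, simplified, OF causal_moment]]
  by (subst Bochner_Integration.integral_sum) (auto simp: causal_mean)

lemma linsum_sel_diff:
  assumes "finite I" "\<And>j. j \<in> I \<Longrightarrow> Lp_le RZ 4 (\<lambda>\<omega>. causal f (int j) (sel {} \<omega>) - causal f (int j) (sel L \<omega>)) (e j)"
  shows "Lp_le RZ 4 (\<lambda>\<omega>. linsum I a (sel {} \<omega>) - linsum I a (sel L \<omega>)) (\<Sum>j\<in>I. \<bar>a j\<bar> * e j)"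
proof -
  have "Lp_le RZ 4 (\<lambda>\<omega>. \<Sum>j\<in>I. a j *\<^sub>R (causal f (int j) (sel {} \<omega>) - causal f (int j) (sel L \<omega>))) (\<Sum>j\<in>I. \<bar>a j\<bar> * e j)"
    by (intro Lp_le_sum Lp_le_scaleR assms) auto
  then show ?thesis by (simp add: linsum_def sum_subtractf scaleR_diff_right)
qed

lemma linsum_single:
  "finite I \<Longrightarrow> Lp_le RZ 4 (\<lambda>\<omega>. linsum I a (sel {} \<omega>) - linsum I a (sel {l} \<omega>)) (\<Sum>j\<in>I. \<bar>a j\<bar> * influence l j)"
  by (intro linsum_sel_diff single_coupling)

text \<open>Seen from time \<open>j\<close>, the cut at \<open>J - n\<close> lies
  \<open>j - J + n\<close> steps back. The condition \<open>n \<ge> nat J\<close> makes this number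
  nonnegative for every natural \<open>j\<close>, so that \<open>nat\<close> does not
  truncate.\<close>

lemma coupling_tail:
  assumes "\<And>j. j \<in> I \<Longrightarrow> int j \<le> J" "n \<ge> nat J" "j \<in> I"
  shows "Lp_le RZ 4 (\<lambda>\<omega>. causal f (int j) (sel {} \<omega>) - causal f (int j) (sel {..J - int n} \<omega>)) (\<delta> (nat ((int j - J) + int n)))"
proof -
  have "int j - int (nat ((int j - J) + int n)) = J - int n" using assms(2) by linarith
  then show ?thesis using coupling[of "int j" "nat ((int j - J) + int n)"] by simp
qed

lemma \<delta>_tendsto: "\<delta> \<longlonglongrightarrow> 0" using summable_\<delta> by (rule summable_LIMSEQ_zero)

lemma sum_influence_sq: "finite I \<Longrightarrow> (\<Sum>i<n. (\<Sum>j\<in>I. \<bar>a j\<bar> * influence (J - int i) j)\<^sup>2) \<le> G\<^sup>2 * (\<Sum>j\<in>I. (a j)\<^sup>2)"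
  by (rule schur_test_sum) (auto intro: influence_nonneg influence_row influence_col G_nonneg)

lemma finite_int_bound: "finite (I :: nat set) \<Longrightarrow> \<exists>J. \<forall>j\<in>I. int j \<le> J"
  by (rule exI[of _ "int (Max (insert 0 I))"]) auto

text \<open>Efron-Stein, with the increment at innovation \<open>l\<close> bounded by the weighted
  influences of \<open>l\<close>; Schur's test sums the squares of these increments. The mean
  vanishes, so the variance is the second moment.\<close>

lemma linsum_variance:
  assumes I: "finite I"
  shows "(\<integral>x. (norm (linsum I a x))\<^sup>2 \<partial>PZ) \<le> G\<^sup>2 * (\<Sum>j\<in>I. (a j)\<^sup>2) / 2"
proof -
  obtain J where J: "\<And>j. j \<in> I \<Longrightarrow> int j \<le> J" using finite_int_bound[OF I] by blast
  let ?t = "\<lambda>n. \<Sum>j\<in>I. \<bar>a j\<bar> * \<delta> (nat ((int j - J) + int n))"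
  have "(\<integral>x. (norm (linsum I a x))\<^sup>2 \<partial>PZ) - (norm (\<integral>x. linsum I a x \<partial>PZ))\<^sup>2 \<le> G\<^sup>2 * (\<Sum>j\<in>I. (a j)\<^sup>2) / 2"
  proof (rule efron_stein[where J=J and t="?t" and d="\<lambda>l. \<Sum>j\<in>I. \<bar>a j\<bar> * influence l j"])
    show "Lp_le PZ 2 (linsum I a) (\<Sum>j\<in>I. \<bar>a j\<bar> * c4)"
      using PZ.Lp_le_half[of 2, simplified, OF linsum_moment[OF I]] .
    show "linsum I a x = linsum I a y" if "\<forall>k\<le>J. x k = y k" for x y
      using J that by (rule linsum_cong)
    show "\<forall>\<^sub>F n in sequentially. Lp_le RZ 2 (\<lambda>\<omega>. linsum I a (sel {} \<omega>) - linsum I a (sel {..J - int n} \<omega>)) (?t n)"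
      using eventually_ge_at_top[of "nat J"]
    proof eventually_elim
      fix n assume n: "nat J \<le> n"
      show "Lp_le RZ 2 (\<lambda>\<omega>. linsum I a (sel {} \<omega>) - linsum I a (sel {..J - int n} \<omega>)) (?t n)"
        by (rule RZ.Lp_le_half[of 2, simplified], rule linsum_sel_diff[OF I], rule coupling_tail[OF J n])
    qed
    have "?t \<longlonglongrightarrow> (\<Sum>j\<in>I. \<bar>a j\<bar> * 0)"
      by (intro tendsto_sum tendsto_mult tendsto_const tendsto_shifted_coupling \<delta>_tendsto)
    then show "?t \<longlonglongrightarrow> 0" by simp
    show "Lp_le RZ 2 (\<lambda>\<omega>. linsum I a (sel {} \<omega>) - linsum I a (sel {l} \<omega>)) (\<Sum>j\<in>I. \<bar>a j\<bar> * influence l j)" for l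
      by (rule RZ.Lp_le_half[of 2, simplified], rule linsum_single[OF I])
  qed (rule sum_influence_sq[OF I])
  then show ?thesis by (simp add: linsum_mean I)
qed

lemma linsum_L2: "finite I \<Longrightarrow> Lp_le PZ 2 (linsum I a) (G * sqrt (\<Sum>j\<in>I. (a j)\<^sup>2))"
proof (rule Lp_leI_integrable)
  assume I: "finite I"
  show "integrable PZ (\<lambda>x. (norm (linsum I a x))\<^sup>2)"
    using PZ.Lp_le_half[of 2, simplified, OF linsum_moment[OF I]] by (rule Lp_le_integrable_norm)
  have "(\<integral>x. (norm (linsum I a x))\<^sup>2 \<partial>PZ) \<le> G\<^sup>2 * (\<Sum>j\<in>I. (a j)\<^sup>2) / 2" by (rule linsum_variance[OF I])
  also have "\<dots> \<le> G\<^sup>2 * (\<Sum>j\<in>I. (a j)\<^sup>2)" by (simp add: sum_nonneg)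
  finally show "(\<integral>x. (norm (linsum I a x))\<^sup>2 \<partial>PZ) \<le> (G * sqrt (\<Sum>j\<in>I. (a j)\<^sup>2))\<^sup>2"
    by (simp add: power_mult_distrib sum_nonneg)
qed (auto simp: G_nonneg sum_nonneg)

text \<open>A self-bounding argument. With \<open>s\<close> the L^4 norm of the sum and
  \<open>A\<close> the sum of squared coefficients, Efron-Stein for the squared norm has increments
  at most 2 s times those of the sum itself. This gives s^4 \<le> 2 s^2 G^2 A + (G^2 A / 2)^2, which
  forces s^2 \<le> 4 G^2 A.\<close>

lemma linsum_L4:
  assumes I: "finite I"
  shows "Lp_le PZ 4 (linsum I a) (2 * G * sqrt (\<Sum>j\<in>I. (a j)\<^sup>2))"
proof -
  obtain J where J: "\<And>j. j \<in> I \<Longrightarrow> int j \<le> J" using finite_int_bound[OF I] by blast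
  define A where "A = (\<Sum>j\<in>I. (a j)\<^sup>2)"
  define F where "F x = (norm (linsum I a x))\<^sup>2" for x
  have [measurable]: "F \<in> borel_measurable PZ" unfolding F_def by measurable
  have A: "0 \<le> A" by (simp add: A_def sum_nonneg)
  have int4: "integrable PZ (\<lambda>x. norm (linsum I a x) ^ 4)"
    using linsum_moment[OF I] by (rule Lp_le_integrable_norm)
  \<comment> \<open>The exact norm is needed, not a bound: it occurs on both sides of the inequality
    to be solved. It is finite by the crude bound \<open>linsum_moment\<close>.\<close>
  define s where "s = root 4 (\<integral>x. norm (linsum I a x) ^ 4 \<partial>PZ)"
  have s0: "0 \<le> s" by (simp add: s_def)
  have s4: "s ^ 4 = (\<integral>x. norm (linsum I a x) ^ 4 \<partial>PZ)" by (simp add: s_def)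
  have S: "Lp_le PZ 4 (linsum I a) s" by (rule Lp_leI_integrable) (auto simp: s4 s0 int4)
  have Sn: "Lp_le RZ 4 (\<lambda>\<omega>. norm (linsum I a (sel L \<omega>))) s" for L
    using Lp_le_sel[OF S, of L] by (rule Lp_le_AE_mono) auto
  have diff: "Lp_le RZ 2 (\<lambda>\<omega>. F (sel {} \<omega>) - F (sel L \<omega>)) (d * (2 * s))"
    if d: "Lp_le RZ 4 (\<lambda>\<omega>. linsum I a (sel {} \<omega>) - linsum I a (sel L \<omega>)) d" for L d
  proof -
    have "Lp_le RZ 4 (\<lambda>\<omega>. norm (linsum I a (sel {} \<omega>)) + norm (linsum I a (sel L \<omega>))) (2 * s)"
      using Lp_le_add[OF Sn[of "{}"] Sn[of L]] by simp
    then have 2: "Lp_le RZ (2 * 2) (\<lambda>\<omega>. norm (linsum I a (sel {} \<omega>)) + norm (linsum I a (sel L \<omega>))) (2 * s)"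
      by simp
    have 1: "Lp_le RZ (2 * 2) (\<lambda>\<omega>. linsum I a (sel {} \<omega>) - linsum I a (sel L \<omega>)) d" using d by simp
    show ?thesis
    proof (rule Lp_le_mult[OF 1 2])
      have "\<bar>(norm x)\<^sup>2 - (norm y)\<^sup>2\<bar> \<le> norm (x - y) * \<bar>norm x + norm y\<bar>" for x y :: 'h
      proof -
        have "(norm x)\<^sup>2 - (norm y)\<^sup>2 = (norm x - norm y) * (norm x + norm y)"
          by (simp add: power2_eq_square algebra_simps)
        then show ?thesis
          using mult_right_mono[OF norm_triangle_ineq3[of x y], of "norm x + norm y"] by (simp add: abs_mult)
      qed
      then show "AE \<omega> in RZ. norm (F (sel {} \<omega>) - F (sel L \<omega>)) \<le>
          norm (linsum I a (sel {} \<omega>) - linsum I a (sel L \<omega>)) * norm (norm (linsum I a (sel {} \<omega>)) + norm (linsum I a (sel L \<omega>)))"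
        unfolding F_def real_norm_def by (intro AE_I2)
    qed auto
  qed
  let ?t = "\<lambda>n. (\<Sum>j\<in>I. \<bar>a j\<bar> * \<delta> (nat ((int j - J) + int n))) * (2 * s)"
  have "(\<integral>x. (norm (F x))\<^sup>2 \<partial>PZ) - (norm (\<integral>x. F x \<partial>PZ))\<^sup>2 \<le> (2 * s)\<^sup>2 * (G\<^sup>2 * A) / 2"
  proof (rule efron_stein[where J=J and t="?t" and d="\<lambda>l. (\<Sum>j\<in>I. \<bar>a j\<bar> * influence l j) * (2 * s)"])
    show "Lp_le PZ 2 F (s * s)"
      using Lp_le_mult[of PZ 2 "linsum I a" s "linsum I a" s F] S by (simp add: F_def power2_eq_square)
    show "F x = F y" if "\<forall>k\<le>J. x k = y k" for x y
      unfolding F_def using linsum_cong[OF J that] by simp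
    show "\<forall>\<^sub>F n in sequentially. Lp_le RZ 2 (\<lambda>\<omega>. F (sel {} \<omega>) - F (sel {..J - int n} \<omega>)) (?t n)"
      using eventually_ge_at_top[of "nat J"]
    proof eventually_elim
      fix n assume n: "nat J \<le> n"
      show "Lp_le RZ 2 (\<lambda>\<omega>. F (sel {} \<omega>) - F (sel {..J - int n} \<omega>)) (?t n)"
        by (rule diff, rule linsum_sel_diff[OF I], rule coupling_tail[OF J n])
    qed
    have "?t \<longlonglongrightarrow> (\<Sum>j\<in>I. \<bar>a j\<bar> * 0) * (2 * s)"
      by (intro tendsto_sum tendsto_mult tendsto_const tendsto_shifted_coupling \<delta>_tendsto)
    then show "?t \<longlonglongrightarrow> 0" by simp
    show "Lp_le RZ 2 (\<lambda>\<omega>. F (sel {} \<omega>) - F (sel {l} \<omega>)) ((\<Sum>j\<in>I. \<bar>a j\<bar> * influence l j) * (2 * s))" for l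
      by (rule diff, rule linsum_single[OF I])
    show "(\<Sum>i<n. ((\<Sum>j\<in>I. \<bar>a j\<bar> * influence (J - int i) j) * (2 * s))\<^sup>2) \<le> (2 * s)\<^sup>2 * (G\<^sup>2 * A)" for n
      unfolding sum_mult_power2 A_def by (intro mult_left_mono sum_influence_sq I) auto
  qed
  moreover have "(\<integral>x. (norm (F x))\<^sup>2 \<partial>PZ) = s ^ 4"
    unfolding s4 F_def by (intro Bochner_Integration.integral_cong refl) (simp flip: power_mult)
  moreover have "norm (\<integral>x. F x \<partial>PZ) \<le> G\<^sup>2 * A / 2"
  proof -
    have "0 \<le> (\<integral>x. F x \<partial>PZ)" by (simp add: F_def)
    then show ?thesis using linsum_variance[OF I, of a] by (simp add: F_def A_def)
  qed
  then have "(norm (\<integral>x. F x \<partial>PZ))\<^sup>2 \<le> (G\<^sup>2 * A / 2)\<^sup>2" by (rule power_mono) simp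
  moreover have "(2 * s)\<^sup>2 * (G\<^sup>2 * A) / 2 = 2 * s\<^sup>2 * (G\<^sup>2 * A)"
    by (simp add: power_mult_distrib)
  ultimately have le: "s ^ 4 \<le> 2 * s\<^sup>2 * (G\<^sup>2 * A) + (G\<^sup>2 * A / 2)\<^sup>2"
    by linarith
  have "s\<^sup>2 \<le> 4 * (G\<^sup>2 * A)"
  proof (rule ccontr)
    assume n: "\<not> ?thesis"
    \<comment> \<open>If y > 4 B, the right-hand side 2 y B + B^2 / 4 is at most y^2 / 2 + y^2 / 64,
      less than y^2.\<close>
    define y B where "y = s\<^sup>2" and "B = G\<^sup>2 * A"
    have B: "0 \<le> B" "4 * B < y" using n A by (auto simp: B_def y_def)
    have "y * y \<le> 2 * y * B + B * B / 4"
      using le by (simp add: y_def B_def power2_eq_square power4_eq_xxxx field_simps)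
    moreover have "B * (4 * B) \<le> B * y" "4 * B * y \<le> y * y"
      using B by (auto intro!: mult_left_mono mult_right_mono)
    moreover have "0 < y * y" using B by simp
    moreover have "0 \<le> B * B" by simp
    ultimately show False by (simp add: algebra_simps)
  qed
  then have "s\<^sup>2 \<le> (2 * G * sqrt A)\<^sup>2" using A by (simp add: power_mult_distrib)
  then have "s \<le> 2 * G * sqrt A" by (rule power2_le_imp_le) (use G_nonneg A in simp)
  then show ?thesis using S unfolding A_def by (rule Lp_le_mono[rotated])
qed

section \<open>Quadratic forms in the process\<close>

definition quadsum :: "('h \<Rightarrow> 'h \<Rightarrow> 'k::{real_inner, banach, second_countable_topology}) \<Rightarrow> nat set \<Rightarrow> (nat \<Rightarrow> nat \<Rightarrow> real) \<Rightarrow> (int \<Rightarrow> 's) \<Rightarrow> 'k" where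
  "quadsum b I w x = (\<Sum>j\<in>I. \<Sum>i\<in>I. w j i *\<^sub>R b (causal f (int j) x) (causal f (int i) x))"

context
  fixes b :: "'h \<Rightarrow> 'h \<Rightarrow> 'k::{real_inner, banach, second_countable_topology}"
  assumes bil: "bounded_bilinear b" and b_norm: "\<And>x y. norm (b x y) \<le> norm x * norm y"
begin

interpretation b: bounded_bilinear b by (rule bil)

lemma Lp_le_b:
  assumes "Lp_le M 4 X c" "Lp_le M 4 Y d" shows "Lp_le M 2 (\<lambda>\<omega>. b (X \<omega>) (Y \<omega>)) (c * d)"
  using Lp_le_bilinear[OF bil b_norm, of M 2 X c Y d] assms by simp

lemma quadsum_moment:
  assumes I: "finite I"
  shows "Lp_le PZ 2 (quadsum b I w) (\<Sum>j\<in>I. \<Sum>i\<in>I. \<bar>w j i\<bar> * (c4 * c4))"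
  unfolding quadsum_def[abs_def] using I by (intro Lp_le_sum Lp_le_scaleR Lp_le_b causal_moment) auto

text \<open>Each product changes by b(x_j - y_j, x_i) + b(y_j, x_i - y_i). Summing over the
  unchanged factor first produces a linear sum with L^4 norm at most 2 G sqrt W, so one change costs
  the square root of the number of partners and not that number itself. The two halves add up to the
  constant 4.\<close>

lemma quadsum_sel_diff:
  assumes I: "finite I"
    and e: "\<And>j. j \<in> I \<Longrightarrow> Lp_le RZ 4 (\<lambda>\<omega>. causal f (int j) (sel {} \<omega>) - causal f (int j) (sel L \<omega>)) (e j)"
    and W: "\<And>j. j \<in> I \<Longrightarrow> (\<Sum>i\<in>I. (w j i)\<^sup>2) \<le> W" "\<And>i. i \<in> I \<Longrightarrow> (\<Sum>j\<in>I. (w j i)\<^sup>2) \<le> W"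
  shows "Lp_le RZ 2 (\<lambda>\<omega>. quadsum b I w (sel {} \<omega>) - quadsum b I w (sel L \<omega>)) (\<Sum>j\<in>I. e j * (4 * G * sqrt W))"
proof -
  have eq: "quadsum b I w x - quadsum b I w y =
     (\<Sum>j\<in>I. b (causal f (int j) x - causal f (int j) y) (linsum I (w j) x)) +
     (\<Sum>i\<in>I. b (linsum I (\<lambda>j. w j i) y) (causal f (int i) x - causal f (int i) y))" for x y
  proof -
    have "(\<Sum>i\<in>I. b (linsum I (\<lambda>j. w j i) y) (causal f (int i) x - causal f (int i) y))
       = (\<Sum>i\<in>I. \<Sum>j\<in>I. w j i *\<^sub>R b (causal f (int j) y) (causal f (int i) x - causal f (int i) y))"
      by (simp add: linsum_def b.sum_left b.scaleR_left)
    also have "\<dots> = (\<Sum>j\<in>I. \<Sum>i\<in>I. w j i *\<^sub>R b (causal f (int j) y) (causal f (int i) x - causal f (int i) y))"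
      by (rule sum.swap)
    finally have 1: "(\<Sum>i\<in>I. b (linsum I (\<lambda>j. w j i) y) (causal f (int i) x - causal f (int i) y))
       = (\<Sum>j\<in>I. \<Sum>i\<in>I. w j i *\<^sub>R b (causal f (int j) y) (causal f (int i) x - causal f (int i) y))" .
    have 2: "(\<Sum>j\<in>I. b (causal f (int j) x - causal f (int j) y) (linsum I (w j) x))
       = (\<Sum>j\<in>I. \<Sum>i\<in>I. w j i *\<^sub>R b (causal f (int j) x - causal f (int j) y) (causal f (int i) x))"
      by (simp add: linsum_def b.sum_right b.scaleR_right)
    show ?thesis
      unfolding 1 2 quadsum_def sum.distrib[symmetric] sum_subtractf[symmetric]
      by (intro sum.cong refl) (simp add: b.diff_left b.diff_right scaleR_diff_right)
  qed
  have lin: "Lp_le RZ 4 (\<lambda>\<omega>. linsum I a (sel L' \<omega>)) (2 * G * sqrt W)" if "(\<Sum>i\<in>I. (a i)\<^sup>2) \<le> W" for a L'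
    using that G_nonneg by (intro Lp_le_mono[OF Lp_le_sel[OF linsum_L4[OF I]]] mult_left_mono) auto
  have "Lp_le RZ 2 (\<lambda>\<omega>. (\<Sum>j\<in>I. b (causal f (int j) (sel {} \<omega>) - causal f (int j) (sel L \<omega>)) (linsum I (w j) (sel {} \<omega>))) +
     (\<Sum>i\<in>I. b (linsum I (\<lambda>j. w j i) (sel L \<omega>)) (causal f (int i) (sel {} \<omega>) - causal f (int i) (sel L \<omega>))))
     ((\<Sum>j\<in>I. e j * (2 * G * sqrt W)) + (\<Sum>i\<in>I. (2 * G * sqrt W) * e i))"
    by (intro Lp_le_add Lp_le_sum Lp_le_b e lin W I) auto
  moreover have "(\<Sum>j\<in>I. e j * (2 * G * sqrt W)) + (\<Sum>i\<in>I. (2 * G * sqrt W) * e i) = (\<Sum>j\<in>I. e j * (4 * G * sqrt W))"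
    unfolding sum.distrib[symmetric] by (intro sum.cong refl) (simp add: algebra_simps)
  ultimately show ?thesis unfolding eq by simp
qed

text \<open>Efron-Stein with increments 4 G sqrt W times the total influence of the innovation.
  Schur's test with unit coefficients bounds the sum of the squared total influences by G^2 times
  the number of indices. The resulting factor 16 / 2 = 8 is rounded up to 9 to have an integral
  root.\<close>

lemma quadsum_centered:
  assumes I: "finite I"
    and W: "\<And>j. j \<in> I \<Longrightarrow> (\<Sum>i\<in>I. (w j i)\<^sup>2) \<le> W" "\<And>i. i \<in> I \<Longrightarrow> (\<Sum>j\<in>I. (w j i)\<^sup>2) \<le> W"
    and W0: "0 \<le> W"
  shows "Lp_le PZ 2 (\<lambda>x. quadsum b I w x - (\<integral>x. quadsum b I w x \<partial>PZ)) (3 * G\<^sup>2 * sqrt (W * card I))"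
proof -
  obtain J where J: "\<And>j. j \<in> I \<Longrightarrow> int j \<le> J" using finite_int_bound[OF I] by blast
  let ?g = "4 * G * sqrt W"
  let ?t = "\<lambda>n. \<Sum>j\<in>I. \<delta> (nat ((int j - J) + int n)) * ?g"
  let ?d = "\<lambda>l. \<Sum>j\<in>I. influence l j * ?g"
  have "(\<integral>x. (norm (quadsum b I w x))\<^sup>2 \<partial>PZ) - (norm (\<integral>x. quadsum b I w x \<partial>PZ))\<^sup>2 \<le> (?g\<^sup>2 * (G\<^sup>2 * card I)) / 2"
  proof (rule efron_stein[where J=J and t="?t" and d="?d"])
    show "Lp_le PZ 2 (quadsum b I w) (\<Sum>j\<in>I. \<Sum>i\<in>I. \<bar>w j i\<bar> * (c4 * c4))"
      by (rule quadsum_moment[OF I])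
    show "quadsum b I w x = quadsum b I w y" if "\<forall>k\<le>J. x k = y k" for x y
    proof -
      have "causal f (int j) x = causal f (int j) y" if "j \<in> I" for j
        using J[OF that] \<open>\<forall>k\<le>J. x k = y k\<close> by (intro causal_cong) auto
      then show ?thesis by (simp add: quadsum_def)
    qed
    show "\<forall>\<^sub>F n in sequentially. Lp_le RZ 2 (\<lambda>\<omega>. quadsum b I w (sel {} \<omega>) - quadsum b I w (sel {..J - int n} \<omega>)) (?t n)"
      using eventually_ge_at_top[of "nat J"]
    proof eventually_elim
      fix n assume n: "nat J \<le> n"
      show "Lp_le RZ 2 (\<lambda>\<omega>. quadsum b I w (sel {} \<omega>) - quadsum b I w (sel {..J - int n} \<omega>)) (?t n)"
        by (rule quadsum_sel_diff[OF I]) (rule coupling_tail[OF J n] W; assumption)+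
    qed
    have "?t \<longlonglongrightarrow> (\<Sum>j\<in>I. 0 * ?g)"
      by (intro tendsto_sum tendsto_mult tendsto_const tendsto_shifted_coupling \<delta>_tendsto)
    then show "?t \<longlonglongrightarrow> 0" by simp
    show "Lp_le RZ 2 (\<lambda>\<omega>. quadsum b I w (sel {} \<omega>) - quadsum b I w (sel {l} \<omega>)) (?d l)" for l
      by (rule quadsum_sel_diff[OF I single_coupling]) (rule W; assumption)+
    have "(\<Sum>i<n. (?d (J - int i))\<^sup>2) = ?g\<^sup>2 * (\<Sum>i<n. (\<Sum>j\<in>I. \<bar>1\<bar> * influence (J - int i) j)\<^sup>2)" for n
      unfolding sum_distrib_right[symmetric] power_mult_distrib[of _ ?g] by (simp add: mult.commute)
    also have "\<dots> n \<le> ?g\<^sup>2 * (G\<^sup>2 * (\<Sum>j\<in>I. 1\<^sup>2))" for n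
      by (intro mult_left_mono sum_influence_sq[OF I]) auto
    finally show "(\<Sum>i<n. (?d (J - int i))\<^sup>2) \<le> ?g\<^sup>2 * (G\<^sup>2 * card I)" for n by simp
  qed
  from efron_stein_centered[OF quadsum_moment[OF I] this]
  show ?thesis
  proof (rule Lp_le_mono)
    have "?g\<^sup>2 * (G\<^sup>2 * card I) / 2 = 8 * (G\<^sup>2 * G\<^sup>2 * (W * card I))"
      using W0 by (simp add: power_mult_distrib)
    also have "\<dots> \<le> 9 * (G\<^sup>2 * G\<^sup>2 * (W * card I))"
      using W0 by (intro mult_right_mono) auto
    also have "\<dots> = (3 * G\<^sup>2 * sqrt (W * card I))\<^sup>2"
      using W0 by (simp add: power_mult_distrib power2_eq_square)
    finally show "sqrt (?g\<^sup>2 * (G\<^sup>2 * card I) / 2) \<le> 3 * G\<^sup>2 * sqrt (W * card I)"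
      using W0 G_nonneg by (intro real_le_lsqrt) auto
  qed
qed

section \<open>Autocovariances\<close>

lemma autocovariance_shift:
  "(\<integral>x. b (causal f (j + i) x) (causal f i x) \<partial>PZ) = (\<integral>x. b (causal f j x) (causal f 0 x) \<partial>PZ)"
proof -
  have "(\<integral>x. b (causal f j x) (causal f 0 x) \<partial>distr PZ PZ (\<lambda>x k. x (k + i)))
     = (\<integral>x. b (causal f j (\<lambda>k. x (k + i))) (causal f 0 (\<lambda>k. x (k + i))) \<partial>PZ)"
    by (rule integral_distr) (auto intro: borel_measurable_bounded_bilinear bil)
  then show ?thesis
    by (simp add: distr_shift causal_shift[symmetric] causal_shift[of f 0 i, simplified, symmetric])
qed

text \<open>Renewing all innovations up to time 0 makes the value at time \<open>t\<close>
  independent of the value at time 0, and the covariance of independent centred variables is 0. The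
  renewal itself costs \<open>\<delta> t\<close>.\<close>

lemma autocovariance_bound:
  assumes "t \<ge> 1"
  shows "norm (\<integral>x. b (causal f (int t) x) (causal f 0 x) \<partial>PZ) \<le> c4 * \<delta> t"
proof -
  let ?X = "\<lambda>\<omega>. causal f (int t) (sel {} \<omega>)" and ?X' = "\<lambda>\<omega>. causal f (int t) (sel {..0} \<omega>)" and ?Y = "\<lambda>\<omega>. causal f 0 (sel {} \<omega>)"
  have c: "Lp_le RZ 4 (\<lambda>\<omega>. ?X \<omega> - ?X' \<omega>) (\<delta> t)" using coupling[of "int t" t] by simp
  have X: "Lp_le RZ 4 ?X c4" and X': "Lp_le RZ 4 ?X' c4" and Y: "Lp_le RZ 4 ?Y c4"
    by (intro Lp_le_sel causal_moment)+
  have s1: "sel {..0} (swp {..0} \<omega>) = sel {} \<omega>" for \<omega> :: "bool \<times> int \<Rightarrow> 's"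
    by (subst sel_swp) (rule arg_cong[where f="\<lambda>L. sel L \<omega>"], auto)
  have s2: "sel {} (swp {..0} \<omega>) = sel {..0} \<omega>" for \<omega> :: "bool \<times> int \<Rightarrow> 's"
    by (subst sel_swp) (rule arg_cong[where f="\<lambda>L. sel L \<omega>"], auto)
  have s3: "causal f 0 (sel {..0} \<omega>) = causal f 0 (sel UNIV \<omega>)" for \<omega>
    by (rule causal_cong) (simp add: sel_def)
  have bm: "(\<lambda>\<omega>. b (?X' \<omega>) (?Y \<omega>)) \<in> borel_measurable RZ"
    using Lp_leD(1)[OF Lp_le_b[OF X' Y]] .
  have int: "integrable PZ (causal f j)" for j
    by (rule PZ.Lp_le_2_integrable(1)[OF PZ.Lp_le_half[of 2, simplified, OF causal_moment]])
  \<comment> \<open>The swap moves the renewal from the later value to the earlier one. The value at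
    time 0 then depends on the second copy only and the value at time \<open>t\<close> on the first
    copy only.\<close>
  have "(\<integral>\<omega>. b (?X' \<omega>) (?Y \<omega>) \<partial>RZ) = (\<integral>\<omega>. b (?X' (swp {..0} \<omega>)) (?Y (swp {..0} \<omega>)) \<partial>RZ)"
    by (rule integral_swp[OF bm, symmetric])
  also have "\<dots> = (\<integral>\<omega>. b (causal f (int t) (sel {} \<omega>)) (causal f 0 (sel UNIV \<omega>)) \<partial>RZ)"
    by (simp only: s1 s2 s3)
  also have "\<dots> = 0"
    by (subst integral_bilinear_sel[OF bil int int]) (simp add: causal_mean b.zero_left)
  finally have z: "(\<integral>\<omega>. b (?X' \<omega>) (?Y \<omega>) \<partial>RZ) = 0" .
  have "(\<integral>x. b (causal f (int t) x) (causal f 0 x) \<partial>PZ) = (\<integral>\<omega>. b (?X \<omega>) (?Y \<omega>) \<partial>RZ)"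
    by (rule integral_sel[symmetric, of "\<lambda>x. b (causal f (int t) x) (causal f 0 x)"])
       (auto intro: borel_measurable_bounded_bilinear bil)
  also have "\<dots> = (\<integral>\<omega>. b (?X \<omega>) (?Y \<omega>) \<partial>RZ) - (\<integral>\<omega>. b (?X' \<omega>) (?Y \<omega>) \<partial>RZ)" by (simp add: z)
  also have "\<dots> = (\<integral>\<omega>. b (?X \<omega>) (?Y \<omega>) - b (?X' \<omega>) (?Y \<omega>) \<partial>RZ)"
    by (rule Bochner_Integration.integral_diff[symmetric]; rule RZ.Lp_le_2_integrable(1)[OF Lp_le_b]) (rule X X' Y)+
  also have "\<dots> = (\<integral>\<omega>. b (?X \<omega> - ?X' \<omega>) (?Y \<omega>) \<partial>RZ)"
    by (simp add: b.diff_left)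
  finally show ?thesis
    using RZ.Lp_le_2_integrable(2)[OF Lp_le_b[OF c Y]] by (simp add: mult.commute)
qed

end

end

section \<open>Approximable processes on an arbitrary probability space\<close>

lemma powr_4_eq: "0 \<le> x \<Longrightarrow> x powr 4 = x ^ 4" for x :: real
  by (cases "x = 0") (auto simp: powr_numeral)

lemma Lp_le_Lp_norm:
  assumes "X \<in> borel_measurable M" "integrable M (\<lambda>\<omega>. norm (X \<omega>) ^ 4)"
  shows "Lp_le M 4 X (Lp_norm M 4 X)"
proof (rule Lp_leI_integrable[OF assms])
  let ?I = "\<integral>\<omega>. norm (X \<omega>) ^ 4 \<partial>M"
  have "Lp_norm M 4 X ^ 4 = (?I powr (1 / 4)) powr 4"
    by (simp add: Lp_norm_def powr_4_eq)
  also have "\<dots> = ?I" by (simp add: powr_powr)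
  finally show "?I \<le> Lp_norm M 4 X ^ 4" by simp
qed (simp add: Lp_norm_def)

lemma Lp_space_4_iff: "X \<in> Lp_space M 4 \<longleftrightarrow> X \<in> borel_measurable M \<and> integrable M (\<lambda>\<omega>. norm (X \<omega>) ^ 4)"
  by (simp add: Lp_space_def powr_4_eq)

text \<open>Everything that is needed from approximability, in terms that no longer mention the
  innovations. The whole innovation sequence is a map into the canonical space with the product law
  as its image, so the bounds of \<open>causal_process\<close> pull back.\<close>

lemma Lp_m_approximable_bounds:
  fixes S :: "'s measure" and Z :: "int \<Rightarrow> 'w \<Rightarrow> 'h::{real_inner, banach, second_countable_topology}"
    and b :: "'h \<Rightarrow> 'h \<Rightarrow> 'k::{real_inner, banach, second_countable_topology}"
  assumes M: "prob_space M" and app: "Lp_m_approximable M 4 S f eps epsc Z" and mean: "(\<integral>\<omega>. Z 0 \<omega> \<partial>M) = 0"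
    and bil: "bounded_bilinear b" and b_norm: "\<And>x y. norm (b x y) \<le> norm x * norm y"
  obtains G :: real where "0 \<le> G"
    and "summable (\<lambda>t. norm (\<integral>\<omega>. b (Z (int t) \<omega>) (Z 0 \<omega>) \<partial>M))"
    and "\<And>i j. i \<le> j \<Longrightarrow> (\<integral>\<omega>. b (Z (int j) \<omega>) (Z (int i) \<omega>) \<partial>M) = (\<integral>\<omega>. b (Z (int (j - i)) \<omega>) (Z 0 \<omega>) \<partial>M)"
    and "\<And>I a. finite I \<Longrightarrow> Lp_le M 2 (\<lambda>\<omega>. \<Sum>j\<in>I. a j *\<^sub>R Z (int j) \<omega>) (G * sqrt (\<Sum>j\<in>I. (a j)\<^sup>2))"
    and "\<And>I w W. finite I \<Longrightarrow> (\<And>j. j \<in> I \<Longrightarrow> (\<Sum>i\<in>I. (w j i)\<^sup>2) \<le> W) \<Longrightarrow> (\<And>i. i \<in> I \<Longrightarrow> (\<Sum>j\<in>I. (w j i)\<^sup>2) \<le> W) \<Longrightarrow> 0 \<le> W \<Longrightarrow>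
       Lp_le M 2 (\<lambda>\<omega>. (\<Sum>j\<in>I. \<Sum>i\<in>I. w j i *\<^sub>R b (Z (int j) \<omega>) (Z (int i) \<omega>))
          - (\<Sum>j\<in>I. \<Sum>i\<in>I. w j i *\<^sub>R (\<integral>\<omega>. b (Z (int j) \<omega>) (Z (int i) \<omega>) \<partial>M))) (3 * G\<^sup>2 * sqrt (W * card I))"
proof -
  interpret M: prob_space M by (rule M)
  have Z: "\<And>t. Z t \<in> Lp_space M 4" and ind: "M.indep_vars (\<lambda>_. S) eps UNIV"
    and id: "\<And>t. distr M S (eps t) = distr M S (eps 0)"
    and fS: "f \<in> borel_measurable (Pi\<^sub>M UNIV (\<lambda>_. S))"
    and Zf: "\<And>t. AE \<omega> in M. Z t \<omega> = f (\<lambda>k. eps (t - int k) \<omega>)"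
    and cop: "\<And>t m. m \<ge> 1 \<Longrightarrow> M.indep_var (Pi\<^sub>M UNIV (\<lambda>_. S)) (\<lambda>\<omega> k. eps k \<omega>) (Pi\<^sub>M UNIV (\<lambda>_. S)) (\<lambda>\<omega> k. epsc t m k \<omega>)"
      "\<And>t m. m \<ge> 1 \<Longrightarrow> distr M (Pi\<^sub>M UNIV (\<lambda>_. S)) (\<lambda>\<omega> k. epsc t m k \<omega>) = distr M (Pi\<^sub>M UNIV (\<lambda>_. S)) (\<lambda>\<omega> k. eps k \<omega>)"
    and sm: "\<And>t. summable (\<lambda>m. Lp_norm M 4 (\<lambda>\<omega>. Z t \<omega> - m_coupling f eps epsc (Suc m) t \<omega>))"
    using app unfolding Lp_m_approximable_def by auto
  have [measurable]: "Z t \<in> borel_measurable M" for t using Z[of t] by (simp add: Lp_space_def)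
  have eps: "eps t \<in> measurable M S" for t using ind by (auto simp: M.indep_vars_def)
  define N where "N = distr M S (eps 0)"
  have pN: "prob_space N" unfolding N_def by (rule M.prob_space_distr[OF eps])
  interpret iid_sequence N by (rule iid_sequence.intro[OF pN])
  have sN [measurable_cong]: "sets N = sets S" by (simp add: N_def)
  have sPS: "sets (Pi\<^sub>M UNIV (\<lambda>_. S) :: (int \<Rightarrow> _) measure) = sets PZ"
    by (intro sets_PiM_cong) (auto simp: sN)
  have sPS': "sets (Pi\<^sub>M UNIV (\<lambda>_. S) :: (nat \<Rightarrow> _) measure) = sets (Pi\<^sub>M UNIV (\<lambda>_. N))"
    by (intro sets_PiM_cong) (auto simp: sN)
  define E where "E \<omega> = (\<lambda>k. eps k \<omega>)" for \<omega>
  have dE': "distr M (Pi\<^sub>M UNIV (\<lambda>_. S)) E = PZ"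
  proof -
    have "distr M (Pi\<^sub>M UNIV (\<lambda>_. S)) (\<lambda>x. \<lambda>i\<in>UNIV. eps i x) = (\<Pi>\<^sub>M i\<in>UNIV. distr M S (eps i))"
      using ind eps by (subst (asm) M.indep_vars_iff_distr_eq_PiM) auto
    moreover have "(\<lambda>i. distr M S (eps i)) = (\<lambda>_. N)"
      by (rule ext) (simp only: N_def, rule id)
    ultimately show ?thesis by (simp only: E_def[abs_def] restrict_UNIV)
  qed
  have Em [measurable]: "E \<in> measurable M PZ"
    unfolding E_def[abs_def] using eps
    by (intro measurable_PiM_single') (auto simp: space_PiM cong: measurable_cong_sets simp: measurable_cong_sets[OF refl sN] dest: measurable_space simp: sets_eq_imp_space_eq[OF sN])
  have dE: "distr M PZ E = PZ"
    using dE' distr_cong[OF refl sPS, of M E E] by simp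
  have fm: "f \<in> borel_measurable (Pi\<^sub>M UNIV (\<lambda>_. N))"
    using fS measurable_cong_sets[OF sPS' refl] by blast
  note cm [measurable] = measurable_causal_comp[OF fm]
  \<comment> \<open>There are countably many times, so one null set serves all of them.\<close>
  have ZE: "AE \<omega> in M. \<forall>t. Z t \<omega> = causal f t (E \<omega>)"
    unfolding AE_all_countable causal_def E_def using Zf by blast
  define c4 where "c4 = Lp_norm M 4 (Z 0)"
  have Z0: "Lp_le M 4 (Z 0) c4"
    unfolding c4_def using Z[of 0] by (intro Lp_le_Lp_norm) (auto simp: Lp_space_4_iff)
  have EM: "Lp_le PZ p X c \<longleftrightarrow> Lp_le M p (\<lambda>\<omega>. X (E \<omega>)) c" if "X \<in> borel_measurable PZ" for p c and X :: "_ \<Rightarrow> 'b::{banach, second_countable_topology}"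
    using Lp_le_distr[OF Em that] by (simp add: dE)
  have IM: "(\<integral>\<omega>. X (E \<omega>) \<partial>M) = (\<integral>x. X x \<partial>PZ)" if "X \<in> borel_measurable PZ" for X :: "_ \<Rightarrow> 'b::{banach, second_countable_topology}"
    using integral_distr[OF Em that] by (simp add: dE)
  have mom: "Lp_le PZ 4 (causal f 0) c4"
    unfolding EM[OF cm] by (rule Lp_le_AE_cong[OF Z0]) (use ZE in \<open>auto elim!: eventually_mono\<close>)
  have mean0: "(\<integral>x. causal f 0 x \<partial>PZ) = 0"
  proof -
    have "(\<integral>\<omega>. causal f 0 (E \<omega>) \<partial>M) = (\<integral>\<omega>. Z 0 \<omega> \<partial>M)"
      by (rule integral_cong_AE) (use ZE in \<open>auto elim!: eventually_mono\<close>)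
    then show ?thesis using IM[OF cm, of 0] mean by simp
  qed
  \<comment> \<open>The hypothesis starts at \<open>m = 1\<close>; the coefficient for
    \<open>m = 0\<close>, where everything is renewed, comes from the triangle inequality.\<close>
  define \<delta> where "\<delta> m = (if m = 0 then c4 + c4 else Lp_norm M 4 (\<lambda>\<omega>. Z 0 \<omega> - m_coupling f eps epsc m 0 \<omega>))" for m
  have sum\<delta>: "summable \<delta>"
    using sm[of 0] by (subst summable_Suc_iff[symmetric]) (simp add: \<delta>_def)
  have cpl: "Lp_le RZ 4 (\<lambda>\<omega>. causal f 0 (sel {} \<omega>) - causal f 0 (sel {..- int m} \<omega>)) (\<delta> m)" for m
  proof (cases "m = 0")
    case True
    then show ?thesis using Lp_le_diff[OF Lp_le_sel[OF mom] Lp_le_sel[OF mom]] by (simp add: \<delta>_def)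
  next
    case False
    then have m: "m \<ge> 1" by simp
    \<comment> \<open>The coupled variable is a function of the pair of the original sequence and
      its copy. That pair has the product law, which is also the law of the two copies in
      \<open>RZ\<close>; the bound can therefore be moved from one space to the other.\<close>
    let ?mix = "\<lambda>z k. if k \<le> - int m then snd z k else fst z k"
    let ?X = "\<lambda>z. causal f 0 (fst z) - causal f 0 (?mix z)"
    have mixm [measurable]: "?mix \<in> measurable (PZ \<Otimes>\<^sub>M PZ) PZ"
    proof (rule measurable_PiM_single')
      show "(\<lambda>z. ?mix z k) \<in> measurable (PZ \<Otimes>\<^sub>M PZ) N" for k
        by (cases "k \<le> - int m") (auto intro!: measurable_compose[OF measurable_fst] measurable_compose[OF measurable_snd] measurable_component_singleton)
    qed (auto simp: space_PiM space_pair_measure PiE_iff)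
    have Xm: "?X \<in> borel_measurable (PZ \<Otimes>\<^sub>M PZ)" by measurable
    define Ec where "Ec \<omega> = (\<lambda>k. epsc 0 m k \<omega>)" for \<omega>
    have rv: "E \<in> measurable M (Pi\<^sub>M UNIV (\<lambda>_. S))" "Ec \<in> measurable M (Pi\<^sub>M UNIV (\<lambda>_. S))"
      and prod: "distr M (Pi\<^sub>M UNIV (\<lambda>_. S)) E \<Otimes>\<^sub>M distr M (Pi\<^sub>M UNIV (\<lambda>_. S)) Ec = distr M (Pi\<^sub>M UNIV (\<lambda>_. S) \<Otimes>\<^sub>M Pi\<^sub>M UNIV (\<lambda>_. S)) (\<lambda>x. (E x, Ec x))"
      using cop(1)[OF m, of 0] unfolding M.indep_var_distribution_eq E_def Ec_def by auto
    have dEc: "distr M (Pi\<^sub>M UNIV (\<lambda>_. S)) Ec = PZ"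
      using cop(2)[OF m, of 0] dE' by (simp add: E_def[abs_def] Ec_def[abs_def])
    have Ecm: "Ec \<in> measurable M PZ" using rv(2) measurable_cong_sets[OF refl sPS] by blast
    have pairm: "(\<lambda>x. (E x, Ec x)) \<in> measurable M (PZ \<Otimes>\<^sub>M PZ)" using Em Ecm by (rule measurable_Pair)
    have dpair: "distr M (PZ \<Otimes>\<^sub>M PZ) (\<lambda>x. (E x, Ec x)) = PZ \<Otimes>\<^sub>M PZ"
    proof -
      have "sets (Pi\<^sub>M UNIV (\<lambda>_. S) \<Otimes>\<^sub>M Pi\<^sub>M UNIV (\<lambda>_. S) :: ((int \<Rightarrow> _) \<times> (int \<Rightarrow> _)) measure) = sets (PZ \<Otimes>\<^sub>M PZ)"
        by (intro sets_pair_measure_cong sPS)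
      then show ?thesis using prod unfolding dE' dEc by (subst distr_cong[OF refl]) auto
    qed
    have selm: "(\<lambda>\<omega>. (sel {} \<omega>, sel UNIV \<omega>)) \<in> measurable RZ (PZ \<Otimes>\<^sub>M PZ)"
      by (intro measurable_Pair measurable_sel)
    have R: "Lp_le (PZ \<Otimes>\<^sub>M PZ) 4 ?X c \<longleftrightarrow> Lp_le RZ 4 (\<lambda>\<omega>. causal f 0 (sel {} \<omega>) - causal f 0 (sel {..- int m} \<omega>)) c" for c
    proof -
      have "?mix (sel {} \<omega>, sel UNIV \<omega>) = sel {..- int m} \<omega>" for \<omega> :: "bool \<times> int \<Rightarrow> 's"
        by (auto simp: sel_def fun_eq_iff)
      then show ?thesis
        using Lp_le_distr[OF selm Xm, of 4 c] unfolding distr_sel_pair by simp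
    qed
    have cpE: "m_coupling f eps epsc m 0 \<omega> = causal f 0 (?mix (E \<omega>, Ec \<omega>))" for \<omega>
      unfolding m_coupling_def causal_def E_def Ec_def
      by (rule arg_cong[where f=f]) (auto simp: fun_eq_iff)
    have D: "Lp_le (PZ \<Otimes>\<^sub>M PZ) 4 ?X c \<longleftrightarrow> Lp_le M 4 (\<lambda>\<omega>. Z 0 \<omega> - m_coupling f eps epsc m 0 \<omega>) c" for c
    proof -
      have *: "(\<lambda>\<omega>. causal f 0 (E \<omega>) - causal f 0 (?mix (E \<omega>, Ec \<omega>))) \<in> borel_measurable M"
        using measurable_compose[OF pairm Xm] by simp
      have **: "(\<lambda>\<omega>. Z 0 \<omega> - m_coupling f eps epsc m 0 \<omega>) \<in> borel_measurable M"
        unfolding cpE using measurable_compose[OF pairm measurable_compose[OF mixm cm]] by simp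
      have "Lp_le (PZ \<Otimes>\<^sub>M PZ) 4 ?X c \<longleftrightarrow> Lp_le M 4 (\<lambda>\<omega>. causal f 0 (E \<omega>) - causal f 0 (?mix (E \<omega>, Ec \<omega>))) c"
        using Lp_le_distr[OF pairm Xm, of 4 c] unfolding dpair by simp
      also have "\<dots> \<longleftrightarrow> Lp_le M 4 (\<lambda>\<omega>. Z 0 \<omega> - m_coupling f eps epsc m 0 \<omega>) c"
        using ZE by (intro iffI; elim Lp_le_AE_cong) (use * ** in \<open>auto simp: cpE elim!: eventually_mono\<close>)
      finally show ?thesis .
    qed
    \<comment> \<open>A crude bound comes first: it supplies the integrability without which the
      integral in \<open>Lp_norm\<close> would have its default value 0.\<close>
    have "Lp_le M 4 (\<lambda>\<omega>. Z 0 \<omega> - m_coupling f eps epsc m 0 \<omega>) (c4 + c4)"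
      unfolding D[symmetric] R by (intro Lp_le_diff Lp_le_sel mom) simp
    then have "Lp_le M 4 (\<lambda>\<omega>. Z 0 \<omega> - m_coupling f eps epsc m 0 \<omega>) (\<delta> m)"
      using m by (simp add: \<delta>_def) (rule Lp_le_Lp_norm; auto dest: Lp_leD(1) Lp_le_integrable_norm(1))
    then show ?thesis unfolding D[symmetric] R .
  qed
  interpret causal_process N f \<delta> c4
    by unfold_locales (fact fm mom mean0 cpl sum\<delta>)+
  have cov: "(\<integral>\<omega>. b (Z j \<omega>) (Z i \<omega>) \<partial>M) = (\<integral>x. b (causal f j x) (causal f i x) \<partial>PZ)" for i j
  proof -
    have [measurable]: "(\<lambda>x. b (causal f j x) (causal f i x)) \<in> borel_measurable PZ" "(\<lambda>\<omega>. b (Z j \<omega>) (Z i \<omega>)) \<in> borel_measurable M"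
      by (auto intro: borel_measurable_bounded_bilinear[OF bil])
    have "(\<integral>\<omega>. b (Z j \<omega>) (Z i \<omega>) \<partial>M) = (\<integral>\<omega>. b (causal f j (E \<omega>)) (causal f i (E \<omega>)) \<partial>M)"
      by (rule integral_cong_AE) (use ZE in \<open>auto elim!: eventually_mono\<close>)
    also have "\<dots> = (\<integral>x. b (causal f j x) (causal f i x) \<partial>PZ)" by (rule IM) measurable
    finally show ?thesis .
  qed
  show ?thesis
  proof (rule that[of G])
    show "0 \<le> G" by (rule G_nonneg)
    show "summable (\<lambda>t. norm (\<integral>\<omega>. b (Z (int t) \<omega>) (Z 0 \<omega>) \<partial>M))"
    proof (rule summable_comparison_test')
      show "summable (\<lambda>t. c4 * \<delta> t)" by (intro summable_mult sum\<delta>)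
      show "norm (norm (\<integral>\<omega>. b (Z (int t) \<omega>) (Z 0 \<omega>) \<partial>M)) \<le> c4 * \<delta> t" if "t \<ge> 1" for t
        unfolding cov using autocovariance_bound[OF bil b_norm that] by simp
    qed
    show "(\<integral>\<omega>. b (Z (int j) \<omega>) (Z (int i) \<omega>) \<partial>M) = (\<integral>\<omega>. b (Z (int (j - i)) \<omega>) (Z 0 \<omega>) \<partial>M)" if "i \<le> j" for i j
      unfolding cov using autocovariance_shift[OF bil b_norm, of "int (j - i)" "int i"] that by simp
    show "Lp_le M 2 (\<lambda>\<omega>. \<Sum>j\<in>I. a j *\<^sub>R Z (int j) \<omega>) (G * sqrt (\<Sum>j\<in>I. (a j)\<^sup>2))" if "finite I" for I a
    proof (rule Lp_le_AE_cong)
      show "Lp_le M 2 (\<lambda>\<omega>. linsum I a (E \<omega>)) (G * sqrt (\<Sum>j\<in>I. (a j)\<^sup>2))"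
        using linsum_L2[OF that] by (subst (asm) EM) auto
      show "AE \<omega> in M. (\<Sum>j\<in>I. a j *\<^sub>R Z (int j) \<omega>) = linsum I a (E \<omega>)"
        using ZE by eventually_elim (simp add: linsum_def)
    qed measurable
    fix I :: "nat set" and w :: "nat \<Rightarrow> nat \<Rightarrow> real" and W
    assume I: "finite I" and W: "\<And>j. j \<in> I \<Longrightarrow> (\<Sum>i\<in>I. (w j i)\<^sup>2) \<le> W" "\<And>i. i \<in> I \<Longrightarrow> (\<Sum>j\<in>I. (w j i)\<^sup>2) \<le> W" "0 \<le> W"
    have int: "integrable PZ (\<lambda>x. b (causal f j x) (causal f i x))" for i j
      by (rule PZ.Lp_le_2_integrable(1)[OF Lp_le_b[OF bil b_norm causal_moment causal_moment]])
    have mq: "(\<integral>x. quadsum b I w x \<partial>PZ) = (\<Sum>j\<in>I. \<Sum>i\<in>I. w j i *\<^sub>R (\<integral>\<omega>. b (Z (int j) \<omega>) (Z (int i) \<omega>) \<partial>M))"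
      unfolding quadsum_def cov
      by (simp add: Bochner_Integration.integral_sum Bochner_Integration.integrable_sum int)
    have bm [measurable]: "(\<lambda>\<omega>. b (Z j \<omega>) (Z i \<omega>)) \<in> borel_measurable M" for i j
      by (auto intro: borel_measurable_bounded_bilinear[OF bil])
    show "Lp_le M 2 (\<lambda>\<omega>. (\<Sum>j\<in>I. \<Sum>i\<in>I. w j i *\<^sub>R b (Z (int j) \<omega>) (Z (int i) \<omega>))
          - (\<Sum>j\<in>I. \<Sum>i\<in>I. w j i *\<^sub>R (\<integral>\<omega>. b (Z (int j) \<omega>) (Z (int i) \<omega>) \<partial>M))) (3 * G\<^sup>2 * sqrt (W * card I))"
    proof (rule Lp_le_AE_cong)
      have q: "Lp_le PZ 2 (\<lambda>x. quadsum b I w x - (\<integral>x. quadsum b I w x \<partial>PZ)) (3 * G\<^sup>2 * sqrt (W * card I))"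
        by (rule quadsum_centered[OF bil b_norm I]) (fact W)+
      show "Lp_le M 2 (\<lambda>\<omega>. quadsum b I w (E \<omega>) - (\<integral>x. quadsum b I w x \<partial>PZ)) (3 * G\<^sup>2 * sqrt (W * card I))"
        using q unfolding EM[OF Lp_leD(1)[OF q]] .
      show "AE \<omega> in M. (\<Sum>j\<in>I. \<Sum>i\<in>I. w j i *\<^sub>R b (Z (int j) \<omega>) (Z (int i) \<omega>))
          - (\<Sum>j\<in>I. \<Sum>i\<in>I. w j i *\<^sub>R (\<integral>\<omega>. b (Z (int j) \<omega>) (Z (int i) \<omega>) \<partial>M)) = quadsum b I w (E \<omega>) - (\<integral>x. quadsum b I w x \<partial>PZ)"
        unfolding mq using ZE by eventually_elim (simp add: quadsum_def)
    qed measurable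
  qed
qed

section \<open>Kernels and integral operators\<close>

lemma inner_eqI: "(\<And>z. inner x z = inner y z) \<Longrightarrow> x = y" for x y :: "'a::real_inner"
  using inner_eq_zero_iff[of "x - y"] by (simp add: inner_diff_left)

text \<open>Expanding the squared norm of x - y. Equality of kernels can thus be checked by inner
  products alone, without handling representatives.\<close>

lemma norm_diff_eq_0I:
  fixes x y :: "'a::real_inner"
  assumes "inner x x = inner x y" "inner y y = inner x y" shows "x = y"
proof -
  have "inner (x - y) (x - y) = 0" using assms by (simp add: inner_diff_left inner_diff_right inner_commute)
  then show ?thesis by simp
qed

lemma pair_sigma_finite_cube: "pair_sigma_finite (cube :: 'a::euclidean_space measure) (cube :: 'b::euclidean_space measure)"
  by (intro pair_sigma_finite.intro prob_space_imp_sigma_finite prob_space_cube)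

lemma square_integrable_tensor:
  fixes f g :: "'a::euclidean_space \<Rightarrow> real"
  assumes "square_integrable f" "square_integrable g"
  shows "square_integrable (\<lambda>(s1, s2). f s1 * g s2)"
proof -
  have m: "f \<in> borel_measurable cube" "g \<in> borel_measurable cube"
    and i: "integrable cube (\<lambda>s. (f s)\<^sup>2)" "integrable cube (\<lambda>s. (g s)\<^sup>2)"
    using assms by (auto simp: square_integrable_def)
  from integrable_cube_tensor[OF i] m show ?thesis
    unfolding square_integrable_def cube_prod case_prod_beta power_mult_distrib by simp
qed

lemma inner_L2_of_tensor:
  fixes f g f' g' :: "'a::euclidean_space \<Rightarrow> real"
  assumes f: "square_integrable f" and g: "square_integrable g" and f': "square_integrable f'" and g': "square_integrable g'"
  shows "inner (L2_of (\<lambda>(s1, s2). f s1 * g s2)) (L2_of (\<lambda>(s1, s2). f' s1 * g' s2))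
    = inner (L2_of f) (L2_of f') * inner (L2_of g) (L2_of g')"
proof -
  interpret pair_sigma_finite "cube :: 'a measure" "cube :: 'a measure" by (rule pair_sigma_finite_cube)
  have int: "integrable (cube \<Otimes>\<^sub>M cube) (\<lambda>z. (f (fst z) * f' (fst z)) * (g (snd z) * g' (snd z)))"
    by (rule integrable_cube_tensor) (intro square_integrable_mult assms)+
  have "inner (L2_of (\<lambda>(s1, s2). f s1 * g s2)) (L2_of (\<lambda>(s1, s2). f' s1 * g' s2))
      = (\<integral>z. (f (fst z) * f' (fst z)) * (g (snd z) * g' (snd z)) \<partial>(cube \<Otimes>\<^sub>M cube))"
    unfolding inner_L2_of[OF square_integrable_tensor[OF f g] square_integrable_tensor[OF f' g']] cube_prod
    by (simp add: case_prod_beta mult_ac)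
  also have "\<dots> = (\<integral>s. (\<integral>t. (f s * f' s) * (g t * g' t) \<partial>cube) \<partial>cube)"
    using integral_fst'[OF int] by simp
  also have "\<dots> = inner (L2_of f) (L2_of f') * inner (L2_of g) (L2_of g')"
    by (simp add: inner_L2_of assms)
  finally show ?thesis .
qed

lemma inner_kernel_tensor: "inner (kernel_tensor a b) (kernel_tensor c d) = inner a c * inner b d"
  unfolding kernel_tensor_def using inner_L2_of_tensor[of "L2_fun a" "L2_fun b" "L2_fun c" "L2_fun d"] by simp

lemma kernel_tensor_L2_of:
  "square_integrable f \<Longrightarrow> square_integrable g \<Longrightarrow> kernel_tensor (L2_of f) (L2_of g) = L2_of (\<lambda>(s1, s2). f s1 * g s2)"
  unfolding kernel_tensor_def by (rule norm_diff_eq_0I) (simp_all add: inner_L2_of_tensor)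

lemma norm_kernel_tensor: "norm (kernel_tensor a b) = norm a * norm b"
  by (simp add: norm_eq_sqrt_inner inner_kernel_tensor real_sqrt_mult)

lemma bounded_bilinear_kernel_tensor: "bounded_bilinear (kernel_tensor :: 'a::euclidean_space L2 \<Rightarrow> _)"
proof
  fix a a' b b' :: "'a L2" and r :: real
  show "kernel_tensor (a + a') b = kernel_tensor a b + kernel_tensor a' b"
    by (rule norm_diff_eq_0I) (simp_all add: inner_add_left inner_add_right inner_kernel_tensor algebra_simps inner_commute)
  show "kernel_tensor a (b + b') = kernel_tensor a b + kernel_tensor a b'"
    by (rule norm_diff_eq_0I) (simp_all add: inner_add_left inner_add_right inner_kernel_tensor algebra_simps inner_commute)
  show "kernel_tensor (r *\<^sub>R a) b = r *\<^sub>R kernel_tensor a b"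
    by (rule norm_diff_eq_0I) (simp_all add: inner_kernel_tensor)
  show "kernel_tensor a (r *\<^sub>R b) = r *\<^sub>R kernel_tensor a b"
    by (rule norm_diff_eq_0I) (simp_all add: inner_kernel_tensor)
  show "\<exists>K. \<forall>a b :: 'a L2. norm (kernel_tensor a b) \<le> norm a * norm b * K"
    by (rule exI[of _ 1]) (simp add: norm_kernel_tensor)
qed

lemma inner_kernel_swap_left:
  fixes k l :: "('a::euclidean_space \<times> 'a) L2"
  shows "inner (kernel_swap k) l = inner k (kernel_swap l)"
proof -
  interpret pair_sigma_finite "cube :: 'a measure" "cube :: 'a measure" by (rule pair_sigma_finite_cube)
  have m: "L2_fun k \<in> borel_measurable (cube \<Otimes>\<^sub>M cube)" "L2_fun l \<in> borel_measurable (cube \<Otimes>\<^sub>M cube)"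
    using square_integrable_L2_fun[of k] square_integrable_L2_fun[of l] by (auto simp: square_integrable_def cube_prod)
  have ml: "(\<lambda>(s1, s2). L2_fun l (s2, s1)) \<in> borel_measurable (cube \<Otimes>\<^sub>M cube)"
    using square_integrable_kernel_swap[of l] by (simp add: square_integrable_def cube_prod)
  have "inner (kernel_swap k) l = (\<integral>(s1, s2). L2_fun k (s2, s1) * L2_fun l (s1, s2) \<partial>(cube \<Otimes>\<^sub>M cube))"
    unfolding kernel_swap_def using inner_L2_of[OF square_integrable_kernel_swap[of k] square_integrable_L2_fun[of l]]
    by (simp add: cube_prod split_beta')
  also have "\<dots> = (\<integral>z. L2_fun k z * (case z of (s1, s2) \<Rightarrow> L2_fun l (s2, s1)) \<partial>(cube \<Otimes>\<^sub>M cube))"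
    using integral_product_swap[of "\<lambda>z. L2_fun k z * (case z of (s1, s2) \<Rightarrow> L2_fun l (s2, s1))"] m(1) ml by simp
  also have "\<dots> = inner k (kernel_swap l)"
    unfolding kernel_swap_def using inner_L2_of[OF square_integrable_L2_fun[of k] square_integrable_kernel_swap[of l]]
    by (simp add: cube_prod)
  finally show ?thesis .
qed

lemma inner_kernel_swap_tensor:
  fixes k :: "('a::euclidean_space \<times> 'a) L2"
  shows "inner (kernel_swap k) (kernel_tensor z x) = inner k (kernel_tensor x z)"
proof -
  interpret pair_sigma_finite "cube :: 'a measure" "cube :: 'a measure" by (rule pair_sigma_finite_cube)
  have m: "L2_fun k \<in> borel_measurable (cube \<Otimes>\<^sub>M cube)"
    using square_integrable_L2_fun[of k] by (auto simp: square_integrable_def cube_prod)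
  have mt: "(\<lambda>(s1, s2). L2_fun x s1 * L2_fun z s2) \<in> borel_measurable (cube \<Otimes>\<^sub>M cube)"
    using square_integrable_kernel_tensor[of x z] by (simp add: square_integrable_def cube_prod)
  have "inner (kernel_swap k) (kernel_tensor z x) = (\<integral>(s1, s2). L2_fun k (s2, s1) * (L2_fun x s2 * L2_fun z s1) \<partial>(cube \<Otimes>\<^sub>M cube))"
    unfolding kernel_swap_def kernel_tensor_def
    using inner_L2_of[OF square_integrable_kernel_swap[of k] square_integrable_kernel_tensor[of z x]]
    by (simp add: cube_prod split_beta' mult_ac)
  also have "\<dots> = (\<integral>s. L2_fun k s * (case s of (s1, s2) \<Rightarrow> L2_fun x s1 * L2_fun z s2) \<partial>(cube \<Otimes>\<^sub>M cube))"
    using integral_product_swap[of "\<lambda>s. L2_fun k s * (case s of (s1, s2) \<Rightarrow> L2_fun x s1 * L2_fun z s2)"] m mt by simp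
  also have "\<dots> = inner k (kernel_tensor x z)"
    unfolding kernel_tensor_def using inner_L2_of[OF square_integrable_L2_fun[of k] square_integrable_kernel_tensor[of x z]]
    by (simp add: cube_prod)
  finally show ?thesis .
qed

lemma inner_kernel_swap: "inner (kernel_swap k) (kernel_swap l) = inner k l"
  for k l :: "('a::euclidean_space \<times> 'a) L2"
proof -
  interpret pair_sigma_finite "cube :: 'a measure" "cube :: 'a measure" by (rule pair_sigma_finite_cube)
  have m: "L2_fun k \<in> borel_measurable (cube \<Otimes>\<^sub>M cube)" "L2_fun l \<in> borel_measurable (cube \<Otimes>\<^sub>M cube)"
    using square_integrable_L2_fun[of k] square_integrable_L2_fun[of l] by (auto simp: square_integrable_def cube_prod)
  have "inner (kernel_swap k) (kernel_swap l) = (\<integral>(s1, s2). L2_fun k (s2, s1) * L2_fun l (s2, s1) \<partial>(cube \<Otimes>\<^sub>M cube))"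
    unfolding kernel_swap_def using inner_L2_of[OF square_integrable_kernel_swap[of k] square_integrable_kernel_swap[of l]]
    by (simp add: cube_prod split_beta')
  also have "\<dots> = (\<integral>z. L2_fun k z * L2_fun l z \<partial>(cube \<Otimes>\<^sub>M cube))"
    using integral_product_swap[of "\<lambda>z. L2_fun k z * L2_fun l z"] m by simp
  also have "\<dots> = inner k l" by (simp add: inner_L2_fun cube_prod)
  finally show ?thesis .
qed

lemma kernel_swap_swap [simp]: "kernel_swap (kernel_swap k) = k"
proof (rule norm_diff_eq_0I)
  have "inner (kernel_swap (kernel_swap k)) k = inner k k"
    by (subst inner_kernel_swap_left) (rule inner_kernel_swap)
  then show "inner (kernel_swap (kernel_swap k)) (kernel_swap (kernel_swap k)) = inner (kernel_swap (kernel_swap k)) k"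
    "inner k k = inner (kernel_swap (kernel_swap k)) k"
    by (simp_all only: inner_kernel_swap)
qed

lemma kernel_swap_tensor [simp]: "kernel_swap (kernel_tensor a b) = kernel_tensor b a"
  by (rule norm_diff_eq_0I) (simp_all add: inner_kernel_swap inner_kernel_swap_tensor inner_kernel_tensor)

lemma norm_kernel_swap [simp]: "norm (kernel_swap k) = norm k"
  by (simp add: norm_eq_sqrt_inner inner_kernel_swap)

lemma linear_kernel_swap: "linear (kernel_swap :: ('a::euclidean_space \<times> 'a) L2 \<Rightarrow> _)"
proof
  fix k l :: "('a \<times> 'a) L2" and r :: real
  show "kernel_swap (k + l) = kernel_swap k + kernel_swap l"
    by (rule inner_eqI) (simp add: inner_kernel_swap_left inner_add_left)
  show "kernel_swap (r *\<^sub>R k) = r *\<^sub>R kernel_swap k"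
    by (rule inner_eqI) (simp add: inner_kernel_swap_left)
qed

lemma kernel_swap_scaleR: "kernel_swap (c *\<^sub>R k) = c *\<^sub>R kernel_swap k"
  by (rule linear_cmul[OF linear_kernel_swap])

lemma kernel_swap_sum: "kernel_swap (\<Sum>i\<in>I. k i) = (\<Sum>i\<in>I. kernel_swap (k i))"
  by (rule linear_sum[OF linear_kernel_swap])

lemma bounded_linear_kernel_swap: "bounded_linear (kernel_swap :: ('a::euclidean_space \<times> 'a) L2 \<Rightarrow> _)"
  by (intro bounded_linear.intro linear_kernel_swap bounded_linear_axioms.intro exI[of _ 1]) simp

section \<open>Integral operators as functions of their kernel\<close>

lemma integral_operator_add_kernel: "integral_operator (k + l) x = integral_operator k x + integral_operator l x"
  by (rule inner_eqI) (simp add: inner_add_left inner_integral_operator)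

lemma integral_operator_scaleR_kernel: "integral_operator (c *\<^sub>R k) x = c *\<^sub>R integral_operator k x"
  by (rule inner_eqI) (simp add: inner_integral_operator)

lemma integral_operator_diff_kernel: "integral_operator (k - l) x = integral_operator k x - integral_operator l x"
  by (rule inner_eqI) (simp add: inner_diff_left inner_integral_operator)

lemma integral_operator_tensor: "integral_operator (kernel_tensor a b) x = inner b x *\<^sub>R a"
  by (rule inner_eqI) (simp add: inner_integral_operator inner_kernel_tensor)

lemma linear_integral_operator: "linear (integral_operator k)"
proof
  interpret bounded_bilinear kernel_tensor by (rule bounded_bilinear_kernel_tensor)
  show "integral_operator k (x + y) = integral_operator k x + integral_operator k y" for x y
    by (rule inner_eqI) (simp add: inner_add_left inner_add_right inner_integral_operator add_right)
  show "integral_operator k (r *\<^sub>R x) = r *\<^sub>R integral_operator k x" for r x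
    by (rule inner_eqI) (simp add: inner_integral_operator scaleR_right)
qed

lemma norm_integral_operator_le: "norm (integral_operator k x) \<le> norm k * norm x"
proof (cases "integral_operator k x = 0")
  case False
  let ?y = "integral_operator k x"
  have "norm ?y * norm ?y = inner ?y ?y" by (simp add: norm_eq_sqrt_inner)
  also have "\<dots> = inner k (kernel_tensor ?y x)" by (rule inner_integral_operator)
  also have "\<dots> \<le> norm k * norm (kernel_tensor ?y x)" by (rule norm_cauchy_schwarz)
  also have "\<dots> = norm ?y * (norm k * norm x)" by (simp add: norm_kernel_tensor)
  finally show ?thesis using False by simp
qed simp

lemma integral_operator_selfadjoint:
  "kernel_swap k = k \<Longrightarrow> inner (integral_operator k x) y = inner x (integral_operator k y)"
  by (metis inner_commute inner_integral_operator inner_kernel_swap_tensor)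

text \<open>An induction principle for kernels. The indicator of a rectangle is a tensor, and
  rectangles form an intersection-stable generator of the Borel sets of the product; hence the
  tensors span a dense subspace.\<close>

lemma kernels_closed_subspace_UNIV:
  fixes V :: "('a::euclidean_space \<times> 'a) L2 set"
  assumes V: "closed V" "subspace V" and tensor: "\<And>a b. kernel_tensor a b \<in> V"
  shows "k \<in> V"
proof (rule L2_closed_subspace_UNIV[OF V])
  fix A :: "('a \<times> 'a) set" assume A: "A \<in> sets borel"
  define P :: "('a \<times> 'a) set set" where "P = {a \<times> b |a b. a \<in> sets borel \<and> b \<in> sets borel}"
  have rect: "L2_ind B \<in> V" if "B \<in> P" for B
  proof -
    obtain a b where ab: "B = a \<times> b" "a \<in> sets borel" "b \<in> sets borel" using \<open>B \<in> P\<close> by (auto simp: P_def)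
    have "(indicator B :: 'a \<times> 'a \<Rightarrow> real) = (\<lambda>(s1, s2). indicator a s1 * indicator b s2)"
      by (auto simp: ab indicator_def fun_eq_iff)
    then have "L2_ind B = kernel_tensor (L2_ind a) (L2_ind b)"
      by (simp add: L2_ind_def kernel_tensor_L2_of square_integrable_indicator ab)
    then show ?thesis by (simp add: tensor)
  qed
  show "L2_ind A \<in> V"
  proof (rule L2_ind_in_closed_subspace[OF V _ _ rect _ A])
    show "Int_stable P"
    proof (rule Int_stableI)
      fix A B assume "A \<in> P" "B \<in> P"
      then obtain a b c d where "A = a \<times> b" "B = c \<times> d" "a \<in> sets borel" "b \<in> sets borel" "c \<in> sets borel" "d \<in> sets borel"
        by (auto simp: P_def)
      then show "A \<inter> B \<in> P"
        by (auto simp: P_def Times_Int_Times)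
    qed
    show "sigma_sets UNIV P = sets borel"
      unfolding P_def borel_prod[symmetric] by (simp add: sets_pair_measure)
    have "UNIV \<times> UNIV \<in> P" unfolding P_def by (intro CollectI exI[of _ UNIV] conjI) auto
    then show "L2_ind UNIV \<in> V" using rect by simp
  qed
qed

text \<open>Hilbert-Schmidt operators are compact. The kernels with the stated property form a
  closed subspace: finite nets can be added and scaled, and a kernel close in norm has an operator
  uniformly close on the unit ball. Tensors belong to it because their operators map the ball into a
  bounded piece of a line.\<close>

lemma totally_bounded_integral_operator:
  fixes k :: "('a::euclidean_space \<times> 'a) L2"
  assumes "e > 0"
  shows "\<exists>F. finite F \<and> integral_operator k ` cball 0 1 \<subseteq> (\<Union>x\<in>F. ball x e)"
proof -
  define V :: "('a \<times> 'a) L2 set" where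
    "V = {k. \<forall>e>0. \<exists>F. finite F \<and> integral_operator k ` cball 0 1 \<subseteq> (\<Union>x\<in>F. ball x e)}"
  have "k \<in> V"
  proof (rule kernels_closed_subspace_UNIV)
    show "kernel_tensor a b \<in> V" for a b
    proof -
      let ?S = "(\<lambda>c. c *\<^sub>R a) ` cbox (- norm b) (norm b)"
      have "compact ?S" by (intro compact_continuous_image continuous_intros compact_cbox)
      moreover have "integral_operator (kernel_tensor a b) ` cball 0 1 \<subseteq> ?S"
      proof (intro image_subsetI)
        fix x :: "'a L2" assume "x \<in> cball 0 1"
        then have "\<bar>inner b x\<bar> \<le> norm b * 1"
          by (intro order_trans[OF Cauchy_Schwarz_ineq2] mult_left_mono) auto
        then show "integral_operator (kernel_tensor a b) x \<in> ?S"
          unfolding integral_operator_tensor by (intro imageI) (auto simp: abs_le_iff)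
      qed
      moreover have "\<forall>e>0. \<exists>F. finite F \<and> ?S \<subseteq> (\<Union>x\<in>F. ball x e)"
        using \<open>compact ?S\<close> unfolding compact_eq_totally_bounded by (rule conjunct2)
      ultimately have "\<forall>e>0. \<exists>F. finite F \<and> integral_operator (kernel_tensor a b) ` cball 0 1 \<subseteq> (\<Union>x\<in>F. ball x e)"
        by (meson order_trans)
      then show ?thesis unfolding V_def by (rule CollectI)
    qed
    show "subspace V"
    proof (rule subspaceI)
      have "integral_operator (0 :: ('a \<times> 'a) L2) x = 0" for x
        using integral_operator_scaleR_kernel[of 0 0 x] by simp
      then have "integral_operator (0 :: ('a \<times> 'a) L2) ` cball 0 1 \<subseteq> (\<Union>x\<in>{0}. ball x e)" if "e > 0" for e
        using that by auto
      then show "0 \<in> V" unfolding V_def by (intro CollectI allI impI exI[of _ "{0}"] conjI) simp_all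
    next
      fix k l assume kl: "k \<in> V" "l \<in> V"
      show "k + l \<in> V" unfolding V_def
      proof (intro CollectI allI impI)
        fix e :: real assume "e > 0"
        then have e2: "e / 2 > 0" by simp
        obtain F where F: "finite F" "integral_operator k ` cball 0 1 \<subseteq> (\<Union>x\<in>F. ball x (e/2))"
          using kl(1) e2 unfolding V_def by blast
        obtain H where H: "finite H" "integral_operator l ` cball 0 1 \<subseteq> (\<Union>x\<in>H. ball x (e/2))"
          using kl(2) e2 unfolding V_def by blast
        have "integral_operator (k + l) ` cball 0 1 \<subseteq> (\<Union>x\<in>(\<lambda>(a, b). a + b) ` (F \<times> H). ball x e)"
        proof (intro image_subsetI)
          fix x :: "'a L2" assume x: "x \<in> cball 0 1"
          then have "integral_operator k x \<in> (\<Union>x\<in>F. ball x (e/2))" "integral_operator l x \<in> (\<Union>x\<in>H. ball x (e/2))"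
            using F(2) H(2) by blast+
          then obtain a b where ab: "a \<in> F" "dist a (integral_operator k x) < e/2" "b \<in> H" "dist b (integral_operator l x) < e/2"
            by auto
          then have "dist (a + b) (integral_operator (k + l) x) < e"
            using dist_triangle_add[of a b "integral_operator k x" "integral_operator l x"] by (simp add: integral_operator_add_kernel)
          then show "integral_operator (k + l) x \<in> (\<Union>x\<in>(\<lambda>(a, b). a + b) ` (F \<times> H). ball x e)"
            using ab by (intro UN_I[of "a + b"]) auto
        qed
        then show "\<exists>F. finite F \<and> integral_operator (k + l) ` cball 0 1 \<subseteq> (\<Union>x\<in>F. ball x e)"
          using F(1) H(1) by (intro exI[of _ "(\<lambda>(a, b). a + b) ` (F \<times> H)"] conjI finite_imageI finite_cartesian_product)
      qed
    next
      fix c k assume k: "k \<in> V"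
      show "c *\<^sub>R k \<in> V" unfolding V_def
      proof (intro CollectI allI impI)
        fix e :: real assume e: "e > 0"
        \<comment> \<open>The added 1 covers \<open>c = 0\<close>.\<close>
        define e' where "e' = e / (\<bar>c\<bar> + 1)"
        have e': "e' > 0" "\<bar>c\<bar> * e' < e" using e by (auto simp: e'_def field_simps)
        then obtain F where F: "finite F" "integral_operator k ` cball 0 1 \<subseteq> (\<Union>x\<in>F. ball x e')"
          using k unfolding V_def by blast
        have "integral_operator (c *\<^sub>R k) ` cball 0 1 \<subseteq> (\<Union>x\<in>(\<lambda>a. c *\<^sub>R a) ` F. ball x e)"
        proof (intro image_subsetI)
          fix x :: "'a L2" assume x: "x \<in> cball 0 1"
          then have "integral_operator k x \<in> (\<Union>x\<in>F. ball x e')" using F(2) by blast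
          then obtain a where a: "a \<in> F" "dist a (integral_operator k x) < e'" by auto
          have "dist (c *\<^sub>R a) (integral_operator (c *\<^sub>R k) x) = \<bar>c\<bar> * dist a (integral_operator k x)"
            by (simp add: integral_operator_scaleR_kernel dist_norm flip: scaleR_diff_right)
          also have "\<dots> \<le> \<bar>c\<bar> * e'" using a by (intro mult_left_mono) auto
          finally show "integral_operator (c *\<^sub>R k) x \<in> (\<Union>x\<in>(\<lambda>a. c *\<^sub>R a) ` F. ball x e)"
            using a e' by (intro UN_I[of "c *\<^sub>R a"]) auto
        qed
        then show "\<exists>F. finite F \<and> integral_operator (c *\<^sub>R k) ` cball 0 1 \<subseteq> (\<Union>x\<in>F. ball x e)"
          using F(1) by (intro exI[of _ "(\<lambda>a. c *\<^sub>R a) ` F"] conjI finite_imageI)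
      qed
    qed
    show "closed V" unfolding closed_sequential_limits
    proof (intro allI impI, elim conjE)
      fix X k assume X: "\<forall>n. X n \<in> V" "X \<longlonglongrightarrow> k"
      show "k \<in> V" unfolding V_def
      proof (intro CollectI allI impI)
        fix e :: real assume e: "e > 0"
        then have e2: "e / 2 > 0" by simp
        obtain n where n: "dist (X n) k < e/2"
          using metric_LIMSEQ_D[OF X(2) e2] by blast
        have "X n \<in> V" using X(1) by blast
        then obtain F where F: "finite F" "integral_operator (X n) ` cball 0 1 \<subseteq> (\<Union>x\<in>F. ball x (e/2))"
          using e2 unfolding V_def by blast
        have "integral_operator k ` cball 0 1 \<subseteq> (\<Union>x\<in>F. ball x e)"
        proof (intro image_subsetI)
          fix x :: "'a L2" assume x: "x \<in> cball 0 1"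
          then have "integral_operator (X n) x \<in> (\<Union>x\<in>F. ball x (e/2))" using F(2) by blast
          then obtain a where a: "a \<in> F" "dist a (integral_operator (X n) x) < e/2" by auto
          have "dist (integral_operator (X n) x) (integral_operator k x) = norm (integral_operator (X n - k) x)"
            by (simp add: integral_operator_diff_kernel dist_norm)
          also have "\<dots> \<le> norm (X n - k) * 1"
            using x by (intro order_trans[OF norm_integral_operator_le] mult_left_mono) auto
          also have "\<dots> < e/2" using n by (simp add: dist_norm)
          finally have "dist a (integral_operator k x) < e"
            using a(2) dist_triangle[of a "integral_operator k x" "integral_operator (X n) x"] by linarith
          then show "integral_operator k x \<in> (\<Union>x\<in>F. ball x e)" using a by auto
        qed
        then show "\<exists>F. finite F \<and> integral_operator k ` cball 0 1 \<subseteq> (\<Union>x\<in>F. ball x e)" using F(1) by blast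
      qed
    qed
  qed
  then have "\<forall>e>0. \<exists>F. finite F \<and> integral_operator k ` cball 0 1 \<subseteq> (\<Union>x\<in>F. ball x e)"
    unfolding V_def by (rule CollectD)
  with assms show ?thesis by simp
qed

lemma integral_operator_compact:
  fixes X :: "nat \<Rightarrow> 'a::euclidean_space L2"
  assumes "\<And>n. norm (X n) \<le> 1"
  shows "\<exists>l r. strict_mono r \<and> (\<lambda>n. integral_operator k (X (r n))) \<longlonglongrightarrow> l"
proof -
  let ?S = "closure (integral_operator k ` cball 0 1)"
  have "compact ?S" unfolding compact_eq_totally_bounded
  proof (intro conjI allI impI)
    fix e :: real assume e: "e > 0"
    then obtain F where F: "finite F" "integral_operator k ` cball 0 1 \<subseteq> (\<Union>x\<in>F. ball x (e/2))"
      using totally_bounded_integral_operator[of "e/2" k] by auto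
    have "integral_operator k ` cball 0 1 \<subseteq> (\<Union>x\<in>F. cball x (e/2))"
      by (rule order_trans[OF F(2)]) (intro UN_mono order_refl ball_subset_cball)
    then have "?S \<subseteq> (\<Union>x\<in>F. cball x (e/2))"
      using F(1) by (intro closure_minimal closed_UN) auto
    also have "\<dots> \<subseteq> (\<Union>x\<in>F. ball x e)" using e by fastforce
    finally show "\<exists>F. finite F \<and> ?S \<subseteq> (\<Union>x\<in>F. ball x e)" using F(1) by blast
  qed (simp add: complete_eq_closed)
  then have sc: "seq_compact ?S" by (rule compact_imp_seq_compact)
  have "\<forall>n. integral_operator k (X n) \<in> ?S"
    using assms by (auto intro!: subsetD[OF closure_subset] imageI)
  with sc[unfolded seq_compact_def, THEN spec, of "\<lambda>n. integral_operator k (X n)"]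
  obtain l r where "strict_mono r" "((\<lambda>n. integral_operator k (X n)) \<circ> r) \<longlonglongrightarrow> l"
    by auto
  then show ?thesis by (auto simp: o_def)
qed

section \<open>Eigenvalues of compact self-adjoint operators\<close>

text \<open>A dimension count: otherwise \<open>T\<close>, whose values lie in the span of
  \<open>E\<close>, would be injective on the larger space spanned by \<open>B\<close>. It tests
  orthogonality because the inner product of \<open>T x\<close> with \<open>x\<close> is the sum of
  the squared coefficients of \<open>x\<close> along \<open>E\<close>.\<close>

lemma exists_orthogonal_in_span:
  fixes B E :: "'a::real_inner set"
  assumes "finite B" "independent B" "finite E" "card E < card B"
  shows "\<exists>x\<in>span B. x \<noteq> 0 \<and> (\<forall>e\<in>E. inner x e = 0)"
proof (rule ccontr)
  assume contra: "\<not> ?thesis"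
  define T where "T x = (\<Sum>e\<in>E. inner x e *\<^sub>R e)" for x :: 'a
  have lin: "linear T"
    by (intro linearI) (simp_all add: T_def inner_add_left scaleR_add_left sum.distrib scaleR_sum_right)
  have zero: "\<forall>e\<in>E. inner x e = 0" if "T x = 0" for x
  proof -
    have "(\<Sum>e\<in>E. (inner x e)\<^sup>2) = inner (T x) x"
      unfolding T_def inner_sum_left inner_scaleR_left power2_eq_square by (simp add: inner_commute)
    then show ?thesis using that assms(3) by (simp add: sum_nonneg_eq_0_iff)
  qed
  have inj: "inj_on T (span B)"
  proof (rule inj_onI)
    fix x y assume xy: "x \<in> span B" "y \<in> span B" "T x = T y"
    then have "T (x - y) = 0" "x - y \<in> span B" using lin by (simp_all add: linear_diff span_diff)
    with zero contra show "x = y" by force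
  qed
  have "independent (T ` B)" using linear_independent_injective_image[OF lin assms(2) inj] .
  moreover have "T ` B \<subseteq> span E" unfolding T_def by (intro image_subsetI span_sum span_scale span_base)
  ultimately have "card (T ` B) \<le> card E" using independent_span_bound[OF assms(3)] by blast
  moreover have "card (T ` B) = card B" using inj_on_subset[OF inj span_superset] by (rule card_image)
  ultimately show False using assms(4) by simp
qed

text \<open>The subspace side of the max-min principle: the quadratic form is at least
  \<open>l\<close> on some space of dimension \<open>j\<close>. Unlike a condition on eigenvectors,
  this survives a small change of the form.\<close>

definition form_bounded_below :: "('a::real_inner \<Rightarrow> 'a) \<Rightarrow> nat \<Rightarrow> real \<Rightarrow> bool" where
  "form_bounded_below A j l \<longleftrightarrow> (\<exists>B. finite B \<and> card B = j \<and> independent B \<and> (\<forall>x\<in>span B. l * (norm x)\<^sup>2 \<le> inner (A x) x))"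

lemma form_bounded_below_mono:
  assumes "form_bounded_below A j l" "i \<le> j" "l' \<le> l"
  shows "form_bounded_below A i l'"
proof -
  obtain B where B: "finite B" "card B = j" "independent B" "\<forall>x\<in>span B. l * (norm x)\<^sup>2 \<le> inner (A x) x"
    using assms by (auto simp: form_bounded_below_def)
  obtain C where C: "C \<subseteq> B" "card C = i" using obtain_subset_with_card_n[of i B] assms(2) B(2) by auto
  have "l' * (norm x)\<^sup>2 \<le> inner (A x) x" if "x \<in> span C" for x
  proof -
    have "l' * (norm x)\<^sup>2 \<le> l * (norm x)\<^sup>2" using assms(3) by (intro mult_right_mono) auto
    also have "\<dots> \<le> inner (A x) x" using B(4) that span_mono[OF C(1)] by blast
    finally show ?thesis .
  qed
  then show ?thesis
    unfolding form_bounded_below_def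
    using C B(1) independent_mono[OF B(3) C(1)] finite_subset[OF C(1)] by blast
qed

lemma form_bounded_below_perturb:
  assumes "form_bounded_below A j l" "\<And>x. inner (A x) x - d * (norm x)\<^sup>2 \<le> inner (A' x) x"
  shows "form_bounded_below A' j (l - d)"
proof -
  obtain B where B: "finite B" "card B = j" "independent B" "\<forall>x\<in>span B. l * (norm x)\<^sup>2 \<le> inner (A x) x"
    using assms by (auto simp: form_bounded_below_def)
  have "(l - d) * (norm x)\<^sup>2 \<le> inner (A' x) x" if "x \<in> span B" for x
    using B(4) that assms(2)[of x] by (force simp: algebra_simps)
  then show ?thesis unfolding form_bounded_below_def using B by blast
qed

locale compact_selfadjoint =
  fixes A :: "'a::{real_inner, banach} \<Rightarrow> 'a" and C :: real
  assumes lin: "linear A" and bound: "\<And>x. norm (A x) \<le> C * norm x" and C_nonneg: "0 \<le> C"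
    and selfadj: "\<And>x y. inner (A x) y = inner x (A y)"
    and compact: "\<And>X :: nat \<Rightarrow> 'a. (\<And>n. norm (X n) \<le> 1) \<Longrightarrow> \<exists>l r. strict_mono r \<and> (\<lambda>n. A (X (r n))) \<longlonglongrightarrow> l"
begin

lemma bounded_linear_A: "bounded_linear A"
  using lin bound by (intro bounded_linear.intro bounded_linear_axioms.intro exI[of _ C]) (simp_all add: mult.commute)

lemma form_le: "inner (A x) x \<le> C * (norm x)\<^sup>2"
proof -
  have "inner (A x) x \<le> norm (A x) * norm x" by (rule norm_cauchy_schwarz)
  also have "\<dots> \<le> C * norm x * norm x" by (intro mult_right_mono bound) auto
  finally show ?thesis by (simp add: power2_eq_square mult.assoc)
qed

lemma eigenvectors_orthogonal:
  assumes "A x = m *\<^sub>R x" "A y = m' *\<^sub>R y" "m \<noteq> m'" shows "inner x y = 0"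
  using selfadj[of x y] assms by (simp add: inner_commute)

text \<open>Independent eigenvectors for one eigenvalue need not be orthogonal, so the expansion of
  \<open>x\<close> is grouped by eigenvalue. Different groups are orthogonal, and the form is
  diagonal in them.\<close>

lemma form_on_eigenvectors:
  assumes B: "finite B" "\<forall>x\<in>B. \<exists>\<mu>\<ge>l. A x = \<mu> *\<^sub>R x" and x: "x \<in> span B"
  shows "l * (norm x)\<^sup>2 \<le> inner (A x) x"
proof -
  obtain ev where ev: "\<And>b. b \<in> B \<Longrightarrow> ev b \<ge> l \<and> A b = ev b *\<^sub>R b" using B(2) by metis
  obtain c where c: "x = (\<Sum>b\<in>B. c b *\<^sub>R b)" using x B(1) by (auto simp: span_finite)
  define E where "E = ev ` B"
  define y where "y m = (\<Sum>b\<in>{b\<in>B. ev b = m}. c b *\<^sub>R b)" for m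
  have fE: "finite E" using B(1) by (simp add: E_def)
  have xy: "x = (\<Sum>m\<in>E. y m)" unfolding c y_def E_def by (rule sum.image_gen[OF B(1)])
  have Ay: "A (y m) = m *\<^sub>R y m" for m
    unfolding y_def linear_sum[OF lin] scaleR_sum_right
    by (intro sum.cong refl) (use ev in \<open>auto simp: linear_cmul[OF lin] mult.commute\<close>)
  have orth: "inner (y m) (y m') = 0" if "m \<noteq> m'" for m m'
    using eigenvectors_orthogonal[OF Ay Ay that] .
  have diag: "(\<Sum>m\<in>E. \<Sum>m'\<in>E. k m * inner (y m) (y m')) = (\<Sum>m\<in>E. k m * (norm (y m))\<^sup>2)" for k
  proof (intro sum.cong refl)
    fix m assume m: "m \<in> E"
    have "(\<Sum>m'\<in>E. k m * inner (y m) (y m')) = (\<Sum>m'\<in>E. if m' = m then k m * (norm (y m))\<^sup>2 else 0)"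
      by (intro sum.cong refl) (auto simp: orth power2_norm_eq_inner)
    then show "(\<Sum>m'\<in>E. k m * inner (y m) (y m')) = k m * (norm (y m))\<^sup>2" using fE m by simp
  qed
  have "l * (norm x)\<^sup>2 = (\<Sum>m\<in>E. \<Sum>m'\<in>E. l * inner (y m) (y m'))"
    unfolding power2_norm_eq_inner by (subst (1 2) xy) (simp add: inner_sum_left inner_sum_right sum_distrib_left, rule sum.swap)
  also have "\<dots> = (\<Sum>m\<in>E. l * (norm (y m))\<^sup>2)" using diag[of "\<lambda>_. l"] by simp
  also have "\<dots> \<le> (\<Sum>m\<in>E. m * (norm (y m))\<^sup>2)"
    by (intro sum_mono mult_right_mono) (use ev in \<open>auto simp: E_def\<close>)
  also have "\<dots> = (\<Sum>m\<in>E. \<Sum>m'\<in>E. m * inner (y m) (y m'))" using diag[of "\<lambda>m. m"] by simp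
  also have "\<dots> = inner (A x) x"
    by (subst (1 2) xy) (simp add: linear_sum[OF lin] Ay inner_sum_left inner_sum_right, rule sum.swap)
  finally show ?thesis .
qed

text \<open>The supremum of the form on an invariant complement is attained. There
  \<open>T = s - A\<close> is nonnegative, which gives |T x|^2 \<le> K <T x, x>; so along a
  maximising sequence T tends to 0, and compactness of \<open>A\<close> extracts a limit.\<close>

lemma exists_maximal_eigenvector:
  assumes E: "finite E" "\<forall>e\<in>E. \<exists>\<mu>. A e = \<mu> *\<^sub>R e" and s: "s > 0"
    and up: "\<And>x. \<forall>e\<in>E. inner x e = 0 \<Longrightarrow> inner (A x) x \<le> s * (norm x)\<^sup>2"
    and approx: "\<And>\<epsilon>. \<epsilon> > 0 \<Longrightarrow> \<exists>x. (\<forall>e\<in>E. inner x e = 0) \<and> norm x = 1 \<and> inner (A x) x > s - \<epsilon>"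
  shows "\<exists>x. (\<forall>e\<in>E. inner x e = 0) \<and> norm x = 1 \<and> A x = s *\<^sub>R x"
proof -
  define T where "T x = s *\<^sub>R x - A x" for x
  define K where "K = s + C"
  have K: "K > 0" using s C_nonneg by (simp add: K_def)
  have linT: "linear T" unfolding T_def using lin by (intro linear_compose_sub linear_scale_self)
  have TV: "\<forall>e\<in>E. inner (T x) e = 0" if "\<forall>e\<in>E. inner x e = 0" for x
  proof
    fix e assume e: "e \<in> E"
    then obtain \<mu> where "A e = \<mu> *\<^sub>R e" using E by blast
    then show "inner (T x) e = 0" using that e by (simp add: T_def inner_diff_left selfadj)
  qed
  have Tup: "inner (T y) y \<le> K * (norm y)\<^sup>2" for y
  proof -
    have "- inner (A y) y \<le> C * (norm y)\<^sup>2"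
    proof -
      have "- inner (A y) y \<le> norm (A y) * norm y" using Cauchy_Schwarz_ineq2[of "A y" y] by linarith
      also have "\<dots> \<le> C * norm y * norm y" by (intro mult_right_mono bound) auto
      finally show ?thesis by (simp add: power2_eq_square mult.assoc)
    qed
    then show ?thesis by (simp add: T_def K_def inner_diff_left power2_norm_eq_inner algebra_simps)
  qed
  have key: "(norm (T x))\<^sup>2 \<le> K * inner (T x) x" if x: "\<forall>e\<in>E. inner x e = 0" for x
  proof -
    \<comment> \<open>One gradient step of length 1 / K away from \<open>x\<close>. That the form of
      \<open>T\<close> is still nonnegative there is, after expansion, the claimed
      inequality.\<close>
    define z where "z = x - (1 / K) *\<^sub>R T x"
    have "\<forall>e\<in>E. inner z e = 0" using x TV[OF x] by (simp add: z_def inner_diff_left)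
    then have "0 \<le> inner (T z) z" using up[of z] by (simp add: T_def inner_diff_left power2_norm_eq_inner)
    also have "inner (T z) z = inner (T x) x - (2 / K) * inner (T x) (T x) + (1 / K)\<^sup>2 * inner (T (T x)) (T x)"
    proof -
      have "T z = T x - (1 / K) *\<^sub>R T (T x)" unfolding z_def by (simp add: linear_diff[OF linT] linear_cmul[OF linT])
      then have "inner (T z) z = inner (T x - (1 / K) *\<^sub>R T (T x)) (x - (1 / K) *\<^sub>R T x)"
        by (simp only: z_def)
      moreover have "inner (T (T x)) x = inner (T x) (T x)"
        by (simp add: T_def inner_diff_left inner_diff_right selfadj linear_diff[OF lin] linear_cmul[OF lin])
      ultimately show ?thesis
        by (simp add: inner_diff_left inner_diff_right power2_eq_square diff_divide_distrib)
    qed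
    also have "\<dots> \<le> inner (T x) x - (2 / K) * inner (T x) (T x) + (1 / K)\<^sup>2 * (K * (norm (T x))\<^sup>2)"
      by (intro add_mono mult_left_mono order_refl Tup) auto
    also have "\<dots> = inner (T x) x - (1 / K) * (norm (T x))\<^sup>2"
      using K by (simp add: dot_square_norm power2_eq_square field_simps)
    finally show ?thesis using K by (simp add: field_simps)
  qed
  have "\<exists>x. (\<forall>e\<in>E. inner x e = 0) \<and> norm x = 1 \<and> inner (A x) x > s - 1 / real (Suc n)" for n
    by (rule approx) simp
  then obtain X where X: "\<And>n. \<forall>e\<in>E. inner (X n) e = 0" "\<And>n. norm (X n) = 1" "\<And>n. inner (A (X n)) (X n) > s - 1 / real (Suc n)"
    by metis
  have TX: "(\<lambda>n. T (X n)) \<longlonglongrightarrow> 0"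
  proof -
    have "(norm (T (X n)))\<^sup>2 \<le> K * (1 / real (Suc n))" for n
    proof -
      have "inner (T (X n)) (X n) = s - inner (A (X n)) (X n)"
        using X(2)[of n] by (simp add: T_def inner_diff_left norm_eq_1)
      then have "inner (T (X n)) (X n) \<le> 1 / real (Suc n)" using X(3)[of n] by simp
      then show ?thesis using K by (intro order_trans[OF key[OF X(1), of n]] mult_left_mono) auto
    qed
    moreover have "(\<lambda>n. K * (1 / real (Suc n))) \<longlonglongrightarrow> K * 0"
      by (rule tendsto_mult[OF tendsto_const LIMSEQ_inverse_real_of_nat[unfolded inverse_eq_divide]])
    ultimately have "(\<lambda>n. (norm (T (X n)))\<^sup>2) \<longlonglongrightarrow> 0"
      by (intro Lim_null_comparison[of "\<lambda>n. (norm (T (X n)))\<^sup>2" "\<lambda>n. K * (1 / real (Suc n))"]) auto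
    then have "(\<lambda>n. sqrt ((norm (T (X n)))\<^sup>2)) \<longlonglongrightarrow> sqrt 0" by (rule tendsto_real_sqrt)
    then show ?thesis by (simp add: tendsto_norm_zero_iff)
  qed
  obtain l r where r: "strict_mono r" and l: "(\<lambda>n. A (X (r n))) \<longlonglongrightarrow> l"
    using compact[of X] X(2) by auto
  \<comment> \<open>As X = (T X + A X) / s with both summands convergent along the subsequence, the
    vectors themselves converge. Division by the positive \<open>s\<close> is essential:
    \<open>A\<close> alone gives convergence of the images only.\<close>
  define e where "e = (1 / s) *\<^sub>R (0 + l)"
  have "(\<lambda>n. (1 / s) *\<^sub>R (T (X (r n)) + A (X (r n)))) \<longlonglongrightarrow> e"
    unfolding e_def using LIMSEQ_subseq_LIMSEQ[OF TX r] by (intro tendsto_intros l) (simp add: o_def)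
  then have lim: "(\<lambda>n. X (r n)) \<longlonglongrightarrow> e" using s by (simp add: T_def)
  have "norm e = 1"
    using tendsto_norm[OF lim] X(2) by (simp add: LIMSEQ_const_iff)
  moreover have "\<forall>f\<in>E. inner e f = 0"
  proof
    fix f assume "f \<in> E"
    have "(\<lambda>n. inner (X (r n)) f) \<longlonglongrightarrow> inner e f" by (intro tendsto_intros lim)
    then show "inner e f = 0" using X(1) \<open>f \<in> E\<close> by (simp add: LIMSEQ_const_iff)
  qed
  moreover have "A e = s *\<^sub>R e"
  proof -
    have "(\<lambda>n. A (X (r n))) \<longlonglongrightarrow> A e" by (rule bounded_linear.tendsto[OF bounded_linear_A lim])
    then have "A e = l" using l by (rule LIMSEQ_unique)
    then show ?thesis using s by (simp add: e_def)
  qed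
  ultimately show ?thesis by blast
qed

text \<open>The max-min principle by successive maximisation on the complement of the vectors
  already found. The positive form bound \<open>l0\<close> keeps every supremum positive, as the
  existence of a maximiser requires. The bound on the complement is carried along so that each new
  eigenvalue is at most the previous ones.\<close>

lemma greedy_eigenvectors:
  assumes "form_bounded_below A j l0" "l0 > 0"
  shows "\<exists>E \<mu>. finite E \<and> card E = j \<and> pairwise orthogonal E \<and> (\<forall>e\<in>E. norm e = 1) \<and> (\<forall>e\<in>E. \<exists>\<nu>\<ge>\<mu>. A e = \<nu> *\<^sub>R e)
    \<and> (\<forall>x. (\<forall>e\<in>E. inner x e = 0) \<longrightarrow> inner (A x) x \<le> \<mu> * (norm x)\<^sup>2)
    \<and> (j \<ge> 1 \<longrightarrow> (\<exists>e\<in>E. A e = \<mu> *\<^sub>R e) \<and> (\<forall>l. form_bounded_below A j l \<longrightarrow> l \<le> \<mu>))"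
  using assms(1)
proof (induction j)
  case 0
  \<comment> \<open>With no vector chosen, any upper bound of the form will do.\<close>
  show ?case by (intro exI[of _ "{}"] exI[of _ C]) (auto intro: form_le)
next
  case (Suc j)
  have "form_bounded_below A j l0" using Suc.prems by (rule form_bounded_below_mono) auto
  then obtain E \<mu> where E: "finite E" "card E = j" "pairwise orthogonal E" "\<forall>e\<in>E. norm e = 1" "\<forall>e\<in>E. \<exists>\<nu>\<ge>\<mu>. A e = \<nu> *\<^sub>R e"
    and up: "\<And>x. \<forall>e\<in>E. inner x e = 0 \<Longrightarrow> inner (A x) x \<le> \<mu> * (norm x)\<^sup>2"
    using Suc.IH by blast
  define S where "S = {inner (A x) x |x. (\<forall>e\<in>E. inner x e = 0) \<and> norm x = 1}"
  define s where "s = Sup S"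
  \<comment> \<open>A space of dimension j + 1 contains a unit vector orthogonal to the j vectors
    already chosen; so any form bound of order j + 1 is at most the next supremum.\<close>
  have ex: "\<exists>x. (\<forall>e\<in>E. inner x e = 0) \<and> norm x = 1 \<and> l \<le> inner (A x) x" if "form_bounded_below A (Suc j) l" for l
  proof -
    obtain B where B: "finite B" "card B = Suc j" "independent B" "\<forall>x\<in>span B. l * (norm x)\<^sup>2 \<le> inner (A x) x"
      using \<open>form_bounded_below A (Suc j) l\<close> unfolding form_bounded_below_def by blast
    obtain x where x: "x \<in> span B" "x \<noteq> 0" "\<forall>e\<in>E. inner x e = 0"
      using exists_orthogonal_in_span[OF B(1,3) E(1)] E(2) B(2) by auto
    have "sgn x \<in> span B" using x(1) by (simp add: sgn_div_norm span_scale)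
    then have "l * (norm (sgn x))\<^sup>2 \<le> inner (A (sgn x)) (sgn x)" using B(4) by blast
    moreover have "norm (sgn x) = 1" using x(2) by (simp add: norm_sgn)
    moreover have "\<forall>e\<in>E. inner (sgn x) e = 0" using x(3) by (simp add: sgn_div_norm)
    ultimately show ?thesis by (intro exI[of _ "sgn x"]) simp
  qed
  have bdd: "bdd_above S"
  proof (rule bdd_aboveI)
    fix y assume "y \<in> S"
    then obtain x where "y = inner (A x) x" "norm x = 1" by (auto simp: S_def)
    then show "y \<le> C" using form_le[of x] by simp
  qed
  have le_s: "inner (A x) x \<le> s" if "\<forall>e\<in>E. inner x e = 0" "norm x = 1" for x
    unfolding s_def by (rule cSup_upper[OF _ bdd]) (use that in \<open>auto simp: S_def\<close>)
  have l_le_s: "l \<le> s" if "form_bounded_below A (Suc j) l" for l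
    using ex[OF that] le_s by (auto intro: order_trans)
  have s0: "s > 0" using l_le_s[OF Suc.prems] assms(2) by linarith
  have Sne: "S \<noteq> {}" using ex[OF Suc.prems] by (auto simp: S_def)
  have s_le: "s \<le> \<mu>"
    unfolding s_def
  proof (rule cSup_least[OF Sne])
    fix y assume "y \<in> S"
    then obtain x where "y = inner (A x) x" "norm x = 1" "\<forall>e\<in>E. inner x e = 0" by (auto simp: S_def)
    then show "y \<le> \<mu>" using up[of x] by simp
  qed
  have ups: "inner (A x) x \<le> s * (norm x)\<^sup>2" if x: "\<forall>e\<in>E. inner x e = 0" for x
  proof (cases "x = 0")
    case False
    have "inner (A (sgn x)) (sgn x) \<le> s"
      by (rule le_s) (use x False in \<open>auto simp: sgn_div_norm\<close>)
    then show ?thesis using False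
      by (simp add: sgn_div_norm linear_cmul[OF lin] field_simps power2_eq_square)
  qed (simp add: linear_0[OF lin])
  have "\<exists>x. (\<forall>e\<in>E. inner x e = 0) \<and> norm x = 1 \<and> A x = s *\<^sub>R x"
  proof (rule exists_maximal_eigenvector[OF E(1) _ s0 ups])
    show "\<forall>e\<in>E. \<exists>\<mu>. A e = \<mu> *\<^sub>R e" using E(5) by blast
    show "\<exists>x. (\<forall>e\<in>E. inner x e = 0) \<and> norm x = 1 \<and> inner (A x) x > s - \<epsilon>" if "\<epsilon> > 0" for \<epsilon>
    proof -
      have "s - \<epsilon> < Sup S" using that by (simp add: s_def)
      then show ?thesis unfolding less_cSup_iff[OF Sne bdd] by (auto simp: S_def)
    qed
  qed
  then obtain e where e: "\<forall>f\<in>E. inner e f = 0" "norm e = 1" "A e = s *\<^sub>R e" by blast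
  have "e \<notin> E"
  proof
    assume "e \<in> E"
    then have "inner e e = 0" using e(1) by blast
    then show False using e(2) by simp
  qed
  show ?case
  proof (intro exI[of _ "insert e E"] exI[of _ s] conjI impI allI)
    show "card (insert e E) = Suc j" using E \<open>e \<notin> E\<close> by simp
    show "pairwise orthogonal (insert e E)"
      using E(3) e(1) by (auto simp: pairwise_insert orthogonal_def inner_commute)
    show "\<forall>f\<in>insert e E. \<exists>\<nu>\<ge>s. A f = \<nu> *\<^sub>R f"
    proof
      fix f assume "f \<in> insert e E"
      then consider "f = e" | \<nu> where "\<nu> \<ge> \<mu>" "A f = \<nu> *\<^sub>R f" using E(5) by blast
      then show "\<exists>\<nu>\<ge>s. A f = \<nu> *\<^sub>R f"
      proof cases
        case 1 then show ?thesis using e(3) by (intro exI[of _ s]) simp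
      next
        case 2 then show ?thesis using s_le by (intro exI[of _ \<nu>]) simp
      qed
    qed
    show "\<exists>f\<in>insert e E. A f = s *\<^sub>R f" using e(3) by blast
  qed (use E e ups l_le_s in auto)
qed

section \<open>From form bounds to ordered eigenvalues\<close>

lemma eigenvectors_imp_form_bounded_below:
  assumes "\<exists>B. finite B \<and> card B = j \<and> independent B \<and> (\<forall>x\<in>B. \<exists>\<mu>\<ge>l. A x = \<mu> *\<^sub>R x)"
  shows "form_bounded_below A j l"
proof -
  obtain B where B: "finite B" "card B = j" "independent B" "\<forall>x\<in>B. \<exists>\<mu>\<ge>l. A x = \<mu> *\<^sub>R x" using assms by blast
  then show ?thesis
    unfolding form_bounded_below_def using form_on_eigenvectors[OF B(1,4)] by blast
qed

text \<open>The greedy eigenvectors show that the value is taken. It is the greatest because any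
  competing family of eigenvectors spans a space on which the form is bounded below. The
  \<open>GREATEST\<close> thus equals the max-min value whenever some form bound is
  positive.\<close>

lemma nth_largest_eigenvalue_positive:
  assumes "form_bounded_below A j l0" "l0 > 0" "j \<ge> 1"
  shows "form_bounded_below A j (nth_largest_eigenvalue A j)"
    and "\<And>l. form_bounded_below A j l \<Longrightarrow> l \<le> nth_largest_eigenvalue A j"
proof -
  obtain E \<mu> where E: "finite E" "card E = j" "pairwise orthogonal E" "\<forall>e\<in>E. norm e = 1" "\<forall>e\<in>E. \<exists>\<nu>\<ge>\<mu>. A e = \<nu> *\<^sub>R e"
    and ev: "\<exists>e\<in>E. A e = \<mu> *\<^sub>R e" and max: "\<And>l. form_bounded_below A j l \<Longrightarrow> l \<le> \<mu>"
    using greedy_eigenvectors[OF assms(1,2)] assms(3) by blast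
  have "0 \<notin> E" using E(4) by force
  then have ind: "independent E" using E(3) by (rule pairwise_orthogonal_independent[rotated])
  have P: "(\<exists>x. x \<noteq> 0 \<and> A x = \<mu> *\<^sub>R x) \<and> (\<exists>B. finite B \<and> card B = j \<and> independent B \<and> (\<forall>x\<in>B. \<exists>\<nu>\<ge>\<mu>. A x = \<nu> *\<^sub>R x))"
  proof
    show "\<exists>x. x \<noteq> 0 \<and> A x = \<mu> *\<^sub>R x" using ev \<open>0 \<notin> E\<close> by metis
    show "\<exists>B. finite B \<and> card B = j \<and> independent B \<and> (\<forall>x\<in>B. \<exists>\<nu>\<ge>\<mu>. A x = \<nu> *\<^sub>R x)"
      using E(1,2,5) ind by (intro exI[of _ E] conjI)
  qed
  have "nth_largest_eigenvalue A j = \<mu>"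
    unfolding nth_largest_eigenvalue_def
    using P by (rule Greatest_equality) (rule max, rule eigenvectors_imp_form_bounded_below, erule conjunct2)
  moreover have "form_bounded_below A j \<mu>"
    using P by (intro eigenvectors_imp_form_bounded_below) (rule conjunct2)
  ultimately show "form_bounded_below A j (nth_largest_eigenvalue A j)"
    "\<And>l. form_bounded_below A j l \<Longrightarrow> l \<le> nth_largest_eigenvalue A j"
    using max by simp_all
qed

text \<open>The null vectors witness the value 0, and a larger value would yield a positive form
  bound.\<close>

lemma nth_largest_eigenvalue_zero:
  assumes "\<not> (\<exists>l>0. form_bounded_below A j l)" "j \<ge> 1"
    and B: "finite B" "card B = j" "independent B" "\<forall>x\<in>B. A x = 0"
  shows "nth_largest_eigenvalue A j = 0"
  unfolding nth_largest_eigenvalue_def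
proof (rule Greatest_equality)
  obtain x where "x \<in> B" using B(1,2) assms(2) by fastforce
  moreover have "x \<noteq> 0" using \<open>x \<in> B\<close> B(3) dependent_zero by blast
  ultimately show "(\<exists>x. x \<noteq> 0 \<and> A x = 0 *\<^sub>R x) \<and> (\<exists>B. finite B \<and> card B = j \<and> independent B \<and> (\<forall>x\<in>B. \<exists>\<nu>\<ge>0. A x = \<nu> *\<^sub>R x))"
    using B by (intro conjI exI[of _ x] exI[of _ B]) auto
  show "y \<le> 0" if "(\<exists>x. x \<noteq> 0 \<and> A x = y *\<^sub>R x) \<and> (\<exists>B. finite B \<and> card B = j \<and> independent B \<and> (\<forall>x\<in>B. \<exists>\<nu>\<ge>y. A x = \<nu> *\<^sub>R x))" for y
  proof (rule ccontr)
    assume "\<not> y \<le> 0"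
    moreover have "form_bounded_below A j y"
      by (rule eigenvectors_imp_form_bounded_below) (rule conjunct2[OF that])
    ultimately show False using assms(1) by auto
  qed
qed

end

text \<open>The max-min value truncated at 0. If an operator has fewer than \<open>j\<close>
  positive eigenvalues and its negative ones accumulate at 0 without 0 being an eigenvalue, then the
  maximum in \<open>nth_largest_eigenvalue\<close> does not exist; here the value is 0.\<close>

definition positive_eigenvalue :: "('a::real_inner \<Rightarrow> 'a) \<Rightarrow> nat \<Rightarrow> real" where
  "positive_eigenvalue A j = (if \<exists>l>0. form_bounded_below A j l then nth_largest_eigenvalue A j else 0)"

text \<open>A subspace that serves \<open>A\<close> with the bound \<open>l\<close> serves
  \<open>A'\<close> with \<open>l - d\<close>. Only a positive difference needs this argument, since
  the right-hand side is nonnegative anyway.\<close>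

lemma positive_eigenvalue_le:
  assumes A: "compact_selfadjoint A C" and A': "compact_selfadjoint A' C'" and j: "j \<ge> 1" and d: "d \<ge> 0"
    and le: "\<And>x. inner (A x) x - d * (norm x)\<^sup>2 \<le> inner (A' x) x"
  shows "positive_eigenvalue A j - d \<le> positive_eigenvalue A' j"
proof -
  interpret A: compact_selfadjoint A C by (rule A)
  interpret A': compact_selfadjoint A' C' by (rule A')
  have nonneg: "0 \<le> positive_eigenvalue A' j"
    using A'.nth_largest_eigenvalue_positive(2)[OF _ _ j] by (force simp: positive_eigenvalue_def)
  show ?thesis
  proof (cases "positive_eigenvalue A j - d > 0")
    case True
    then have ex: "\<exists>l>0. form_bounded_below A j l" using d by (auto simp: positive_eigenvalue_def split: if_splits)
    then have "form_bounded_below A j (positive_eigenvalue A j)"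
      using A.nth_largest_eigenvalue_positive(1)[OF _ _ j] by (auto simp: positive_eigenvalue_def)
    then have *: "form_bounded_below A' j (positive_eigenvalue A j - d)"
      using le by (rule form_bounded_below_perturb)
    then have "positive_eigenvalue A' j = nth_largest_eigenvalue A' j"
      unfolding positive_eigenvalue_def[of A'] by (intro if_P exI conjI) (rule True)
    then show ?thesis using A'.nth_largest_eigenvalue_positive(2)[OF * True j *] by simp
  next
    case False
    then show ?thesis using nonneg by linarith
  qed
qed

lemma positive_eigenvalue_antimono:
  assumes A: "compact_selfadjoint A C" and ij: "1 \<le> i" "i \<le> j"
  shows "positive_eigenvalue A j \<le> positive_eigenvalue A i"
proof (cases "\<exists>l>0. form_bounded_below A j l")
  interpret A: compact_selfadjoint A C by (rule A)
  case True
  then obtain l where l: "l > 0" "form_bounded_below A j l" by blast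
  have "form_bounded_below A j (nth_largest_eigenvalue A j)"
    using A.nth_largest_eigenvalue_positive(1)[OF l(2,1)] ij by simp
  then have "form_bounded_below A i (nth_largest_eigenvalue A j)"
    using ij(2) by (rule form_bounded_below_mono) simp
  moreover have li: "form_bounded_below A i l" using l(2) ij(2) by (rule form_bounded_below_mono) simp
  ultimately have "nth_largest_eigenvalue A j \<le> nth_largest_eigenvalue A i"
    using A.nth_largest_eigenvalue_positive(2)[OF li l(1) ij(1)] by blast
  then show ?thesis using True li l by (auto simp: positive_eigenvalue_def)
next
  interpret A: compact_selfadjoint A C by (rule A)
  case False
  then show ?thesis
    using A.nth_largest_eigenvalue_positive(2)[OF _ _ ij(1)] by (force simp: positive_eigenvalue_def)
qed

text \<open>An empty \<open>GREATEST\<close> has the same junk value for every \<open>j\<close>; together with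
  \<open>nth_largest_eigenvalue A (Suc j) = 0\<close> this excludes the junk case.\<close>

lemma positive_eigenvalue_eq_nth_largest:
  assumes A: "compact_selfadjoint A C" and j: "j \<ge> 1"
    and pos: "nth_largest_eigenvalue A j > 0" and zero: "nth_largest_eigenvalue A (j + 1) = 0"
  shows "positive_eigenvalue A j = nth_largest_eigenvalue A j" and "positive_eigenvalue A (j + 1) = 0"
proof -
  interpret A: compact_selfadjoint A C by (rule A)
  define P where "P j l \<longleftrightarrow> (\<exists>x. x \<noteq> 0 \<and> A x = l *\<^sub>R x) \<and> (\<exists>B. finite B \<and> card B = j \<and> independent B \<and> (\<forall>x\<in>B. \<exists>\<mu>\<ge>l. A x = \<mu> *\<^sub>R x))" for j l
  have nl: "nth_largest_eigenvalue A j = Greatest (P j)" for j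
    by (simp add: nth_largest_eigenvalue_def P_def[abs_def])
  have Pmono: "P j l" if P: "P (j + 1) l" for j l
  proof -
    obtain B where B: "finite B" "card B = j + 1" "independent B" "\<forall>x\<in>B. \<exists>\<mu>\<ge>l. A x = \<mu> *\<^sub>R x"
      using P unfolding P_def by (elim conjE exE)
    obtain D where D: "D \<subseteq> B" "card D = j" using obtain_subset_with_card_n[of j B] B(2) by auto
    have "finite D \<and> card D = j \<and> independent D \<and> (\<forall>x\<in>D. \<exists>\<mu>\<ge>l. A x = \<mu> *\<^sub>R x)"
      using D B(4) finite_subset[OF D(1) B(1)] independent_mono[OF B(3) D(1)] by auto
    then have e: "\<exists>D. finite D \<and> card D = j \<and> independent D \<and> (\<forall>x\<in>D. \<exists>\<mu>\<ge>l. A x = \<mu> *\<^sub>R x)" by (rule exI)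
    show ?thesis unfolding P_def by (rule conjI[OF conjunct1[OF P[unfolded P_def]] e])
  qed
  have ex: "\<exists>l>0. form_bounded_below A j l"
  proof (rule ccontr)
    assume no: "\<not> ?thesis"
    have Ple: "l \<le> 0" if P: "P j l" for l
    proof (rule ccontr)
      assume "\<not> l \<le> 0"
      moreover have "form_bounded_below A j l"
        using P unfolding P_def by (intro A.eigenvectors_imp_form_bounded_below) (rule conjunct2)
      ultimately show False using no by auto
    qed
    have noG: "\<not> (\<exists>g. P j g \<and> (\<forall>y. P j y \<longrightarrow> y \<le> g))"
    proof
      assume "\<exists>g. P j g \<and> (\<forall>y. P j y \<longrightarrow> y \<le> g)"
      then obtain g where g: "P j g" "\<forall>y. P j y \<longrightarrow> y \<le> g" by blast
      then have "Greatest (P j) = g" by (intro Greatest_equality) auto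
      then show False using pos Ple[OF g(1)] by (simp add: nl)
    qed
    \<comment> \<open>If the maximum exists for \<open>j + 1\<close>, it is 0 by assumption. By
      \<open>Pmono\<close>, 0 then also qualifies for \<open>j\<close>, where nothing positive does;
      so a maximum would exist for \<open>j\<close> after all.\<close>
    show False
    proof (cases "\<exists>g. P (j + 1) g \<and> (\<forall>y. P (j + 1) y \<longrightarrow> y \<le> g)")
      case True
      then obtain g where g: "P (j + 1) g" "\<forall>y. P (j + 1) y \<longrightarrow> y \<le> g" by blast
      then have "Greatest (P (j + 1)) = g" by (intro Greatest_equality) auto
      then have "P j 0" using g zero Pmono by (simp add: nl)
      then show False using noG Ple by blast
    next
      case False
      have "Greatest (P j) = Greatest (P (j + 1))"
      proof -
        have "(\<lambda>x. P j x \<and> (\<forall>y. P j y \<longrightarrow> y \<le> x)) = (\<lambda>x. P (j + 1) x \<and> (\<forall>y. P (j + 1) y \<longrightarrow> y \<le> x))"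
        proof -
          have "(P j x \<and> (\<forall>y. P j y \<longrightarrow> y \<le> x)) = False" for x using noG by blast
          moreover have "(P (j + 1) x \<and> (\<forall>y. P (j + 1) y \<longrightarrow> y \<le> x)) = False" for x using False by blast
          ultimately show ?thesis by (simp only:)
        qed
        then show ?thesis unfolding Greatest_def by simp
      qed
      then show False using pos zero by (simp add: nl)
    qed
  qed
  then show "positive_eigenvalue A j = nth_largest_eigenvalue A j" by (simp add: positive_eigenvalue_def)
  show "positive_eigenvalue A (j + 1) = 0" using zero by (simp add: positive_eigenvalue_def)
qed

lemma compact_selfadjoint_integral_operator:
  "kernel_swap k = k \<Longrightarrow> compact_selfadjoint (integral_operator k) (norm k)"
  by (intro compact_selfadjoint.intro linear_integral_operator norm_integral_operator_le norm_ge_zero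
      integral_operator_selfadjoint integral_operator_compact)

lemma positive_eigenvalue_nonneg:
  assumes A: "compact_selfadjoint A C" and j: "j \<ge> 1" shows "0 \<le> positive_eigenvalue A j"
proof (cases "\<exists>l>0. form_bounded_below A j l")
  case True
  then obtain l where l: "l > 0" "form_bounded_below A j l" by blast
  have "l \<le> nth_largest_eigenvalue A j"
    by (rule compact_selfadjoint.nth_largest_eigenvalue_positive(2)[OF A l(2,1) j l(2)])
  then show ?thesis using l True by (simp add: positive_eigenvalue_def)
next
  case False
  then have "positive_eigenvalue A j = 0" unfolding positive_eigenvalue_def by (rule if_not_P)
  then show ?thesis by simp
qed

section \<open>The rank estimator\<close>

text \<open>Vanishing on the orthogonal complement of finitely many vectors. In this form the
  property is visible for sums of tensors and yields null vectors directly.\<close>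

definition finite_rank :: "('a::euclidean_space \<times> 'a) L2 \<Rightarrow> bool" where
  "finite_rank k \<longleftrightarrow> (\<exists>F. finite F \<and> (\<forall>x. (\<forall>e\<in>F. inner x e = 0) \<longrightarrow> integral_operator k x = 0))"

lemma finite_rank_tensor: "finite_rank (kernel_tensor a b)"
  unfolding finite_rank_def by (rule exI[of _ "{b}"]) (simp add: integral_operator_tensor inner_commute)

lemma finite_rank_add: "finite_rank k \<Longrightarrow> finite_rank l \<Longrightarrow> finite_rank (k + l)"
  unfolding finite_rank_def
proof (elim exE conjE)
  fix F H assume *: "finite F" "\<forall>x. (\<forall>e\<in>F. inner x e = 0) \<longrightarrow> integral_operator k x = 0"
    "finite H" "\<forall>x. (\<forall>e\<in>H. inner x e = 0) \<longrightarrow> integral_operator l x = 0"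
  then show "\<exists>F. finite F \<and> (\<forall>x. (\<forall>e\<in>F. inner x e = 0) \<longrightarrow> integral_operator (k + l) x = 0)"
    by (intro exI[of _ "F \<union> H"]) (simp add: integral_operator_add_kernel)
qed

lemma finite_rank_scaleR: "finite_rank k \<Longrightarrow> finite_rank (c *\<^sub>R k)"
  unfolding finite_rank_def by (auto simp: integral_operator_scaleR_kernel)

lemma finite_rank_zero: "finite_rank 0"
  using finite_rank_scaleR[OF finite_rank_tensor, of 0] by simp

lemma finite_rank_sum: "(\<And>i. i \<in> I \<Longrightarrow> finite_rank (k i)) \<Longrightarrow> finite_rank (\<Sum>i\<in>I. k i)"
  by (induction I rule: infinite_finite_induct) (auto intro: finite_rank_add finite_rank_zero)

text \<open>The space has infinite dimension: \<open>n\<close> disjoint boxes of side 1 / n along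
  the diagonal of the cube have orthogonal indicators, and none of these is 0 because each box has
  positive volume.\<close>

lemma exists_independent_L2: "\<exists>B :: 'a::euclidean_space L2 set. finite B \<and> card B = n \<and> independent B"
proof (cases "n = 0")
  case True
  then show ?thesis by (intro exI[of _ "{}"]) (simp add: independent_empty)
next
  case False
  then have n: "real n > 0" by simp
  define A :: "nat \<Rightarrow> 'a set" where "A i = box ((real i / real n) *\<^sub>R One) ((real (Suc i) / real n) *\<^sub>R One)" for i
  have mem: "x \<in> A i \<longleftrightarrow> (\<forall>b\<in>Basis. real i / real n < inner x b \<and> inner x b < real (Suc i) / real n)" for x i
    by (simp add: A_def mem_box)
  have sq: "square_integrable (indicator (A i) :: 'a \<Rightarrow> real)" for i
    by (intro square_integrable_indicator) (simp add: A_def)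
  have sub: "A i \<subseteq> cbox 0 One" if "i < n" for i
  proof
    fix x assume x: "x \<in> A i"
    have "real (Suc i) / real n \<le> 1" "0 \<le> real i / real n" using that n by simp_all
    then have "\<forall>b\<in>Basis. 0 \<le> inner x b \<and> inner x b \<le> 1" using x unfolding mem by (meson less_imp_le order_trans)
    then show "x \<in> cbox 0 One" by (simp add: mem_box)
  qed
  have pos: "inner (L2_ind (A i)) (L2_ind (A i)) \<noteq> 0" if "i < n" for i
  proof -
    have "inner (L2_ind (A i)) (L2_ind (A i)) = (\<integral>x. indicator (A i) x \<partial>cube)"
      unfolding L2_ind_def inner_L2_of[OF sq sq] by (intro Bochner_Integration.integral_cong refl) (simp add: indicator_def)
    also have "\<dots> = measure cube (A i)"
      using sub[OF that] by (simp add: cube_def space_restrict_space inf.absorb1)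
    also have "\<dots> = measure lborel (A i)"
      unfolding cube_def using sub[OF that] by (intro measure_restrict_space) auto
    also have "\<dots> = (\<Prod>b\<in>(Basis :: 'a set). 1 / real n)"
    proof -
      have "measure lborel (A i) = (\<Prod>b\<in>(Basis :: 'a set). inner ((real (Suc i) / real n) *\<^sub>R One - (real i / real n) *\<^sub>R One) b)"
        unfolding A_def using n by (subst measure_lborel_box_eq) (auto simp: divide_right_mono)
      also have "\<dots> = (\<Prod>b\<in>(Basis :: 'a set). 1 / real n)"
        by (intro prod.cong refl) (simp add: inner_diff_left diff_divide_distrib[symmetric])
      finally show ?thesis .
    qed
    also have "\<dots> \<noteq> 0" using n by simp
    finally show ?thesis .
  qed
  have orth: "inner (L2_ind (A i)) (L2_ind (A j)) = 0" if "i \<noteq> j" for i j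
  proof -
    have "A i \<inter> A j = {}"
    proof -
      have *: False if "x \<in> A i" "x \<in> A j" "i < j" for x i j
      proof -
        obtain b :: 'a where b: "b \<in> Basis" using nonempty_Basis by blast
        have "real j / real n < inner x b" "inner x b < real (Suc i) / real n" using that b unfolding mem by auto
        moreover have "real (Suc i) / real n \<le> real j / real n" using \<open>i < j\<close> n by (intro divide_right_mono) auto
        ultimately show False by linarith
      qed
      show ?thesis using *[of _ i j] *[of _ j i] that by (metis disjoint_iff linorder_neqE_nat)
    qed
    then have "(\<lambda>x. indicator (A i) x * indicator (A j) x :: real) = (\<lambda>x. 0)"
      by (auto simp: indicator_def fun_eq_iff)
    then show ?thesis unfolding L2_ind_def inner_L2_of[OF sq sq] by simp
  qed
  define B where "B = (\<lambda>i. L2_ind (A i)) ` {..<n}"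
  have inj: "inj_on (\<lambda>i. L2_ind (A i)) {..<n}"
  proof (rule inj_onI, rule ccontr)
    fix i j assume ij: "i \<in> {..<n}" "L2_ind (A i) = L2_ind (A j)" "i \<noteq> j"
    then have "inner (L2_ind (A i)) (L2_ind (A i)) = 0" using orth[of i j] by simp
    then show False using pos[of i] ij(1) by simp
  qed
  have "pairwise orthogonal B"
    unfolding B_def pairwise_image orthogonal_def using orth by (auto simp: pairwise_def; metis)
  moreover have "0 \<notin> B"
  proof
    assume "0 \<in> B"
    then obtain i where "i < n" "L2_ind (A i) = 0" by (auto simp: B_def)
    then show False using pos[of i] by simp
  qed
  ultimately have "independent B" by (rule pairwise_orthogonal_independent)
  then show ?thesis using card_image[OF inj] by (intro exI[of _ B]) (simp add: B_def)
qed

text \<open>The operator sees only the directions in \<open>F\<close>. In infinite dimension one can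
  always add a nonzero vector orthogonal to \<open>F\<close> and to the vectors found so
  far.\<close>

lemma finite_rank_null_vectors:
  assumes "finite_rank (k :: ('a::euclidean_space \<times> 'a) L2)"
  shows "\<exists>B. finite B \<and> card B = j \<and> independent B \<and> (\<forall>x\<in>B. integral_operator k x = 0)"
proof -
  obtain F where F: "finite F" "\<And>x. \<forall>e\<in>F. inner x e = 0 \<Longrightarrow> integral_operator k x = 0"
    using assms unfolding finite_rank_def by blast
  have "\<exists>B. finite B \<and> card B = j \<and> pairwise orthogonal B \<and> 0 \<notin> B \<and> (\<forall>x\<in>B. \<forall>e\<in>F. inner x e = 0)"
  proof (induction j)
    case 0 show ?case by (intro exI[of _ "{}"]) simp
  next
    case (Suc j)
    then obtain B where B: "finite B" "card B = j" "pairwise orthogonal B" "0 \<notin> B" "\<forall>x\<in>B. \<forall>e\<in>F. inner x e = 0" by blast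
    obtain C :: "'a L2 set" where C: "finite C" "card C = Suc (card (F \<union> B))" "independent C" using exists_independent_L2 by blast
    obtain x where x: "x \<noteq> 0" "\<forall>e\<in>F \<union> B. inner x e = 0"
      using exists_orthogonal_in_span[OF C(1,3), of "F \<union> B"] C(2) F(1) B(1) by auto
    have "x \<notin> B" using x by (metis UnI2 inner_eq_zero_iff)
    show ?case
    proof (intro exI[of _ "insert x B"] conjI)
      show "pairwise orthogonal (insert x B)"
        using B(3) x(2) by (auto simp: pairwise_insert orthogonal_def inner_commute)
    qed (use B x \<open>x \<notin> B\<close> in auto)
  qed
  then obtain B where B: "finite B" "card B = j" "pairwise orthogonal B" "0 \<notin> B" "\<forall>x\<in>B. \<forall>e\<in>F. inner x e = 0" by blast
  have "independent B" using B(3,4) by (rule pairwise_orthogonal_independent)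
  then show ?thesis using B F(2) by blast
qed

text \<open>When no positive eigenvalue of order \<open>j\<close> is left, the null vectors make the
  \<open>GREATEST\<close> exist with value 0. For estimates the undefined case therefore never
  occurs.\<close>

lemma finite_rank_nth_largest_eigenvalue:
  assumes "kernel_swap k = k" "finite_rank k" "j \<ge> 1"
  shows "nth_largest_eigenvalue (integral_operator k) j = positive_eigenvalue (integral_operator k) j"
proof -
  interpret compact_selfadjoint "integral_operator k" "norm k" by (rule compact_selfadjoint_integral_operator[OF assms(1)])
  obtain B where B: "finite B" "card B = j" "independent B" "\<forall>x\<in>B. integral_operator k x = 0"
    using finite_rank_null_vectors[OF assms(2)] by blast
  show ?thesis
    using nth_largest_eigenvalue_zero[OF _ assms(3) B] by (auto simp: positive_eigenvalue_def)
qed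

lemma positive_eigenvalue_lipschitz:
  assumes k: "kernel_swap k = k" and l: "kernel_swap l = l" and j: "j \<ge> 1"
  shows "\<bar>positive_eigenvalue (integral_operator k) j - positive_eigenvalue (integral_operator l) j\<bar> \<le> norm (k - l)"
proof -
  have d: "\<bar>inner (integral_operator k x) x - inner (integral_operator l x) x\<bar> \<le> norm (k - l) * (norm x)\<^sup>2" for k l :: "('a \<times> 'a) L2" and x
  proof -
    have "\<bar>inner (integral_operator k x) x - inner (integral_operator l x) x\<bar> = \<bar>inner (integral_operator (k - l) x) x\<bar>"
      by (simp add: integral_operator_diff_kernel inner_diff_left)
    also have "\<dots> \<le> norm (integral_operator (k - l) x) * norm x" by (rule Cauchy_Schwarz_ineq2)
    also have "\<dots> \<le> norm (k - l) * norm x * norm x" by (intro mult_right_mono norm_integral_operator_le) auto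
    finally show ?thesis by (simp add: power2_eq_square mult.assoc)
  qed
  note cs = compact_selfadjoint_integral_operator[OF k] compact_selfadjoint_integral_operator[OF l]
  have "positive_eigenvalue (integral_operator k) j - norm (k - l) \<le> positive_eigenvalue (integral_operator l) j"
    by (rule positive_eigenvalue_le[OF cs j]) (use d[of k _ l] in \<open>simp_all add: abs_le_iff algebra_simps\<close>)
  moreover have "positive_eigenvalue (integral_operator l) j - norm (k - l) \<le> positive_eigenvalue (integral_operator k) j"
    by (rule positive_eigenvalue_le[OF cs(2,1) j]) (use d[of k _ l] in \<open>simp_all add: abs_le_iff algebra_simps\<close>)
  ultimately show ?thesis by linarith
qed

text \<open>The \<open>GREATEST\<close> is under control only for symmetric kernels of finite rank.
  Measurability comes from \<open>positive_eigenvalue\<close> of the symmetrised kernel: this map is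
  defined on all kernels, is Lipschitz, and agrees with the eigenvalue on the kernels in
  question.\<close>

lemma borel_measurable_nth_largest_eigenvalue:
  fixes k :: "'w \<Rightarrow> ('a::euclidean_space \<times> 'a) L2"
  assumes k: "k \<in> borel_measurable M" and sym: "\<And>\<omega>. \<omega> \<in> space M \<Longrightarrow> kernel_swap (k \<omega>) = k \<omega>"
    and fr: "\<And>\<omega>. \<omega> \<in> space M \<Longrightarrow> finite_rank (k \<omega>)" and j: "j \<ge> 1"
  shows "(\<lambda>\<omega>. nth_largest_eigenvalue (integral_operator (k \<omega>)) j) \<in> borel_measurable M"
proof -
  define s :: "('a \<times> 'a) L2 \<Rightarrow> _" where "s l = (1 / 2) *\<^sub>R (l + kernel_swap l)" for l
  define p where "p l = positive_eigenvalue (integral_operator (s l)) j" for l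
  have sw: "kernel_swap (s l) = s l" for l
    by (simp add: s_def linear_add[OF linear_kernel_swap] kernel_swap_scaleR add.commute)
  have "1-lipschitz_on UNIV p"
  proof (rule lipschitz_onI)
    fix l l' :: "('a \<times> 'a) L2"
    have "dist (p l) (p l') \<le> norm (s l - s l')"
      unfolding p_def dist_real_def by (rule positive_eigenvalue_lipschitz[OF sw sw j])
    also have "s l - s l' = (1 / 2) *\<^sub>R ((l - l') + kernel_swap (l - l'))"
      by (simp add: s_def linear_diff[OF linear_kernel_swap] algebra_simps)
    also have "norm \<dots> \<le> (1 / 2) * (norm (l - l') + norm (l - l'))"
      using norm_triangle_ineq[of "l - l'" "kernel_swap (l - l')"] by simp
    finally show "dist (p l) (p l') \<le> 1 * dist l l'" by (simp add: dist_norm)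
  qed simp
  then have "continuous_on UNIV p" by (rule lipschitz_on_continuous_on)
  then have "(\<lambda>\<omega>. p (k \<omega>)) \<in> borel_measurable M" using k by (rule borel_measurable_continuous_on)
  moreover have "nth_largest_eigenvalue (integral_operator (k \<omega>)) j = p (k \<omega>)" if "\<omega> \<in> space M" for \<omega>
  proof -
    have "s (k \<omega>) = k \<omega>" using sym[OF that] by (simp add: s_def scaleR_2[symmetric])
    then show ?thesis using finite_rank_nth_largest_eigenvalue[OF sym[OF that] fr[OF that] j] by (simp add: p_def)
  qed
  ultimately show ?thesis by (simp cong: measurable_cong)
qed

text \<open>The choice made among several minimisers is opaque, but it depends only on the set of
  minimisers. That set takes finitely many values and is a measurable function of the data.\<close>

lemma borel_measurable_arg_min_on:
  fixes g :: "'w \<Rightarrow> 'b \<Rightarrow> real" and h :: "'b \<Rightarrow> real"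
  assumes S: "finite S" and g: "\<And>x. x \<in> S \<Longrightarrow> (\<lambda>\<omega>. g \<omega> x) \<in> borel_measurable M"
  shows "(\<lambda>\<omega>. h (arg_min_on (g \<omega>) S)) \<in> borel_measurable M"
proof -
  define Z where "Z \<omega> = {x\<in>S. \<forall>y\<in>S. g \<omega> x \<le> g \<omega> y}" for \<omega>
  have eq: "arg_min_on (g \<omega>) S = (SOME x. x \<in> Z \<omega>)" for \<omega>
  proof -
    have "is_arg_min (g \<omega>) (\<lambda>x. x \<in> S) = (\<lambda>x. x \<in> Z \<omega>)"
      unfolding Z_def by (rule ext) (simp add: is_arg_min_linorder Ball_def)
    then show ?thesis unfolding arg_min_on_def arg_min_def by simp
  qed
  have "Z \<in> measurable M (count_space (Pow S))"
  proof (rule measurable_count_space_eq2[THEN iffD2])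
    show "finite (Pow S)" using S by simp
    have "Z -` {A} \<inter> space M \<in> sets M" if "A \<subseteq> S" for A
    proof -
      have "Z -` {A} \<inter> space M = {\<omega>\<in>space M. \<forall>x\<in>S. (x \<in> A) = (\<forall>y\<in>S. g \<omega> x \<le> g \<omega> y)}"
      proof -
        have "Z \<omega> = A \<longleftrightarrow> (\<forall>x\<in>S. (x \<in> A) = (x \<in> Z \<omega>))" for \<omega>
          using that unfolding Z_def by blast
        then have "Z \<omega> = A \<longleftrightarrow> (\<forall>x\<in>S. (x \<in> A) = (\<forall>y\<in>S. g \<omega> x \<le> g \<omega> y))" for \<omega>
          by (simp add: Z_def)
        then show ?thesis by blast
      qed
      also have "\<dots> \<in> sets M"
      proof (rule sets.sets_Collect_finite_All[OF _ S])
        fix x assume "x \<in> S"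
        have *: "{\<omega>\<in>space M. \<forall>y\<in>S. g \<omega> x \<le> g \<omega> y} \<in> sets M"
          by (rule sets.sets_Collect_finite_All[OF _ S]) (intro borel_measurable_le g \<open>x \<in> S\<close>)
        show "{\<omega>\<in>space M. (x \<in> A) = (\<forall>y\<in>S. g \<omega> x \<le> g \<omega> y)} \<in> sets M"
          using * sets.sets_Collect_neg[OF *] by (cases "x \<in> A") auto
      qed
      finally show ?thesis .
    qed
    then show "Z \<in> space M \<rightarrow> Pow S \<and> (\<forall>A\<in>Pow S. Z -` {A} \<inter> space M \<in> sets M)"
      by (auto simp: Z_def)
  qed
  then have "(\<lambda>\<omega>. h (SOME x. x \<in> Z \<omega>)) \<in> borel_measurable M"
    by (rule measurable_compose[where g="\<lambda>A. h (SOME x. x \<in> A)"]) simp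
  then show ?thesis by (simp add: eq)
qed

lemma borel_measurable_rank_estimator:
  fixes k :: "'w \<Rightarrow> ('a::euclidean_space \<times> 'a) L2"
  assumes k: "k \<in> borel_measurable M" and sym: "\<And>\<omega>. \<omega> \<in> space M \<Longrightarrow> kernel_swap (k \<omega>) = k \<omega>"
    and fr: "\<And>\<omega>. \<omega> \<in> space M \<Longrightarrow> finite_rank (k \<omega>)"
  shows "(\<lambda>\<omega>. real (rank_estimator \<epsilon>0 q (k \<omega>))) \<in> borel_measurable M"
  unfolding rank_estimator_def
proof (rule borel_measurable_arg_min_on)
  fix j assume "j \<in> {1..q}"
  then have [measurable]: "(\<lambda>\<omega>. nth_largest_eigenvalue (integral_operator (k \<omega>)) j) \<in> borel_measurable M"
      "(\<lambda>\<omega>. nth_largest_eigenvalue (integral_operator (k \<omega>)) (j + 1)) \<in> borel_measurable M"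
      "(\<lambda>\<omega>. nth_largest_eigenvalue (integral_operator (k \<omega>)) 1) \<in> borel_measurable M"
    by (intro borel_measurable_nth_largest_eigenvalue assms; simp)+
  show "(\<lambda>\<omega>. eigenvalue_ratio \<epsilon>0 (nth_largest_eigenvalue (integral_operator (k \<omega>))) j) \<in> borel_measurable M"
    unfolding eigenvalue_ratio_def truncated_eigenvalue_def by measurable
qed simp

lemma rank_estimator_near:
  fixes \<phi> :: "('a::euclidean_space \<times> 'a) L2"
  assumes sym: "kernel_swap \<phi> = \<phi>" and \<eta>: "\<eta> = nth_largest_eigenvalue (integral_operator \<phi>)"
    and q0: "q0 \<ge> 1" "\<eta> q0 > \<eta> (q0 + 1)" "\<eta> (q0 + 1) = 0" "qbar \<ge> q0" and \<epsilon>0: "\<epsilon>0 > 0" "\<epsilon>0 < \<eta> q0 / \<eta> 1"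
  shows "\<exists>d>0. \<forall>k. kernel_swap k = k \<and> finite_rank k \<and> norm (k - \<phi>) < d \<longrightarrow> rank_estimator \<epsilon>0 qbar k = q0"
proof -
  note cs = compact_selfadjoint_integral_operator[OF sym]
  define L where "L j = positive_eigenvalue (integral_operator \<phi>) j" for j
  \<comment> \<open>The hypotheses concern \<open>\<eta>\<close>, which might have been undefined.
    The positive value at \<open>q0\<close> followed by the value 0 excludes this at the orders that
    matter.\<close>
  have Lq: "L q0 = \<eta> q0" "L (q0 + 1) = 0"
    unfolding L_def \<eta> using q0 by (intro positive_eigenvalue_eq_nth_largest[OF cs]; simp add: \<eta>)+
  have L_nonneg: "0 \<le> L j" if "j \<ge> 1" for j
    unfolding L_def by (rule positive_eigenvalue_nonneg[OF cs that])
  have Lmono: "L j \<le> L i" if "1 \<le> i" "i \<le> j" for i j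
    unfolding L_def by (rule positive_eigenvalue_antimono[OF cs that])
  have Lq0: "0 < L q0" using Lq q0 by simp
  have L1: "L 1 \<ge> L q0" using Lmono q0 by simp
  then have L1\<eta>: "L 1 = \<eta> 1" using Lq0 unfolding L_def \<eta> by (auto simp: positive_eigenvalue_def split: if_splits)
  have g: "\<epsilon>0 * L 1 < L q0" using \<epsilon>0 L1 Lq0 unfolding Lq L1\<eta> by (simp add: pos_less_divide_eq)
  \<comment> \<open>The choice ensures \<epsilon>0 (L 1 + d) \<le> L q0 - d and d \<le> \<epsilon>0
    (L 1 - d): after a perturbation smaller than \<open>d\<close>, the threshold still lies below
    every eigenvalue up to order \<open>q0\<close> and above all later ones.\<close>
  define d where "d = min (L q0 - \<epsilon>0 * L 1) (\<epsilon>0 * L 1) / (1 + \<epsilon>0)"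
  have d0: "d > 0" using g \<epsilon>0 L1 Lq0 by (simp add: d_def)
  have "d * (1 + \<epsilon>0) = min (L q0 - \<epsilon>0 * L 1) (\<epsilon>0 * L 1)" using \<epsilon>0 by (simp add: d_def)
  then have d1: "d * (1 + \<epsilon>0) \<le> L q0 - \<epsilon>0 * L 1" and d2: "d * (1 + \<epsilon>0) \<le> \<epsilon>0 * L 1" by simp_all
  have "rank_estimator \<epsilon>0 qbar k = q0" if k: "kernel_swap k = k" "finite_rank k" "norm (k - \<phi>) < d" for k
  proof -
    define e where "e = nth_largest_eigenvalue (integral_operator k)"
    define t where "t = truncated_eigenvalue \<epsilon>0 e"
    have near: "\<bar>e j - L j\<bar> < d" if "j \<ge> 1" for j
      using positive_eigenvalue_lipschitz[OF k(1) sym that] k(3) finite_rank_nth_largest_eigenvalue[OF k(1,2) that]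
      by (simp add: e_def L_def)
    have e_nonneg: "0 \<le> e j" if "j \<ge> 1" for j
      unfolding e_def finite_rank_nth_largest_eigenvalue[OF k(1,2) that]
      by (rule positive_eigenvalue_nonneg[OF compact_selfadjoint_integral_operator[OF k(1)] that])
    have n1: "L 1 - d < e 1" "e 1 < L 1 + d" using near[of 1] by auto
    have "L 1 - d > 0"
    proof -
      have "0 < \<epsilon>0 * L 1" "0 < \<epsilon>0 * d" using \<epsilon>0 L1 Lq0 d0 by simp_all
      then show ?thesis using d1 L1 by (simp add: algebra_simps)
    qed
    then have e1: "e 1 > 0" using n1 by linarith
    have big: "t j > 0" if j: "1 \<le> j" "j \<le> q0" for j
    proof -
      have "\<epsilon>0 * e 1 \<le> \<epsilon>0 * (L 1 + d)" using n1 \<epsilon>0 by (intro mult_left_mono) auto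
      also have "\<dots> \<le> L q0 - d" using d1 by (simp add: algebra_simps)
      also have "\<dots> \<le> L j - d" using Lmono[OF j] by simp
      also have "\<dots> < e j" using near[OF j(1)] by auto
      finally have lt: "\<epsilon>0 * e 1 < e j" .
      then have "\<epsilon>0 < \<bar>e j / e 1\<bar>" using e1 e_nonneg[OF j(1)] by (simp add: pos_less_divide_eq)
      moreover have "e j > 0" using lt mult_pos_pos[OF \<epsilon>0(1) e1] by linarith
      ultimately show ?thesis by (simp add: t_def truncated_eigenvalue_def)
    qed
    have small: "t j = 0" if j: "q0 < j" for j
    proof -
      have "L j = 0" using Lmono[of "q0 + 1" j] L_nonneg[of j] Lq j by simp
      then have "e j < d" using near[of j] j by auto
      also have "d \<le> \<epsilon>0 * (L 1 - d)" using d2 by (simp add: algebra_simps)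
      also have "\<dots> \<le> \<epsilon>0 * e 1" using n1 \<epsilon>0 by (intro mult_left_mono) auto
      finally have "e j / e 1 < \<epsilon>0" using e1 by (simp add: pos_divide_less_eq)
      then show ?thesis using e1 e_nonneg[of j] j by (simp add: t_def truncated_eigenvalue_def)
    qed
    define r where "r = eigenvalue_ratio \<epsilon>0 e"
    have r: "r j = (if t (j + 1) = 0 \<and> t j = 0 then 1 else t (j + 1) / t j)" for j
      by (simp add: r_def t_def eigenvalue_ratio_def)
    have rq: "r q0 = 0" using big[of q0] small[of "q0 + 1"] q0 by (simp add: r)
    have rpos: "r j > 0" if "1 \<le> j" "j \<noteq> q0" for j
    proof (cases "j < q0")
      case True then show ?thesis using big[of j] big[of "j + 1"] that by (simp add: r)
    next
      case False then show ?thesis using small[of j] small[of "j + 1"] that by (simp add: r)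
    qed
    let ?a = "arg_min_on r {1..qbar}"
    have "?a \<in> {1..qbar}" and "\<not> (\<exists>x\<in>{1..qbar}. r x < r ?a)"
      using arg_min_if_finite[of "{1..qbar}" r] q0 by auto
    then have "\<not> r q0 < r ?a" "1 \<le> ?a" using q0 by auto
    then have "?a = q0" using rpos[of ?a] rq by (cases "?a = q0") auto
    then show ?thesis by (simp add: rank_estimator_def r_def e_def)
  qed
  with d0 show ?thesis by blast
qed

section \<open>The local long-run covariance estimator\<close>

lemma card_nat_interval_le:
  assumes "\<And>j. j \<in> J \<Longrightarrow> a \<le> real j \<and> real j \<le> a + L" "0 \<le> L"
  shows "finite (J :: nat set)" "real (card J) \<le> L + 1"
proof -
  have sub: "int ` J \<subseteq> {\<lceil>a\<rceil>..\<lfloor>a + L\<rfloor>}"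
    using assms(1) by (auto simp: ceiling_le_iff le_floor_iff)
  then have "finite (int ` J)" by (rule finite_subset) simp
  then show "finite J" by (rule finite_imageD) (simp add: inj_on_def)
  have "card J = card (int ` J)" by (simp add: card_image inj_on_def)
  also have "\<dots> \<le> card {\<lceil>a\<rceil>..\<lfloor>a + L\<rfloor>}" using sub by (intro card_mono) auto
  finally have "real (card J) \<le> real (nat (\<lfloor>a + L\<rfloor> - \<lceil>a\<rceil> + 1))" by (simp add: algebra_simps)
  moreover have "real_of_int (\<lfloor>a + L\<rfloor> - \<lceil>a\<rceil> + 1) \<le> L + 1" by (simp, linarith)
  ultimately show "real (card J) \<le> L + 1" using assms(2) by linarith
qed

lemma sum_abs_le_support:
  fixes f :: "nat \<Rightarrow> real"
  assumes "finite I" "\<And>i. i \<in> I \<Longrightarrow> \<bar>f i\<bar> \<le> c" "\<And>i. i \<in> I \<Longrightarrow> f i \<noteq> 0 \<Longrightarrow> a \<le> real i \<and> real i \<le> a + L"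
    and "L + 1 \<le> N" "0 \<le> L" "0 \<le> c"
  shows "(\<Sum>i\<in>I. \<bar>f i\<bar>) \<le> c * N"
proof -
  let ?J = "{i\<in>I. f i \<noteq> 0}"
  have "(\<Sum>i\<in>I. \<bar>f i\<bar>) = (\<Sum>i\<in>?J. \<bar>f i\<bar>)"
    using assms(1) by (intro sum.mono_neutral_right) auto
  also have "\<dots> \<le> (\<Sum>i\<in>?J. c)" using assms(2) by (intro sum_mono) auto
  also have "\<dots> = real (card ?J) * c" by simp
  also have "real (card ?J) \<le> L + 1" by (rule card_nat_interval_le) (use assms in auto)
  then have "real (card ?J) * c \<le> N * c" using assms by (intro mult_right_mono) auto
  finally show ?thesis by (simp add: mult.commute)
qed

lemma sum_sq_le_support:
  fixes f :: "nat \<Rightarrow> real"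
  assumes "finite I" "\<And>i. i \<in> I \<Longrightarrow> \<bar>f i\<bar> \<le> c" "\<And>i. i \<in> I \<Longrightarrow> f i \<noteq> 0 \<Longrightarrow> a \<le> real i \<and> real i \<le> a + L"
    and "L + 1 \<le> N" "0 \<le> L" "0 \<le> c"
  shows "(\<Sum>i\<in>I. (f i)\<^sup>2) \<le> c\<^sup>2 * N"
proof -
  have "(\<Sum>i\<in>I. (f i)\<^sup>2) = (\<Sum>i\<in>I. \<bar>f i\<bar> * \<bar>f i\<bar>)" by (simp add: power2_eq_square)
  also have "\<dots> \<le> (\<Sum>i\<in>I. c * \<bar>f i\<bar>)" using assms by (intro sum_mono mult_right_mono) auto
  also have "\<dots> \<le> c * (c * N)"
    unfolding sum_distrib_left[symmetric] using assms by (intro mult_left_mono sum_abs_le_support[where a=a and L=L]) auto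
  finally show ?thesis by (simp add: power2_eq_square)
qed

text \<open>The two cross terms are summed over the stationary factor first, which gives a linear
  sum of norm at most G sqrt W. Only the term with both deviations pays the absolute row sums
  \<open>V\<close>. Since nothing but an L^2 bound is asked of \<open>d\<close>, the products are
  controlled in L^1.\<close>

lemma quadratic_form_perturbation:
  fixes z d :: "nat \<Rightarrow> 'w \<Rightarrow> 'h::{banach, second_countable_topology}"
    and b :: "'h \<Rightarrow> 'h \<Rightarrow> 'k::{banach, second_countable_topology}"
  assumes bil: "bounded_bilinear b" and bn: "\<And>x y. norm (b x y) \<le> norm x * norm y" and I: "finite I"
    and lin: "\<And>a. Lp_le M 2 (\<lambda>\<omega>. \<Sum>j\<in>I. a j *\<^sub>R z j \<omega>) (G * sqrt (\<Sum>j\<in>I. (a j)\<^sup>2))"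
    and d: "\<And>j. j \<in> I \<Longrightarrow> Lp_le M 2 (d j) \<delta>"
    and W: "\<And>j. j \<in> I \<Longrightarrow> (\<Sum>i\<in>I. (w j i)\<^sup>2) \<le> W" "\<And>i. i \<in> I \<Longrightarrow> (\<Sum>j\<in>I. (w j i)\<^sup>2) \<le> W"
    and V: "\<And>j. j \<in> I \<Longrightarrow> (\<Sum>i\<in>I. \<bar>w j i\<bar>) \<le> V"
    and nn: "0 \<le> G" "0 \<le> \<delta>"
  shows "Lp_le M 1 (\<lambda>\<omega>. (\<Sum>j\<in>I. \<Sum>i\<in>I. w j i *\<^sub>R b (z j \<omega> + d j \<omega>) (z i \<omega> + d i \<omega>)) - (\<Sum>j\<in>I. \<Sum>i\<in>I. w j i *\<^sub>R b (z j \<omega>) (z i \<omega>)))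
    (card I * (2 * G * sqrt W * \<delta> + V * \<delta>\<^sup>2))"
proof -
  interpret b: bounded_bilinear b by (rule bil)
  have b1: "Lp_le M 1 (\<lambda>\<omega>. b (X \<omega>) (Y \<omega>)) (c * e)" if "Lp_le M 2 X c" "Lp_le M 2 Y e" for X Y c e
    using Lp_le_bilinear[OF bil bn, of M 1 X c Y e] that by simp
  have L: "Lp_le M 2 (\<lambda>\<omega>. \<Sum>j\<in>I. a j *\<^sub>R z j \<omega>) (G * sqrt W)" if "(\<Sum>j\<in>I. (a j)\<^sup>2) \<le> W" for a
    using that nn by (intro Lp_le_mono[OF lin] mult_left_mono) auto
  have "Lp_le M 1 (\<lambda>\<omega>. (\<Sum>j\<in>I. b (d j \<omega>) (\<Sum>i\<in>I. w j i *\<^sub>R z i \<omega>)) + (\<Sum>i\<in>I. b (\<Sum>j\<in>I. w j i *\<^sub>R z j \<omega>) (d i \<omega>))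
      + (\<Sum>j\<in>I. \<Sum>i\<in>I. w j i *\<^sub>R b (d j \<omega>) (d i \<omega>)))
    ((\<Sum>j\<in>I. \<delta> * (G * sqrt W)) + (\<Sum>i\<in>I. (G * sqrt W) * \<delta>) + (\<Sum>j\<in>I. \<Sum>i\<in>I. \<bar>w j i\<bar> * (\<delta> * \<delta>)))"
    by (intro Lp_le_add Lp_le_sum Lp_le_scaleR b1 L d W I) auto
  moreover have "(\<Sum>j\<in>I. b (d j \<omega>) (\<Sum>i\<in>I. w j i *\<^sub>R z i \<omega>)) + (\<Sum>i\<in>I. b (\<Sum>j\<in>I. w j i *\<^sub>R z j \<omega>) (d i \<omega>))
      + (\<Sum>j\<in>I. \<Sum>i\<in>I. w j i *\<^sub>R b (d j \<omega>) (d i \<omega>))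
    = (\<Sum>j\<in>I. \<Sum>i\<in>I. w j i *\<^sub>R b (z j \<omega> + d j \<omega>) (z i \<omega> + d i \<omega>)) - (\<Sum>j\<in>I. \<Sum>i\<in>I. w j i *\<^sub>R b (z j \<omega>) (z i \<omega>))" for \<omega>
  proof -
    have 1: "(\<Sum>i\<in>I. b (\<Sum>j\<in>I. w j i *\<^sub>R z j \<omega>) (d i \<omega>)) = (\<Sum>j\<in>I. \<Sum>i\<in>I. w j i *\<^sub>R b (z j \<omega>) (d i \<omega>))"
      unfolding b.sum_left b.scaleR_left by (rule sum.swap)
    show ?thesis
      unfolding 1 unfolding b.sum_right b.scaleR_right b.add_left b.add_right scaleR_add_right sum.distrib by simp
  qed
  moreover have "(\<Sum>j\<in>I. \<delta> * (G * sqrt W)) + (\<Sum>i\<in>I. (G * sqrt W) * \<delta>) + (\<Sum>j\<in>I. \<Sum>i\<in>I. \<bar>w j i\<bar> * (\<delta> * \<delta>))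
      \<le> card I * (2 * G * sqrt W * \<delta> + V * \<delta>\<^sup>2)"
  proof -
    have "(\<Sum>j\<in>I. \<Sum>i\<in>I. \<bar>w j i\<bar> * (\<delta> * \<delta>)) \<le> (\<Sum>j\<in>I. V * (\<delta> * \<delta>))"
      unfolding sum_distrib_right[symmetric] using V by (intro sum_mono mult_right_mono) auto
    then show ?thesis by (simp add: power2_eq_square algebra_simps)
  qed
  ultimately show ?thesis by (auto intro: Lp_le_mono)
qed

text \<open>The estimator is symmetrised as \<open>B + kernel_swap B\<close>, which counts lag \<open>0\<close> twice.\<close>

definition lag_weight :: "(real \<Rightarrow> real) \<Rightarrow> real \<Rightarrow> nat \<Rightarrow> real" where
  "lag_weight K2 b t = (if t = 0 then 1 / 2 else K2 (real t / b))"

definition pair_weight :: "(real \<Rightarrow> real) \<Rightarrow> (real \<Rightarrow> real) \<Rightarrow> real \<Rightarrow> real \<Rightarrow> real \<Rightarrow> nat \<Rightarrow> nat \<Rightarrow> nat \<Rightarrow> real" where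
  "pair_weight K1 K2 h b u T j i = (if i \<le> j then K1 ((u - real j / real T) / h) * lag_weight K2 b (j - i) else 0)"

lemma local_long_run_covariance_eq:
  fixes x :: "nat \<Rightarrow> 'a::euclidean_space L2" and K1 K2 :: "real \<Rightarrow> real" and h b u :: real and T :: nat
  defines "y \<equiv> \<lambda>t. x t - local_mean K1 h u T x"
  defines "B \<equiv> (1 / (real T * h)) *\<^sub>R (\<Sum>j=1..T. \<Sum>i=1..T. pair_weight K1 K2 h b u T j i *\<^sub>R kernel_tensor (y j) (y i))"
  shows "local_long_run_covariance K1 K2 h b u T x = B + kernel_swap B"
proof -
  let ?a = "\<lambda>j. K1 ((u - real j / real T) / h)"
  define g where "g t = local_autocovariance K1 h u T x t" for t
  have g: "g t = (1 / (real T * h)) *\<^sub>R (\<Sum>j=t+1..T. ?a j *\<^sub>R kernel_tensor (y j) (y (j - t)))" for t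
    by (simp add: g_def local_autocovariance_def y_def)
  have "(\<Sum>j=1..T. \<Sum>i=1..T. pair_weight K1 K2 h b u T j i *\<^sub>R kernel_tensor (y j) (y i))
      = (\<Sum>j=1..T. \<Sum>i=1..j. (?a j * lag_weight K2 b (j - i)) *\<^sub>R kernel_tensor (y j) (y i))"
  proof (rule sum.cong[OF refl])
    fix j assume j: "j \<in> {1..T}"
    have "(\<Sum>i=1..T. pair_weight K1 K2 h b u T j i *\<^sub>R kernel_tensor (y j) (y i)) = (\<Sum>i=1..j. pair_weight K1 K2 h b u T j i *\<^sub>R kernel_tensor (y j) (y i))"
      using j by (intro sum.mono_neutral_right) (auto simp: pair_weight_def)
    then show "(\<Sum>i=1..T. pair_weight K1 K2 h b u T j i *\<^sub>R kernel_tensor (y j) (y i)) = (\<Sum>i=1..j. (?a j * lag_weight K2 b (j - i)) *\<^sub>R kernel_tensor (y j) (y i))"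
      by (simp add: pair_weight_def)
  qed
  also have "\<dots> = (\<Sum>(j, i)\<in>(SIGMA j:{1..T}. {1..j}). (?a j * lag_weight K2 b (j - i)) *\<^sub>R kernel_tensor (y j) (y i))"
    by (subst sum.Sigma) auto
  also have "\<dots> = (\<Sum>(t, j)\<in>(SIGMA t:{0..<T}. {t+1..T}). lag_weight K2 b t *\<^sub>R ?a j *\<^sub>R kernel_tensor (y j) (y (j - t)))"
    by (rule sum.reindex_bij_witness[where i="\<lambda>(t, j). (j, j - t)" and j="\<lambda>(j, i). (j - i, j)"]) (auto simp: mult.commute)
  also have "\<dots> = (\<Sum>t=0..<T. \<Sum>j=t+1..T. lag_weight K2 b t *\<^sub>R ?a j *\<^sub>R kernel_tensor (y j) (y (j - t)))"
    by (subst sum.Sigma) auto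
  finally have S: "(\<Sum>j=1..T. \<Sum>i=1..T. pair_weight K1 K2 h b u T j i *\<^sub>R kernel_tensor (y j) (y i))
      = (\<Sum>t=0..<T. \<Sum>j=t+1..T. lag_weight K2 b t *\<^sub>R ?a j *\<^sub>R kernel_tensor (y j) (y (j - t)))" .
  have B: "B = (\<Sum>t=0..<T. lag_weight K2 b t *\<^sub>R g t)"
    unfolding B_def S g scaleR_sum_right by (simp add: mult_ac)
  have sw: "kernel_swap B = (\<Sum>t=0..<T. lag_weight K2 b t *\<^sub>R kernel_swap (g t))"
    by (subst B, subst kernel_swap_sum, subst kernel_swap_scaleR, rule refl)
  have g0: "kernel_swap (g 0) = g 0"
    by (subst (1 2) g) (simp add: kernel_swap_sum kernel_swap_scaleR)
  have "B + kernel_swap B = (\<Sum>t=0..<T. lag_weight K2 b t *\<^sub>R (g t + kernel_swap (g t)))"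
    unfolding sw unfolding B by (simp add: sum.distrib scaleR_add_right)
  also have "\<dots> = g 0 + (\<Sum>t=1..T-1. K2 (real t / b) *\<^sub>R (g t + kernel_swap (g t)))"
  proof (cases T)
    case 0
    then show ?thesis by (simp add: g)
  next
    case (Suc T')
    have "{0..<T} = insert 0 {1..T - 1}" using Suc by auto
    then have "(\<Sum>t=0..<T. lag_weight K2 b t *\<^sub>R (g t + kernel_swap (g t)))
        = lag_weight K2 b 0 *\<^sub>R (g 0 + kernel_swap (g 0)) + (\<Sum>t=1..T-1. lag_weight K2 b t *\<^sub>R (g t + kernel_swap (g t)))"
      by simp
    also have "lag_weight K2 b 0 *\<^sub>R (g 0 + kernel_swap (g 0)) = g 0"
      unfolding g0 by (simp add: lag_weight_def scaleR_2[symmetric])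
    also have "(\<Sum>t=1..T-1. lag_weight K2 b t *\<^sub>R (g t + kernel_swap (g t))) = (\<Sum>t=1..T-1. K2 (real t / b) *\<^sub>R (g t + kernel_swap (g t)))"
      by (intro sum.cong refl) (simp add: lag_weight_def)
    finally show ?thesis .
  qed
  finally show ?thesis by (simp add: local_long_run_covariance_def g_def)
qed

section \<open>Symmetry, finite rank and measurability of the estimators\<close>

lemma local_long_run_covariance_symmetric:
  "kernel_swap (local_long_run_covariance K1 K2 h b u T x) = local_long_run_covariance K1 K2 h b u T x"
  unfolding local_long_run_covariance_eq by (simp add: linear_add[OF linear_kernel_swap] add.commute)

lemma local_long_run_covariance_finite_rank: "finite_rank (local_long_run_covariance K1 K2 h b u T x)"
  unfolding local_long_run_covariance_eq kernel_swap_scaleR kernel_swap_sum kernel_swap_tensor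
  by (intro finite_rank_add finite_rank_scaleR finite_rank_sum finite_rank_tensor)

lemma pooled_estimator_symmetric:
  "kernel_swap (pooled_estimator K1 K2 h b u T1 T2 x y) = pooled_estimator K1 K2 h b u T1 T2 x y"
  by (simp add: pooled_estimator_def Let_def linear_add[OF linear_kernel_swap] kernel_swap_scaleR local_long_run_covariance_symmetric)

lemma pooled_estimator_finite_rank: "finite_rank (pooled_estimator K1 K2 h b u T1 T2 x y)"
  unfolding pooled_estimator_def Let_def by (intro finite_rank_add finite_rank_scaleR local_long_run_covariance_finite_rank)

lemma borel_measurable_local_long_run_covariance:
  fixes x :: "nat \<Rightarrow> 'w \<Rightarrow> 'a::euclidean_space L2"
  assumes x: "\<And>t. 1 \<le> t \<Longrightarrow> t \<le> T \<Longrightarrow> x t \<in> borel_measurable M"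
  shows "(\<lambda>\<omega>. local_long_run_covariance K1 K2 h b u T (\<lambda>t. x t \<omega>)) \<in> borel_measurable M"
proof -
  have mean: "(\<lambda>\<omega>. local_mean K1 h u T (\<lambda>t. x t \<omega>)) \<in> borel_measurable M"
    unfolding local_mean_def by (intro borel_measurable_scaleR borel_measurable_const borel_measurable_sum x) auto
  have swap: "(\<lambda>\<omega>. kernel_swap (k \<omega>)) \<in> borel_measurable M" if "k \<in> borel_measurable M" for k :: "_ \<Rightarrow> ('a \<times> 'a) L2"
    using that by (rule borel_measurable_continuous_on[OF linear_continuous_on[OF bounded_linear_kernel_swap]])
  show ?thesis
    unfolding local_long_run_covariance_eq
    by (intro borel_measurable_add swap borel_measurable_scaleR borel_measurable_const borel_measurable_sum
        borel_measurable_bounded_bilinear[OF bounded_bilinear_kernel_tensor] borel_measurable_diff x mean) auto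
qed

text \<open>The deterministic side of the estimate at one sample size. \<open>R\<close> bounds both
  supports, and the constants are normalised to be at least 1, so that isolated summands 1 can be
  absorbed into products.\<close>

locale kernel_window =
  fixes K1 K2 :: "real \<Rightarrow> real" and h b u R k1 k2 :: real and T :: nat
  assumes K1: "\<And>z. \<bar>K1 z\<bar> \<le> k1" "\<And>z. K1 z \<noteq> 0 \<Longrightarrow> \<bar>z\<bar> \<le> R"
    and K2: "\<And>z. \<bar>K2 z\<bar> \<le> k2" "\<And>z. K2 z \<noteq> 0 \<Longrightarrow> \<bar>z\<bar> \<le> R"
    and range_bounds: "1 \<le> R" "1 \<le> k1" "1 \<le> k2" "0 < h" "1 \<le> real T * h" "1 \<le> b" "b \<le> real T * h"
begin

abbreviation "a \<equiv> \<lambda>j. K1 ((u - real j / real T) / h)"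
abbreviation "w \<equiv> pair_weight K1 K2 h b u T"

text \<open>Half-width 2 R h: the support of \<open>K1\<close> accounts for R h, and a lag of at
  most R b shifts the rescaled time by R b / T, which is again at most R h because b \<le> T h.
  Hence both indices of every active pair lie in the window.\<close>

definition window :: "nat set" where
  "window = {j\<in>{1..T}. \<bar>real j / real T - u\<bar> \<le> 2 * R * h}"

lemma T_pos: "0 < real T"
  using range_bounds by (cases "T = 0") auto

lemma Th_pos: "0 < real T * h"
  using range_bounds by linarith

lemma inverse_T_le: "1 / real T \<le> h"
  using range_bounds T_pos by (simp add: pos_divide_le_eq mult.commute)

lemma finite_window: "finite window" by (simp add: window_def)

lemma K1_support:
  assumes "a j \<noteq> 0" shows "\<bar>real j / real T - u\<bar> \<le> R * h"
proof -
  have "\<bar>(u - real j / real T) / h\<bar> \<le> R" using K1(2)[OF assms] .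
  then show ?thesis using range_bounds by (simp add: abs_divide pos_divide_le_eq abs_minus_commute)
qed

lemma K1_window: "a j \<noteq> 0 \<Longrightarrow> j \<in> {1..T} \<Longrightarrow> j \<in> window"
proof -
  assume *: "a j \<noteq> 0" "j \<in> {1..T}"
  have "R * h \<le> 2 * R * h" using range_bounds by simp
  then show "j \<in> window" using K1_support[OF *(1)] *(2) by (simp add: window_def)
qed

lemma lag_support: "lag_weight K2 b t \<noteq> 0 \<Longrightarrow> real t \<le> R * b"
proof (cases "t = 0")
  case False
  assume "lag_weight K2 b t \<noteq> 0"
  then have "K2 (real t / b) \<noteq> 0" using False by (simp add: lag_weight_def)
  then have "\<bar>real t / b\<bar> \<le> R" by (rule K2(2))
  then show ?thesis using range_bounds by (simp add: abs_divide pos_divide_le_eq)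
qed (use range_bounds in simp)

lemma lag_bound: "\<bar>lag_weight K2 b t\<bar> \<le> k2"
  using K2(1) range_bounds by (simp add: lag_weight_def)

lemma w_support: "w j i \<noteq> 0 \<Longrightarrow> i \<le> j \<and> a j \<noteq> 0 \<and> real j - real i \<le> R * b"
  using lag_support[of "j - i"] by (auto simp: pair_weight_def of_nat_diff split: if_splits)

lemma w_window:
  assumes "w j i \<noteq> 0" "j \<in> {1..T}" "i \<in> {1..T}" shows "j \<in> window" "i \<in> window"
proof -
  note s = w_support[OF assms(1)]
  show "j \<in> window" using K1_window s assms by blast
  have "\<bar>real i / real T - u\<bar> \<le> \<bar>real j / real T - u\<bar> + (real j - real i) / real T"
    using s T_pos by (simp add: diff_divide_distrib divide_right_mono) (use divide_right_mono[of "real i" "real j" "real T"] in linarith)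
  also have "(real j - real i) / real T \<le> R * b / real T" using s T_pos by (intro divide_right_mono) auto
  also have "R * b / real T \<le> R * h"
    using range_bounds T_pos mult_left_mono[of b "real T * h" R] by (simp add: pos_divide_le_eq mult_ac)
  also have "\<bar>real j / real T - u\<bar> \<le> R * h" using K1_support s by blast
  finally show "i \<in> window" using assms(3) by (simp add: window_def)
qed

lemma w_bound: "\<bar>w j i\<bar> \<le> k1 * k2"
  using mult_mono[OF K1(1) lag_bound] range_bounds by (auto simp: pair_weight_def abs_mult)

lemma Rb1: "R * b + 1 \<le> 2 * R * b"
  using range_bounds mult_mono[of 1 R 1 b] by simp

lemma w_row_sq: "(\<Sum>i\<in>window. (w j i)\<^sup>2) \<le> (k1 * k2)\<^sup>2 * (2 * R * b)"
  by (rule sum_sq_le_support[where a="real j - R * b" and L="R * b"])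
     (use finite_window w_bound w_support range_bounds Rb1 in \<open>auto simp: algebra_simps\<close>)

lemma w_col_sq: "(\<Sum>j\<in>window. (w j i)\<^sup>2) \<le> (k1 * k2)\<^sup>2 * (2 * R * b)"
  by (rule sum_sq_le_support[where a="real i" and L="R * b"])
     (use finite_window w_bound w_support range_bounds Rb1 in \<open>auto simp: algebra_simps\<close>)

lemma w_row_abs: "(\<Sum>i\<in>window. \<bar>w j i\<bar>) \<le> k1 * k2 * (2 * R * b)"
  by (rule sum_abs_le_support[where a="real j - R * b" and L="R * b"])
     (use finite_window w_bound w_support range_bounds Rb1 in \<open>auto simp: algebra_simps\<close>)

text \<open>An interval of length 4 R T h contains at most 4 R T h + 1 integers, and 1 \<le> R T
  h.\<close>

lemma card_window: "real (card window) \<le> 5 * R * (real T * h)"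
proof -
  have "real T * (u - 2 * R * h) \<le> real j \<and> real j \<le> real T * (u - 2 * R * h) + 4 * R * (real T * h)" if "j \<in> window" for j
  proof -
    have "\<bar>real T * (real j / real T - u)\<bar> \<le> real T * (2 * R * h)"
      using that T_pos unfolding abs_mult window_def by (intro mult_mono) auto
    then show ?thesis using T_pos by (simp add: algebra_simps abs_le_iff)
  qed
  then have "real (card window) \<le> 4 * R * (real T * h) + 1"
    by (rule card_nat_interval_le) (use range_bounds Th_pos in auto)
  also have "1 \<le> R * (real T * h)" using range_bounds mult_mono[of 1 R 1 "real T * h"] by simp
  finally show ?thesis by (simp add: mult_ac)
qed

lemma sum_K1_restrict: "(\<Sum>j=1..T. a j *\<^sub>R (x j :: 'v::real_vector)) = (\<Sum>j\<in>window. a j *\<^sub>R x j)"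
  by (intro sum.mono_neutral_right) (auto simp: window_def dest!: K1_window[unfolded window_def])

lemma sum_w_restrict: "(\<Sum>j=1..T. \<Sum>i=1..T. w j i *\<^sub>R (x j i :: 'v::real_vector)) = (\<Sum>j\<in>window. \<Sum>i\<in>window. w j i *\<^sub>R x j i)"
proof -
  have sub: "window \<subseteq> {1..T}" by (auto simp: window_def)
  have "(\<Sum>i=1..T. w j i *\<^sub>R x j i) = (\<Sum>i\<in>window. w j i *\<^sub>R x j i)" if "j \<in> {1..T}" for j
  proof (intro sum.mono_neutral_right ballI)
    fix i assume "i \<in> {1..T} - window"
    then have "w j i = 0" using w_window(2)[of j i] that by blast
    then show "w j i *\<^sub>R x j i = 0" by simp
  qed (use sub in auto)
  then have "(\<Sum>j=1..T. \<Sum>i=1..T. w j i *\<^sub>R x j i) = (\<Sum>j=1..T. \<Sum>i\<in>window. w j i *\<^sub>R x j i)" by simp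
  also have "\<dots> = (\<Sum>j\<in>window. \<Sum>i\<in>window. w j i *\<^sub>R x j i)"
  proof (intro sum.mono_neutral_right ballI)
    fix j assume j: "j \<in> {1..T} - window"
    have "w j i = 0" if "i \<in> window" for i using w_window(1)[of j i] j that sub by blast
    then show "(\<Sum>i\<in>window. w j i *\<^sub>R x j i) = 0" by simp
  qed (use sub in auto)
  finally show ?thesis .
qed

text \<open>A Riemann sum compared cell by cell. On each unit cell the Lipschitz bound gives an
  error L / (T h), and only the cells of the window contribute; there are at most 5 R T h of them,
  so the factors T h cancel. The conditions on \<open>u\<close> place the whole support of the
  rescaled kernel inside [0, T].\<close>

lemma kernel_sum_approx:
  assumes L: "L-lipschitz_on UNIV K1" and int: "(\<integral>z. K1 z \<partial>lborel) = 1" and u: "R * h \<le> u" "u + R * h \<le> 1"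
  shows "\<bar>(\<Sum>j=1..T. a j) - real T * h\<bar> \<le> 5 * R * L"
proof -
  define g where "g x = K1 ((u - x / real T) / h)" for x
  have L0: "0 \<le> L" using L by (rule lipschitz_on_nonneg)
  have g_lip: "\<bar>g x - g y\<bar> \<le> L / (real T * h) * \<bar>x - y\<bar>" for x y
  proof -
    have "\<bar>g x - g y\<bar> \<le> L * \<bar>(u - x / real T) / h - (u - y / real T) / h\<bar>"
      using lipschitz_onD[OF L, of "(u - x / real T) / h" "(u - y / real T) / h"] by (simp add: g_def dist_real_def)
    also have "(u - x / real T) / h - (u - y / real T) / h = (y - x) / (real T * h)"
      using T_pos range_bounds by (simp add: field_simps)
    finally show ?thesis using Th_pos range_bounds by (simp add: abs_divide abs_mult abs_minus_commute)
  qed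
  have cont: "continuous_on S g" for S
    unfolding g_def using T_pos range_bounds
    by (intro continuous_on_compose2[OF lipschitz_on_continuous_on[OF L]] continuous_intros) auto
  have supp: "g x = 0" if "R * h < \<bar>x / real T - u\<bar>" for x
  proof (rule ccontr)
    assume "g x \<noteq> 0"
    then have "K1 ((u - x / real T) / h) \<noteq> 0" by (simp add: g_def)
    then have "\<bar>(u - x / real T) / h\<bar> \<le> R" by (rule K1(2))
    then have "\<bar>x / real T - u\<bar> \<le> R * h" using range_bounds by (simp add: abs_divide pos_divide_le_eq abs_minus_commute)
    then show False using that by simp
  qed
  \<comment> \<open>An integral of a function that is not integrable would be 0 by default, not
    1.\<close>
  have intK: "integrable lborel K1" using int not_integrable_integral_eq[of lborel K1] by fastforce
  have geq: "g = (\<lambda>x. K1 (u / h + (- 1 / (real T * h)) * x))"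
    using T_pos range_bounds by (auto simp: g_def fun_eq_iff field_simps)
  have c0: "- 1 / (real T * h) \<noteq> 0" using Th_pos T_pos range_bounds by simp
  have gi: "integrable lborel g" unfolding geq by (rule lborel_integrable_real_affine[OF intK c0])
  have "(\<integral>z. K1 z \<partial>lborel) = \<bar>- 1 / (real T * h)\<bar> *\<^sub>R (\<integral>x. g x \<partial>lborel)"
    unfolding geq by (rule lborel_integral_real_affine[OF c0])
  also have "\<bar>- 1 / (real T * h)\<bar> = 1 / (real T * h)"
    unfolding minus_divide_left[symmetric] abs_minus_cancel
    by (intro abs_of_nonneg divide_nonneg_nonneg zero_le_one less_imp_le[OF Th_pos])
  finally have gint: "(\<integral>x. g x \<partial>lborel) = real T * h"
    using int T_pos range_bounds by (simp add: field_simps)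
  have g0: "(\<lambda>x. if x \<in> {0..real T} then g x else 0) = g"
  proof
    fix x
    have "g x = 0" if "x \<notin> {0..real T}"
    proof (rule supp)
      have "x < 0 \<or> real T < x" using that by auto
      then have "x / real T < 0 \<or> 1 < x / real T" using T_pos by (auto simp: divide_less_0_iff)
      then show "R * h < \<bar>x / real T - u\<bar>" using u by linarith
    qed
    then show "(if x \<in> {0..real T} then g x else 0) = g x" by simp
  qed
  have tot: "integral {0..real T} g = real T * h"
  proof -
    have "integral {0..real T} g = integral UNIV g"
      using integral_restrict_UNIV[of "{0..real T}" g] unfolding g0 by simp
    also have "\<dots> = (\<integral>x. g x \<partial>lborel)" by (rule integral_lborel[OF gi])
    finally show ?thesis using gint by simp
  qed
  have split: "integral {0..real n} g = (\<Sum>j=1..n. integral {real j - 1..real j} g)" for n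
  proof (induction n)
    case (Suc n)
    have "integral {0..real n} g + integral {real n..real (Suc n)} g = integral {0..real (Suc n)} g"
      by (rule Henstock_Kurzweil_Integration.integral_combine) (auto intro: integrable_continuous_real cont)
    then show ?case using Suc by simp
  qed simp
  have cell: "\<bar>integral {real j - 1..real j} g - g (real j)\<bar> \<le> (if j \<in> window then L / (real T * h) else 0)" if j: "j \<in> {1..T}" for j
  proof -
    have "integral {real j - 1..real j} g - g (real j) = integral {real j - 1..real j} (\<lambda>x. g x - g (real j))"
      by (subst Henstock_Kurzweil_Integration.integral_diff) (auto intro: integrable_continuous_real cont)
    also have "\<bar>\<dots>\<bar> \<le> (if j \<in> window then L / (real T * h) else 0) * (real j - (real j - 1))"
      unfolding real_norm_def[symmetric]
    proof (rule integral_bound)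
      fix x assume x: "x \<in> {real j - 1..real j}"
      show "norm (g x - g (real j)) \<le> (if j \<in> window then L / (real T * h) else 0)"
      proof (cases "j \<in> window")
        case True
        have "\<bar>g x - g (real j)\<bar> \<le> L / (real T * h) * \<bar>x - real j\<bar>" by (rule g_lip)
        also have "\<dots> \<le> L / (real T * h) * 1" using x L0 Th_pos by (intro mult_left_mono) auto
        finally show ?thesis using True by simp
      next
        case False
        \<comment> \<open>The window is twice as wide as the support, so a move by at most 1 / T
          \<le> h within the cell cannot reach the support. Both values of \<open>g\<close>
          vanish.\<close>
        then have far: "2 * R * h < \<bar>real j / real T - u\<bar>" using j by (auto simp: window_def)
        have "\<bar>x / real T - real j / real T\<bar> \<le> 1 / real T"
          unfolding diff_divide_distrib[symmetric] abs_divide using x T_pos by (auto intro: divide_right_mono)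
        then have "\<bar>x / real T - real j / real T\<bar> \<le> h" using inverse_T_le by linarith
        moreover have "h \<le> R * h" using range_bounds by simp
        ultimately have "R * h < \<bar>x / real T - u\<bar>" "R * h < \<bar>real j / real T - u\<bar>" using far range_bounds by linarith+
        then show ?thesis using supp False by simp
      qed
    qed (auto intro: continuous_intros cont)
    finally show ?thesis by simp
  qed
  have "(\<Sum>j=1..T. a j) - real T * h = (\<Sum>j=1..T. g (real j) - integral {real j - 1..real j} g)"
    unfolding tot[symmetric] split sum_subtractf by (simp add: g_def)
  also have "\<bar>\<dots>\<bar> \<le> (\<Sum>j=1..T. if j \<in> window then L / (real T * h) else 0)"
    using cell by (intro order_trans[OF sum_abs] sum_mono) (simp add: abs_minus_commute)
  also have "\<dots> = (\<Sum>j\<in>{1..T} \<inter> window. L / (real T * h))"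
    by (rule sum.inter_restrict[symmetric]) simp
  also have "{1..T} \<inter> window = window" by (auto simp: window_def)
  also have "(\<Sum>j\<in>window. L / (real T * h)) = real (card window) * (L / (real T * h))" by simp
  also have "\<dots> \<le> 5 * R * (real T * h) * (L / (real T * h))"
    using L0 Th_pos by (intro mult_right_mono card_window) auto
  also have "\<dots> = 5 * R * L" using T_pos range_bounds by simp
  finally show ?thesis .
qed

text \<open>There is no boundary effect: where \<open>K1\<close> is active the index satisfies j > R
  b, so every lag of nonzero weight is available and the inner sum is the complete series, the same
  for all \<open>j\<close>.\<close>

lemma bias_sum_eq:
  fixes \<gamma> :: "nat \<Rightarrow> 'v::{real_normed_vector}"
  assumes u: "R * b < real T * (u - R * h)"
  shows "(\<Sum>j=1..T. \<Sum>i=1..T. w j i *\<^sub>R \<gamma> (j - i)) = (\<Sum>j=1..T. a j) *\<^sub>R (\<Sum>t. lag_weight K2 b t *\<^sub>R \<gamma> t)"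
  unfolding scaleR_sum_left
proof (rule sum.cong[OF refl])
  fix j assume j: "j \<in> {1..T}"
  show "(\<Sum>i=1..T. w j i *\<^sub>R \<gamma> (j - i)) = a j *\<^sub>R (\<Sum>t. lag_weight K2 b t *\<^sub>R \<gamma> t)"
  proof (cases "a j = 0")
    case True
    then show ?thesis by (auto simp: pair_weight_def intro!: sum.neutral)
  next
    case False
    have "real T * (u - R * h) \<le> real T * (real j / real T)"
      using K1_support[OF False] T_pos by (intro mult_left_mono) auto
    then have jb: "R * b < real j" using u T_pos by simp
    have "(\<Sum>i=1..T. w j i *\<^sub>R \<gamma> (j - i)) = (\<Sum>i=1..j. w j i *\<^sub>R \<gamma> (j - i))"
      using j by (intro sum.mono_neutral_right) (auto simp: pair_weight_def)
    also have "\<dots> = (\<Sum>i=1..j. a j *\<^sub>R lag_weight K2 b (j - i) *\<^sub>R \<gamma> (j - i))"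
      by (simp add: pair_weight_def)
    also have "\<dots> = (\<Sum>t<j. a j *\<^sub>R lag_weight K2 b t *\<^sub>R \<gamma> t)"
      by (rule sum.reindex_bij_witness[where i="\<lambda>t. j - t" and j="\<lambda>i. j - i"]) auto
    also have "\<dots> = a j *\<^sub>R (\<Sum>t<j. lag_weight K2 b t *\<^sub>R \<gamma> t)" by (simp add: scaleR_sum_right)
    also have "(\<Sum>t<j. lag_weight K2 b t *\<^sub>R \<gamma> t) = (\<Sum>t. lag_weight K2 b t *\<^sub>R \<gamma> t)"
    proof (rule suminf_finite[symmetric])
      show "lag_weight K2 b t *\<^sub>R \<gamma> t = 0" if "t \<notin> {..<j}" for t
        using lag_support[of t] that jb by fastforce
    qed simp
    finally show ?thesis .
  qed
qed

end

text \<open>Tannery's theorem with dominating series 2 k2 |\<gamma> t|. The limit weight 1 at a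
  positive lag is the right limit of \<open>K2\<close> at 0, while lag 0 keeps its weight 1 / 2
  throughout.\<close>

lemma lag_weight_series_tendsto:
  fixes \<gamma> :: "nat \<Rightarrow> 'v::banach"
  assumes sum: "summable (\<lambda>t. norm (\<gamma> t))" and K2: "\<And>z. \<bar>K2 z\<bar> \<le> k2" "K2 0 = 1" "continuous (at_right 0) K2" "1 \<le> k2"
    and b: "filterlim b at_top sequentially"
  shows "(\<lambda>n. \<Sum>t. lag_weight K2 (b n) t *\<^sub>R \<gamma> t) \<longlonglongrightarrow> (\<Sum>t. (if t = 0 then 1 / 2 else 1) *\<^sub>R \<gamma> t)"
proof -
  let ?k = "\<lambda>t::nat. if t = 0 then 1 / 2 else 1 :: real"
  have lim: "(\<lambda>n. lag_weight K2 (b n) t) \<longlonglongrightarrow> ?k t" for t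
  proof (cases "t = 0")
    case False
    \<comment> \<open>For a positive lag the argument tends to 0 through positive values, so
      continuity from the right suffices.\<close>
    have "filterlim (\<lambda>n. real t / b n) (at_right 0) sequentially"
      unfolding filterlim_at
    proof
      show "(\<lambda>n. real t / b n) \<longlonglongrightarrow> 0" using b by (intro tendsto_divide_0[OF tendsto_const] filterlim_at_top_imp_at_infinity)
      show "\<forall>\<^sub>F n in sequentially. real t / b n \<in> {0<..} \<and> real t / b n \<noteq> 0"
        using filterlim_at_top_dense[THEN iffD1, OF b, rule_format, of 0] by eventually_elim (use False in auto)
    qed
    then have "(\<lambda>n. K2 (real t / b n)) \<longlonglongrightarrow> K2 0"
      using K2(3) unfolding continuous_within by (rule filterlim_compose[rotated])
    then show ?thesis using False by (simp add: lag_weight_def K2)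
  qed (simp add: lag_weight_def)
  have bnd: "\<bar>lag_weight K2 c t\<bar> \<le> k2" for c t using K2(1,4) by (simp add: lag_weight_def)
  have sm: "summable (\<lambda>t. c t *\<^sub>R \<gamma> t)" if "\<And>t. \<bar>c t\<bar> \<le> k2" for c
  proof (rule summable_comparison_test')
    show "summable (\<lambda>t. k2 * norm (\<gamma> t))" using sum by (rule summable_mult)
    show "norm (c t *\<^sub>R \<gamma> t) \<le> k2 * norm (\<gamma> t)" for t using that by (simp add: mult_right_mono)
  qed
  have kb: "\<bar>?k t\<bar> \<le> k2" for t using K2(4) by simp
  let ?d = "\<lambda>t n. norm ((lag_weight K2 (b n) t - ?k t) *\<^sub>R \<gamma> t)"
  have db: "?d t n \<le> 2 * k2 * norm (\<gamma> t)" for t n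
    unfolding norm_scaleR using bnd[of "b n" t] kb[of t] by (intro mult_right_mono norm_ge_zero) linarith
  have "(\<lambda>n. \<Sum>t. ?d t n) \<longlonglongrightarrow> (\<Sum>t. 0)"
  proof (rule conjunct2[OF conjunct2[OF tannerys_theorem]])
    show "(\<lambda>n. ?d t n) \<longlonglongrightarrow> 0" for t
      using tendsto_norm_zero[OF tendsto_scaleR[OF LIM_zero[OF lim[of t]] tendsto_const, of "\<gamma> t", simplified]] by simp
    show "\<forall>\<^sub>F (t, n) in sequentially \<times>\<^sub>F sequentially. norm (?d t n) \<le> 2 * k2 * norm (\<gamma> t)"
      using db by (intro always_eventually) auto
    show "summable (\<lambda>t. 2 * k2 * norm (\<gamma> t))" using sum by (rule summable_mult)
  qed simp
  then have lim0: "(\<lambda>n. \<Sum>t. ?d t n) \<longlonglongrightarrow> 0" by simp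
  show ?thesis
  proof (rule LIM_zero_cancel, rule Lim_null_comparison[OF _ lim0], rule always_eventually, rule allI)
    fix n
    have sd: "summable (\<lambda>t. ?d t n)"
    proof (rule summable_comparison_test')
      show "summable (\<lambda>t. 2 * k2 * norm (\<gamma> t))" using sum by (rule summable_mult)
    qed (use db in simp)
    have "(\<Sum>t. lag_weight K2 (b n) t *\<^sub>R \<gamma> t) - (\<Sum>t. ?k t *\<^sub>R \<gamma> t) = (\<Sum>t. (lag_weight K2 (b n) t - ?k t) *\<^sub>R \<gamma> t)"
      unfolding scaleR_diff_left by (rule suminf_diff[OF sm[OF bnd] sm[OF kb]])
    then show "norm ((\<Sum>t. lag_weight K2 (b n) t *\<^sub>R \<gamma> t) - (\<Sum>t. ?k t *\<^sub>R \<gamma> t)) \<le> (\<Sum>t. ?d t n)"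
      using summable_norm[OF sd] by simp
  qed
qed

lemma (in prob_space) Lp_le_2_imp_1: "Lp_le M 2 X c \<Longrightarrow> Lp_le M 1 X c"
  using Lp_le_half[of 1 X c] by simp

text \<open>The constant \<open>c1\<close> bounds the error of a single observation in units of h:
  |t / T - u| + 1 / T is at most 3 R h in the window, and the trend moves by at most 2 R h times its
  Lipschitz constant. To this \<open>c\<close> adds the error of the local mean. In the bound, the
  term linear in \<open>s\<close> stems from one deviation against a linear sum, the square from two
  deviations, the term sqrt(b / (T h)) from the stationary fluctuation; the bias is left
  explicit.\<close>

lemma (in kernel_window) local_long_run_covariance_L1:
  fixes X v :: "nat \<Rightarrow> 'w \<Rightarrow> 'a::euclidean_space L2" and Z :: "int \<Rightarrow> 'w \<Rightarrow> 'a L2" and m :: "real \<Rightarrow> 'a L2"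
    and \<gamma> :: "nat \<Rightarrow> ('a \<times> 'a) L2" and \<Gamma> :: "('a \<times> 'a) L2" and G L c\<^sub>U C\<^sub>m :: real
  defines "c1 \<equiv> 3 * R * c\<^sub>U + 2 * R * C\<^sub>m"
  defines "c \<equiv> c1 + (G * k1 * sqrt (5 * R) + 5 * R * k1 * c1 + 5 * R * L * norm (m u))"
  defines "s \<equiv> sqrt b * (h + 1 / sqrt (real T * h))"
  assumes M: "prob_space M"
    and X: "\<And>t \<omega>. t \<in> {1..T} \<Longrightarrow> \<omega> \<in> space M \<Longrightarrow> X t \<omega> = m (real t / real T) + v t \<omega>"
    and vm: "\<And>t. t \<in> {1..T} \<Longrightarrow> v t \<in> borel_measurable M" and Zm: "\<And>t. Z t \<in> borel_measurable M"
    and m: "0 \<le> C\<^sub>m" "\<And>r s. r \<in> {0..1} \<Longrightarrow> s \<in> {0..1} \<Longrightarrow> norm (m s - m r) \<le> C\<^sub>m * \<bar>r - s\<bar>"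
    and loc: "0 \<le> c\<^sub>U" "\<And>t. t \<in> {1..T} \<Longrightarrow> Lp_le M 2 (\<lambda>\<omega>. v t \<omega> - Z (int t) \<omega>) ((\<bar>real t / real T - u\<bar> + 1 / real T) * c\<^sub>U)"
    and G: "0 \<le> G" "\<And>I a. finite I \<Longrightarrow> Lp_le M 2 (\<lambda>\<omega>. \<Sum>j\<in>I. a j *\<^sub>R Z (int j) \<omega>) (G * sqrt (\<Sum>j\<in>I. (a j)\<^sup>2))"
    and quad: "\<And>W. (\<And>j. j \<in> window \<Longrightarrow> (\<Sum>i\<in>window. (w j i)\<^sup>2) \<le> W) \<Longrightarrow> (\<And>i. i \<in> window \<Longrightarrow> (\<Sum>j\<in>window. (w j i)\<^sup>2) \<le> W) \<Longrightarrow> 0 \<le> W \<Longrightarrow>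
       Lp_le M 2 (\<lambda>\<omega>. (\<Sum>j\<in>window. \<Sum>i\<in>window. w j i *\<^sub>R kernel_tensor (Z (int j) \<omega>) (Z (int i) \<omega>))
          - (\<Sum>j\<in>window. \<Sum>i\<in>window. w j i *\<^sub>R \<gamma> (j - i))) (3 * G\<^sup>2 * sqrt (W * card window))"
    and L: "L-lipschitz_on UNIV K1" and int: "(\<integral>z. K1 z \<partial>lborel) = 1" and u: "u \<in> {0..1}" "2 * R * h < u" "u + R * h \<le> 1"
  shows "Lp_le M 1 (\<lambda>\<omega>. local_long_run_covariance K1 K2 h b u T (\<lambda>t. X t \<omega>) - (\<Gamma> + kernel_swap \<Gamma>))
    (2 * (10 * R * G * (k1 * k2) * sqrt (2 * R) * c * s + 10 * R\<^sup>2 * (k1 * k2) * c\<^sup>2 * s\<^sup>2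
       + 3 * G\<^sup>2 * (k1 * k2) * sqrt (2 * R) * sqrt (5 * R) * sqrt (b / (real T * h))
       + norm ((1 / (real T * h) * (\<Sum>j=1..T. a j)) *\<^sub>R (\<Sum>t. lag_weight K2 b t *\<^sub>R \<gamma> t) - \<Gamma>)))"
proof -
  interpret M: prob_space M by (rule M)
  define N where "N = real T * h"
  have N: "0 < N" "1 \<le> N" using Th_pos range_bounds by (simp_all add: N_def)
  have L0: "0 \<le> L" using L by (rule lipschitz_on_nonneg)
  have c1: "0 \<le> c1" unfolding c1_def using range_bounds loc(1) m(1) by simp
  define \<mu> where "\<mu> \<omega> = local_mean K1 h u T (\<lambda>t. X t \<omega>)" for \<omega>
  \<comment> \<open>The error of an observation against the stationary value plus the fixed level
    \<open>m u\<close>. Comparing with the level at \<open>u\<close>, not with the moving trend, is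
    what allows the local mean to remove it.\<close>
  define e where "e t \<omega> = v t \<omega> - Z (int t) \<omega> + (m (real t / real T) - m u)" for t \<omega>
  have sub: "window \<subseteq> {1..T}" by (auto simp: window_def)
  have Xm: "X t \<in> borel_measurable M" if "t \<in> {1..T}" for t
    using vm[OF that] X[OF that] by (subst measurable_cong[of M _ "\<lambda>\<omega>. m (real t / real T) + v t \<omega>"]) auto
  have \<mu>m: "\<mu> \<in> borel_measurable M"
    unfolding \<mu>_def local_mean_def by (intro borel_measurable_scaleR borel_measurable_const borel_measurable_sum Xm) auto
  have e: "Lp_le M 2 (e t) (c1 * h)" if t: "t \<in> window" for t
  proof -
    have t1: "t \<in> {1..T}" and far: "\<bar>real t / real T - u\<bar> \<le> 2 * R * h" using t by (auto simp: window_def)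
    have "real t / real T \<in> {0..1}" using t1 T_pos by simp
    then have mu: "norm (m (real t / real T) - m u) \<le> C\<^sub>m * (2 * R * h)"
      using m(2)[OF u(1), of "real t / real T"] mult_left_mono[OF far m(1)] by (simp add: abs_minus_commute)
    have "h \<le> R * h" using range_bounds by simp
    then have "(\<bar>real t / real T - u\<bar> + 1 / real T) * c\<^sub>U \<le> (3 * R * h) * c\<^sub>U"
      using far inverse_T_le loc(1) by (intro mult_right_mono) auto
    moreover have "Lp_le M 2 (e t) ((\<bar>real t / real T - u\<bar> + 1 / real T) * c\<^sub>U + norm (m (real t / real T) - m u))"
      unfolding e_def by (intro Lp_le_add loc(2) t1 M.Lp_le_const) simp
    ultimately show ?thesis using mu by (elim Lp_le_mono) (simp add: c1_def algebra_simps)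
  qed
  have sK: "(\<Sum>j\<in>window. (a j)\<^sup>2) \<le> k1\<^sup>2 * (5 * R * N)"
  proof -
    have "(\<Sum>j\<in>window. (a j)\<^sup>2) \<le> (\<Sum>j\<in>window. k1\<^sup>2)"
      using K1(1) by (intro sum_mono) (metis abs_ge_zero power2_abs power_mono)
    also have "\<dots> = card window * k1\<^sup>2" by simp
    also have "\<dots> \<le> (5 * R * N) * k1\<^sup>2" using card_window by (intro mult_right_mono) (auto simp: N_def)
    finally show ?thesis by (simp add: mult.commute)
  qed
  \<comment> \<open>The weights sum to N only up to a Riemann-sum error, so the local mean
    reproduces q times the level. The same factor multiplies the bias series below.\<close>
  define q where "q = (1 / N) * (\<Sum>j=1..T. a j)"
  have q: "\<bar>q - 1\<bar> \<le> 5 * R * L / N"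
  proof -
    have "R * h \<le> u" using u range_bounds mult_nonneg_nonneg[of R h] by linarith
    then have "\<bar>(\<Sum>j=1..T. a j) - N\<bar> \<le> 5 * R * L" unfolding N_def by (rule kernel_sum_approx[OF L int _ u(3)])
    then have "\<bar>(\<Sum>j=1..T. a j) - N\<bar> / N \<le> 5 * R * L / N" using N by (intro divide_right_mono) auto
    moreover have "q - 1 = ((\<Sum>j=1..T. a j) - N) / N" using N by (simp add: q_def field_simps)
    ultimately show ?thesis using N by (simp add: abs_divide)
  qed
  have Nsq: "1 / N \<le> 1 / sqrt N" "sqrt N * sqrt N = N" "0 < sqrt N"
  proof -
    show "sqrt N * sqrt N = N" "0 < sqrt N" using N by simp_all
    have "1 \<le> sqrt N" using N(2) by simp
    then have "sqrt N * 1 \<le> sqrt N * sqrt N" by (intro mult_left_mono) auto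
    then have "sqrt N \<le> N" using N by simp
    then show "1 / N \<le> 1 / sqrt N" using N by (simp add: frac_le)
  qed
  have N1: "\<bar>1 / N\<bar> = 1 / N" "0 \<le> 1 / N" using N by simp_all
  have NN: "1 / N = 1 / sqrt N * (1 / sqrt N)" by (simp only: times_divide_times_eq Nsq(2) mult_1)
  have cancel: "1 / x * (1 / x) * (a * (b * x)) = a * b * (1 / x)" if "x > 0" for x a b :: real
    using that by (simp add: field_simps)
  have \<mu>: "Lp_le M 2 (\<lambda>\<omega>. \<mu> \<omega> - m u) ((G * k1 * sqrt (5 * R) + 5 * R * k1 * c1 + 5 * R * L * norm (m u)) * (h + 1 / sqrt N))"
  proof -
    have "Lp_le M 2 (\<lambda>\<omega>. (1 / N) *\<^sub>R ((\<Sum>j\<in>window. a j *\<^sub>R Z (int j) \<omega>) + (\<Sum>j\<in>window. a j *\<^sub>R e j \<omega>)) + (q - 1) *\<^sub>R m u)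
        (\<bar>1 / N\<bar> * (G * sqrt (\<Sum>j\<in>window. (a j)\<^sup>2) + (\<Sum>j\<in>window. \<bar>a j\<bar> * (c1 * h))) + norm ((q - 1) *\<^sub>R m u))"
      by (intro Lp_le_add Lp_le_scaleR Lp_le_sum G(2) e finite_window M.Lp_le_const) auto
    moreover have "\<mu> \<omega> - m u = (1 / N) *\<^sub>R ((\<Sum>j\<in>window. a j *\<^sub>R Z (int j) \<omega>) + (\<Sum>j\<in>window. a j *\<^sub>R e j \<omega>)) + (q - 1) *\<^sub>R m u"
      if "\<omega> \<in> space M" for \<omega>
    proof -
      have "\<mu> \<omega> = (1 / N) *\<^sub>R (\<Sum>j\<in>window. a j *\<^sub>R X j \<omega>)"
        unfolding \<mu>_def local_mean_def N_def sum_K1_restrict by (rule refl)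
      also have "(\<Sum>j\<in>window. a j *\<^sub>R X j \<omega>) = (\<Sum>j\<in>window. a j *\<^sub>R Z (int j) \<omega>) + (\<Sum>j\<in>window. a j *\<^sub>R e j \<omega>) + (\<Sum>j\<in>window. a j *\<^sub>R m u)"
        unfolding sum.distrib[symmetric] by (intro sum.cong refl) (use X[OF _ that] sub in \<open>auto simp: e_def scaleR_right_distrib scaleR_diff_right subset_iff\<close>)
      also have "(\<Sum>j\<in>window. a j *\<^sub>R m u) = (\<Sum>j=1..T. a j) *\<^sub>R m u"
        unfolding sum_K1_restrict[symmetric] by (simp add: scaleR_sum_left)
      finally show ?thesis by (simp add: q_def scaleR_right_distrib scaleR_diff_left)
    qed
    ultimately have "Lp_le M 2 (\<lambda>\<omega>. \<mu> \<omega> - m u)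
        (\<bar>1 / N\<bar> * (G * sqrt (\<Sum>j\<in>window. (a j)\<^sup>2) + (\<Sum>j\<in>window. \<bar>a j\<bar> * (c1 * h))) + norm ((q - 1) *\<^sub>R m u))"
      using \<mu>m by (elim Lp_le_AE_cong) auto
    then show ?thesis
    proof (rule Lp_le_mono)
      have 1: "\<bar>1 / N\<bar> * (G * sqrt (\<Sum>j\<in>window. (a j)\<^sup>2)) \<le> G * k1 * sqrt (5 * R) * (1 / sqrt N)"
      proof -
        have "sqrt (\<Sum>j\<in>window. (a j)\<^sup>2) \<le> sqrt (k1\<^sup>2 * (5 * R * N))" using sK by simp
        also have "\<dots> = k1 * sqrt (5 * R) * sqrt N" using range_bounds by (simp add: real_sqrt_mult)
        finally have "\<bar>1 / N\<bar> * (G * sqrt (\<Sum>j\<in>window. (a j)\<^sup>2)) \<le> (1 / N) * (G * (k1 * sqrt (5 * R) * sqrt N))"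
          using N G(1) by (simp add: divide_right_mono mult_left_mono)
        also have "\<dots> = G * (k1 * sqrt (5 * R)) * (1 / sqrt N)"
          unfolding NN by (rule cancel[OF Nsq(3)])
        finally show ?thesis by (simp only: mult.assoc)
      qed
      have 2: "\<bar>1 / N\<bar> * (\<Sum>j\<in>window. \<bar>a j\<bar> * (c1 * h)) \<le> 5 * R * k1 * c1 * h"
      proof -
        have "(\<Sum>j\<in>window. \<bar>a j\<bar> * (c1 * h)) \<le> (\<Sum>j\<in>window. k1 * (c1 * h))"
          using K1(1) c1 range_bounds by (intro sum_mono mult_right_mono) auto
        also have "\<dots> = card window * (k1 * (c1 * h))" by simp
        also have "\<dots> \<le> (5 * R * N) * (k1 * (c1 * h))"
          using card_window c1 range_bounds by (intro mult_right_mono) (auto simp: N_def)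
        finally have "(\<Sum>j\<in>window. \<bar>a j\<bar> * (c1 * h)) \<le> (5 * R * N) * (k1 * (c1 * h))" .
        then have "\<bar>1 / N\<bar> * (\<Sum>j\<in>window. \<bar>a j\<bar> * (c1 * h)) \<le> (1 / N) * ((5 * R * N) * (k1 * (c1 * h)))"
          unfolding N1(1) by (rule mult_left_mono[OF _ N1(2)])
        also have "\<dots> = 5 * R * k1 * c1 * h" using N by simp
        finally show ?thesis .
      qed
      have 3: "norm ((q - 1) *\<^sub>R m u) \<le> 5 * R * L * norm (m u) * (1 / sqrt N)"
      proof -
        have "norm ((q - 1) *\<^sub>R m u) \<le> 5 * R * L * (1 / N) * norm (m u)"
          using mult_right_mono[OF q norm_ge_zero[of "m u"]] by simp
        also have "\<dots> \<le> 5 * R * L * (1 / sqrt N) * norm (m u)"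
          using Nsq(1) L0 range_bounds by (intro mult_right_mono mult_left_mono) auto
        finally show ?thesis by (simp add: mult_ac)
      qed
      have p: "0 \<le> G * k1 * sqrt (5 * R)" "0 \<le> 5 * R * k1 * c1" "0 \<le> 5 * R * L * norm (m u)" "0 \<le> 1 / sqrt N" "0 \<le> h"
        using G(1) range_bounds c1 L0 Nsq(3) by simp_all
      have "0 \<le> G * k1 * sqrt (5 * R) * h" "0 \<le> 5 * R * k1 * c1 * (1 / sqrt N)" "0 \<le> 5 * R * L * norm (m u) * h"
        by (rule mult_nonneg_nonneg[OF p(1) p(5)], rule mult_nonneg_nonneg[OF p(2) p(4)], rule mult_nonneg_nonneg[OF p(3) p(5)])
      then show "\<bar>1 / N\<bar> * (G * sqrt (\<Sum>j\<in>window. (a j)\<^sup>2) + (\<Sum>j\<in>window. \<bar>a j\<bar> * (c1 * h))) + norm ((q - 1) *\<^sub>R m u)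
         \<le> (G * k1 * sqrt (5 * R) + 5 * R * k1 * c1 + 5 * R * L * norm (m u)) * (h + 1 / sqrt N)"
        using 1 2 3 unfolding distrib_left distrib_right by linarith
    qed
  qed
  define D where "D = h + 1 / sqrt N"
  have D: "0 \<le> D" "h \<le> D" using range_bounds Nsq(3) by (simp_all add: D_def)
  \<comment> \<open>Centring cancels the level \<open>m u\<close>: what remains is the error of the
    observation minus the error of the local mean.\<close>
  define d where "d j \<omega> = X j \<omega> - \<mu> \<omega> - Z (int j) \<omega>" for j \<omega>
  have c0: "0 \<le> c" unfolding c_def using c1 G(1) range_bounds L0 by simp
  have d: "Lp_le M 2 (d j) (c * D)" if j: "j \<in> window" for j
  proof -
    have "Lp_le M 2 (\<lambda>\<omega>. e j \<omega> - (\<mu> \<omega> - m u)) (c1 * h + (G * k1 * sqrt (5 * R) + 5 * R * k1 * c1 + 5 * R * L * norm (m u)) * D)"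
      unfolding D_def by (intro Lp_le_diff e j \<mu>) simp
    moreover have "c1 * h \<le> c1 * D" using D c1 by (intro mult_left_mono)
    ultimately have "Lp_le M 2 (\<lambda>\<omega>. e j \<omega> - (\<mu> \<omega> - m u)) (c * D)"
      by (elim Lp_le_mono) (simp add: c_def distrib_right)
    moreover have "d j \<omega> = e j \<omega> - (\<mu> \<omega> - m u)" if "\<omega> \<in> space M" for \<omega>
      using X[OF _ that, of j] sub j by (auto simp: d_def e_def)
    moreover have "d j \<in> borel_measurable M"
      unfolding d_def using Xm sub j \<mu>m Zm by (intro borel_measurable_diff) auto
    ultimately show ?thesis by (elim Lp_le_AE_cong) auto
  qed
  \<comment> \<open>Row and column bounds of the pair weights, each carrying one factor b. Hence
    sqrt W is of order sqrt b and \<open>V\<close> of order b, matching the orders of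
    \<open>s\<close> and its square.\<close>
  define W V where "W = (k1 * k2)\<^sup>2 * (2 * R * b)" and "V = k1 * k2 * (2 * R * b)"
  have kk: "0 \<le> k1 * k2" using range_bounds by simp
  have W0: "0 \<le> W" using range_bounds by (simp add: W_def)
  have sW: "sqrt W = k1 * k2 * sqrt (2 * R) * sqrt b" using kk by (simp add: W_def real_sqrt_mult)
  have lin: "Lp_le M 2 (\<lambda>\<omega>. \<Sum>j\<in>window. a j *\<^sub>R Z (int j) \<omega>) (G * sqrt (\<Sum>j\<in>window. (a j)\<^sup>2))" for a
    by (rule G(2)[OF finite_window])
  let ?S1 = "\<lambda>\<omega>. \<Sum>j\<in>window. \<Sum>i\<in>window. w j i *\<^sub>R kernel_tensor (Z (int j) \<omega> + d j \<omega>) (Z (int i) \<omega> + d i \<omega>)"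
  let ?S2 = "\<lambda>\<omega>. \<Sum>j\<in>window. \<Sum>i\<in>window. w j i *\<^sub>R kernel_tensor (Z (int j) \<omega>) (Z (int i) \<omega>)"
  let ?S3 = "\<Sum>j\<in>window. \<Sum>i\<in>window. w j i *\<^sub>R \<gamma> (j - i)"
  have P1: "Lp_le M 1 (\<lambda>\<omega>. ?S1 \<omega> - ?S2 \<omega>) (card window * (2 * G * sqrt W * (c * D) + V * (c * D)\<^sup>2))"
    by (rule quadratic_form_perturbation[OF bounded_bilinear_kernel_tensor _ finite_window lin d])
       (use w_row_sq w_col_sq w_row_abs G(1) c0 D in \<open>auto simp: W_def V_def norm_kernel_tensor\<close>)
  have P2: "Lp_le M 1 (\<lambda>\<omega>. ?S2 \<omega> - ?S3) (3 * G\<^sup>2 * sqrt (W * card window))"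
    by (rule M.Lp_le_2_imp_1, rule quad[OF _ _ W0]) (unfold W_def, rule w_row_sq, rule w_col_sq)
  define B where "B \<omega> = (1 / N) *\<^sub>R ?S1 \<omega>" for \<omega>
  have B: "local_long_run_covariance K1 K2 h b u T (\<lambda>t. X t \<omega>) = B \<omega> + kernel_swap (B \<omega>)" for \<omega>
  proof -
    have "B \<omega> = (1 / (real T * h)) *\<^sub>R (\<Sum>j=1..T. \<Sum>i=1..T. w j i *\<^sub>R kernel_tensor (X j \<omega> - local_mean K1 h u T (\<lambda>t. X t \<omega>)) (X i \<omega> - local_mean K1 h u T (\<lambda>t. X t \<omega>)))"
      unfolding sum_w_restrict B_def N_def by (simp add: d_def \<mu>_def)
    then show ?thesis unfolding local_long_run_covariance_eq by simp
  qed
  let ?bias = "norm (q *\<^sub>R (\<Sum>t. lag_weight K2 b t *\<^sub>R \<gamma> t) - \<Gamma>)"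
  have bias: "(1 / N) *\<^sub>R ?S3 - \<Gamma> = q *\<^sub>R (\<Sum>t. lag_weight K2 b t *\<^sub>R \<gamma> t) - \<Gamma>"
  proof -
    have "R * b \<le> R * (real T * h)" using range_bounds by (intro mult_left_mono) auto
    also have "\<dots> < real T * (u - R * h)"
    proof -
      have "real T * (R * h) < real T * (u - R * h)" using u(2) T_pos by (intro mult_strict_left_mono) auto
      then show ?thesis by (simp add: mult_ac)
    qed
    finally have "(\<Sum>j=1..T. \<Sum>i=1..T. w j i *\<^sub>R \<gamma> (j - i)) = (\<Sum>j=1..T. a j) *\<^sub>R (\<Sum>t. lag_weight K2 b t *\<^sub>R \<gamma> t)"
      by (rule bias_sum_eq)
    then show ?thesis unfolding sum_w_restrict by (simp add: q_def)
  qed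
  define ra where "ra = \<bar>1 / N\<bar> * (card window * (2 * G * sqrt W * (c * D) + V * (c * D)\<^sup>2)) + \<bar>1 / N\<bar> * (3 * G\<^sup>2 * sqrt (W * card window)) + ?bias"
  have B1: "Lp_le M 1 (\<lambda>\<omega>. B \<omega> - \<Gamma>) ra"
  proof -
    have "Lp_le M 1 (\<lambda>\<omega>. (1 / N) *\<^sub>R (?S1 \<omega> - ?S2 \<omega>) + (1 / N) *\<^sub>R (?S2 \<omega> - ?S3) + ((1 / N) *\<^sub>R ?S3 - \<Gamma>)) ra"
      unfolding ra_def bias[symmetric] by (intro Lp_le_add Lp_le_scaleR P1 P2 M.Lp_le_const) auto
    then show ?thesis by (simp add: B_def scaleR_diff_right)
  qed
  have ra: "ra \<le> 10 * R * G * (k1 * k2) * sqrt (2 * R) * c * s + 10 * R\<^sup>2 * (k1 * k2) * c\<^sup>2 * s\<^sup>2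
       + 3 * G\<^sup>2 * (k1 * k2) * sqrt (2 * R) * sqrt (5 * R) * sqrt (b / N) + ?bias"
  proof -
    have sD: "s = sqrt b * D" by (simp add: s_def D_def N_def)
    have 1: "\<bar>1 / N\<bar> * (card window * (2 * G * sqrt W * (c * D) + V * (c * D)\<^sup>2))
        \<le> 10 * R * G * (k1 * k2) * sqrt (2 * R) * c * s + 10 * R\<^sup>2 * (k1 * k2) * c\<^sup>2 * s\<^sup>2"
    proof -
      let ?y = "2 * G * sqrt W * (c * D) + V * (c * D)\<^sup>2"
      have y0: "0 \<le> ?y" using G(1) W0 c0 D kk range_bounds by (simp add: V_def)
      have "\<bar>1 / N\<bar> * (card window * ?y) \<le> (1 / N) * ((5 * R * N) * ?y)"
        unfolding N1(1) using mult_right_mono[OF card_window[folded N_def] y0] by (rule mult_left_mono[OF _ N1(2)])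
      also have "\<dots> = 5 * R * ?y" using N by simp
      also have "\<dots> = 10 * R * G * (k1 * k2) * sqrt (2 * R) * c * s + 10 * R\<^sup>2 * (k1 * k2) * c\<^sup>2 * ((sqrt b)\<^sup>2 * D\<^sup>2)"
        unfolding sW sD V_def using range_bounds by (simp add: power_mult_distrib power2_eq_square algebra_simps)
      also have "(sqrt b)\<^sup>2 * D\<^sup>2 = s\<^sup>2" unfolding sD by (simp add: power_mult_distrib)
      finally show ?thesis .
    qed
    have 2: "\<bar>1 / N\<bar> * (3 * G\<^sup>2 * sqrt (W * card window)) \<le> 3 * G\<^sup>2 * (k1 * k2) * sqrt (2 * R) * sqrt (5 * R) * sqrt (b / N)"
    proof -
      have "sqrt (W * card window) \<le> sqrt (W * (5 * R * N))"
        using card_window W0 by (intro real_sqrt_le_mono mult_left_mono) (auto simp: N_def)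
      also have "\<dots> = k1 * k2 * sqrt (2 * R) * sqrt b * (sqrt (5 * R) * sqrt N)"
        unfolding real_sqrt_mult[of W] sW by (simp add: real_sqrt_mult)
      finally have "sqrt (W * card window) \<le> k1 * k2 * sqrt (2 * R) * sqrt b * sqrt (5 * R) * sqrt N" by (simp add: mult.assoc)
      then have "\<bar>1 / N\<bar> * (3 * G\<^sup>2 * sqrt (W * card window)) \<le> (1 / N) * (3 * G\<^sup>2 * (k1 * k2 * sqrt (2 * R) * sqrt b * sqrt (5 * R) * sqrt N))"
        using N by (simp add: divide_right_mono mult_left_mono)
      also have "\<dots> = 3 * G\<^sup>2 * (k1 * k2 * sqrt (2 * R) * sqrt b * sqrt (5 * R)) * (1 / sqrt N)"
        unfolding NN by (rule cancel[OF Nsq(3)])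
      also have "\<dots> = 3 * G\<^sup>2 * (k1 * k2) * sqrt (2 * R) * sqrt (5 * R) * sqrt (b / N)"
        by (simp add: real_sqrt_divide)
      finally show ?thesis .
    qed
    show ?thesis unfolding ra_def using 1 2 by linarith
  qed
  \<comment> \<open>The swap is an isometry, so adding the swapped kernel doubles the bound; this is
    the leading factor 2.\<close>
  have swap: "Lp_le M 1 (\<lambda>\<omega>. kernel_swap (B \<omega> - \<Gamma>)) ra"
  proof (rule Lp_le_AE_mono[OF B1])
    show "(\<lambda>\<omega>. kernel_swap (B \<omega> - \<Gamma>)) \<in> borel_measurable M"
      using Lp_leD(1)[OF B1] by (rule borel_measurable_continuous_on[OF linear_continuous_on[OF bounded_linear_kernel_swap]])
  qed simp
  have "Lp_le M 1 (\<lambda>\<omega>. (B \<omega> - \<Gamma>) + kernel_swap (B \<omega> - \<Gamma>)) (ra + ra)"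
    by (rule Lp_le_add[OF B1 swap]) simp
  moreover have "(B \<omega> - \<Gamma>) + kernel_swap (B \<omega> - \<Gamma>) = local_long_run_covariance K1 K2 h b u T (\<lambda>t. X t \<omega>) - (\<Gamma> + kernel_swap \<Gamma>)" for \<omega>
    unfolding B linear_diff[OF linear_kernel_swap] by simp
  ultimately show ?thesis
    using ra unfolding q_def N_def by (simp, elim Lp_le_mono) simp
qed

section \<open>Consistency\<close>

lemma compact_support_bound:
  fixes K :: "real \<Rightarrow> real"
  assumes "compact (closure {z. K z \<noteq> 0})" shows "\<exists>R. \<forall>z. K z \<noteq> 0 \<longrightarrow> \<bar>z\<bar> \<le> R"
proof -
  have "bounded {z. K z \<noteq> 0}"
    by (rule bounded_subset[OF compact_imp_bounded[OF assms] closure_subset])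
  then show ?thesis unfolding bounded_iff by auto
qed

lemma Lp_space_4_imp_Lp_le:
  assumes "Z \<in> Lp_space M 4" shows "\<exists>c. Lp_le M 4 Z c"
  using assms Lp_le_Lp_norm[of Z M] by (auto simp: Lp_space_4_iff)

lemma integrable_kernel_tensor:
  assumes "prob_space M" "X \<in> Lp_space M 4" "Y \<in> Lp_space M 4"
  shows "integrable M (\<lambda>\<omega>. kernel_tensor (X \<omega>) (Y \<omega>))"
proof -
  interpret prob_space M by fact
  obtain c d where "Lp_le M 4 X c" "Lp_le M 4 Y d" using Lp_space_4_imp_Lp_le assms by blast
  then have "Lp_le M 2 (\<lambda>\<omega>. kernel_tensor (X \<omega>) (Y \<omega>)) (c * d)"
    using Lp_le_bilinear[OF bounded_bilinear_kernel_tensor, of M 2 X c Y d] by (simp add: norm_kernel_tensor)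
  then show ?thesis by (rule Lp_le_2_integrable)
qed

text \<open>The kernel at lag 0 is symmetric and is halved in \<open>\<Gamma>\<close>, so
  symmetrisation restores it exactly once. At every other lag the swap exchanges the factors of the
  tensor and commutes with expectation and series, being bounded and linear.\<close>

lemma long_run_covariance_eq:
  fixes M :: "'w measure" and Z :: "int \<Rightarrow> 'w \<Rightarrow> 'a::euclidean_space L2"
  defines "\<gamma> \<equiv> \<lambda>t. \<integral>\<omega>. kernel_tensor (Z (int t) \<omega>) (Z 0 \<omega>) \<partial>M"
  defines "\<Gamma> \<equiv> \<Sum>t. (if t = 0 then 1 / 2 else 1) *\<^sub>R \<gamma> t"
  assumes M: "prob_space M" and Z: "\<And>t. Z t \<in> Lp_space M 4" and sum: "summable (\<lambda>t. norm (\<gamma> t))"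
  shows "long_run_covariance M Z = \<Gamma> + kernel_swap \<Gamma>"
proof -
  define f where "f t = (if t = 0 then 1 / 2 else 1) *\<^sub>R \<gamma> t" for t :: nat
  have swap: "(\<integral>\<omega>. kernel_tensor (Z 0 \<omega>) (Z (int t) \<omega>) \<partial>M) = kernel_swap (\<gamma> t)" for t
    unfolding \<gamma>_def using integral_bounded_linear[OF bounded_linear_kernel_swap integrable_kernel_tensor[OF M Z[of "int t"] Z[of 0]]]
    by simp
  have g0: "kernel_swap (\<gamma> 0) = \<gamma> 0" using swap[of 0] by (simp add: \<gamma>_def)
  have sf: "summable f"
  proof (rule summable_comparison_test'[OF sum])
    show "norm (f t) \<le> norm (\<gamma> t)" for t by (simp add: f_def)
  qed
  have \<Gamma>: "\<Gamma> = suminf f" unfolding \<Gamma>_def f_def by (rule refl)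
  have 1: "\<Gamma> = (1 / 2) *\<^sub>R \<gamma> 0 + (\<Sum>t. \<gamma> (Suc t))"
    using suminf_split_head[OF sf] unfolding \<Gamma> by (simp add: f_def)
  have sg: "summable (\<lambda>t. \<gamma> (Suc t))"
    using summable_ignore_initial_segment[OF summable_norm_cancel[OF sum], of 1] by simp
  have "kernel_swap (\<Sum>t. \<gamma> (Suc t)) = (\<Sum>t. kernel_swap (\<gamma> (Suc t)))"
    using bounded_linear.suminf[OF bounded_linear_kernel_swap sg] by simp
  then have 2: "kernel_swap \<Gamma> = (1 / 2) *\<^sub>R \<gamma> 0 + (\<Sum>t. kernel_swap (\<gamma> (Suc t)))"
    unfolding 1 linear_add[OF linear_kernel_swap] kernel_swap_scaleR g0 by simp
  have "long_run_covariance M Z = \<gamma> 0 + (\<Sum>t. kernel_swap (\<gamma> (Suc t))) + (\<Sum>t. \<gamma> (Suc t))"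
    unfolding long_run_covariance_def swap by (simp add: \<gamma>_def)
  also have "\<dots> = \<Gamma> + kernel_swap \<Gamma>"
  proof -
    have half: "\<gamma> 0 = (1 / 2) *\<^sub>R \<gamma> 0 + (1 / 2) *\<^sub>R \<gamma> 0" by (simp add: scaleR_left_distrib[symmetric])
    have "\<Gamma> + kernel_swap \<Gamma> = ((1 / 2) *\<^sub>R \<gamma> 0 + (1 / 2) *\<^sub>R \<gamma> 0) + (\<Sum>t. kernel_swap (\<gamma> (Suc t))) + (\<Sum>t. \<gamma> (Suc t))"
      by (subst 2, subst 1) (simp only: ac_simps)
    then show ?thesis unfolding half[symmetric] by simp
  qed
  finally show ?thesis .
qed

lemma locally_stationary_imp_Lp_le:
  fixes v :: "nat \<Rightarrow> nat \<Rightarrow> 'w \<Rightarrow> 'h::{banach, second_countable_topology}"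
  assumes M: "prob_space M" and loc: "locally_stationary M 4 4 v vs" and u: "u \<in> {0..1}"
  obtains c where "0 \<le> c" "\<And>T t. 1 \<le> t \<Longrightarrow> t \<le> T \<Longrightarrow> Lp_le M 2 (\<lambda>\<omega>. v T t \<omega> - vs u (int t) \<omega>) ((\<bar>real t / real T - u\<bar> + 1 / real T) * c)"
proof -
  interpret prob_space M by (rule M)
  obtain C where "\<forall>u\<in>{0..1}. \<exists>U. \<forall>T t. 1 \<le> t \<and> t \<le> T \<longrightarrow>
        U T t \<in> borel_measurable M \<and> (\<forall>\<omega>\<in>space M. U T t \<omega> > 0) \<and>
        integrable M (\<lambda>\<omega>. U T t \<omega> powr 4) \<and> (\<integral>\<omega>. U T t \<omega> powr 4 \<partial>M) < C \<and>
        (AE \<omega> in M. norm (v T t \<omega> - vs u (int t) \<omega>) \<le> (\<bar>real t / real T - u\<bar> + 1 / real T) * U T t \<omega>)"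
    using loc unfolding locally_stationary_def by blast
  then obtain U where U: "\<And>T t. 1 \<le> t \<and> t \<le> T \<Longrightarrow>
        U T t \<in> borel_measurable M \<and> (\<forall>\<omega>\<in>space M. U T t \<omega> > 0) \<and>
        integrable M (\<lambda>\<omega>. U T t \<omega> powr 4) \<and> (\<integral>\<omega>. U T t \<omega> powr 4 \<partial>M) < C \<and>
        (AE \<omega> in M. norm (v T t \<omega> - vs u (int t) \<omega>) \<le> (\<bar>real t / real T - u\<bar> + 1 / real T) * U T t \<omega>)"
    using u by blast
  \<comment> \<open>The hypothesis bounds a fourth moment by \<open>C\<close>, whereas
    \<open>Lp_le\<close> asks for a bound on the norm. For c = max 1 C one has C \<le> c \<le>
    c^4.\<close>
  define c where "c = max 1 C"
  show ?thesis
  proof (rule that[of c])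
    show "0 \<le> c" by (simp add: c_def)
    fix T t :: nat assume t: "1 \<le> t" "t \<le> T"
    note Ut = U[of t T, OF conjI[OF t]]
    have eq: "U T t \<omega> powr 4 = norm (U T t \<omega>) ^ 4" if "\<omega> \<in> space M" for \<omega>
      using Ut that powr_4_eq[of "U T t \<omega>"] by (auto simp: less_imp_le)
    have "Lp_le M 4 (U T t) c"
    proof (rule Lp_leI_integrable)
      have "integrable M (\<lambda>\<omega>. U T t \<omega> powr 4) \<longleftrightarrow> integrable M (\<lambda>\<omega>. norm (U T t \<omega>) ^ 4)"
        by (rule Bochner_Integration.integrable_cong[OF refl]) (rule eq)
      then show "integrable M (\<lambda>\<omega>. norm (U T t \<omega>) ^ 4)" using Ut by blast
      have "(\<integral>\<omega>. norm (U T t \<omega>) ^ 4 \<partial>M) = (\<integral>\<omega>. U T t \<omega> powr 4 \<partial>M)"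
        by (rule Bochner_Integration.integral_cong[OF refl]) (rule eq[symmetric])
      also have "\<dots> \<le> c" using Ut by (auto simp: c_def)
      also have "\<dots> \<le> c ^ 4" by (rule self_le_power) (auto simp: c_def)
      finally show "(\<integral>\<omega>. norm (U T t \<omega>) ^ 4 \<partial>M) \<le> c ^ 4" .
    qed (use Ut in \<open>auto simp: c_def\<close>)
    then have "Lp_le M 2 (U T t) c" using Lp_le_half[of 2 "U T t" c] by simp
    from Lp_le_scaleR[OF this, of "\<bar>real t / real T - u\<bar> + 1 / real T"]
    have "Lp_le M 2 (\<lambda>\<omega>. (\<bar>real t / real T - u\<bar> + 1 / real T) *\<^sub>R U T t \<omega>) ((\<bar>real t / real T - u\<bar> + 1 / real T) * c)"
      by simp
    then show "Lp_le M 2 (\<lambda>\<omega>. v T t \<omega> - vs u (int t) \<omega>) ((\<bar>real t / real T - u\<bar> + 1 / real T) * c)"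
    proof (rule Lp_le_AE_mono)
      show "(\<lambda>\<omega>. v T t \<omega> - vs u (int t) \<omega>) \<in> borel_measurable M"
        using loc t u unfolding locally_stationary_def Lp_space_def by (intro borel_measurable_diff) auto
      have "AE \<omega> in M. norm (v T t \<omega> - vs u (int t) \<omega>) \<le> (\<bar>real t / real T - u\<bar> + 1 / real T) * U T t \<omega>" using Ut by blast
      then show "AE \<omega> in M. norm (v T t \<omega> - vs u (int t) \<omega>) \<le> norm ((\<bar>real t / real T - u\<bar> + 1 / real T) *\<^sub>R U T t \<omega>)"
      proof eventually_elim
        fix \<omega> assume "norm (v T t \<omega> - vs u (int t) \<omega>) \<le> (\<bar>real t / real T - u\<bar> + 1 / real T) * U T t \<omega>"
        also have "\<dots> \<le> norm ((\<bar>real t / real T - u\<bar> + 1 / real T) *\<^sub>R U T t \<omega>)"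
          unfolding real_scaleR_def real_norm_def by (rule abs_ge_self)
        finally show "norm (v T t \<omega> - vs u (int t) \<omega>) \<le> norm ((\<bar>real t / real T - u\<bar> + 1 / real T) *\<^sub>R U T t \<omega>)" .
      qed
    qed
  qed
qed

text \<open>The second limit rests on the factorisation of b h^2 into b / (T h) and T h^3, both of
  which tend to 0.\<close>

lemma bandwidth_rates:
  fixes T :: "nat \<Rightarrow> nat" and h b :: "nat \<Rightarrow> real"
  assumes Th: "filterlim (\<lambda>n. real (T n) * h n) at_top sequentially"
    and Th3: "filterlim (\<lambda>n. 1 / (real (T n) * h n ^ 3)) at_top sequentially"
    and b: "filterlim b at_top sequentially"
    and Thb: "filterlim (\<lambda>n. real (T n) * h n / b n) at_top sequentially"
  shows "(\<lambda>n. b n / (real (T n) * h n)) \<longlonglongrightarrow> 0"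
    and "(\<lambda>n. sqrt (b n) * (h n + 1 / sqrt (real (T n) * h n))) \<longlonglongrightarrow> 0"
    and "\<forall>\<^sub>F n in sequentially. 0 < h n \<and> 1 \<le> real (T n) * h n \<and> 1 \<le> b n \<and> b n \<le> real (T n) * h n"
proof -
  have x: "(\<lambda>n. b n / (real (T n) * h n)) \<longlonglongrightarrow> 0"
    using tendsto_inverse_0_at_top[OF Thb] by (simp add: inverse_eq_divide)
  then show "(\<lambda>n. b n / (real (T n) * h n)) \<longlonglongrightarrow> 0" .
  have y: "(\<lambda>n. real (T n) * h n ^ 3) \<longlonglongrightarrow> 0"
    using tendsto_inverse_0_at_top[OF Th3] by (simp add: inverse_eq_divide)
  have e: "\<forall>\<^sub>F n in sequentially. 1 \<le> real (T n) * h n" "\<forall>\<^sub>F n in sequentially. 1 \<le> b n" "\<forall>\<^sub>F n in sequentially. 1 \<le> real (T n) * h n / b n"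
    using Th b Thb unfolding filterlim_at_top by blast+
  show ev: "\<forall>\<^sub>F n in sequentially. 0 < h n \<and> 1 \<le> real (T n) * h n \<and> 1 \<le> b n \<and> b n \<le> real (T n) * h n"
    using e
  proof eventually_elim
    case (elim n)
    \<comment> \<open>Positivity of the bandwidth is not assumed; it follows from T h \<ge> 1, as T
      is a natural number.\<close>
    have "0 < h n" using elim(1) mult_nonneg_nonpos[of "real (T n)" "h n"] by (cases "0 < h n") auto
    then show ?case using elim by (simp add: pos_le_divide_eq)
  qed
  have "(\<lambda>n. sqrt (b n / (real (T n) * h n) * (real (T n) * h n ^ 3)) + sqrt (b n / (real (T n) * h n))) \<longlonglongrightarrow> sqrt (0 * 0) + sqrt 0"
    by (intro tendsto_intros x y)
  then have lim: "(\<lambda>n. sqrt (b n / (real (T n) * h n) * (real (T n) * h n ^ 3)) + sqrt (b n / (real (T n) * h n))) \<longlonglongrightarrow> 0" by simp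
  show "(\<lambda>n. sqrt (b n) * (h n + 1 / sqrt (real (T n) * h n))) \<longlonglongrightarrow> 0"
  proof (rule Lim_transform_eventually[OF lim], use ev in eventually_elim)
    case (elim n)
    then have T: "real (T n) \<noteq> 0" by (cases "T n = 0") auto
    have "b n / (real (T n) * h n) * (real (T n) * h n ^ 3) = b n * (h n)\<^sup>2"
      using T elim by (simp add: power2_eq_square power3_eq_cube)
    then have "sqrt (b n / (real (T n) * h n) * (real (T n) * h n ^ 3)) = sqrt (b n) * h n"
      using elim by (simp add: real_sqrt_mult)
    then show ?case by (simp add: real_sqrt_divide distrib_left)
  qed
qed

text \<open>Consistency of one series, stated as a deterministic rate in L^1. Such bounds combine
  linearly, so pooling and the passage to probabilities can wait until both series have been
  treated.\<close>

lemma local_long_run_covariance_consistent: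
  fixes X v :: "nat \<Rightarrow> nat \<Rightarrow> 'w \<Rightarrow> 'a::euclidean_space L2" and m :: "real \<Rightarrow> 'a L2" and C\<^sub>m :: real
  assumes M: "prob_space M"
    and X: "\<And>T t \<omega>. 1 \<le> t \<Longrightarrow> t \<le> T \<Longrightarrow> \<omega> \<in> space M \<Longrightarrow> X T t \<omega> = m (real t / real T) + v T t \<omega>"
    and m: "C\<^sub>m > 0" "\<And>r s. r \<in> {0..1} \<Longrightarrow> s \<in> {0..1} \<Longrightarrow> norm (m s - m r) \<le> C\<^sub>m * \<bar>r - s\<bar>"
    and loc: "locally_stationary M 4 4 v vs" and app: "Lp_m_approximable M 4 S f eps epsc (vs u)"
    and mean: "(\<integral>\<omega>. vs u 0 \<omega> \<partial>M) = 0"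
    and K1: "bounded (range K1)" "\<exists>L. L-lipschitz_on UNIV K1" "compact (closure {z. K1 z \<noteq> 0})" "(\<integral>z. K1 z \<partial>lborel) = 1"
    and K2: "bounded (range K2)" "compact (closure {z. K2 z \<noteq> 0})" "K2 0 = 1" "continuous (at_right 0) K2"
    and h: "h \<longlonglongrightarrow> 0" and Th: "filterlim (\<lambda>n. real (T n) * h n) at_top sequentially"
    and Th3: "filterlim (\<lambda>n. 1 / (real (T n) * h n ^ 3)) at_top sequentially"
    and b: "filterlim b at_top sequentially"
    and Thb: "filterlim (\<lambda>n. real (T n) * h n / b n) at_top sequentially"
    and u: "u \<in> {0<..<1}"
  shows "kernel_swap (long_run_covariance M (vs u)) = long_run_covariance M (vs u)"
    and "\<exists>r. r \<longlonglongrightarrow> 0 \<and> (\<forall>\<^sub>F n in sequentially.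
       Lp_le M 1 (\<lambda>\<omega>. local_long_run_covariance K1 K2 (h n) (b n) u (T n) (\<lambda>t. X (T n) t \<omega>) - long_run_covariance M (vs u)) (r n))"
proof -
  interpret M: prob_space M by (rule M)
  note K1_int = K1(4)
  define Z where "Z = vs u"
  define \<gamma> where "\<gamma> t = (\<integral>\<omega>. kernel_tensor (Z (int t) \<omega>) (Z 0 \<omega>) \<partial>M)" for t
  define \<Gamma> where "\<Gamma> = (\<Sum>t. (if t = 0 then 1 / 2 else 1) *\<^sub>R \<gamma> t)"
  have app': "Lp_m_approximable M 4 S f eps epsc Z" "(\<integral>\<omega>. Z 0 \<omega> \<partial>M) = 0" using app mean by (simp_all add: Z_def)
  have ZL: "Z t \<in> Lp_space M 4" for t using app'(1) by (simp add: Lp_m_approximable_def)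
  then have Zm: "Z t \<in> borel_measurable M" for t by (simp add: Lp_space_def)
  obtain G where G: "0 \<le> G" and sum: "summable (\<lambda>t. norm (\<gamma> t))"
    and cov: "\<And>i j. i \<le> j \<Longrightarrow> (\<integral>\<omega>. kernel_tensor (Z (int j) \<omega>) (Z (int i) \<omega>) \<partial>M) = \<gamma> (j - i)"
    and lin: "\<And>I a. finite I \<Longrightarrow> Lp_le M 2 (\<lambda>\<omega>. \<Sum>j\<in>I. a j *\<^sub>R Z (int j) \<omega>) (G * sqrt (\<Sum>j\<in>I. (a j)\<^sup>2))"
    and quad: "\<And>I w W. finite I \<Longrightarrow> (\<And>j. j \<in> I \<Longrightarrow> (\<Sum>i\<in>I. (w j i)\<^sup>2) \<le> W) \<Longrightarrow> (\<And>i. i \<in> I \<Longrightarrow> (\<Sum>j\<in>I. (w j i)\<^sup>2) \<le> W) \<Longrightarrow> 0 \<le> W \<Longrightarrow>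
       Lp_le M 2 (\<lambda>\<omega>. (\<Sum>j\<in>I. \<Sum>i\<in>I. w j i *\<^sub>R kernel_tensor (Z (int j) \<omega>) (Z (int i) \<omega>))
          - (\<Sum>j\<in>I. \<Sum>i\<in>I. w j i *\<^sub>R (\<integral>\<omega>. kernel_tensor (Z (int j) \<omega>) (Z (int i) \<omega>) \<partial>M))) (3 * G\<^sup>2 * sqrt (W * card I))"
  proof (rule Lp_m_approximable_bounds[OF M app' bounded_bilinear_kernel_tensor eq_refl[OF norm_kernel_tensor]])
    fix G
    assume "0 \<le> G" "summable (\<lambda>t. norm (\<integral>\<omega>. kernel_tensor (Z (int t) \<omega>) (Z 0 \<omega>) \<partial>M))"
      and "\<And>i j. i \<le> j \<Longrightarrow> (\<integral>\<omega>. kernel_tensor (Z (int j) \<omega>) (Z (int i) \<omega>) \<partial>M) = (\<integral>\<omega>. kernel_tensor (Z (int (j - i)) \<omega>) (Z 0 \<omega>) \<partial>M)"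
      and "\<And>I a. finite I \<Longrightarrow> Lp_le M 2 (\<lambda>\<omega>. \<Sum>j\<in>I. a j *\<^sub>R Z (int j) \<omega>) (G * sqrt (\<Sum>j\<in>I. (a j)\<^sup>2))"
      and "\<And>I w W. finite I \<Longrightarrow> (\<And>j. j \<in> I \<Longrightarrow> (\<Sum>i\<in>I. (w j i)\<^sup>2) \<le> W) \<Longrightarrow> (\<And>i. i \<in> I \<Longrightarrow> (\<Sum>j\<in>I. (w j i)\<^sup>2) \<le> W) \<Longrightarrow> 0 \<le> W \<Longrightarrow>
       Lp_le M 2 (\<lambda>\<omega>. (\<Sum>j\<in>I. \<Sum>i\<in>I. w j i *\<^sub>R kernel_tensor (Z (int j) \<omega>) (Z (int i) \<omega>))
          - (\<Sum>j\<in>I. \<Sum>i\<in>I. w j i *\<^sub>R (\<integral>\<omega>. kernel_tensor (Z (int j) \<omega>) (Z (int i) \<omega>) \<partial>M))) (3 * G\<^sup>2 * sqrt (W * card I))"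
    from this[folded \<gamma>_def] show thesis by (rule that)
  qed
  have lrc: "long_run_covariance M Z = \<Gamma> + kernel_swap \<Gamma>"
    unfolding \<Gamma>_def \<gamma>_def by (rule long_run_covariance_eq[OF M ZL sum[unfolded \<gamma>_def]])
  then show "kernel_swap (long_run_covariance M (vs u)) = long_run_covariance M (vs u)"
    by (simp add: Z_def linear_add[OF linear_kernel_swap] add.commute)
  obtain L where L: "L-lipschitz_on UNIV K1" using K1(2) by blast
  obtain R1 R2 where R12: "\<And>z. K1 z \<noteq> 0 \<Longrightarrow> \<bar>z\<bar> \<le> R1" "\<And>z. K2 z \<noteq> 0 \<Longrightarrow> \<bar>z\<bar> \<le> R2"
    using compact_support_bound K1(3) K2(2) by metis
  \<comment> \<open>The maximum with 1, here and for the bounds below, meets the normalisation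
    required by \<open>kernel_window\<close>.\<close>
  define R where "R = max 1 (max R1 R2)"
  have R: "1 \<le> R" "\<And>z. K1 z \<noteq> 0 \<Longrightarrow> \<bar>z\<bar> \<le> R" "\<And>z. K2 z \<noteq> 0 \<Longrightarrow> \<bar>z\<bar> \<le> R"
    using R12 by (auto simp: R_def le_max_iff_disj)
  obtain B1 B2 where B12: "\<And>z. \<bar>K1 z\<bar> \<le> B1" "\<And>z. \<bar>K2 z\<bar> \<le> B2"
    using K1(1) K2(1) unfolding bounded_iff by auto
  define k1 k2 where "k1 = max 1 B1" and "k2 = max 1 B2"
  have k: "1 \<le> k1" "1 \<le> k2" "\<And>z. \<bar>K1 z\<bar> \<le> k1" "\<And>z. \<bar>K2 z\<bar> \<le> k2"
    using B12 by (auto simp: k1_def k2_def le_max_iff_disj)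
  have u01: "u \<in> {0..1}" using u by auto
  obtain c\<^sub>U where cU: "0 \<le> c\<^sub>U" "\<And>T t. 1 \<le> t \<Longrightarrow> t \<le> T \<Longrightarrow> Lp_le M 2 (\<lambda>\<omega>. v T t \<omega> - Z (int t) \<omega>) ((\<bar>real t / real T - u\<bar> + 1 / real T) * c\<^sub>U)"
  proof (rule locally_stationary_imp_Lp_le[OF M loc u01])
    fix c
    assume "0 \<le> c" "\<And>T t. 1 \<le> t \<Longrightarrow> t \<le> T \<Longrightarrow> Lp_le M 2 (\<lambda>\<omega>. v T t \<omega> - vs u (int t) \<omega>) ((\<bar>real t / real T - u\<bar> + 1 / real T) * c)"
    from this[folded Z_def] show thesis by (rule that)
  qed
  note rates = bandwidth_rates[OF Th Th3 b Thb]
  have hev: "\<forall>\<^sub>F n in sequentially. 2 * R * h n < u \<and> u + R * h n \<le> 1"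
  proof -
    have "(\<lambda>n. 2 * R * h n) \<longlonglongrightarrow> 2 * R * 0" "(\<lambda>n. R * h n) \<longlonglongrightarrow> R * 0" by (intro tendsto_intros h)+
    then have "\<forall>\<^sub>F n in sequentially. 2 * R * h n < u" "\<forall>\<^sub>F n in sequentially. R * h n < 1 - u"
      using u by (auto intro!: order_tendstoD(2))
    then show ?thesis by eventually_elim auto
  qed
  define good where "good n \<longleftrightarrow> kernel_window K1 K2 (h n) (b n) R k1 k2 (T n) \<and> 2 * R * h n < u \<and> u + R * h n \<le> 1" for n
  have good: "\<forall>\<^sub>F n in sequentially. good n"
    using rates(3) hev by eventually_elim (use R k in \<open>auto simp: good_def kernel_window_def\<close>)
  define q where "q n = 1 / (real (T n) * h n) * (\<Sum>j=1..T n. K1 ((u - real j / real (T n)) / h n))" for n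
  have q: "q \<longlonglongrightarrow> 1"
  proof (rule LIM_zero_cancel, rule Lim_null_comparison)
    show "\<forall>\<^sub>F n in sequentially. norm (q n - 1) \<le> 5 * R * L * (1 / (real (T n) * h n))"
      using good
    proof eventually_elim
      fix n assume g: "good n"
      then interpret kernel_window K1 K2 "h n" "b n" u R k1 k2 "T n" by (simp add: good_def)
      have "0 \<le> R * h n" "2 * R * h n < u" using g range_bounds by (simp_all add: good_def)
      then have "R * h n \<le> u" by linarith
      then have "\<bar>(\<Sum>j=1..T n. K1 ((u - real j / real (T n)) / h n)) - real (T n) * h n\<bar> \<le> 5 * R * L"
        using g by (intro kernel_sum_approx[OF L K1_int]) (auto simp: good_def)
      then have "\<bar>(\<Sum>j=1..T n. K1 ((u - real j / real (T n)) / h n)) - real (T n) * h n\<bar> / (real (T n) * h n) \<le> 5 * R * L / (real (T n) * h n)"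
        using Th_pos by (intro divide_right_mono) auto
      moreover have "q n - 1 = ((\<Sum>j=1..T n. K1 ((u - real j / real (T n)) / h n)) - real (T n) * h n) / (real (T n) * h n)"
        using T_pos range_bounds by (simp add: q_def diff_divide_distrib)
      ultimately show "norm (q n - 1) \<le> 5 * R * L * (1 / (real (T n) * h n))"
        using T_pos range_bounds by (simp add: abs_divide)
    qed
    have "(\<lambda>n. 5 * R * L * inverse (real (T n) * h n)) \<longlonglongrightarrow> 5 * R * L * 0"
      by (intro tendsto_mult tendsto_const tendsto_inverse_0_at_top Th)
    then show "(\<lambda>n. 5 * R * L * (1 / (real (T n) * h n))) \<longlonglongrightarrow> 0" by (simp add: inverse_eq_divide)
  qed
  define bias where "bias n = norm (q n *\<^sub>R (\<Sum>t. lag_weight K2 (b n) t *\<^sub>R \<gamma> t) - \<Gamma>)" for n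
  have bias: "bias \<longlonglongrightarrow> 0"
  proof -
    have "(\<lambda>n. q n *\<^sub>R (\<Sum>t. lag_weight K2 (b n) t *\<^sub>R \<gamma> t)) \<longlonglongrightarrow> 1 *\<^sub>R \<Gamma>"
      unfolding \<Gamma>_def by (intro tendsto_scaleR q lag_weight_series_tendsto[OF sum k(4) K2(3,4) k(2) b])
    then show ?thesis unfolding bias_def by (intro tendsto_norm_zero LIM_zero) simp
  qed
  define s where "s n = sqrt (b n) * (h n + 1 / sqrt (real (T n) * h n))" for n
  define c1 where "c1 = 3 * R * c\<^sub>U + 2 * R * C\<^sub>m"
  define c where "c = c1 + (G * k1 * sqrt (5 * R) + 5 * R * k1 * c1 + 5 * R * L * norm (m u))"
  define r where "r n = 2 * (10 * R * G * (k1 * k2) * sqrt (2 * R) * c * s n + 10 * R\<^sup>2 * (k1 * k2) * c\<^sup>2 * (s n)\<^sup>2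
       + 3 * G\<^sup>2 * (k1 * k2) * sqrt (2 * R) * sqrt (5 * R) * sqrt (b n / (real (T n) * h n)) + bias n)" for n
  have "r \<longlonglongrightarrow> 2 * (10 * R * G * (k1 * k2) * sqrt (2 * R) * c * 0 + 10 * R\<^sup>2 * (k1 * k2) * c\<^sup>2 * 0\<^sup>2
       + 3 * G\<^sup>2 * (k1 * k2) * sqrt (2 * R) * sqrt (5 * R) * sqrt 0 + 0)"
    unfolding r_def s_def by (intro tendsto_intros rates bias)
  then have r: "r \<longlonglongrightarrow> 0" by simp
  have "\<forall>\<^sub>F n in sequentially. Lp_le M 1 (\<lambda>\<omega>. local_long_run_covariance K1 K2 (h n) (b n) u (T n) (\<lambda>t. X (T n) t \<omega>) - long_run_covariance M Z) (r n)"
    using good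
  proof eventually_elim
    fix n assume g: "good n"
    then interpret kernel_window K1 K2 "h n" "b n" u R k1 k2 "T n" by (simp add: good_def)
    show "Lp_le M 1 (\<lambda>\<omega>. local_long_run_covariance K1 K2 (h n) (b n) u (T n) (\<lambda>t. X (T n) t \<omega>) - long_run_covariance M Z) (r n)"
      unfolding lrc r_def bias_def q_def s_def c_def c1_def
    proof (rule local_long_run_covariance_L1[OF M])
      show "X (T n) t \<omega> = m (real t / real (T n)) + v (T n) t \<omega>" if "t \<in> {1..T n}" "\<omega> \<in> space M" for t \<omega>
        using X that by auto
      show "v (T n) t \<in> borel_measurable M" if "t \<in> {1..T n}" for t
        using loc that unfolding locally_stationary_def Lp_space_def by auto
      show "Lp_le M 2 (\<lambda>\<omega>. v (T n) t \<omega> - Z (int t) \<omega>) ((\<bar>real t / real (T n) - u\<bar> + 1 / real (T n)) * c\<^sub>U)" if "t \<in> {1..T n}" for t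
        using cU(2) that by auto
      fix W assume W: "\<And>j. j \<in> window \<Longrightarrow> (\<Sum>i\<in>window. (pair_weight K1 K2 (h n) (b n) u (T n) j i)\<^sup>2) \<le> W"
        "\<And>i. i \<in> window \<Longrightarrow> (\<Sum>j\<in>window. (pair_weight K1 K2 (h n) (b n) u (T n) j i)\<^sup>2) \<le> W" "0 \<le> W"
      \<comment> \<open>For i > j the subtraction of natural numbers would give lag 0 instead of the
        true one, but there the weight is 0.\<close>
      have eq: "pair_weight K1 K2 (h n) (b n) u (T n) j i *\<^sub>R (\<integral>\<omega>. kernel_tensor (Z (int j) \<omega>) (Z (int i) \<omega>) \<partial>M)
          = pair_weight K1 K2 (h n) (b n) u (T n) j i *\<^sub>R \<gamma> (j - i)" for j i
        using cov[of i j] by (cases "i \<le> j") (auto simp: pair_weight_def)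
      show "Lp_le M 2 (\<lambda>\<omega>. (\<Sum>j\<in>window. \<Sum>i\<in>window. pair_weight K1 K2 (h n) (b n) u (T n) j i *\<^sub>R kernel_tensor (Z (int j) \<omega>) (Z (int i) \<omega>))
          - (\<Sum>j\<in>window. \<Sum>i\<in>window. pair_weight K1 K2 (h n) (b n) u (T n) j i *\<^sub>R \<gamma> (j - i))) (3 * G\<^sup>2 * sqrt (W * card window))"
        using quad[OF finite_window W] by (simp only: eq)
    qed (use Zm m cU(1) G lin L K1_int u01 g in \<open>auto simp: good_def\<close>)
  qed
  with r show "\<exists>r. r \<longlonglongrightarrow> 0 \<and> (\<forall>\<^sub>F n in sequentially.
       Lp_le M 1 (\<lambda>\<omega>. local_long_run_covariance K1 K2 (h n) (b n) u (T n) (\<lambda>t. X (T n) t \<omega>) - long_run_covariance M (vs u)) (r n))"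
    unfolding Z_def by blast
qed

lemma filterlim_Min_at_top_D:
  fixes S :: "'a \<Rightarrow> real set"
  assumes "filterlim (\<lambda>n. Min (S n)) at_top F" "\<And>n. finite (S n)" "\<And>n. f n \<in> S n"
  shows "filterlim f at_top F"
  by (rule filterlim_at_top_mono[OF assms(1)]) (intro always_eventually allI Min_le assms)

theorem corollary4p1:
  fixes M :: "'w measure"
    and X Y v w :: "nat \<Rightarrow> nat \<Rightarrow> 'w \<Rightarrow> (real ^ 'd) L2"
    and vs ws :: "real \<Rightarrow> int \<Rightarrow> 'w \<Rightarrow> (real ^ 'd) L2"
    and m1 m2 :: "real \<Rightarrow> (real ^ 'd) L2"
    and S1 :: "'s1 measure" and S2 :: "'s2 measure"
    and f1 :: "real \<Rightarrow> (nat \<Rightarrow> 's1) \<Rightarrow> (real ^ 'd) L2"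
    and f2 :: "real \<Rightarrow> (nat \<Rightarrow> 's2) \<Rightarrow> (real ^ 'd) L2"
    and eps1 :: "real \<Rightarrow> int \<Rightarrow> 'w \<Rightarrow> 's1" and epsc1 :: "real \<Rightarrow> int \<Rightarrow> nat \<Rightarrow> int \<Rightarrow> 'w \<Rightarrow> 's1"
    and eps2 :: "real \<Rightarrow> int \<Rightarrow> 'w \<Rightarrow> 's2" and epsc2 :: "real \<Rightarrow> int \<Rightarrow> nat \<Rightarrow> int \<Rightarrow> 'w \<Rightarrow> 's2"
    and K1 K2 :: "real \<Rightarrow> real"
    and T1 T2 :: "nat \<Rightarrow> nat" and h b :: "nat \<Rightarrow> real"
    and C\<^sub>m \<theta> u \<epsilon>0 :: real and q0 qbar :: nat
    and \<phi> :: "((real ^ 'd) \<times> (real ^ 'd)) L2" and \<eta> :: "nat \<Rightarrow> real"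
  assumes "prob_space M"
    (* the two observed series *)
    and "\<And>N1 N2. prob_space.indep_var M
           (Pi\<^sub>M {1..N1} (\<lambda>_. borel)) (\<lambda>\<omega>. \<lambda>t\<in>{1..N1}. X N1 t \<omega>)
           (Pi\<^sub>M {1..N2} (\<lambda>_. borel)) (\<lambda>\<omega>. \<lambda>t\<in>{1..N2}. Y N2 t \<omega>)"
    and "\<And>T t \<omega>. 1 \<le> t \<Longrightarrow> t \<le> T \<Longrightarrow> \<omega> \<in> space M \<Longrightarrow> X T t \<omega> = m1 (real t / real T) + v T t \<omega>"
    and "\<And>T t \<omega>. 1 \<le> t \<Longrightarrow> t \<le> T \<Longrightarrow> \<omega> \<in> space M \<Longrightarrow> Y T t \<omega> = m2 (real t / real T) + w T t \<omega>"
    and "C\<^sub>m > 0"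
    and "\<And>r s. r \<in> {0..1} \<Longrightarrow> s \<in> {0..1} \<Longrightarrow> norm (m1 s - m1 r) \<le> C\<^sub>m * \<bar>r - s\<bar>"
    and "\<And>r s. r \<in> {0..1} \<Longrightarrow> s \<in> {0..1} \<Longrightarrow> norm (m2 s - m2 r) \<le> C\<^sub>m * \<bar>r - s\<bar>"
    (* the error processes *)
    and "locally_stationary M 4 4 v vs" and "locally_stationary M 4 4 w ws"
    and "\<And>T t. 1 \<le> t \<Longrightarrow> t \<le> T \<Longrightarrow> (\<integral>\<omega>. v T t \<omega> \<partial>M) = 0"
    and "\<And>T t. 1 \<le> t \<Longrightarrow> t \<le> T \<Longrightarrow> (\<integral>\<omega>. w T t \<omega> \<partial>M) = 0"
    and "\<And>r. r \<in> {0..1} \<Longrightarrow> Lp_m_approximable M 4 S1 (f1 r) (eps1 r) (epsc1 r) (vs r)"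
    and "\<And>r. r \<in> {0..1} \<Longrightarrow> Lp_m_approximable M 4 S2 (f2 r) (eps2 r) (epsc2 r) (ws r)"
    and "\<And>r t. r \<in> {0..1} \<Longrightarrow> (\<integral>\<omega>. vs r t \<omega> \<partial>M) = 0"
    and "\<And>r t. r \<in> {0..1} \<Longrightarrow> (\<integral>\<omega>. ws r t \<omega> \<partial>M) = 0"
    and "\<And>r. r \<in> {0..1} \<Longrightarrow>
           (\<lambda>m. real m * Lp_norm M 2 (\<lambda>\<omega>. vs r 0 \<omega> - m_coupling (f1 r) (eps1 r) (epsc1 r) m 0 \<omega>))
             \<longlonglongrightarrow> 0"
    and "\<And>r. r \<in> {0..1} \<Longrightarrow>
           (\<lambda>m. real m * Lp_norm M 2 (\<lambda>\<omega>. ws r 0 \<omega> - m_coupling (f2 r) (eps2 r) (epsc2 r) m 0 \<omega>))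
             \<longlonglongrightarrow> 0"
    (* the kernels *)
    and "\<And>z. K1 (- z) = K1 z" and "bounded (range K1)" and "\<exists>L. L-lipschitz_on UNIV K1"
    and "compact (closure {z. K1 z \<noteq> 0})" and "(\<integral>z. K1 z \<partial>lborel) = 1"
    and "bounded (range K2)" and "compact (closure {z. K2 z \<noteq> 0})" and "K2 0 = 1"
    and "continuous (at_right 0) K2"
    (* the asymptotic regime *)
    and "filterlim (\<lambda>n. min (T1 n) (T2 n)) at_top sequentially"
    and "h \<longlonglongrightarrow> 0"
    and "filterlim (\<lambda>n. Min {real (T1 n) * h n, 1 / (real (T1 n) * h n ^ 3), b n, real (T1 n) * h n / b n})
           at_top sequentially"
    and "filterlim (\<lambda>n. Min {real (T2 n) * h n, 1 / (real (T2 n) * h n ^ 3), b n, real (T2 n) * h n / b n})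
           at_top sequentially"
    and "\<theta> \<in> {0<..<1}" and "(\<lambda>n. real (T1 n) / (real (T1 n) + real (T2 n))) \<longlonglongrightarrow> \<theta>"
    (* the target *)
    and "u \<in> {0<..<1}"
    and "\<phi> = (1 - \<theta>) *\<^sub>R long_run_covariance M (vs u) + \<theta> *\<^sub>R long_run_covariance M (ws u)"
    and "\<eta> = nth_largest_eigenvalue (integral_operator \<phi>)"
    and "q0 \<ge> 1" and "\<eta> q0 > \<eta> (q0 + 1)" and "\<eta> (q0 + 1) = 0"
    and "qbar \<ge> q0"
    and "\<epsilon>0 > 0" and "\<epsilon>0 < \<eta> q0 / \<eta> 1"
  shows "converges_in_probability M
           (\<lambda>n \<omega>. real (rank_estimator \<epsilon>0 qbar
              (pooled_estimator K1 K2 (h n) (b n) u (T1 n) (T2 n)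
                (\<lambda>t. X (T1 n) t \<omega>) (\<lambda>t. Y (T2 n) t \<omega>))))
           (\<lambda>_. real q0)"
proof -
  note M = assms(1) and X = assms(3) and Y = assms(4) and Cm = assms(5) and m1 = assms(6) and m2 = assms(7)
    and locv = assms(8) and locw = assms(9) and appv = assms(12) and appw = assms(13)
    and meanv = assms(14) and meanw = assms(15)
    and K1 = assms(19,20,21,22) and K2 = assms(23,24,25,26)
    and h = assms(28) and min1 = assms(29) and min2 = assms(30) and \<theta> = assms(31,32) and u = assms(33)
    and \<phi> = assms(34) and \<eta> = assms(35) and q0 = assms(36,37,38,39) and \<epsilon>0 = assms(40,41)
  interpret M: prob_space M by (rule M)
  have u01: "u \<in> {0..1}" using u by auto
  note lim1 = filterlim_Min_at_top_D[OF min1] and lim2 = filterlim_Min_at_top_D[OF min2]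
  have b: "filterlim b at_top sequentially" by (rule lim1) auto
  define c1 where "c1 = long_run_covariance M (vs u)"
  define c2 where "c2 = long_run_covariance M (ws u)"
  let ?e1 = "\<lambda>n \<omega>. local_long_run_covariance K1 K2 (h n) (b n) u (T1 n) (\<lambda>t. X (T1 n) t \<omega>)"
  let ?e2 = "\<lambda>n \<omega>. local_long_run_covariance K1 K2 (h n) (b n) u (T2 n) (\<lambda>t. Y (T2 n) t \<omega>)"
  have rates1: "filterlim (\<lambda>n. real (T1 n) * h n) at_top sequentially" "filterlim (\<lambda>n. 1 / (real (T1 n) * h n ^ 3)) at_top sequentially"
      "filterlim (\<lambda>n. real (T1 n) * h n / b n) at_top sequentially"
    by (rule lim1; simp)+
  have rates2: "filterlim (\<lambda>n. real (T2 n) * h n) at_top sequentially" "filterlim (\<lambda>n. 1 / (real (T2 n) * h n ^ 3)) at_top sequentially"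
      "filterlim (\<lambda>n. real (T2 n) * h n / b n) at_top sequentially"
    by (rule lim2; simp)+
  note cons1 = local_long_run_covariance_consistent[OF M X Cm m1 locv appv[OF u01] meanv[OF u01] K1 K2 h rates1(1,2) b rates1(3) u]
  note cons2 = local_long_run_covariance_consistent[OF M Y Cm m2 locw appw[OF u01] meanw[OF u01] K1 K2 h rates2(1,2) b rates2(3) u]
  have sym1: "kernel_swap c1 = c1" and ex1: "\<exists>r. r \<longlonglongrightarrow> 0 \<and> (\<forall>\<^sub>F n in sequentially. Lp_le M 1 (\<lambda>\<omega>. ?e1 n \<omega> - c1) (r n))"
    unfolding c1_def by (rule cons1; assumption)+
  have sym2: "kernel_swap c2 = c2" and ex2: "\<exists>r. r \<longlonglongrightarrow> 0 \<and> (\<forall>\<^sub>F n in sequentially. Lp_le M 1 (\<lambda>\<omega>. ?e2 n \<omega> - c2) (r n))"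
    unfolding c2_def by (rule cons2; assumption)+
  obtain r1 where r1: "r1 \<longlonglongrightarrow> 0" "\<forall>\<^sub>F n in sequentially. Lp_le M 1 (\<lambda>\<omega>. ?e1 n \<omega> - c1) (r1 n)" using ex1 by blast
  obtain r2 where r2: "r2 \<longlonglongrightarrow> 0" "\<forall>\<^sub>F n in sequentially. Lp_le M 1 (\<lambda>\<omega>. ?e2 n \<omega> - c2) (r2 n)" using ex2 by blast
  define t where "t n = real (T1 n) / (real (T1 n) + real (T2 n))" for n
  have t: "t \<longlonglongrightarrow> \<theta>" using \<theta>(2) by (simp add: t_def[abs_def])
  let ?k = "\<lambda>n \<omega>. pooled_estimator K1 K2 (h n) (b n) u (T1 n) (T2 n) (\<lambda>t. X (T1 n) t \<omega>) (\<lambda>t. Y (T2 n) t \<omega>)"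
  have k_eq: "?k n \<omega> = (1 - t n) *\<^sub>R ?e1 n \<omega> + t n *\<^sub>R ?e2 n \<omega>" for n \<omega>
    by (simp add: pooled_estimator_def Let_def t_def)
  have \<phi>_eq: "\<phi> = (1 - \<theta>) *\<^sub>R c1 + \<theta> *\<^sub>R c2" by (simp add: \<phi> c1_def c2_def)
  have sym: "kernel_swap \<phi> = \<phi>"
    unfolding \<phi>_eq linear_add[OF linear_kernel_swap] kernel_swap_scaleR sym1 sym2 by (rule refl)
  \<comment> \<open>The last summand pays for replacing the sample proportion by its limit: (t -
    \<theta>) (c2 - c1) is the difference of the two mixtures of \<open>c1\<close> and
    \<open>c2\<close>.\<close>
  define r where "r n = \<bar>1 - t n\<bar> * r1 n + \<bar>t n\<bar> * r2 n + norm ((t n - \<theta>) *\<^sub>R (c2 - c1))" for n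
  have "r \<longlonglongrightarrow> \<bar>1 - \<theta>\<bar> * 0 + \<bar>\<theta>\<bar> * 0 + norm ((\<theta> - \<theta>) *\<^sub>R (c2 - c1))"
    unfolding r_def by (intro tendsto_intros t r1(1) r2(1))
  then have r: "r \<longlonglongrightarrow> 0" by simp
  have close: "\<forall>\<^sub>F n in sequentially. Lp_le M 1 (\<lambda>\<omega>. ?k n \<omega> - \<phi>) (r n)"
    using r1(2) r2(2)
  proof eventually_elim
    fix n assume *: "Lp_le M 1 (\<lambda>\<omega>. ?e1 n \<omega> - c1) (r1 n)" "Lp_le M 1 (\<lambda>\<omega>. ?e2 n \<omega> - c2) (r2 n)"
    have "Lp_le M 1 (\<lambda>\<omega>. (1 - t n) *\<^sub>R (?e1 n \<omega> - c1) + t n *\<^sub>R (?e2 n \<omega> - c2) + (t n - \<theta>) *\<^sub>R (c2 - c1)) (r n)"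
      unfolding r_def by (intro Lp_le_add Lp_le_scaleR * M.Lp_le_const) auto
    moreover have "(1 - t n) *\<^sub>R (?e1 n \<omega> - c1) + t n *\<^sub>R (?e2 n \<omega> - c2) + (t n - \<theta>) *\<^sub>R (c2 - c1) = ?k n \<omega> - \<phi>" for \<omega>
      unfolding k_eq \<phi>_eq by (simp add: scaleR_diff_left scaleR_diff_right algebra_simps)
    ultimately show "Lp_le M 1 (\<lambda>\<omega>. ?k n \<omega> - \<phi>) (r n)" by simp
  qed
  have Xm: "X T t \<in> borel_measurable M" if "1 \<le> t" "t \<le> T" for T t
  proof -
    have "v T t \<in> borel_measurable M" using locv that unfolding locally_stationary_def Lp_space_def by auto
    then show ?thesis using X[OF that] by (subst measurable_cong[of M _ "\<lambda>\<omega>. m1 (real t / real T) + v T t \<omega>"]) auto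
  qed
  have Ym: "Y T t \<in> borel_measurable M" if "1 \<le> t" "t \<le> T" for T t
  proof -
    have "w T t \<in> borel_measurable M" using locw that unfolding locally_stationary_def Lp_space_def by auto
    then show ?thesis using Y[OF that] by (subst measurable_cong[of M _ "\<lambda>\<omega>. m2 (real t / real T) + w T t \<omega>"]) auto
  qed
  \<comment> \<open>Needed for every \<open>n\<close>, not only eventually. It follows from the
    formula of the estimator and requires no condition on the bandwidths.\<close>
  have km: "?k n \<in> borel_measurable M" for n
    unfolding k_eq by (intro borel_measurable_add borel_measurable_scaleR borel_measurable_const borel_measurable_local_long_run_covariance Xm Ym)
  obtain d where d: "d > 0" "\<And>k. kernel_swap k = k \<Longrightarrow> finite_rank k \<Longrightarrow> norm (k - \<phi>) < d \<Longrightarrow> rank_estimator \<epsilon>0 qbar k = q0"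
    using rank_estimator_near[OF sym \<eta> q0 \<epsilon>0] by blast
  show ?thesis
    unfolding converges_in_probability_def
  proof (intro conjI allI impI)
    show "(\<lambda>\<omega>. real (rank_estimator \<epsilon>0 qbar (?k n \<omega>))) \<in> borel_measurable M" for n
      by (rule borel_measurable_rank_estimator[OF km pooled_estimator_symmetric pooled_estimator_finite_rank])
    show "(\<lambda>_. real q0) \<in> borel_measurable M" by simp
    fix e :: real assume e: "e > 0"
    show "(\<lambda>n. M.prob {\<omega>\<in>space M. dist (real (rank_estimator \<epsilon>0 qbar (?k n \<omega>))) (real q0) > e}) \<longlonglongrightarrow> 0"
    proof (rule Lim_null_comparison)
      show "\<forall>\<^sub>F n in sequentially. norm (M.prob {\<omega>\<in>space M. dist (real (rank_estimator \<epsilon>0 qbar (?k n \<omega>))) (real q0) > e}) \<le> r n / d"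
        using close
      proof eventually_elim
        fix n assume *: "Lp_le M 1 (\<lambda>\<omega>. ?k n \<omega> - \<phi>) (r n)"
        have "{\<omega>\<in>space M. dist (real (rank_estimator \<epsilon>0 qbar (?k n \<omega>))) (real q0) > e} \<subseteq> {\<omega>\<in>space M. norm (?k n \<omega> - \<phi>) \<ge> d}"
        proof
          fix \<omega> assume \<omega>: "\<omega> \<in> {\<omega>\<in>space M. dist (real (rank_estimator \<epsilon>0 qbar (?k n \<omega>))) (real q0) > e}"
          then have "rank_estimator \<epsilon>0 qbar (?k n \<omega>) \<noteq> q0" using e by auto
          then have "\<not> norm (?k n \<omega> - \<phi>) < d" using d(2)[OF pooled_estimator_symmetric pooled_estimator_finite_rank] by blast
          then show "\<omega> \<in> {\<omega>\<in>space M. norm (?k n \<omega> - \<phi>) \<ge> d}" using \<omega> by simp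
        qed
        moreover have "{\<omega>\<in>space M. norm (?k n \<omega> - \<phi>) \<ge> d} \<in> sets M"
          using measurable_compose[OF borel_measurable_diff[OF km[of n] borel_measurable_const] borel_measurable_norm] by measurable
        ultimately have "M.prob {\<omega>\<in>space M. dist (real (rank_estimator \<epsilon>0 qbar (?k n \<omega>))) (real q0) > e} \<le> M.prob {\<omega>\<in>space M. norm (?k n \<omega> - \<phi>) \<ge> d}"
          by (rule M.finite_measure_mono)
        also have "\<dots> \<le> r n / d" by (rule M.Lp_le_1_Markov[OF * d(1)])
        finally show "norm (M.prob {\<omega>\<in>space M. dist (real (rank_estimator \<epsilon>0 qbar (?k n \<omega>))) (real q0) > e}) \<le> r n / d" by simp
      qed
      show "(\<lambda>n. r n / d) \<longlonglongrightarrow> 0" using tendsto_divide[OF r tendsto_const, of d] d(1) by simp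
    qed
  qed
qed

end
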